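(* Let $0<\tau<2\pi/q$. Suppose that $\mu'\in\mathcal{G}_\theta(\gamma')$ is a translation-invariant Gibbs measure for the specification $\gamma'$ which is also time-stationary, i.e. $M_\tau\mu'=\mu'$. Then every translation-invariant probability measure $\nu'$ on $\Omega$ with $$h(\nu'|\mu')=h(M_\tau\nu'|\mu')$$ is also a Gibbs measure for the same specification, i.e. $\nu'\in\mathcal{G}_\theta(\gamma')$. Conversely, if $\nu'\in\mathcal{G}_\theta(\gamma')$, then $h(\nu'|\mu')=h(M_\tau\nu'|\mu')$.
   Context: Continuous model. $G=\mathbb{Z}^d$; $S^1=[0,2\pi)$ is the circle with addition modulo $2\pi$ and Lebesgue measure $\lambda$. $\Phi=(\Phi_A)_{A\subset G\text{ finite}}$ is an absolutely summable, translation-invariant potential on $(S^1)^G$ ($\Phi_A$ continuous, depending only on coordinates in $A$, $\sum_{A\ni i}\|\Phi_A\|_\infty<\infty$), invariant under simultaneous rotation of all spins. $H_\Lambda=\sum_{A\cap\Lambda\ne\emptyset}\Phi_A$, and $\gamma^\Phi$ is the Gibbsian specification $$\gamma^\Phi_\Lambda(B|\eta)=\frac{\int 1_B(\sigma_\Lambda\eta_{\Lambda^c})e^{-H_\Lambda(\sigma_\Lambda\eta_{\Lambda^c})}\lambda^{\otimes\Lambda}(d\sigma_\Lambda)}{\int e^{-H_\Lambda(\sigma_\Lambda\eta_{\Lambda^c})}\lambda^{\otimes\Lambda}(d\sigma_\Lambda)},\quad \Lambda\subset G\text{ finite}.$$ For a specification $\gamma$, $\mathcal{G}_\theta(\gamma)$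 is the convex set of translation-invariant Gibbs measures and $\mathrm{ex}\,\mathcal{G}_\theta(\gamma)$ its extreme points. Standing assumption (continuous symmetry breaking): with $\eta_\phi$ the configuration constantly equal to $\phi$, the weak limits $\mu_\phi=\lim_{\Lambda\nearrow G}\gamma^\Phi_\Lambda(\cdot|\eta_\phi)$ exist, are pairwise different for different $\phi\in S^1$, and $\mathrm{ex}\,\mathcal{G}_\theta(\gamma^\Phi)=\{\mu_\phi:\phi\in S^1\}$. Discrete model. For $q\in\mathbb{N}$ let $T:[0,2\pi)\to\{0,\dots,q-1\}$, $T(\phi)=k$ iff $2\pi k/q\le\phi<2\pi(k+1)/q$, applied sitewise to configurations, and $\Omega=\{0,\dots,q-1\}^G$. For $V\subset G$ and $\sigma'\in\Omega$, the constrained specification on $V$ has, for finite $\Delta\subset V$, kernels proportional to $\exp\bigl(-\sum_{A\subset V,\,A\cap\Delta\neq\emptyset}\Phi_A(\sigma_\Delta\eta_{V\setminus\Delta})\bigr)\prod_{i\in\Delta}1_{T(\sigma_i)=\sigma'_i}\lambda(d\sigma_i)$, acting on configurations $\eta_V$ with $T(\eta_V)=\sigma'_V$. Standing assumption, written $q\ge q_0(\Phi)$: $q$ is large enough that these constrained specifications satisfy Dobrushin's uniqueness condition uniformly in $V$ and $\sigma'$, also when the arcs $T^{-1}(\sigma'_i)$ are replaced by subarcs; that is, $\sup_i\sum_j\bar C_{ij}<1$, where $\bar C_{ij}$ is the supremum, over all such constraints and all pairs of admissible boundary conditions differing only at $j$, of the total variation distance of the single-site kernels at $i$. $\mu_V[\sigma'_V]$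 denotes the resulting unique constrained Gibbs measure on $V$. The discrete specification $\gamma'$ on $\Omega$ is $$\gamma'_\Lambda(\sigma'_\Lambda|\sigma'_{\Lambda^c})=\frac{\int\mu_{\Lambda^c}[\sigma'_{\Lambda^c}](d\sigma_{\Lambda^c})\int\lambda^{\otimes\Lambda}(d\sigma_\Lambda)e^{-H_\Lambda(\sigma_\Lambda\sigma_{\Lambda^c})}1_{T(\sigma_\Lambda)=\sigma'_\Lambda}}{\int\mu_{\Lambda^c}[\sigma'_{\Lambda^c}](d\sigma_{\Lambda^c})\int\lambda^{\otimes\Lambda}(d\sigma_\Lambda)e^{-H_\Lambda(\sigma_\Lambda\sigma_{\Lambda^c})}},$$ which is a quasilocal specification. Recalled known fact: $\mu\mapsto T\mu:=\mu\circ T^{-1}$ is a bijection from $\mathrm{ex}\,\mathcal{G}_\theta(\gamma^\Phi)$ to $\mathrm{ex}\,\mathcal{G}_\theta(\gamma')$ with inverse $\mu'\mapsto\int\mu'(d\sigma')\mu_G[\sigma']$. Dynamics. For $\tau\in\mathbb{R}$, $M_\tau$ is the Markov kernel on $\Omega$ such that $M_\tau(\sigma',\cdot)$ is the law of $T(\sigma+\tau)$, where $\sigma\sim\mu_G[\sigma']$ and $\sigma+\tau$ rotates all spins by $\tau$ modulo $2\pi$. $M_\tau\nu'=\int\nu'(d\sigma')M_\tau(\sigma',\cdot)$. Entropy. For finite $\Lambda$, $h_\Lambda(\nu'|\mu')=\sum_{\sigma'_\Lambda\in\{0,\dots,q-1\}^\Lambda}\nu'(\sigma'_\Lambda)\log\frac{\nu'(\sigma'_\Lambda)}{\mu'(\sigma'_\Lambda)}$,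 with $\sigma'_\Lambda$ also denoting the cylinder event, and $h(\nu'|\mu')=\limsup_{\Lambda\uparrow G}\frac1{|\Lambda|}h_\Lambda(\nu'|\mu')$ along hypercubes $\Lambda$ centered at the origin. *)

theory Defs
  imports "HOL-Probability.Probability" "HOL-Library.Real_Mod"
begin

text \<open>The lattice \<open>\<int>\<^sup>d\<close> is the type \<open>int ^ 'd\<close>, with \<open>d = CARD('d)\<close> arbitrary.\<close>

type_synonym 'd site = "int ^ 'd"
type_synonym ('d, 's) conf = "'d site \<Rightarrow> 's"

definition shift_conf :: "('d::finite) site \<Rightarrow> ('d, 's) conf \<Rightarrow> ('d, 's) conf" where
  "shift_conf k \<eta> = (\<lambda>i. \<eta> (i + k))"

subsection \<open>The circle\<close>

definition circle :: "real set" where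
  "circle = {0..<2 * pi}"

text \<open>The topology is that of the circle, not the one inherited from \<open>\<real>\<close>: it is pulled back
  along \<^term>\<open>cis\<close>. Its Borel sets are nevertheless the usual Borel subsets of the interval.\<close>

definition circle_top :: "real topology" where
  "circle_top = pullback_topology circle cis euclidean"

definition conf_top :: "('d, real) conf topology" where
  "conf_top = product_topology (\<lambda>_. circle_top) UNIV"

definition rotate_conf :: "real \<Rightarrow> ('i \<Rightarrow> real) \<Rightarrow> ('i \<Rightarrow> real)" where
  "rotate_conf \<tau> \<eta> = (\<lambda>i. (\<eta> i + \<tau>) rmod (2 * pi))"

text \<open>For a set \<open>V\<close> of sites and a set \<open>S i\<close> of allowed angles at every site \<open>i \<in> V\<close>, the measurable
  space \<open>\<Prod>i\<in>V. S i\<close> of (extensional) configurations on \<open>V\<close>.\<close>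

definition conf_space :: "'i set \<Rightarrow> ('i \<Rightarrow> real set) \<Rightarrow> ('i \<Rightarrow> real) measure" where
  "conf_space V S = PiM V (\<lambda>i. restrict_space borel (S i))"

definition leb_prod :: "'i set \<Rightarrow> ('i \<Rightarrow> real set) \<Rightarrow> ('i \<Rightarrow> real) measure" where
  "leb_prod \<Lambda> S = PiM \<Lambda> (\<lambda>i. restrict_space lborel (S i))"

subsection \<open>Potentials\<close>

text \<open>\<open>\<Phi> A\<close> is a function of all spins; only finite \<open>A\<close> matter. In the locality clause the
  coordinates outside \<open>A\<close> need not be angles, so that \<open>\<Phi> A\<close> can be evaluated on configurations
  living on a set \<open>V \<supseteq> A\<close> only.\<close>

type_synonym 'd potential = "'d site set \<Rightarrow> ('d, real) conf \<Rightarrow> real"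

definition sup_norm :: "(('d, real) conf \<Rightarrow> real) \<Rightarrow> real" where
  "sup_norm f = (SUP \<eta>\<in>UNIV \<rightarrow>\<^sub>E circle. \<bar>f \<eta>\<bar>)"

definition is_potential :: "('d::finite) potential \<Rightarrow> bool" where
  "is_potential \<Phi> \<longleftrightarrow>
     (\<forall>A. finite A \<longrightarrow> continuous_map conf_top euclideanreal (\<Phi> A)) \<and>
     (\<forall>A \<eta> \<zeta>. finite A \<longrightarrow> (\<forall>i\<in>A. \<eta> i \<in> circle \<and> \<eta> i = \<zeta> i) \<longrightarrow> \<Phi> A \<eta> = \<Phi> A \<zeta>) \<and>
     (\<forall>i. (\<lambda>A. sup_norm (\<Phi> A)) summable_on {A. finite A \<and> i \<in> A})"

definition translation_invariant_potential :: "('d::finite) potential \<Rightarrow> bool" where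
  "translation_invariant_potential \<Phi> \<longleftrightarrow>
     (\<forall>A k. \<forall>\<eta>\<in>UNIV \<rightarrow>\<^sub>E circle. finite A \<longrightarrow> \<Phi> ((\<lambda>i. i + k) ` A) \<eta> = \<Phi> A (shift_conf k \<eta>))"

definition rotation_invariant_potential :: "('d::finite) potential \<Rightarrow> bool" where
  "rotation_invariant_potential \<Phi> \<longleftrightarrow>
     (\<forall>A \<tau>. \<forall>\<eta>\<in>UNIV \<rightarrow>\<^sub>E circle. finite A \<longrightarrow> \<Phi> A (rotate_conf \<tau> \<eta>) = \<Phi> A \<eta>)"

text \<open>Hamiltonian of \<open>\<Delta>\<close> for the system living on \<open>V\<close>; \<open>V = UNIV\<close> gives \<open>H\<^sub>\<Delta>\<close>.\<close>

definition hamiltonian :: "'d potential \<Rightarrow> 'd site set \<Rightarrow> 'd site set \<Rightarrow> ('d, real) conf \<Rightarrow> real" where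
  "hamiltonian \<Phi> V \<Delta> \<eta> = (\<Sum>\<^sub>\<infinity>A\<in>{A. finite A \<and> A \<subseteq> V \<and> A \<inter> \<Delta> \<noteq> {}}. \<Phi> A \<eta>)"

subsection \<open>Specifications and Gibbs measures\<close>

text \<open>Conditional law of the spins in \<open>\<Delta>\<close> given \<open>\<eta>\<close> outside, for the system on \<open>V\<close> with the spin at
  \<open>i\<close> constrained to \<open>S i\<close>. The constraint indicators are absorbed in the reference measure.
  \<open>override_on \<eta> \<sigma> \<Delta>\<close> is \<open>\<sigma>\<close> on \<open>\<Delta>\<close> and \<open>\<eta>\<close> elsewhere.\<close>

definition local_law ::
  "'d potential \<Rightarrow> 'd site set \<Rightarrow> ('d site \<Rightarrow> real set) \<Rightarrow> 'd site set \<Rightarrow> ('d, real) conf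
    \<Rightarrow> ('d, real) conf measure" where
  "local_law \<Phi> V S \<Delta> \<eta> =
     (let Z = (\<integral>\<sigma>. exp (- hamiltonian \<Phi> V \<Delta> (override_on \<eta> \<sigma> \<Delta>)) \<partial>leb_prod \<Delta> S)
      in density (leb_prod \<Delta> S)
           (\<lambda>\<sigma>. ennreal (exp (- hamiltonian \<Phi> V \<Delta> (override_on \<eta> \<sigma> \<Delta>)) / Z)))"

definition spec_kernel ::
  "'d potential \<Rightarrow> 'd site set \<Rightarrow> ('d site \<Rightarrow> real set) \<Rightarrow> 'd site set \<Rightarrow> ('d, real) conf
    \<Rightarrow> ('d, real) conf measure" where
  "spec_kernel \<Phi> V S \<Delta> \<eta> = distr (local_law \<Phi> V S \<Delta> \<eta>) (conf_space V S) (\<lambda>\<sigma>. override_on \<eta> \<sigma> \<Delta>)"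

definition gibbs_spec ::
  "'d potential \<Rightarrow> 'd site set \<Rightarrow> ('d, real) conf \<Rightarrow> ('d, real) conf measure" where
  "gibbs_spec \<Phi> = spec_kernel \<Phi> UNIV (\<lambda>_. circle)"

text \<open>DLR equations for a specification \<open>\<gamma>\<close> on the site set \<open>V\<close>; \<open>N\<close> only provides the measurable
  space of configurations on \<open>V\<close>.\<close>

definition gibbs_measures ::
  "'i set \<Rightarrow> ('i \<Rightarrow> 's) measure \<Rightarrow> ('i set \<Rightarrow> ('i \<Rightarrow> 's) \<Rightarrow> ('i \<Rightarrow> 's) measure)
    \<Rightarrow> ('i \<Rightarrow> 's) measure set" where
  "gibbs_measures V N \<gamma> =
     {\<mu>. prob_space \<mu> \<and> sets \<mu> = sets N \<and>
         (\<forall>\<Lambda> B. finite \<Lambda> \<longrightarrow> \<Lambda> \<subseteq> V \<longrightarrow> B \<in> sets N \<longrightarrow>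
            emeasure \<mu> B = (\<integral>\<^sup>+\<eta>. emeasure (\<gamma> \<Lambda> \<eta>) B \<partial>\<mu>))}"

definition ti_prob_measures :: "('d::finite, 's) conf measure \<Rightarrow> ('d, 's) conf measure set" where
  "ti_prob_measures N =
     {\<mu>. prob_space \<mu> \<and> sets \<mu> = sets N \<and> (\<forall>k. distr \<mu> N (shift_conf k) = \<mu>)}"

definition ti_gibbs_measures ::
  "('d::finite, 's) conf measure \<Rightarrow> ('d site set \<Rightarrow> ('d, 's) conf \<Rightarrow> ('d, 's) conf measure)
    \<Rightarrow> ('d, 's) conf measure set" where
  "ti_gibbs_measures N \<gamma> = gibbs_measures UNIV N \<gamma> \<inter> ti_prob_measures N"

text \<open>Measures do not form a real vector space as a type, hence not \<^const>\<open>extreme_point_of\<close>.\<close>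

definition extreme_measures :: "'a measure set \<Rightarrow> 'a measure set" where
  "extreme_measures C =
     {\<mu>\<in>C. \<not> (\<exists>\<mu>1\<in>C. \<exists>\<mu>2\<in>C. \<exists>t. 0 < t \<and> t < 1 \<and> \<mu>1 \<noteq> \<mu>2 \<and>
          (\<forall>B\<in>sets \<mu>. measure \<mu> B = t * measure \<mu>1 B + (1 - t) * measure \<mu>2 B))}"

subsection \<open>Continuous symmetry breaking\<close>

abbreviation circle_conf_space :: "('d, real) conf measure" where
  "circle_conf_space \<equiv> conf_space UNIV (\<lambda>_. circle)"

text \<open>The limit \<open>\<Lambda> \<nearrow> G\<close> is along the net of all finite sets of sites, directed by inclusion. Weak
  convergence is tested against functions continuous for the (compact) circle topology.\<close>

definition continuous_symmetry_breaking :: "('d::finite) potential \<Rightarrow> bool" where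
  "continuous_symmetry_breaking \<Phi> \<longleftrightarrow>
     (\<exists>\<mu> :: real \<Rightarrow> ('d, real) conf measure.
        (\<forall>\<phi>\<in>circle. prob_space (\<mu> \<phi>) \<and> sets (\<mu> \<phi>) = sets circle_conf_space \<and>
           (\<forall>f. continuous_map conf_top euclideanreal f \<longrightarrow>
              ((\<lambda>\<Lambda>. \<integral>\<sigma>. f \<sigma> \<partial>gibbs_spec \<Phi> \<Lambda> (\<lambda>_. \<phi>)) \<longlongrightarrow> (\<integral>\<sigma>. f \<sigma> \<partial>\<mu> \<phi>))
                (finite_subsets_at_top UNIV))) \<and>
        inj_on \<mu> circle \<and>
        extreme_measures (ti_gibbs_measures circle_conf_space (gibbs_spec \<Phi>)) = \<mu> ` circle)"

subsection \<open>Discretisation and constrained Gibbs measures\<close>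

definition coarse :: "nat \<Rightarrow> real \<Rightarrow> nat" where
  "coarse q \<phi> = nat \<lfloor>real q * \<phi> / (2 * pi)\<rfloor>"

definition arc_of :: "nat \<Rightarrow> nat \<Rightarrow> real set" where
  "arc_of q k = {2 * pi * real k / real q ..< 2 * pi * (real k + 1) / real q}"

lemma coarse_eq_iff:
  assumes "0 < q" and "\<phi> \<in> circle"
  shows "coarse q \<phi> = k \<longleftrightarrow> \<phi> \<in> arc_of q k"
proof -
  have nonneg: "0 \<le> real q * \<phi> / (2 * pi)"
    using assms by (simp add: circle_def)
  have "coarse q \<phi> = k \<longleftrightarrow> \<lfloor>real q * \<phi> / (2 * pi)\<rfloor> = int k"
    using nonneg by (auto simp: coarse_def)
  also have "\<dots> \<longleftrightarrow> real k \<le> real q * \<phi> / (2 * pi) \<and> real q * \<phi> / (2 * pi) < real k + 1"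
    by (simp add: floor_eq_iff)
  also have "\<dots> \<longleftrightarrow> \<phi> \<in> arc_of q k"
    using assms by (simp add: arc_of_def field_simps)
  finally show ?thesis .
qed

definition Omega :: "nat \<Rightarrow> ('d, nat) conf measure" where
  "Omega q = PiM UNIV (\<lambda>_. count_space {..<q})"

definition cells :: "nat \<Rightarrow> ('d, nat) conf \<Rightarrow> 'd site \<Rightarrow> real set" where
  "cells q s = (\<lambda>i. arc_of q (s i))"

text \<open>\<open>\<mu>\<^sub>V[\<sigma>'\<^sub>V]\<close>, as a measure on the configurations \<open>\<eta>\<^sub>V\<close> with \<open>T(\<eta>\<^sub>V) = \<sigma>'\<^sub>V\<close>.\<close>

definition constr_gibbs ::
  "'d potential \<Rightarrow> nat \<Rightarrow> 'd site set \<Rightarrow> ('d, nat) conf \<Rightarrow> ('d, real) conf measure" where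
  "constr_gibbs \<Phi> q V s =
     (THE \<mu>. \<mu> \<in> gibbs_measures V (conf_space V (cells q s)) (spec_kernel \<Phi> V (cells q s)))"

subsection \<open>Dobrushin's uniqueness condition\<close>

definition tv_dist :: "'a measure \<Rightarrow> 'a measure \<Rightarrow> ennreal" where
  "tv_dist M N = (SUP B\<in>sets M. ennreal \<bar>measure M B - measure N B\<bar>)"

text \<open>Constraints on \<open>V\<close>: at every site a non-degenerate half-open subarc of one of the \<open>q\<close> arcs.\<close>

definition arc_constraint :: "nat \<Rightarrow> 'd site set \<Rightarrow> ('d site \<Rightarrow> real set) \<Rightarrow> bool" where
  "arc_constraint q V S \<longleftrightarrow>
     (\<forall>i\<in>V. \<exists>k<q. \<exists>a b. a < b \<and> S i = {a..<b} \<and> {a..<b} \<subseteq> arc_of q k)"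

definition dobrushin_coeff :: "'d potential \<Rightarrow> nat \<Rightarrow> 'd site \<Rightarrow> 'd site \<Rightarrow> ennreal" where
  "dobrushin_coeff \<Phi> q i j =
     (SUP (V, S, \<eta>, \<zeta>) \<in> {(V, S, \<eta>, \<zeta>). i \<in> V \<and> arc_constraint q V S \<and>
          \<eta> \<in> PiE V S \<and> \<zeta> \<in> PiE V S \<and> (\<forall>k\<in>V - {j}. \<eta> k = \<zeta> k)}.
        tv_dist (local_law \<Phi> V S {i} \<eta>) (local_law \<Phi> V S {i} \<zeta>))"

definition dobrushin_condition :: "('d::finite) potential \<Rightarrow> nat \<Rightarrow> bool" where
  "dobrushin_condition \<Phi> q \<longleftrightarrow> (SUP i. \<Sum>\<^sub>\<infinity>j. dobrushin_coeff \<Phi> q i j) < 1"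

subsection \<open>The discrete specification\<close>

definition disc_prob ::
  "'d potential \<Rightarrow> nat \<Rightarrow> 'd site set \<Rightarrow> ('d, nat) conf \<Rightarrow> ('d, nat) conf \<Rightarrow> real" where
  "disc_prob \<Phi> q \<Lambda> w s =
     (\<integral>\<xi>. (\<integral>\<sigma>. exp (- hamiltonian \<Phi> UNIV \<Lambda> (override_on \<xi> \<sigma> \<Lambda>))
               * indicator {\<sigma>. \<forall>i\<in>\<Lambda>. coarse q (\<sigma> i) = w i} \<sigma> \<partial>leb_prod \<Lambda> (\<lambda>_. circle))
          \<partial>constr_gibbs \<Phi> q (- \<Lambda>) s)
     / (\<integral>\<xi>. (\<integral>\<sigma>. exp (- hamiltonian \<Phi> UNIV \<Lambda> (override_on \<xi> \<sigma> \<Lambda>)) \<partial>leb_prod \<Lambda> (\<lambda>_. circle))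
          \<partial>constr_gibbs \<Phi> q (- \<Lambda>) s)"

definition disc_spec ::
  "'d potential \<Rightarrow> nat \<Rightarrow> 'd site set \<Rightarrow> ('d, nat) conf \<Rightarrow> ('d, nat) conf measure" where
  "disc_spec \<Phi> q \<Lambda> s =
     distr (density (count_space (\<Lambda> \<rightarrow>\<^sub>E {..<q})) (\<lambda>w. ennreal (disc_prob \<Phi> q \<Lambda> w s)))
       (Omega q) (\<lambda>w. override_on s w \<Lambda>)"

subsection \<open>Dynamics and relative entropy density\<close>

definition rot_kernel ::
  "'d potential \<Rightarrow> nat \<Rightarrow> real \<Rightarrow> ('d, nat) conf \<Rightarrow> ('d, nat) conf measure" where
  "rot_kernel \<Phi> q \<tau> s =
     distr (constr_gibbs \<Phi> q UNIV s) (Omega q) (\<lambda>\<sigma> i. coarse q (rotate_conf \<tau> \<sigma> i))"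

definition evolve ::
  "'d potential \<Rightarrow> nat \<Rightarrow> real \<Rightarrow> ('d, nat) conf measure \<Rightarrow> ('d, nat) conf measure" where
  "evolve \<Phi> q \<tau> \<nu> = Giry_Monad.bind \<nu> (rot_kernel \<Phi> q \<tau>)"

definition entropy_term :: "real \<Rightarrow> real \<Rightarrow> ereal" where
  "entropy_term p r = (if p = 0 then 0 else if r = 0 then \<infinity> else ereal (p * ln (p / r)))"

definition cylinder :: "nat \<Rightarrow> 'd site set \<Rightarrow> ('d, nat) conf \<Rightarrow> ('d, nat) conf set" where
  "cylinder q \<Lambda> w = {s \<in> space (Omega q). \<forall>i\<in>\<Lambda>. s i = w i}"

definition local_entropy ::
  "nat \<Rightarrow> 'd site set \<Rightarrow> ('d, nat) conf measure \<Rightarrow> ('d, nat) conf measure \<Rightarrow> ereal" where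
  "local_entropy q \<Lambda> \<nu> \<mu> =
     (\<Sum>w\<in>\<Lambda> \<rightarrow>\<^sub>E {..<q}. entropy_term (measure \<nu> (cylinder q \<Lambda> w)) (measure \<mu> (cylinder q \<Lambda> w)))"

definition hypercube :: "nat \<Rightarrow> ('d::finite) site set" where
  "hypercube n = {i. \<forall>k. \<bar>i $ k\<bar> \<le> int n}"

definition rel_entropy_density ::
  "nat \<Rightarrow> ('d::finite, nat) conf measure \<Rightarrow> ('d, nat) conf measure \<Rightarrow> ereal" where
  "rel_entropy_density q \<nu> \<mu> =
     limsup (\<lambda>n. local_entropy q (hypercube n) \<nu> \<mu> / ereal (real (card (hypercube n :: 'd site set))))"

end

theory Submission
  imports Defs
begin

text \<open>Let \<open>\<lambda>\<close> be the rotated lift of \<open>\<nu>'\<close> to continuous spins and \<open>\<lambda>'\<close> the lift of the evolved measure; they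
  have the same discrete marginal. On a finite box, up to boundary terms, both have a density with respect
  to the free-boundary weight, which is rotation invariant, so the entropy lost in one step bounds the
  relative entropy of \<open>\<lambda>\<close> with respect to \<open>\<lambda>'\<close>. If \<open>\<lambda>\<close> is not invariant under the single-site kernels
  constrained to the cells, a local observable sees this, and copies of it packed into the box make the
  relative entropy grow like the volume. So equality of the entropy densities makes \<open>\<lambda>\<close> constrained Gibbs:
  the lift of \<open>\<nu>'\<close> is invariant under the kernels constrained to the cells and to the rotated cells.
  As \<open>0 < \<tau> < 2\<pi>/q\<close>, the two families of arcs overlap in a chain around the circle, and
  the lift is invariant under the unconstrained kernels. Uniqueness of the constrained Gibbs measures then
  turns this into the discrete DLR equations. Conversely, both entropy densities of a Gibbs measure vanish,
  because its cylinder probabilities agree with the free-boundary weights up to boundary terms.\<close>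


section \<open>Bounded measurable functions\<close>

text \<open>The entropy density is only a limsup along cubes, so equal densities do not by
  themselves make the entropy loss small in a prescribed box. The failure of one single-site
  equation must be turned into a loss of at least a fixed multiple of the volume in every large
  cube, against errors given by the interaction across the boundary, which is o(volume). The
  variational form of relative entropy yields this from the exponential moment of one test function,
  so neither conditional entropies nor densities of infinite-volume measures appear. Conditional
  expectations are treated as operators on bounded functions: \<open>K V E Y\<close> averages over
  the spins in \<open>Y\<close>, each kept in its class for an equivalence relation \<open>E\<close>
  on the circle. Dobrushin's condition enters in one form: compositions of one-site operators
  flatten a quasilocal function on every box of cells. This gives existence and uniqueness of the
  constrained measures, and it lets outside spins be replaced by their constrained law in the final
  DLR computation.\<close>

lemmas icong = Bochner_Integration.integral_cong

text \<open>Observables are kept bounded and measurable throughout: integrability against a finite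
  measure is then automatic, and the averaging operators below map this class into itself.\<close>

definition bm :: "'a measure => ('a => real) => bool" where
  "bm M f \<longleftrightarrow> f \<in> borel_measurable M \<and> (\<exists>b. \<forall>x\<in>space M. \<bar>f x\<bar> \<le> b)"

lemma bmI: "f \<in> borel_measurable M ==> (\<And>x. x \<in> space M ==> \<bar>f x\<bar> \<le> b) ==> bm M f"
  by (auto simp: bm_def)

lemma bm_measurable [measurable_dest]: "bm M f ==> f \<in> borel_measurable M"
  by (auto simp: bm_def)

lemma bm_bounded:
  assumes "bm M f" obtains b where "b > 0" "\<And>x. x \<in> space M ==> \<bar>f x\<bar> \<le> b"
proof -
  obtain b where "\<forall>x\<in>space M. \<bar>f x\<bar> \<le> b" using assms by (auto simp: bm_def)
  then show ?thesis by (intro that[of "\<bar>b\<bar> + 1"]) (auto intro: order_trans)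
qed

lemma bm_const [simp, intro]: "bm M (\<lambda>_. c)"
  by (rule bmI[of _ _ "\<bar>c\<bar>"]) auto

lemma bm_add [intro]: assumes "bm M f" "bm M g" shows "bm M (\<lambda>x. f x + g x)"
proof -
  obtain a where "\<And>x. x \<in> space M ==> \<bar>f x\<bar> \<le> a" using bm_bounded[OF assms(1)] by blast
  moreover obtain b where "\<And>x. x \<in> space M ==> \<bar>g x\<bar> \<le> b" using bm_bounded[OF assms(2)] by blast
  ultimately show ?thesis using assms
    by (intro bmI[of _ _ "a + b"]) (auto simp: bm_measurable intro: order_trans[OF abs_triangle_ineq] add_mono)
qed

lemma bm_mult [intro]: assumes "bm M f" "bm M g" shows "bm M (\<lambda>x. f x * g x)"
proof -
  obtain a where "a > 0" "\<And>x. x \<in> space M ==> \<bar>f x\<bar> \<le> a" using bm_bounded[OF assms(1)] by blast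
  moreover obtain b where "b > 0" "\<And>x. x \<in> space M ==> \<bar>g x\<bar> \<le> b" using bm_bounded[OF assms(2)] by blast
  ultimately show ?thesis using assms
    by (intro bmI[of _ _ "a * b"]) (auto simp: bm_measurable abs_mult intro!: mult_mono)
qed

lemma bm_uminus [intro]: "bm M f ==> bm M (\<lambda>x. - f x)"
  using bm_mult[OF bm_const, of M f "-1"] by simp

lemma bm_diff [intro]: "bm M f ==> bm M g ==> bm M (\<lambda>x. f x - g x)"
  using bm_add[OF _ bm_uminus, of M f g] by simp

lemma bm_sum [intro]: "(\<And>i. i \<in> I ==> bm M (f i)) ==> bm M (\<lambda>x. \<Sum>i\<in>I. f i x)"
  by (induction I rule: infinite_finite_induct) auto

lemma bm_exp [intro]: assumes "bm M f" shows "bm M (\<lambda>x. exp (f x))"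
proof -
  obtain a where "\<And>x. x \<in> space M ==> \<bar>f x\<bar> \<le> a" using bm_bounded[OF assms(1)] by blast
  then show ?thesis using assms
    by (intro bmI[of _ _ "exp a"]) (auto simp: bm_measurable abs_le_iff)
qed

lemma bm_divide:
  assumes "bm M f" "bm M g" "c > 0" "\<And>x. x \<in> space M ==> g x \<ge> c"
  shows "bm M (\<lambda>x. f x / g x)"
proof -
  have "bm M (\<lambda>x. 1 / g x)"
    using assms by (intro bmI[of _ _ "1 / c"]) (force simp: bm_measurable intro!: divide_left_mono)+
  from bm_mult[OF assms(1) this] show ?thesis by simp
qed

lemma bm_compose:
  assumes "bm M f" "g \<in> measurable N M" shows "bm N (\<lambda>x. f (g x))"
proof -
  obtain a where "\<And>x. x \<in> space M ==> \<bar>f x\<bar> \<le> a" using bm_bounded[OF assms(1)] by blast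
  then show ?thesis using assms
    by (intro bmI[of _ _ a]) (auto simp: measurable_space intro: measurable_compose bm_measurable)
qed

lemma bm_cong: "bm M f ==> (\<And>x. x \<in> space M ==> f x = g x) ==> bm M g"
  unfolding bm_def using measurable_cong[of M f g] by auto

lemma bm_sets_cong: "sets M = sets N ==> bm M f = bm N f"
  unfolding bm_def using measurable_cong_sets[of M N borel borel] sets_eq_imp_space_eq[of M N] by auto

lemma bm_indicator: "A \<in> sets M ==> bm M (indicator A)"
  by (rule bmI[of _ _ 1]) (auto split: split_indicator)

lemma bm_integrable:
  assumes "finite_measure M" "bm M f" shows "integrable M f"
proof -
  interpret finite_measure M by fact
  obtain a where "\<And>x. x \<in> space M ==> \<bar>f x\<bar> \<le> a" using bm_bounded[OF assms(2)] by blast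
  then show ?thesis using assms(2)
    by (intro integrable_const_bound[of _ a]) (auto simp: bm_measurable)
qed

lemma abs_integral_le:
  assumes "finite_measure M" "bm M f" "\<And>x. x \<in> space M ==> \<bar>f x\<bar> \<le> a"
  shows "\<bar>integral\<^sup>L M f\<bar> \<le> a * measure M (space M)"
proof -
  interpret finite_measure M by fact
  have i: "integrable M f" using assms bm_integrable by blast
  have "\<bar>integral\<^sup>L M f\<bar> \<le> (LINT x|M. \<bar>f x\<bar>)" by (rule integral_abs_bound)
  also have "\<dots> \<le> (LINT x|M. a)" by (rule integral_mono) (use i assms in auto)
  finally show ?thesis by (simp add: mult.commute)
qed

lemma bm_integral:
  assumes N: "finite_measure N" and f: "bm (M \<Otimes>\<^sub>M N) (\<lambda>(x, y). f x y)"
  shows "bm M (\<lambda>x. LINT y|N. f x y)"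
proof -
  interpret finite_measure N by fact
  obtain a where a: "\<And>z. z \<in> space (M \<Otimes>\<^sub>M N) ==> \<bar>(\<lambda>(x, y). f x y) z\<bar> \<le> a" using bm_bounded[OF f] by blast
  have m [measurable]: "(\<lambda>(x, y). f x y) \<in> borel_measurable (M \<Otimes>\<^sub>M N)" using f by (rule bm_measurable)
  show ?thesis
  proof (rule bmI)
    show "(\<lambda>x. LINT y|N. f x y) \<in> borel_measurable M"
      by (rule borel_measurable_lebesgue_integral) (rule m)
    fix x assume x: "x \<in> space M"
    show "\<bar>LINT y|N. f x y\<bar> \<le> a * measure N (space N)"
    proof (rule abs_integral_le)
      have "(\<lambda>y. (x, y)) \<in> measurable N (M \<Otimes>\<^sub>M N)" using x by measurable
      from bm_compose[OF f this] show "bm N (f x)" by simp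
      show "\<And>y. y \<in> space N ==> \<bar>f x y\<bar> \<le> a" using a[of "(x, _)"] x by (auto simp: space_pair_measure)
    qed fact
  qed
qed

lemma prob_abs_integral_le:
  assumes "prob_space M" "bm M f" "\<And>x. x \<in> space M ==> \<bar>f x\<bar> \<le> a"
  shows "\<bar>integral\<^sup>L M f\<bar> \<le> a"
  using abs_integral_le[OF prob_space.finite_measure[OF assms(1)] assms(2,3)] prob_space.prob_space[OF assms(1)] by auto

lemma prob_integrable: "prob_space M ==> bm M f ==> integrable M f"
  using bm_integrable prob_space.finite_measure by blast

section \<open>The circle and the potential\<close>

abbreviation LC :: "real measure" where "LC \<equiv> restrict_space lborel circle"
abbreviation cspace :: "'i set => ('i => real) measure" where "cspace V \<equiv> conf_space V (\<lambda>_. circle)"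
abbreviation cs :: "'i set => ('i => real) set" where "cs V \<equiv> space (cspace V)"
abbreviation lebc :: "'i set => ('i => real) measure" where "lebc Y \<equiv> leb_prod Y (\<lambda>_. circle)"

lemma circle_sets [measurable, simp]: "circle \<in> sets borel"
  by (simp add: circle_def)

lemma space_LC [simp]: "space LC = circle"
  by (simp add: space_restrict_space)

lemma sets_LC: "sets LC = sets (restrict_space borel circle)"
  by (simp add: sets_restrict_space)

lemma finite_measure_LC: "finite_measure LC"
  by (rule finite_measureI) (simp add: emeasure_restrict_space circle_def)

lemma zero_circle [simp]: "0 \<in> circle"
  by (simp add: circle_def)

lemma sets_leb_prod: "sets (leb_prod Y S) = sets (conf_space Y S)"
  unfolding leb_prod_def conf_space_def by (rule sets_PiM_cong) (auto simp: sets_restrict_space)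

lemma space_conf_space: "space (conf_space V S) = PiE V S"
  by (simp add: conf_space_def space_PiM space_restrict_space)

lemma space_leb_prod: "space (leb_prod V S) = PiE V S"
  by (simp add: leb_prod_def space_PiM space_restrict_space)

lemma product_sigma_finite_LC: "product_sigma_finite (\<lambda>_. LC)"
  using finite_measure.sigma_finite_measure[OF finite_measure_LC]
  by (simp add: product_sigma_finite_def)

lemma measure_LC: "measure LC circle = 2 * pi"
  by (subst measure_restrict_space) (auto simp: circle_def)

lemma emeasure_LC: "emeasure LC circle = ennreal (2 * pi)"
  by (subst emeasure_restrict_space) (auto simp: circle_def)

lemma finite_measure_lebc: assumes "finite Y" shows "finite_measure (lebc Y)"
proof (rule finite_measureI)
  interpret product_sigma_finite "\<lambda>_. LC" by (rule product_sigma_finite_LC)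
  have "emeasure (PiM Y (\<lambda>_. LC)) (PiE Y (\<lambda>_. circle)) = (\<Prod>i\<in>Y. emeasure LC circle)"
    using emeasure_PiM[OF assms, of "\<lambda>_. circle"] by (metis sets.top space_LC)
  then show "emeasure (lebc Y) (space (lebc Y)) \<noteq> \<infinity>"
    unfolding space_leb_prod unfolding leb_prod_def by (simp add: emeasure_LC power_eq_top_ennreal)
qed

text \<open>The half-open interval is the image of the unit circle under \<open>Arg2pi\<close>,
  which is continuous for the pulled-back topology because \<open>cis\<close> undoes it. Compactness
  makes each \<open>\<Phi> A\<close> bounded, so that \<open>sup_norm\<close> is an honest
  supremum.\<close>

lemma compact_space_circle_top: "compact_space circle_top"
proof -
  have ts: "topspace circle_top = circle"
    by (simp add: circle_top_def topspace_pullback_topology)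
  have im: "Arg2pi ` sphere 0 1 = circle"
  proof
    show "Arg2pi ` sphere 0 1 \<subseteq> circle"
      using Arg2pi by (auto simp: circle_def)
    show "circle \<subseteq> Arg2pi ` sphere 0 1"
    proof
      fix x :: real assume "x \<in> circle"
      then have "Arg2pi (cis x) = x" by (intro Arg2pi_unique[of 1]) (auto simp: circle_def cis_conv_exp)
      then show "x \<in> Arg2pi ` sphere 0 1" by (intro image_eqI[of _ _ "cis x"]) auto
    qed
  qed
  have "continuous_map (top_of_set (sphere 0 1)) circle_top Arg2pi"
    unfolding circle_top_def
  proof (rule continuous_map_pullback')
    have "cis (Arg2pi z) = z" if "z \<in> sphere 0 1" for z
      using Arg2pi_eq[of z] that by (simp add: cis_conv_exp)
    then have "continuous_on (sphere 0 1) (cis \<circ> Arg2pi)"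
      by (subst continuous_on_cong[OF refl, where g = id]) auto
    then show "continuous_map (top_of_set (sphere 0 1)) euclidean (cis \<circ> Arg2pi)"
      by simp
    show "topspace (top_of_set (sphere 0 1)) \<subseteq> Arg2pi -` circle" using im by auto
  qed
  then have "compactin circle_top (Arg2pi ` sphere 0 1)"
    by (rule image_compactin[rotated]) (auto simp: compactin_subtopology)
  then show ?thesis unfolding im by (simp add: compact_space_def ts)
qed

lemma topspace_conf_top: "topspace conf_top = UNIV \<rightarrow>\<^sub>E circle"
  by (simp add: conf_top_def circle_top_def topspace_pullback_topology)

lemma compact_space_conf_top: "compact_space conf_top"
  by (auto simp: conf_top_def compact_space_product_topology compact_space_circle_top)

text \<open>Coordinatewise \<open>cis\<close> identifies configurations with a product of unit
  circles inside a countable product of complex planes, where open sets belong to the product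
  \<sigma>-algebra. Pulling back along \<open>cis\<close> turns topological openness into
  measurability for the coordinates, which makes continuous potentials measurable.\<close>

lemma openin_conf_top_sets:
  assumes "openin (conf_top :: ('d::finite, real) conf topology) W"
  shows "W \<in> sets (cspace UNIV)"
proof -
  define T :: "('d site => complex) set" where "T = PiE UNIV (\<lambda>_. sphere 0 1)"
  define h :: "('d site => complex) => ('d site => real)" where "h z = (\<lambda>i. Arg2pi (z i))" for z
  define e :: "('d site => real) => ('d site => complex)" where "e x = (\<lambda>i. cis (x i))" for x
  have he: "h (e x) = x" if "x \<in> UNIV \<rightarrow>\<^sub>E circle" for x
  proof
    fix i have "x i \<in> circle" using that by auto
    then show "h (e x) i = x i" unfolding h_def e_def by (intro Arg2pi_unique[of 1]) (auto simp: circle_def cis_conv_exp)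
  qed
  have c: "continuous_map (top_of_set T) conf_top h"
    unfolding conf_top_def continuous_map_componentwise_UNIV
  proof
    fix i
    show "continuous_map (top_of_set T) circle_top (\<lambda>x. h x i)"
      unfolding circle_top_def
    proof (rule continuous_map_pullback')
      have "(cis \<circ> (\<lambda>x. h x i)) z = z i" if "z \<in> T" for z
        using Arg2pi_eq[of "z i"] that by (auto simp: T_def h_def cis_conv_exp PiE_iff)
      then have "continuous_on T (cis \<circ> (\<lambda>x. h x i))"
        by (subst continuous_on_cong[OF refl, where g = "\<lambda>z. z i"]) (auto intro: continuous_on_subset[OF continuous_on_product_coordinates])
      then show "continuous_map (top_of_set T) euclidean (cis \<circ> (\<lambda>x. h x i))" by simp
      show "topspace (top_of_set T) \<subseteq> (\<lambda>x. h x i) -` circle" using Arg2pi by (auto simp: h_def circle_def)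
    qed
  qed
  have "openin (top_of_set T) {z \<in> T. h z \<in> W}"
    using openin_continuous_map_preimage[OF c assms] by simp
  then obtain U where U: "open U" "{z \<in> T. h z \<in> W} = T \<inter> U" by (auto simp: openin_open)
  have W: "W \<subseteq> UNIV \<rightarrow>\<^sub>E circle" using openin_subset[OF assms] topspace_conf_top by auto
  have "W = e -` U \<inter> cs UNIV"
  proof (intro set_eqI iffI)
    fix x assume x: "x \<in> W"
    then have "e x \<in> {z \<in> T. h z \<in> W}" using W he by (auto simp: T_def e_def)
    then show "x \<in> e -` U \<inter> cs UNIV" using x W by (auto simp: U space_conf_space)
  next
    fix x assume x: "x \<in> e -` U \<inter> cs UNIV"
    then have "e x \<in> T \<inter> U" by (auto simp: T_def e_def)
    then have "h (e x) \<in> W" using U(2) by blast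
    then show "x \<in> W" using x he by (simp add: space_conf_space)
  qed
  moreover have "e \<in> borel_measurable (cspace UNIV)"
    unfolding e_def
  proof (rule measurable_coordinatewise_then_product)
    fix i :: "'d site"
    have "(\<lambda>x. x i) \<in> measurable (cspace UNIV) (restrict_space borel circle)" unfolding conf_space_def by measurable
    then have "(\<lambda>x. x i) \<in> borel_measurable (cspace UNIV)" by (simp add: measurable_restrict_space2_iff)
    moreover have "cis \<in> borel_measurable borel" by (intro borel_measurable_continuous_onI continuous_intros)
    ultimately show "(\<lambda>x. cis (x i)) \<in> borel_measurable (cspace UNIV)" by simp
  qed
  ultimately show ?thesis using U(1) by (metis borel_open measurable_sets)
qed

text \<open>Countable unordered sums become limits along a sequence of finite subsets, so that they
  inherit measurability from finite sums.\<close>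

lemma finite_enum_subsets_at_top:
  fixes F :: "'a set" assumes "countable F"
  shows "filterlim (\<lambda>n. {A \<in> F. to_nat_on F A < n}) (finite_subsets_at_top F) sequentially"
  unfolding filterlim_finite_subsets_at_top
proof (intro allI impI)
  fix X assume X: "finite X \<and> X \<subseteq> F"
  have fin: "finite {A \<in> F. to_nat_on F A < n}" for n
    by (rule finite_imageD[where f = "to_nat_on F"])
      (auto intro: finite_subset[of _ "{..<n}"] inj_on_subset[OF inj_on_to_nat_on[OF assms]])
  show "\<forall>\<^sub>F n in sequentially. finite {A \<in> F. to_nat_on F A < n} \<and> X \<subseteq> {A \<in> F. to_nat_on F A < n} \<and> {A \<in> F. to_nat_on F A < n} \<subseteq> F"
  proof (rule eventually_sequentiallyI[of "Suc (Max (to_nat_on F ` X))"])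
    fix n assume n: "Suc (Max (to_nat_on F ` X)) \<le> n"
    have "to_nat_on F A < n" if "A \<in> X" for A
    proof -
      have "to_nat_on F A \<le> Max (to_nat_on F ` X)" using X that by (intro Max_ge) auto
      then show ?thesis using n by linarith
    qed
    then show "finite {A \<in> F. to_nat_on F A < n} \<and> X \<subseteq> {A \<in> F. to_nat_on F A < n} \<and> {A \<in> F. to_nat_on F A < n} \<subseteq> F"
      using X fin by auto
  qed
qed

lemma borel_measurable_infsum_real:
  fixes f :: "'a => 'b => real"
  assumes "countable F" "\<And>A. A \<in> F ==> f A \<in> borel_measurable M"
    "\<And>x. x \<in> space M ==> (\<lambda>A. f A x) summable_on F"
  shows "(\<lambda>x. \<Sum>\<^sub>\<infinity>A\<in>F. f A x) \<in> borel_measurable M"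
proof (rule borel_measurable_LIMSEQ_real)
  fix x assume "x \<in> space M"
  then have "((\<lambda>A. f A x) has_sum (\<Sum>\<^sub>\<infinity>A\<in>F. f A x)) F" using assms(3) by simp
  then show "(\<lambda>n. \<Sum>A\<in>{A \<in> F. to_nat_on F A < n}. f A x) \<longlonglongrightarrow> (\<Sum>\<^sub>\<infinity>A\<in>F. f A x)"
    unfolding has_sum_def using finite_enum_subsets_at_top[OF assms(1)] by (rule filterlim_compose)
next
  fix n show "(\<lambda>x. \<Sum>A\<in>{A \<in> F. to_nat_on F A < n}. f A x) \<in> borel_measurable M"
    using assms(2) by (intro borel_measurable_sum) auto
qed

lemma cspace_component [measurable (raw)]:
  "i \<in> V ==> (\<lambda>x. x i) \<in> measurable (cspace V) (restrict_space borel circle)"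
  unfolding conf_space_def by measurable

lemma measurable_cspaceI:
  assumes "\<And>i. i \<in> V ==> (\<lambda>x. f x i) \<in> measurable M (restrict_space borel circle)"
    "\<And>x. x \<in> space M ==> f x \<in> extensional V"
  shows "f \<in> measurable M (cspace V)"
  unfolding conf_space_def
proof (rule measurable_PiM_single')
  show "f \<in> space M \<rightarrow> (\<Pi>\<^sub>E i\<in>V. space (restrict_space borel circle))"
    using assms(2) measurable_space[OF assms(1)] by (auto simp: PiE_iff)
qed (use assms in auto)

section \<open>Absolutely summable potentials and their Hamiltonians\<close>

locale potential =
  fixes \<Phi> :: "('d::finite) potential"
  assumes is_pot: "is_potential \<Phi>"
begin

definition nrm :: "'d site set => real" where "nrm A = sup_norm (\<Phi> A)"

definition bonds :: "'d site set => 'd site set => 'd site set set" where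
  "bonds V \<Delta> = {A. finite A \<and> A \<subseteq> V \<and> A \<inter> \<Delta> \<noteq> {}}"

abbreviation H :: "'d site set => 'd site set => ('d, real) conf => real" where
  "H \<equiv> hamiltonian \<Phi>"

lemma H_def: "H V \<Delta> \<eta> = (\<Sum>\<^sub>\<infinity>A\<in>bonds V \<Delta>. \<Phi> A \<eta>)"
  by (simp add: hamiltonian_def bonds_def)

lemma \<Phi>_cong: "finite A ==> (\<And>i. i \<in> A ==> \<eta> i \<in> circle \<and> \<eta> i = \<zeta> i) ==> \<Phi> A \<eta> = \<Phi> A \<zeta>"
  using is_pot unfolding is_potential_def by blast

lemma bdd_\<Phi>: assumes "finite A" shows "bdd_above ((\<lambda>\<eta>. \<bar>\<Phi> A \<eta>\<bar>) ` (UNIV \<rightarrow>\<^sub>E circle))"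
proof -
  have "continuous_map conf_top euclideanreal (\<Phi> A)"
    using is_pot assms unfolding is_potential_def by blast
  then have "compactin euclideanreal (\<Phi> A ` topspace conf_top)"
    using compact_space_conf_top unfolding compact_space_def by (rule image_compactin[rotated])
  then have "bounded (\<Phi> A ` (UNIV \<rightarrow>\<^sub>E circle))" by (simp add: topspace_conf_top compact_imp_bounded)
  then show ?thesis by (auto simp: bounded_iff bdd_above_def)
qed

lemma abs_\<Phi>_le: assumes "finite A" "\<And>i. i \<in> A ==> \<eta> i \<in> circle" shows "\<bar>\<Phi> A \<eta>\<bar> \<le> nrm A"
proof -
  \<comment> \<open>\<open>sup_norm\<close> ranges over total configurations of angles; the
    coordinates outside \<open>A\<close> do not matter to \<open>\<Phi> A\<close> and are reset to
    the angle 0.\<close>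
  let ?z = "\<lambda>i. if i \<in> A then \<eta> i else 0"
  have "\<Phi> A \<eta> = \<Phi> A ?z" using assms by (intro \<Phi>_cong) auto
  moreover have "?z \<in> UNIV \<rightarrow>\<^sub>E circle" using assms by auto
  ultimately show ?thesis unfolding nrm_def sup_norm_def using bdd_\<Phi>[OF assms(1)] by (auto intro: cSUP_upper2)
qed

lemma nrm_nonneg: "finite A ==> 0 \<le> nrm A"
  using abs_\<Phi>_le[of A "\<lambda>_. 0"] by auto

lemma countable_bonds: "countable (bonds V \<Delta>)"
  by (rule countable_subset[OF _ countable_Collect_finite]) (auto simp: bonds_def)

lemma summable_bonds: assumes "finite \<Delta>" shows "nrm summable_on bonds V \<Delta>"
proof -
  have "nrm summable_on (\<Union>i\<in>\<Delta>. {A. finite A \<and> i \<in> A})"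
    using assms
  proof induction
    case (insert i \<Delta>)
    have "nrm summable_on {A. finite A \<and> i \<in> A}"
      using is_pot unfolding is_potential_def nrm_def by blast
    then show ?case using insert by (auto intro: summable_on_union)
  qed auto
  then show ?thesis by (rule summable_on_subset) (auto simp: bonds_def)
qed

lemma summable_\<Phi>: assumes "nrm summable_on F" "\<And>A. A \<in> F ==> finite A" "\<And>A i. A \<in> F ==> i \<in> A ==> \<eta> i \<in> circle"
  shows "(\<lambda>A. \<Phi> A \<eta>) summable_on F" and "\<bar>\<Sum>\<^sub>\<infinity>A\<in>F. \<Phi> A \<eta>\<bar> \<le> (\<Sum>\<^sub>\<infinity>A\<in>F. nrm A)"
proof -
  have a: "(\<lambda>A. norm (\<Phi> A \<eta>)) summable_on F"
    using assms(1) by (rule summable_on_comparison_test) (use assms abs_\<Phi>_le in auto)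
  then show "(\<lambda>A. \<Phi> A \<eta>) summable_on F" by (rule abs_summable_summable)
  have "\<bar>\<Sum>\<^sub>\<infinity>A\<in>F. \<Phi> A \<eta>\<bar> \<le> (\<Sum>\<^sub>\<infinity>A\<in>F. \<bar>\<Phi> A \<eta>\<bar>)" using norm_infsum_bound[OF a] by simp
  also have "\<dots> \<le> (\<Sum>\<^sub>\<infinity>A\<in>F. nrm A)" using a assms abs_\<Phi>_le by (intro infsum_mono) auto
  finally show "\<bar>\<Sum>\<^sub>\<infinity>A\<in>F. \<Phi> A \<eta>\<bar> \<le> (\<Sum>\<^sub>\<infinity>A\<in>F. nrm A)" .
qed

lemma bondsD: "A \<in> bonds V \<Delta> ==> finite A \<and> A \<subseteq> V \<and> A \<inter> \<Delta> \<noteq> {}"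
  by (simp add: bonds_def)

text \<open>Bounds \<open>H V \<Delta>\<close> for every \<open>V\<close> at once, since the bonds
  inside \<open>V\<close> are among those of the whole lattice.\<close>

definition Nrm :: "'d site set => real" where "Nrm \<Delta> = (\<Sum>\<^sub>\<infinity>A\<in>bonds UNIV \<Delta>. nrm A)"

lemma summable_H: assumes "finite \<Delta>" "\<And>i. i \<in> V ==> \<eta> i \<in> circle"
  shows "(\<lambda>A. \<Phi> A \<eta>) summable_on bonds V \<Delta>"
proof (rule summable_\<Phi>(1)[OF summable_bonds[OF assms(1)]])
  fix A i assume "A \<in> bonds V \<Delta>" "i \<in> A"
  then show "\<eta> i \<in> circle" using assms(2) bondsD by blast
qed (auto dest: bondsD)

lemma abs_H_le: assumes "finite \<Delta>" "\<And>i. i \<in> V ==> \<eta> i \<in> circle" shows "\<bar>H V \<Delta> \<eta>\<bar> \<le> Nrm \<Delta>"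
proof -
  have "\<bar>H V \<Delta> \<eta>\<bar> \<le> (\<Sum>\<^sub>\<infinity>A\<in>bonds V \<Delta>. nrm A)"
    unfolding H_def
  proof (rule summable_\<Phi>(2)[OF summable_bonds[OF assms(1)]])
    fix A i assume "A \<in> bonds V \<Delta>" "i \<in> A"
    then show "\<eta> i \<in> circle" using assms(2) bondsD by blast
  qed (auto dest: bondsD)
  also have "\<dots> \<le> Nrm \<Delta>"
    unfolding Nrm_def by (rule infsum_mono2[OF summable_bonds summable_bonds]) (use assms in \<open>auto simp: bonds_def nrm_nonneg\<close>)
  finally show ?thesis .
qed

lemma H_cong: assumes "\<And>i. i \<in> V ==> \<eta> i \<in> circle \<and> \<eta> i = \<zeta> i" shows "H V \<Delta> \<eta> = H V \<Delta> \<zeta>"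
  unfolding H_def by (rule infsum_cong, rule \<Phi>_cong) (use assms in \<open>auto simp: bonds_def\<close>)

lemma \<Phi>_measurable: assumes "finite A" "A \<subseteq> V" shows "\<Phi> A \<in> borel_measurable (cspace V)"
proof -
  have c: "continuous_map conf_top euclideanreal (\<Phi> A)"
    using is_pot assms unfolding is_potential_def by blast
  have [measurable]: "\<Phi> A \<in> borel_measurable (cspace UNIV)"
  proof (rule borel_measurableI)
    fix S :: "real set" assume "open S"
    then have "openin conf_top {x \<in> topspace conf_top. \<Phi> A x \<in> S}"
      using c by (simp add: openin_continuous_map_preimage)
    from openin_conf_top_sets[OF this] show "\<Phi> A -` S \<inter> cs UNIV \<in> sets (cspace UNIV)"
      by (simp add: topspace_conf_top space_conf_space vimage_def Int_def conj_commute)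
  qed
  let ?g = "\<lambda>x i. if i \<in> V then x i else 0"
  have "?g \<in> measurable (cspace V) (cspace UNIV)"
  proof (rule measurable_cspaceI)
    fix i show "(\<lambda>x. if i \<in> V then x i else 0) \<in> measurable (cspace V) (restrict_space borel circle)"
      by (cases "i \<in> V") (auto intro!: measurable_restrict_space2)
  qed auto
  then have "(\<lambda>x. \<Phi> A (?g x)) \<in> borel_measurable (cspace V)" by measurable
  then show ?thesis
    by (rule measurable_cong[THEN iffD1, rotated])
      (use assms in \<open>intro \<Phi>_cong, auto simp: space_conf_space\<close>)
qed

lemma H_measurable [measurable]: assumes "finite \<Delta>" shows "H V \<Delta> \<in> borel_measurable (cspace V)"
  unfolding H_def[abs_def]
  by (rule borel_measurable_infsum_real[OF countable_bonds])
    (use assms in \<open>auto dest!: bondsD intro!: \<Phi>_measurable summable_H simp: space_conf_space\<close>)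

lemma bm_H: "finite \<Delta> ==> bm (cspace V) (H V \<Delta>)"
  by (rule bmI[of _ _ "Nrm \<Delta>"]) (auto intro!: abs_H_le simp: space_conf_space)

text \<open>Finitely many bonds carry the total norm up to \<open>\<epsilon> / 2\<close>. Their
  union is the window: the finite part agrees exactly, and each of the two tails costs
  \<open>\<epsilon> / 2\<close>.\<close>

lemma H_quasilocal:
  assumes "finite \<Delta>" "\<epsilon> > 0"
  shows "\<exists>J. finite J \<and> J \<subseteq> V \<and> (\<forall>\<xi>\<in>cs V. \<forall>\<eta>\<in>cs V. (\<forall>i\<in>J. \<xi> i = \<eta> i) \<longrightarrow> \<bar>H V \<Delta> \<xi> - H V \<Delta> \<eta>\<bar> \<le> \<epsilon>)"
proof -
  let ?F = "bonds V \<Delta>"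
  note sm = summable_bonds[OF assms(1), of V]
  have "(nrm has_sum infsum nrm ?F) ?F" using sm by simp
  then have "\<forall>\<^sub>F X in finite_subsets_at_top ?F. dist (sum nrm X) (infsum nrm ?F) < \<epsilon> / 2"
    unfolding has_sum_def using assms(2) tendstoD half_gt_zero by blast
  then obtain X where X: "finite X" "X \<subseteq> ?F" "dist (sum nrm X) (infsum nrm ?F) < \<epsilon> / 2"
    by (auto simp: eventually_finite_subsets_at_top)
  have sX: "nrm summable_on X" "nrm summable_on (?F - X)"
    using sm X by (auto intro: summable_on_subset_banach)
  have "infsum nrm ?F = sum nrm X + infsum nrm (?F - X)"
    using infsum_Un_disjoint[OF sX] X by (simp add: Un_absorb1)
  then have tail: "infsum nrm (?F - X) \<le> \<epsilon> / 2" using X(3) by (simp add: dist_real_def)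
  have split: "H V \<Delta> \<xi> = (\<Sum>A\<in>X. \<Phi> A \<xi>) + (\<Sum>\<^sub>\<infinity>A\<in>?F - X. \<Phi> A \<xi>)" "\<bar>\<Sum>\<^sub>\<infinity>A\<in>?F - X. \<Phi> A \<xi>\<bar> \<le> \<epsilon> / 2"
    if "\<xi> \<in> cs V" for \<xi>
  proof -
    have c: "\<And>i. i \<in> V ==> \<xi> i \<in> circle" using that by (auto simp: space_conf_space)
    have s: "(\<lambda>A. \<Phi> A \<xi>) summable_on ?F" using summable_H[OF assms(1)] c by auto
    have "(\<lambda>A. \<Phi> A \<xi>) summable_on X" "(\<lambda>A. \<Phi> A \<xi>) summable_on (?F - X)"
      using s X by (auto intro: summable_on_subset_banach)
    from infsum_Un_disjoint[OF this] show "H V \<Delta> \<xi> = (\<Sum>A\<in>X. \<Phi> A \<xi>) + (\<Sum>\<^sub>\<infinity>A\<in>?F - X. \<Phi> A \<xi>)"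
      using X unfolding H_def by (simp add: Un_absorb1)
    have "\<bar>\<Sum>\<^sub>\<infinity>A\<in>?F - X. \<Phi> A \<xi>\<bar> \<le> infsum nrm (?F - X)"
    proof (rule summable_\<Phi>(2)[OF sX(2)])
      fix A i assume "A \<in> bonds V \<Delta> - X" "i \<in> A"
      then show "\<xi> i \<in> circle" using c bondsD by blast
    qed (auto dest: bondsD)
    then show "\<bar>\<Sum>\<^sub>\<infinity>A\<in>?F - X. \<Phi> A \<xi>\<bar> \<le> \<epsilon> / 2" using tail by simp
  qed
  show ?thesis
  proof (intro exI[of _ "\<Union>X"] conjI ballI impI)
    show "finite (\<Union>X)" using X by (auto simp: bonds_def)
    show "\<Union>X \<subseteq> V" using X by (auto simp: bonds_def)
    fix \<xi> \<eta> assume h: "\<xi> \<in> cs V" "\<eta> \<in> cs V" "\<forall>i\<in>\<Union>X. \<xi> i = \<eta> i"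
    have "(\<Sum>A\<in>X. \<Phi> A \<xi>) = (\<Sum>A\<in>X. \<Phi> A \<eta>)"
    proof (rule sum.cong[OF refl], rule \<Phi>_cong)
      fix A assume A: "A \<in> X"
      show "finite A" using A X(2) bondsD by blast
      fix i assume "i \<in> A"
      then have "i \<in> V" "\<xi> i = \<eta> i" using A h(3) X(2) bondsD by blast+
      then show "\<xi> i \<in> circle \<and> \<xi> i = \<eta> i" using PiE_mem[of \<xi> V "\<lambda>_. circle" i] h(1) by (simp add: space_conf_space)
    qed
    then show "\<bar>H V \<Delta> \<xi> - H V \<Delta> \<eta>\<bar> \<le> \<epsilon>" using split[OF h(1)] split[OF h(2)] by linarith
  qed
qed

text \<open>A bond in \<open>V\<close> meeting \<open>L \<union> D\<close> either meets
  \<open>L\<close> or avoids it, and the latter are the bonds of the system on \<open>V - L\<close>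
  that meet \<open>D\<close>. This splitting underlies the consistency of the kernels and the
  cancellation of the weights inside a block in the discrete DLR equations.\<close>

lemma H_cocycle:
  assumes "finite L" "finite D" "\<And>i. i \<in> V ==> \<eta> i \<in> circle" "L \<inter> D = {}"
  shows "H V (L \<union> D) \<eta> = H V L \<eta> + H (V - L) D \<eta>"
proof -
  have u: "bonds V (L \<union> D) = bonds V L \<union> bonds (V - L) D" "bonds V L \<inter> bonds (V - L) D = {}"
    by (auto simp: bonds_def)
  show ?thesis unfolding H_def u(1)
    by (rule infsum_Un_disjoint[OF _ _ u(2)]) (use assms in \<open>auto intro!: summable_H\<close>)
qed

text \<open>Norm of the bonds crossing the boundary of \<open>Y\<close>: the price for replacing the
  true Hamiltonian by that of the free system on \<open>Y\<close>, whatever the outside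
  configuration.\<close>

definition Bd :: "'d site set => real" where
  "Bd Y = (\<Sum>\<^sub>\<infinity>A\<in>{A. finite A \<and> A \<inter> Y \<noteq> {} \<and> \<not> A \<subseteq> Y}. nrm A)"

lemma Bd_nonneg: "0 \<le> Bd Y"
  unfolding Bd_def by (rule infsum_nonneg) (auto simp: nrm_nonneg)

lemma H_boundary:
  assumes "finite Y" "\<And>i. \<eta> i \<in> circle"
  shows "\<bar>H UNIV Y \<eta> - H Y Y \<eta>\<bar> \<le> Bd Y"
proof -
  let ?R = "{A. finite A \<and> A \<inter> Y \<noteq> {} \<and> \<not> A \<subseteq> Y}"
  have u: "bonds UNIV Y = bonds Y Y \<union> ?R" "bonds Y Y \<inter> ?R = {}"
    by (auto simp: bonds_def)
  have s: "nrm summable_on ?R"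
    by (rule summable_on_subset[OF summable_bonds[OF assms(1), of UNIV]]) (auto simp: bonds_def)
  have sR: "(\<lambda>A. \<Phi> A \<eta>) summable_on ?R" "\<bar>\<Sum>\<^sub>\<infinity>A\<in>?R. \<Phi> A \<eta>\<bar> \<le> Bd Y"
    using summable_\<Phi>[OF s] assms(2) unfolding Bd_def by auto
  have "H UNIV Y \<eta> = H Y Y \<eta> + (\<Sum>\<^sub>\<infinity>A\<in>?R. \<Phi> A \<eta>)"
    unfolding H_def u(1) by (rule infsum_Un_disjoint[OF _ sR(1) u(2)]) (use assms in \<open>auto intro!: summable_H\<close>)
  then show ?thesis using sR(2) by simp
qed

end

section \<open>Local resampling operators\<close>

text \<open>Resampling a spin within its class covers the free system, both discretisations, and their constrained versions
  by one family of operators.\<close>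

definition fatrel :: "(real => real => bool) => bool" where
  "fatrel E \<longleftrightarrow> (\<lambda>(x, y). (of_bool (E x y) :: real)) \<in> borel_measurable (LC \<Otimes>\<^sub>M LC) \<and>
     (\<forall>x\<in>circle. E x x) \<and> (\<forall>x\<in>circle. \<forall>y\<in>circle. \<forall>z\<in>circle. E x y \<longrightarrow> E x z \<longrightarrow> E y z) \<and>
     (\<exists>c>0::real. \<forall>x\<in>circle. c \<le> (LINT y|LC. of_bool (E x y)))"

lemma fatrel_iff: "fatrel E ==> x \<in> circle ==> y \<in> circle ==> z \<in> circle ==> E x y ==> E y z \<longleftrightarrow> E x z"
  unfolding fatrel_def by metis

definition comp_ind :: "(real => real => bool) => 'i set => ('i => real) => ('i => real) => real" where
  "comp_ind E Y \<eta> \<sigma> = (\<Prod>i\<in>Y. of_bool (E (\<eta> i) (\<sigma> i)))"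

lemma comp_ind_bounds: "0 \<le> comp_ind E Y \<eta> \<sigma>" "comp_ind E Y \<eta> \<sigma> \<le> 1" "\<bar>comp_ind E Y \<eta> \<sigma>\<bar> \<le> 1"
proof -
  show a: "0 \<le> comp_ind E Y \<eta> \<sigma>" unfolding comp_ind_def by (rule prod_nonneg) auto
  show b: "comp_ind E Y \<eta> \<sigma> \<le> 1" unfolding comp_ind_def by (rule prod_le_1) auto
  show "\<bar>comp_ind E Y \<eta> \<sigma>\<bar> \<le> 1" using a b by simp
qed

lemma comp_ind_zero: "finite Y ==> comp_ind E Y \<eta> \<sigma> = 0 \<or> (\<forall>i\<in>Y. E (\<eta> i) (\<sigma> i))"
  unfolding comp_ind_def by auto

lemma cspaceD: "\<eta> \<in> cs V ==> i \<in> V ==> \<eta> i \<in> circle"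
  by (auto simp: space_conf_space)

lemma override_space:
  assumes "\<eta> \<in> cs V" "\<sigma> \<in> space (lebc Y)" "Y \<subseteq> V"
  shows "override_on \<eta> \<sigma> Y \<in> cs V"
  using assms by (auto simp: space_conf_space space_leb_prod override_on_def PiE_iff extensional_def)

lemma override_measurable [measurable]:
  assumes "Y \<subseteq> V"
  shows "(\<lambda>(\<eta>, \<sigma>). override_on \<eta> \<sigma> Y) \<in> measurable (cspace V \<Otimes>\<^sub>M lebc Y) (cspace V)"
proof (rule measurable_cspaceI)
  fix i assume "i \<in> V"
  show "(\<lambda>x. (case x of (\<eta>, \<sigma>) => override_on \<eta> \<sigma> Y) i) \<in> measurable (cspace V \<Otimes>\<^sub>M lebc Y) (restrict_space borel circle)"
  proof (cases "i \<in> Y")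
    case True
    have "(\<lambda>x. x i) \<in> measurable (lebc Y) (restrict_space borel circle)"
      using cspace_component[OF True] measurable_cong_sets[OF sets_leb_prod refl] by blast
    from measurable_compose[OF measurable_snd this]
    have "(\<lambda>x. snd x i) \<in> measurable (cspace V \<Otimes>\<^sub>M lebc Y) (restrict_space borel circle)" .
    then show ?thesis using True by (simp add: case_prod_beta override_on_def)
  next
    case False
    from measurable_compose[OF measurable_fst cspace_component[OF \<open>i \<in> V\<close>]]
    have "(\<lambda>x. fst x i) \<in> measurable (cspace V \<Otimes>\<^sub>M lebc Y) (restrict_space borel circle)" .
    then show ?thesis using False by (simp add: case_prod_beta override_on_def)
  qed
qed (use assms in \<open>auto simp: space_pair_measure intro!: override_space[THEN subsetD[OF equalityD1[OF space_conf_space]], THEN PiE_iff[THEN iffD1], THEN conjunct2]\<close>)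

lemma override_measurable2:
  assumes "Y \<subseteq> V" "\<eta> \<in> cs V"
  shows "(\<lambda>\<sigma>. override_on \<eta> \<sigma> Y) \<in> measurable (lebc Y) (cspace V)"
  using measurable_compose[OF measurable_Pair1'[OF assms(2)] override_measurable[OF assms(1)]] by simp

lemma bm_comp_ind:
  assumes "fatrel E" "Y \<subseteq> V" "finite Y"
  shows "bm (cspace V \<Otimes>\<^sub>M lebc Y) (\<lambda>(\<eta>, \<sigma>). comp_ind E Y \<eta> \<sigma>)"
proof (rule bmI[of _ _ 1])
  have [measurable]: "(\<lambda>z. of_bool (E (fst z) (snd z)) :: real) \<in> borel_measurable (LC \<Otimes>\<^sub>M LC)"
    using assms(1) by (simp add: fatrel_def split_beta')
  have "(\<lambda>z. of_bool (E (fst z i) (snd z i)) :: real) \<in> borel_measurable (cspace V \<Otimes>\<^sub>M lebc Y)" if "i \<in> Y" for i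
  proof -
    have 1: "(\<lambda>x. x i) \<in> measurable (lebc Y) LC"
      using that unfolding leb_prod_def by measurable
    have 2: "(\<lambda>x. x i) \<in> measurable (cspace V) LC"
      using cspace_component[of i V] that assms(2) measurable_cong_sets[OF refl sets_LC] by blast
    have "(\<lambda>z. (fst z i, snd z i)) \<in> measurable (cspace V \<Otimes>\<^sub>M lebc Y) (LC \<Otimes>\<^sub>M LC)"
      using measurable_compose[OF measurable_fst 2] measurable_compose[OF measurable_snd 1] by (rule measurable_Pair)
    from measurable_compose[OF this \<open>(\<lambda>z. of_bool (E (fst z) (snd z)) :: real) \<in> borel_measurable (LC \<Otimes>\<^sub>M LC)\<close>]
    show ?thesis by simp
  qed
  then show "(\<lambda>(\<eta>, \<sigma>). comp_ind E Y \<eta> \<sigma>) \<in> borel_measurable (cspace V \<Otimes>\<^sub>M lebc Y)"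
    unfolding comp_ind_def split_beta' by (rule borel_measurable_prod)
qed (auto simp: comp_ind_bounds)

lemma bm_section: "bm (M \<Otimes>\<^sub>M N) (\<lambda>(x, y). f x y) ==> x \<in> space M ==> bm N (f x)"
  using bm_compose[OF _ measurable_Pair1'] by fastforce

text \<open>Unnormalised resampling with respect to Lebesgue measure. The reference measure is that
  of the full circle and the class constraint sits in the indicator, so that operators for different
  relations can be compared under one integral.\<close>

definition J :: "(real => real => bool) => 'i set => (('i => real) => real) => ('i => real) => real" where
  "J E Y f \<eta> = (LINT \<sigma>|lebc Y. comp_ind E Y \<eta> \<sigma> * f (override_on \<eta> \<sigma> Y))"

lemma bm_integrand:
  assumes "fatrel E" "Y \<subseteq> V" "finite Y" "bm (cspace V) f"
  shows "bm (cspace V \<Otimes>\<^sub>M lebc Y) (\<lambda>(\<eta>, \<sigma>). comp_ind E Y \<eta> \<sigma> * f (override_on \<eta> \<sigma> Y))"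
  using bm_mult[OF bm_comp_ind[OF assms(1-3)] bm_compose[OF assms(4) override_measurable[OF assms(2)]]]
  by (simp add: split_beta')

locale resample =
  fixes E :: "real => real => bool" and V Y :: "'i set"
  assumes E: "fatrel E" and sub: "Y \<subseteq> V" and fin: "finite Y"
begin

lemma bm_J: "bm (cspace V) f ==> bm (cspace V) (J E Y f)"
  unfolding J_def[abs_def]
  by (rule bm_integral[OF finite_measure_lebc[OF fin]]) (rule bm_integrand[OF E sub fin])

lemma bm_integrand2: "bm (cspace V) f ==> \<eta> \<in> cs V ==>
  bm (lebc Y) (\<lambda>\<sigma>. comp_ind E Y \<eta> \<sigma> * f (override_on \<eta> \<sigma> Y))"
  by (rule bm_section[OF bm_integrand[OF E sub fin]])

lemma J_integrable: "bm (cspace V) f ==> \<eta> \<in> cs V ==>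
  integrable (lebc Y) (\<lambda>\<sigma>. comp_ind E Y \<eta> \<sigma> * f (override_on \<eta> \<sigma> Y))"
  using bm_integrand2 bm_integrable finite_measure_lebc[OF fin] by blast

lemma J_affine:
  assumes "bm (cspace V) f" "bm (cspace V) g" "\<eta> \<in> cs V"
  shows "J E Y (\<lambda>\<zeta>. a * f \<zeta> + b * g \<zeta>) \<eta> = a * J E Y f \<eta> + b * J E Y g \<eta>"
proof -
  have "J E Y (\<lambda>\<zeta>. a * f \<zeta> + b * g \<zeta>) \<eta> = (LINT \<sigma>|lebc Y. a * (comp_ind E Y \<eta> \<sigma> * f (override_on \<eta> \<sigma> Y)) + b * (comp_ind E Y \<eta> \<sigma> * g (override_on \<eta> \<sigma> Y)))"
    unfolding J_def by (simp add: algebra_simps)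
  also have "\<dots> = a * J E Y f \<eta> + b * J E Y g \<eta>"
    unfolding J_def using J_integrable[OF assms(1,3)] J_integrable[OF assms(2,3)] by simp
  finally show ?thesis .
qed

lemma J_mono:
  assumes "bm (cspace V) f" "bm (cspace V) g" "\<eta> \<in> cs V"
    "\<And>\<zeta>. \<zeta> \<in> cs V ==> f \<zeta> \<le> g \<zeta>"
  shows "J E Y f \<eta> \<le> J E Y g \<eta>"
  unfolding J_def
  by (rule integral_mono[OF J_integrable[OF assms(1,3)] J_integrable[OF assms(2,3)]])
    (use assms(4) override_space[OF assms(3) _ sub] in \<open>auto intro!: mult_left_mono comp_ind_bounds\<close>)

lemma J_cong:
  assumes "\<eta> \<in> cs V"
    "\<And>\<sigma>. \<sigma> \<in> space (lebc Y) ==> (\<And>i. i \<in> Y ==> E (\<eta> i) (\<sigma> i)) ==> f (override_on \<eta> \<sigma> Y) = g (override_on \<eta> \<sigma> Y)"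
  shows "J E Y f \<eta> = J E Y g \<eta>"
  unfolding J_def by (rule icong[OF refl]) (metis assms(2) comp_ind_zero[OF fin] mult_zero_left)

lemma J_cong_space:
  assumes "\<eta> \<in> cs V" "\<And>\<zeta>. \<zeta> \<in> cs V ==> f \<zeta> = g \<zeta>"
  shows "J E Y f \<eta> = J E Y g \<eta>"
  using assms override_space[OF _ _ sub] by (intro J_cong) auto

lemma J_pull:
  assumes "\<eta> \<in> cs V"
    "\<And>\<sigma>. \<sigma> \<in> space (lebc Y) ==> (\<And>i. i \<in> Y ==> E (\<eta> i) (\<sigma> i)) ==> g (override_on \<eta> \<sigma> Y) = g \<eta>"
  shows "J E Y (\<lambda>\<zeta>. g \<zeta> * f \<zeta>) \<eta> = g \<eta> * J E Y f \<eta>"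
proof -
  have "J E Y (\<lambda>\<zeta>. g \<zeta> * f \<zeta>) \<eta> = J E Y (\<lambda>\<zeta>. g \<eta> * f \<zeta>) \<eta>"
    using assms by (intro J_cong) auto
  also have "\<dots> = g \<eta> * J E Y f \<eta>" unfolding J_def by (simp add: mult.left_commute)
  finally show ?thesis .
qed

text \<open>The integrand forgets the spins in \<open>Y\<close> except for their classes, and these
  do not change when spins move inside them.\<close>

lemma J_self:
  assumes "\<eta> \<in> cs V" "\<sigma> \<in> space (lebc Y)" "\<And>i. i \<in> Y ==> E (\<eta> i) (\<sigma> i)"
  shows "J E Y f (override_on \<eta> \<sigma> Y) = J E Y f \<eta>"
  unfolding J_def
proof (rule icong[OF refl])
  fix \<sigma>' assume s: "\<sigma>' \<in> space (lebc Y)"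
  have "E (override_on \<eta> \<sigma> Y i) (\<sigma>' i) = E (\<eta> i) (\<sigma>' i)" if "i \<in> Y" for i
    using fatrel_iff[OF E, of "\<eta> i" "\<sigma> i" "\<sigma>' i"] assms s that sub
    by (auto simp: space_leb_prod space_conf_space PiE_iff)
  then have "comp_ind E Y (override_on \<eta> \<sigma> Y) \<sigma>' = comp_ind E Y \<eta> \<sigma>'" by (simp add: comp_ind_def)
  moreover have "override_on (override_on \<eta> \<sigma> Y) \<sigma>' Y = override_on \<eta> \<sigma>' Y" by (auto simp: override_on_def)
  ultimately show "comp_ind E Y (override_on \<eta> \<sigma> Y) \<sigma>' * f (override_on (override_on \<eta> \<sigma> Y) \<sigma>' Y) =
      comp_ind E Y \<eta> \<sigma>' * f (override_on \<eta> \<sigma>' Y)" by simp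
qed

text \<open>The value is the product over \<open>Y\<close> of the measures of the classes, each
  bounded below by the constant in \<open>fatrel\<close>.\<close>

lemma J_one: "\<exists>c>0. \<forall>\<eta>\<in>cs V. c \<le> J E Y (\<lambda>_. 1) \<eta>"
proof -
  interpret product_sigma_finite "\<lambda>_. LC" by (rule product_sigma_finite_LC)
  obtain c :: real where c: "c > 0" "\<And>x. x \<in> circle ==> c \<le> (LINT y|LC. of_bool (E x y))" using E by (auto simp: fatrel_def)
  have "c ^ card Y \<le> J E Y (\<lambda>_. 1) \<eta>" if "\<eta> \<in> cs V" for \<eta>
  proof -
    have circ: "\<eta> i \<in> circle" if "i \<in> Y" for i using that \<open>\<eta> \<in> cs V\<close> sub by (auto simp: space_conf_space)
    have int: "integrable LC (\<lambda>y. of_bool (E (\<eta> i) y) :: real)" if "i \<in> Y" for i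
    proof (rule bm_integrable[OF finite_measure_LC])
      have "bm (LC \<Otimes>\<^sub>M LC) (\<lambda>(x, y). of_bool (E x y))"
        using E by (intro bmI[of _ _ 1]) (auto simp: fatrel_def)
      from bm_section[OF this, of "\<eta> i"] show "bm LC (\<lambda>y. of_bool (E (\<eta> i) y))" using circ[OF that] by simp
    qed
    have "J E Y (\<lambda>_. 1) \<eta> = (\<Prod>i\<in>Y. LINT y|LC. of_bool (E (\<eta> i) y))"
      unfolding J_def comp_ind_def leb_prod_def using product_integral_prod[OF fin int] by simp
    also have "\<dots> \<ge> (\<Prod>i\<in>Y. c)" using c circ by (intro prod_mono) (auto intro: less_imp_le)
    finally show ?thesis by simp
  qed
  then show ?thesis using c(1) by (intro exI[of _ "c ^ card Y"]) auto
qed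

end

text \<open>Fubini with one site split off from the block; the site \<open>i\<close> is integrated
  inside.\<close>

lemma J_insert:
  assumes E: "fatrel E" and sub: "insert i Y \<subseteq> V" and fin: "finite Y" "i \<notin> Y" and f: "bm (cspace V) f"
    and \<eta>: "\<eta> \<in> cs V"
  shows "J E (insert i Y) f \<eta> = J E Y (J E {i} f) \<eta>"
proof -
  interpret product_sigma_finite "\<lambda>_. LC" by (rule product_sigma_finite_LC)
  interpret r: resample E V "insert i Y" using assms by unfold_locales auto
  interpret ri: resample E V "{i}" using assms by unfold_locales auto
  let ?h = "\<lambda>\<sigma>. comp_ind E (insert i Y) \<eta> \<sigma> * f (override_on \<eta> \<sigma> (insert i Y))"
  have "J E (insert i Y) f \<eta> = (LINT \<sigma>|lebc Y. (LINT y|LC. ?h (\<sigma>(i := y))))"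
    using product_integral_insert[OF fin r.J_integrable[OF f \<eta>, unfolded leb_prod_def]]
    unfolding J_def leb_prod_def by simp
  also have "\<dots> = J E Y (J E {i} f) \<eta>"
    unfolding J_def[of E Y]
  proof (rule icong[OF refl])
    fix \<sigma> assume s: "\<sigma> \<in> space (lebc Y)"
    let ?z = "override_on \<eta> \<sigma> Y"
    have z: "?z \<in> cs V" using override_space[OF \<eta> s] sub by auto
    have "J E {i} f ?z = (LINT y|LC. of_bool (E (\<eta> i) y) * f (?z(i := y)))"
    proof -
      have "bm (lebc {i}) (\<lambda>\<sigma>. comp_ind E {i} ?z \<sigma> * f (override_on ?z \<sigma> {i}))" by (rule ri.bm_integrand2[OF f z])
      moreover have "(\<lambda>y. (\<lambda>_\<in>{i}. y)) \<in> measurable LC (lebc {i})"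
        unfolding leb_prod_def by (intro measurable_restrict) auto
      ultimately have "bm LC (\<lambda>y. comp_ind E {i} ?z (\<lambda>_\<in>{i}. y) * f (override_on ?z (\<lambda>_\<in>{i}. y) {i}))" by (rule bm_compose)
      then have m: "(\<lambda>y. of_bool (E (\<eta> i) y) * f (?z(i := y))) \<in> borel_measurable LC"
        using fin(2) by (auto simp: comp_ind_def override_on_insert override_on_def dest!: bm_measurable cong: if_cong)
          (simp add: fun_upd_def)
      have "J E {i} f ?z = (LINT \<sigma>|PiM {i} (\<lambda>_. LC). (\<lambda>y. of_bool (E (\<eta> i) y) * f (?z(i := y))) (\<sigma> i))"
        using fin(2) unfolding J_def leb_prod_def by (simp add: comp_ind_def override_on_insert)
      also have "\<dots> = (LINT y|LC. of_bool (E (\<eta> i) y) * f (?z(i := y)))"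
        by (rule product_integral_singleton[OF m])
      finally show ?thesis .
    qed
    moreover have "?h (\<sigma>(i := y)) = comp_ind E Y \<eta> \<sigma> * (of_bool (E (\<eta> i) y) * f (?z(i := y)))" for y
    proof -
      have "override_on \<eta> (\<sigma>(i := y)) (insert i Y) = ?z(i := y)" by (auto simp: override_on_def)
      moreover have "comp_ind E (insert i Y) \<eta> (\<sigma>(i := y)) = of_bool (E (\<eta> i) y) * comp_ind E Y \<eta> \<sigma>"
        unfolding comp_ind_def using fin by (subst prod.insert) (auto intro!: prod.cong arg_cong2[of _ _ _ _ "(*)"])
      ultimately show ?thesis by simp
    qed
    ultimately show "(LINT y|LC. ?h (\<sigma>(i := y))) = comp_ind E Y \<eta> \<sigma> * J E {i} f (override_on \<eta> \<sigma> Y)" by simp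
  qed
  finally show ?thesis .
qed

section \<open>Gibbs weights and normalised resampling kernels\<close>

context potential
begin

definition wt :: "'d site set => 'd site set => ('d, real) conf => real" where
  "wt V \<Delta> \<eta> = exp (- H V \<Delta> \<eta>)"

definition num :: "'d site set => (real => real => bool) => 'd site set => (('d, real) conf => real) => ('d, real) conf => real" where
  "num V E Y f = J E Y (\<lambda>\<zeta>. wt V Y \<zeta> * f \<zeta>)"

text \<open>The Gibbs kernel of \<open>Y\<close> for the system on \<open>V\<close>, conditioned on
  every spin of \<open>Y\<close> staying in its own class. The constraint is read off from the
  configuration itself, so that one operator handles all constraint configurations
  simultaneously.\<close>

definition K :: "'d site set => (real => real => bool) => 'd site set => (('d, real) conf => real) => ('d, real) conf => real" where
  "K V E Y f \<eta> = num V E Y f \<eta> / num V E Y (\<lambda>_. 1) \<eta>"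

lemma bm_wt: "finite \<Delta> ==> bm (cspace V) (wt V \<Delta>)"
  unfolding wt_def[abs_def] by (intro bm_exp bm_uminus bm_H)

lemma wt_bounds: assumes "finite \<Delta>" "\<eta> \<in> cs V"
  shows "exp (- Nrm \<Delta>) \<le> wt V \<Delta> \<eta>" "wt V \<Delta> \<eta> \<le> exp (Nrm \<Delta>)"
proof -
  have "\<bar>H V \<Delta> \<eta>\<bar> \<le> Nrm \<Delta>" using assms by (intro abs_H_le) (auto simp: space_conf_space)
  then show "exp (- Nrm \<Delta>) \<le> wt V \<Delta> \<eta>" "wt V \<Delta> \<eta> \<le> exp (Nrm \<Delta>)" by (auto simp: wt_def)
qed

lemma wt_pos: "0 < wt V \<Delta> \<eta>" by (simp add: wt_def)

end

locale pot_resample = potential \<Phi> + resample E V Y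
  for \<Phi> :: "('d::finite) potential" and E and V Y :: "'d site set"
begin

abbreviation "X \<equiv> cs V"

lemma bm_wf: "bm (cspace V) f ==> bm (cspace V) (\<lambda>\<zeta>. wt V Y \<zeta> * f \<zeta>)"
  using bm_wt[OF fin] by auto

lemma bm_num: "bm (cspace V) f ==> bm (cspace V) (num V E Y f)"
  unfolding num_def by (rule bm_J[OF bm_wf])

lemma num_lower_J:
  assumes "bm (cspace V) f" "\<eta> \<in> X" "\<And>\<zeta>. \<zeta> \<in> X ==> 0 \<le> f \<zeta>"
  shows "exp (- Nrm Y) * J E Y f \<eta> \<le> num V E Y f \<eta>"
proof -
  have "J E Y (\<lambda>\<zeta>. exp (- Nrm Y) * f \<zeta> + 0 * f \<zeta>) \<eta> \<le> num V E Y f \<eta>"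
    unfolding num_def using assms wt_bounds[OF fin] by (intro J_mono bm_wf) (auto intro!: mult_right_mono)
  then show ?thesis using J_affine[OF assms(1,1,2), of "exp (- Nrm Y)" 0] by simp
qed

lemma num_upper_J:
  assumes "bm (cspace V) f" "\<eta> \<in> X" "\<And>\<zeta>. \<zeta> \<in> X ==> 0 \<le> f \<zeta>"
  shows "num V E Y f \<eta> \<le> exp (Nrm Y) * J E Y f \<eta>"
proof -
  have "num V E Y f \<eta> \<le> J E Y (\<lambda>\<zeta>. exp (Nrm Y) * f \<zeta> + 0 * f \<zeta>) \<eta>"
    unfolding num_def using assms wt_bounds[OF fin] by (intro J_mono bm_wf) (auto intro!: mult_right_mono)
  then show ?thesis using J_affine[OF assms(1,1,2), of "exp (Nrm Y)" 0] by simp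
qed

lemma num_one_lower: "\<exists>c>0. \<forall>\<eta>\<in>X. c \<le> num V E Y (\<lambda>_. 1) \<eta>"
proof -
  obtain c where c: "c > 0" "\<forall>\<eta>\<in>X. c \<le> J E Y (\<lambda>_. 1) \<eta>" using J_one by blast
  then show ?thesis using num_lower_J[of "\<lambda>_. 1"]
    by (intro exI[of _ "exp (- Nrm Y) * c"]) (auto intro: order_trans[OF mult_left_mono])
qed

lemma num_one_pos: "\<eta> \<in> X ==> 0 < num V E Y (\<lambda>_. 1) \<eta>"
  using num_one_lower by force

lemma num_affine:
  assumes "bm (cspace V) f" "bm (cspace V) g" "\<eta> \<in> X"
  shows "num V E Y (\<lambda>\<zeta>. a * f \<zeta> + b * g \<zeta>) \<eta> = a * num V E Y f \<eta> + b * num V E Y g \<eta>"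
  unfolding num_def using J_affine[OF bm_wf[OF assms(1)] bm_wf[OF assms(2)] assms(3), of a b]
  by (simp add: algebra_simps)

lemma num_mono:
  assumes "bm (cspace V) f" "bm (cspace V) g" "\<eta> \<in> X" "\<And>\<zeta>. \<zeta> \<in> X ==> f \<zeta> \<le> g \<zeta>"
  shows "num V E Y f \<eta> \<le> num V E Y g \<eta>"
  unfolding num_def by (rule J_mono) (use assms in \<open>auto intro!: bm_wf mult_left_mono less_imp_le[OF wt_pos]\<close>)

lemma num_pull:
  assumes "\<eta> \<in> X" "\<And>\<sigma>. \<sigma> \<in> space (lebc Y) ==> (\<And>i. i \<in> Y ==> E (\<eta> i) (\<sigma> i)) ==> g (override_on \<eta> \<sigma> Y) = g \<eta>"
  shows "num V E Y (\<lambda>\<zeta>. g \<zeta> * f \<zeta>) \<eta> = g \<eta> * num V E Y f \<eta>"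
  unfolding num_def using J_pull[of \<eta> g "\<lambda>\<zeta>. wt V Y \<zeta> * f \<zeta>"] assms by (simp add: mult.left_commute)

lemma bm_K: "bm (cspace V) f ==> bm (cspace V) (K V E Y f)"
  using num_one_lower unfolding K_def[abs_def] by (auto intro!: bm_divide bm_num)

lemma K_affine:
  assumes "bm (cspace V) f" "bm (cspace V) g" "\<eta> \<in> X"
  shows "K V E Y (\<lambda>\<zeta>. a * f \<zeta> + b * g \<zeta>) \<eta> = a * K V E Y f \<eta> + b * K V E Y g \<eta>"
  unfolding K_def num_affine[OF assms] by (simp add: add_divide_distrib)

lemma K_const: "\<eta> \<in> X ==> K V E Y (\<lambda>_. a) \<eta> = a"
  using num_pull[of \<eta> "\<lambda>_. a" "\<lambda>_. 1"] num_one_pos[of \<eta>] by (simp add: K_def)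

lemma K_shift: "bm (cspace V) f ==> \<eta> \<in> X ==> K V E Y (\<lambda>\<zeta>. a + s * f \<zeta>) \<eta> = a + s * K V E Y f \<eta>"
  using K_affine[of "\<lambda>_. 1" f \<eta> a s] K_const[of \<eta> 1] by simp

lemma K_diff: "bm (cspace V) f ==> bm (cspace V) g ==> \<eta> \<in> X ==> K V E Y (\<lambda>\<zeta>. f \<zeta> - g \<zeta>) \<eta> = K V E Y f \<eta> - K V E Y g \<eta>"
  using K_affine[of f g \<eta> 1 "-1"] by simp

lemma K_mono:
  assumes "bm (cspace V) f" "bm (cspace V) g" "\<eta> \<in> X" "\<And>\<zeta>. \<zeta> \<in> X ==> f \<zeta> \<le> g \<zeta>"
  shows "K V E Y f \<eta> \<le> K V E Y g \<eta>"
  unfolding K_def using num_mono[OF assms] num_one_pos[OF assms(3)] by (simp add: divide_right_mono)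

lemma K_abs_le:
  assumes "bm (cspace V) f" "\<eta> \<in> X" "\<And>\<zeta>. \<zeta> \<in> X ==> \<bar>f \<zeta>\<bar> \<le> b"
  shows "\<bar>K V E Y f \<eta>\<bar> \<le> b"
proof -
  have "f \<zeta> \<le> b" "- b \<le> f \<zeta>" if "\<zeta> \<in> X" for \<zeta> using assms(3)[OF that] by auto
  then show ?thesis
    using K_mono[OF assms(1) bm_const assms(2), of b] K_mono[OF bm_const assms(1,2), of "-b"] K_const[OF assms(2)] by force
qed

lemma K_cong:
  assumes "\<eta> \<in> X" "\<And>\<zeta>. \<zeta> \<in> X ==> f \<zeta> = g \<zeta>" shows "K V E Y f \<eta> = K V E Y g \<eta>"
  unfolding K_def num_def using assms J_cong_space[OF assms(1), of "\<lambda>\<zeta>. wt V Y \<zeta> * f \<zeta>" "\<lambda>\<zeta>. wt V Y \<zeta> * g \<zeta>"] by auto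

lemma num_self:
  assumes "\<eta> \<in> X" "\<sigma> \<in> space (lebc Y)" "\<And>i. i \<in> Y ==> E (\<eta> i) (\<sigma> i)"
  shows "num V E Y f (override_on \<eta> \<sigma> Y) = num V E Y f \<eta>"
  unfolding num_def by (rule J_self[OF assms])

lemma K_self:
  assumes "\<eta> \<in> X" "\<sigma> \<in> space (lebc Y)" "\<And>i. i \<in> Y ==> E (\<eta> i) (\<sigma> i)"
  shows "K V E Y f (override_on \<eta> \<sigma> Y) = K V E Y f \<eta>"
  unfolding K_def using num_self[of \<eta> \<sigma>] assms by simp

lemma K_pull:
  assumes "\<eta> \<in> X" "\<And>\<sigma>. \<sigma> \<in> space (lebc Y) ==> (\<And>i. i \<in> Y ==> E (\<eta> i) (\<sigma> i)) ==> g (override_on \<eta> \<sigma> Y) = g \<eta>"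
  shows "K V E Y (\<lambda>\<zeta>. g \<zeta> * f \<zeta>) \<eta> = g \<eta> * K V E Y f \<eta>"
  unfolding K_def using num_pull[of \<eta> g f] assms by simp

text \<open>\<open>K V E Y f\<close> is constant as the spins in \<open>Y\<close> move inside their
  classes, so it comes out of the integral and its denominator cancels.\<close>

lemma num_K: assumes "\<eta> \<in> X" shows "num V E Y (K V E Y f) \<eta> = num V E Y f \<eta>"
  using num_pull[OF assms, of "K V E Y f" "\<lambda>_. 1"] K_self[OF assms, where f = f] num_one_pos[OF assms] by (simp add: K_def[of V E Y f \<eta>])

lemma K_idem: assumes "\<eta> \<in> X" shows "K V E Y (K V E Y f) \<eta> = K V E Y f \<eta>"
  using num_K[OF assms, of f] by (simp add: K_def)

text \<open>The Boltzmann factor lies between \<open>exp (- Nrm Y)\<close> and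
  \<open>exp (Nrm Y)\<close>, so on nonnegative functions \<open>K\<close> and \<open>J\<close>
  dominate multiples of each other, with constants independent of the function and the
  configuration. The two comparisons feed the minorisation of a sweep by the block kernel.\<close>

lemma K_lower_J: "\<exists>c>0. \<forall>f. bm (cspace V) f \<longrightarrow> (\<forall>\<zeta>\<in>X. 0 \<le> f \<zeta>) \<longrightarrow> (\<forall>\<eta>\<in>X. c * J E Y f \<eta> \<le> K V E Y f \<eta>)"
proof -
  obtain b where b: "b > 0" "\<And>\<eta>. \<eta> \<in> X ==> \<bar>num V E Y (\<lambda>_. 1) \<eta>\<bar> \<le> b" using bm_bounded[OF bm_num[OF bm_const]] by blast
  show ?thesis
  proof (intro exI[of _ "exp (- Nrm Y) / b"] conjI allI impI ballI)
    fix f \<eta> assume f: "bm (cspace V) f" "\<forall>\<zeta>\<in>X. 0 \<le> f \<zeta>" and \<eta>: "\<eta> \<in> X"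
    have j: "exp (- Nrm Y) * J E Y f \<eta> \<le> num V E Y f \<eta>" using num_lower_J f \<eta> by blast
    have "0 \<le> num V E Y f \<eta>" using num_mono[OF bm_const f(1) \<eta>, of 0] f(2) num_pull[OF \<eta>, of "\<lambda>_. 0" "\<lambda>_. 1"] by simp
    then have "num V E Y f \<eta> / b \<le> K V E Y f \<eta>"
      unfolding K_def using b(2)[OF \<eta>] num_one_pos[OF \<eta>] b(1) by (intro divide_left_mono) auto
    then show "exp (- Nrm Y) / b * J E Y f \<eta> \<le> K V E Y f \<eta>"
      using divide_right_mono[OF j, of b] b(1) by simp
  qed (use b in simp)
qed

lemma K_upper_J: "\<exists>c>0. \<forall>f. bm (cspace V) f \<longrightarrow> (\<forall>\<zeta>\<in>X. 0 \<le> f \<zeta>) \<longrightarrow> (\<forall>\<eta>\<in>X. c * K V E Y f \<eta> \<le> J E Y f \<eta>)"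
proof -
  obtain c where c: "c > 0" "\<And>\<eta>. \<eta> \<in> X ==> c \<le> num V E Y (\<lambda>_. 1) \<eta>" using num_one_lower by blast
  show ?thesis
  proof (intro exI[of _ "c * exp (- Nrm Y)"] conjI allI impI ballI)
    fix f \<eta> assume f: "bm (cspace V) f" "\<forall>\<zeta>\<in>X. 0 \<le> f \<zeta>" and \<eta>: "\<eta> \<in> X"
    have j: "num V E Y f \<eta> \<le> exp (Nrm Y) * J E Y f \<eta>" using num_upper_J f \<eta> by blast
    have "0 \<le> num V E Y f \<eta>" using num_mono[OF bm_const f(1) \<eta>, of 0] f(2) num_pull[OF \<eta>, of "\<lambda>_. 0" "\<lambda>_. 1"] by simp
    then have "K V E Y f \<eta> \<le> num V E Y f \<eta> / c"
      unfolding K_def using c(2)[OF \<eta>] num_one_pos[OF \<eta>] c(1) by (intro divide_left_mono) auto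
    then have "c * K V E Y f \<eta> \<le> exp (Nrm Y) * J E Y f \<eta>" using j c(1) by (simp add: field_simps)
    then show "c * exp (- Nrm Y) * K V E Y f \<eta> \<le> J E Y f \<eta>"
      using mult_left_mono[of _ _ "exp (- Nrm Y)"] by (simp add: exp_minus field_simps)
  qed (use c in simp)
qed

end

context potential
begin

lemma wt_insert:
  assumes "finite Y" "i \<notin> Y" "\<zeta> \<in> cs V"
  shows "wt V (insert i Y) \<zeta> = wt (V - {i}) Y \<zeta> * wt V {i} \<zeta>"
  using H_cocycle[of "{i}" Y V \<zeta>] assms cspaceD[OF assms(3)] by (simp add: wt_def flip: exp_add)

lemma wt_cong:
  assumes "\<zeta> \<in> cs V" "\<And>j. j \<in> W ==> \<zeta> j = \<xi> j" "W \<subseteq> V"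
  shows "wt W Y \<zeta> = wt W Y \<xi>"
  unfolding wt_def using assms cspaceD[OF assms(1)] by (subst H_cong[of W \<zeta> \<xi>]) (auto simp flip: assms(2))

lemma bm_wt_sub: assumes "finite Y" "W \<subseteq> V" shows "bm (cspace V) (wt W Y)"
proof -
  have r: "(\<lambda>x. restrict x W) \<in> measurable (cspace V) (cspace W)"
    by (rule measurable_cspaceI) (use assms in auto)
  have "bm (cspace V) (\<lambda>x. wt W Y (restrict x W))" by (rule bm_compose[OF bm_wt[OF assms(1)] r])
  then show ?thesis
  proof (rule bm_cong)
    fix x assume "x \<in> cs V"
    then show "wt W Y (restrict x W) = wt W Y x"
      using wt_cong[of x V W "restrict x W"] assms(2) by auto
  qed
qed

text \<open>By the cocycle identity the weight splits off its bonds through \<open>i\<close>; the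
  remaining weight of \<open>Y\<close> in \<open>V - {i}\<close> does not see the spin at
  \<open>i\<close> and leaves the inner integral.\<close>

lemma num_insert:
  assumes E: "fatrel E" and sub: "insert i Y \<subseteq> V" and fin: "finite Y" "i \<notin> Y" and f: "bm (cspace V) f"
    and \<eta>: "\<eta> \<in> cs V"
  shows "num V E (insert i Y) f \<eta> = J E Y (\<lambda>\<zeta>. wt (V - {i}) Y \<zeta> * num V E {i} f \<zeta>) \<eta>"
proof -
  interpret r: pot_resample \<Phi> E V "insert i Y" using assms by unfold_locales auto
  interpret ri: pot_resample \<Phi> E V "{i}" using assms by unfold_locales auto
  interpret rl: pot_resample \<Phi> E V "Y" using assms by unfold_locales auto
  have "num V E (insert i Y) f \<eta> = J E Y (J E {i} (\<lambda>\<zeta>. wt V (insert i Y) \<zeta> * f \<zeta>)) \<eta>"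
    unfolding num_def by (rule J_insert[OF E sub fin r.bm_wf[OF f] \<eta>])
  also have "\<dots> = J E Y (\<lambda>\<zeta>. wt (V - {i}) Y \<zeta> * num V E {i} f \<zeta>) \<eta>"
  proof (rule rl.J_cong_space[OF \<eta>])
    fix \<zeta> assume \<zeta>: "\<zeta> \<in> cs V"
    have "J E {i} (\<lambda>\<zeta>. wt V (insert i Y) \<zeta> * f \<zeta>) \<zeta> = J E {i} (\<lambda>\<zeta>. wt (V - {i}) Y \<zeta> * (wt V {i} \<zeta> * f \<zeta>)) \<zeta>"
      by (rule ri.J_cong_space[OF \<zeta>]) (simp add: wt_insert[OF fin])
    also have "\<dots> = wt (V - {i}) Y \<zeta> * num V E {i} f \<zeta>"
      unfolding num_def
    proof (rule ri.J_pull[OF \<zeta>])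
      fix \<sigma> assume "\<sigma> \<in> space (lebc {i})"
      from override_space[OF \<zeta> this ri.sub] show "wt (V - {i}) Y (override_on \<zeta> \<sigma> {i}) = wt (V - {i}) Y \<zeta>"
        using wt_cong[of "override_on \<zeta> \<sigma> {i}" V "V - {i}" \<zeta>] by auto
    qed
    finally show "J E {i} (\<lambda>\<zeta>. wt V (insert i Y) \<zeta> * f \<zeta>) \<zeta> = wt (V - {i}) Y \<zeta> * num V E {i} f \<zeta>" .
  qed
  finally show ?thesis .
qed

text \<open>In \<open>num_insert\<close> the function enters only through its one-site numerator,
  which is unchanged when the function is replaced by its one-site average.\<close>

lemma K_consistent:
  assumes E: "fatrel E" and sub: "Y \<subseteq> V" and fin: "finite Y" "i \<in> Y" and f: "bm (cspace V) f"
    and \<eta>: "\<eta> \<in> cs V"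
  shows "K V E Y (K V E {i} f) \<eta> = K V E Y f \<eta>"
proof -
  interpret ri: pot_resample \<Phi> E V "{i}" using assms by unfold_locales auto
  interpret rl: pot_resample \<Phi> E V "Y - {i}" using assms by unfold_locales auto
  have [simp]: "insert i (Y - {i}) = Y" using fin by auto
  have n: "num V E Y g \<eta> = J E (Y - {i}) (\<lambda>\<zeta>. wt (V - {i}) (Y - {i}) \<zeta> * num V E {i} g \<zeta>) \<eta>"
    if "bm (cspace V) g" for g
    using num_insert[OF E, of i "Y - {i}" V g \<eta>] that \<eta> sub fin by (simp add: insert_absorb subset_iff)
  have "num V E Y (K V E {i} f) \<eta> = J E (Y - {i}) (\<lambda>\<zeta>. wt (V - {i}) (Y - {i}) \<zeta> * num V E {i} (K V E {i} f) \<zeta>) \<eta>"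
    by (rule n[OF ri.bm_K[OF f]])
  also have "\<dots> = J E (Y - {i}) (\<lambda>\<zeta>. wt (V - {i}) (Y - {i}) \<zeta> * num V E {i} f \<zeta>) \<eta>"
    by (rule rl.J_cong_space[OF \<eta>]) (simp add: ri.num_K)
  also have "\<dots> = num V E Y f \<eta>" by (rule n[OF f, symmetric])
  finally show ?thesis by (simp add: K_def)
qed

section \<open>Sweeps of one-site moves and measures invariant under them\<close>

definition Ks :: "'d site set => (real => real => bool) => 'd site list => (('d, real) conf => real) => ('d, real) conf => real" where
  "Ks V E is = foldr (\<lambda>i. K V E {i}) is"

lemma Ks_simps [simp]: "Ks V E [] f = f" "Ks V E (i # is) f = K V E {i} (Ks V E is f)"
  "Ks V E (is @ js) f = Ks V E is (Ks V E js f)"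
  by (auto simp: Ks_def)

lemma bm_Ks: "fatrel E ==> set is \<subseteq> V ==> bm (cspace V) f ==> bm (cspace V) (Ks V E is f)"
proof (induction "is")
  case (Cons i "is")
  interpret pot_resample \<Phi> E V "{i}" using Cons by unfold_locales auto
  show ?case using Cons by (auto intro: bm_K)
qed auto

lemma Ks_shift: "fatrel E ==> set is \<subseteq> V ==> bm (cspace V) f ==> \<eta> \<in> cs V ==>
  Ks V E is (\<lambda>\<zeta>. a + s * f \<zeta>) \<eta> = a + s * Ks V E is f \<eta>"
proof (induction "is" arbitrary: \<eta>)
  case (Cons i "is")
  interpret pot_resample \<Phi> E V "{i}" using Cons by unfold_locales auto
  have "Ks V E (i # is) (\<lambda>\<zeta>. a + s * f \<zeta>) \<eta> = K V E {i} (\<lambda>\<zeta>. a + s * Ks V E is f \<zeta>) \<eta>"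
    using Cons by (auto intro!: K_cong)
  then show ?case using Cons by (auto intro!: K_shift bm_Ks)
qed auto

lemma K_Ks:
  assumes E: "fatrel E" and sub: "Y \<subseteq> V" and fin: "finite Y" and f: "bm (cspace V) f"
    and \<eta>: "\<eta> \<in> cs V" and "set is \<subseteq> Y"
  shows "K V E Y (Ks V E is f) \<eta> = K V E Y f \<eta>"
  using assms(6)
proof (induction "is")
  case (Cons i "is")
  then show ?case using K_consistent[OF E sub fin _ bm_Ks[OF E _ f, of "is"] \<eta>] sub by auto
qed auto

text \<open>Each one-site kernel dominates a multiple of the one-site \<open>J\<close>, and by
  Fubini the one-site integrals over distinct sites compose to the block integral. Positivity lets
  the constants multiply.\<close>

lemma Ks_lower_J:
  assumes "fatrel E" "set is \<subseteq> V" "distinct is"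
  shows "\<exists>c>0. \<forall>f. bm (cspace V) f \<longrightarrow> (\<forall>\<zeta>\<in>cs V. 0 \<le> f \<zeta>) \<longrightarrow>
    (\<forall>\<eta>\<in>cs V. c * J E (set is) f \<eta> \<le> Ks V E is f \<eta>)"
  using assms
proof (induction "is" rule: rev_induct)
  case Nil
  have "J E {} f \<eta> = f \<eta>" for f and \<eta> :: "('d, real) conf"
  proof -
    have "measure (lebc ({} :: 'd site set)) (space (lebc {})) = 1"
      by (simp add: leb_prod_def PiM_empty measure_def)
    then show ?thesis by (simp add: J_def comp_ind_def)
  qed
  then show ?case by (intro exI[of _ 1]) auto
next
  case (snoc i "is")
  interpret ri: pot_resample \<Phi> E V "{i}" using snoc by unfold_locales auto
  interpret rl: pot_resample \<Phi> E V "set is" using snoc by unfold_locales auto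
  obtain c where c: "c > 0" "\<And>f \<eta>. bm (cspace V) f ==> (\<forall>\<zeta>\<in>cs V. 0 \<le> f \<zeta>) ==> \<eta> \<in> cs V ==>
    c * J E (set is) f \<eta> \<le> Ks V E is f \<eta>" using snoc by auto
  obtain d where d: "d > 0" "\<And>f \<eta>. bm (cspace V) f ==> (\<forall>\<zeta>\<in>cs V. 0 \<le> f \<zeta>) ==> \<eta> \<in> cs V ==>
    d * J E {i} f \<eta> \<le> K V E {i} f \<eta>" using ri.K_lower_J by blast
  show ?case
  proof (intro exI[of _ "c * d"] conjI allI impI ballI)
    fix f \<eta> assume f: "bm (cspace V) f" "\<forall>\<zeta>\<in>cs V. 0 \<le> f \<zeta>" and \<eta>: "\<eta> \<in> cs V"
    have J0: "0 \<le> J E {i} f \<zeta>" if "\<zeta> \<in> cs V" for \<zeta>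
      using ri.J_mono[OF bm_const f(1) that, of 0] f(2) by (simp add: J_def)
    have bd: "bm (cspace V) (\<lambda>\<zeta>. d * J E {i} f \<zeta>)" using ri.bm_J[OF f(1)] by auto
    have "d * J E (set (is @ [i])) f \<eta> = d * J E (set is) (J E {i} f) \<eta>"
      using J_insert[OF snoc(2), of i "set is" V f \<eta>] snoc f \<eta> by simp
    also have "\<dots> = J E (set is) (\<lambda>\<zeta>. d * J E {i} f \<zeta>) \<eta>"
      using rl.J_pull[OF \<eta>, of "\<lambda>_. d" "J E {i} f"] by simp
    also have "\<dots> \<le> J E (set is) (K V E {i} f) \<eta>"
      by (rule rl.J_mono[OF bd ri.bm_K[OF f(1)] \<eta> d(2)[OF f]])
    finally have 1: "c * (d * J E (set (is @ [i])) f \<eta>) \<le> c * J E (set is) (K V E {i} f) \<eta>"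
      using c(1) by (intro mult_left_mono) auto
    have "0 \<le> K V E {i} f \<zeta>" if "\<zeta> \<in> cs V" for \<zeta>
      using d(2)[OF f that] mult_nonneg_nonneg[OF less_imp_le[OF d(1)] J0[OF that]] by linarith
    then have 2: "c * J E (set is) (K V E {i} f) \<eta> \<le> Ks V E is (K V E {i} f) \<eta>"
      by (intro c(2) ri.bm_K f \<eta>) auto
    show "c * d * J E (set (is @ [i])) f \<eta> \<le> Ks V E (is @ [i]) f \<eta>" using order_trans[OF 1 2] by simp
  qed (use c d in auto)
qed

text \<open>Stated with one-site equations and without fixing a constraint: mixtures of constrained
  Gibbs measures over different cell configurations qualify for the cell relation, and lifts of
  discrete measures are such mixtures.\<close>

definition invar :: "'d site set => (real => real => bool) => ('d, real) conf measure => bool" where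
  "invar V E \<mu> \<longleftrightarrow> prob_space \<mu> \<and> sets \<mu> = sets (cspace V) \<and>
     (\<forall>i\<in>V. \<forall>f. bm (cspace V) f \<longrightarrow> (LINT x|\<mu>. K V E {i} f x) = (LINT x|\<mu>. f x))"

lemma invar_Ks:
  assumes "invar V E \<mu>" "fatrel E" "set is \<subseteq> V" "bm (cspace V) f"
  shows "(LINT x|\<mu>. Ks V E is f x) = (LINT x|\<mu>. f x)"
  using assms(3)
proof (induction "is")
  case (Cons i "is")
  then show ?case using assms bm_Ks[of E "is" V f] unfolding invar_def by auto
qed auto

text \<open>A full sweep \<open>P\<close> of single-site moves dominates a multiple of the block kernel \<open>K\<close> and satisfies
  \<open>K P = K\<close>; so it contracts the kernel of \<open>K\<close> in the uniform norm, while \<open>\<mu> P = \<mu>\<close>.\<close>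

lemma invar_block:
  assumes inv: "invar V E \<mu>" and E: "fatrel E" and sub: "Y \<subseteq> V" and fin: "finite Y" and f: "bm (cspace V) f"
  shows "(LINT x|\<mu>. K V E Y f x) = (LINT x|\<mu>. f x)"
proof -
  interpret pot_resample \<Phi> E V Y using assms by unfold_locales auto
  have p: "prob_space \<mu>" and s: "sets \<mu> = sets (cspace V)" using inv by (auto simp: invar_def)
  have sp: "space \<mu> = X" using s by (rule sets_eq_imp_space_eq)
  note bs = bm_sets_cong[OF s]
  obtain "is" where is': "set is = Y" "distinct is" using finite_distinct_list[OF fin] by blast
  define P where "P = Ks V E is"
  obtain c where c: "c > 0" "\<And>f \<eta>. bm (cspace V) f ==> (\<forall>\<zeta>\<in>X. 0 \<le> f \<zeta>) ==> \<eta> \<in> X ==> c * J E Y f \<eta> \<le> P f \<eta>"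
    using Ks_lower_J[OF E, of "is" V] is' sub unfolding P_def by auto
  obtain d where d: "d > 0" "\<And>f \<eta>. bm (cspace V) f ==> (\<forall>\<zeta>\<in>X. 0 \<le> f \<zeta>) ==> \<eta> \<in> X ==> d * K V E Y f \<eta> \<le> J E Y f \<eta>"
    using K_upper_J by blast
  \<comment> \<open>Capping at 1 keeps \<open>1 - e\<close> nonnegative and below 1, so that its
    powers tend to 0.\<close>
  define e where "e = min (c * d) 1"
  have e: "e > 0" "e \<le> 1" using c d by (auto simp: e_def)
  have PK: "e * K V E Y g \<eta> \<le> P g \<eta>" if g: "bm (cspace V) g" "\<forall>\<zeta>\<in>X. 0 \<le> g \<zeta>" and \<eta>: "\<eta> \<in> X" for g \<eta>
  proof -
    have "0 \<le> K V E Y g \<eta>" using K_mono[OF bm_const g(1) \<eta>, of 0] g(2) K_const[OF \<eta>] by auto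
    then have "e * K V E Y g \<eta> \<le> c * (d * K V E Y g \<eta>)" by (simp add: e_def mult_right_mono flip: mult.assoc)
    also have "\<dots> \<le> c * J E Y g \<eta>" using d(2)[OF g \<eta>] c(1) by (intro mult_left_mono) auto
    also have "\<dots> \<le> P g \<eta>" by (rule c(2)[OF g \<eta>])
    finally show ?thesis .
  qed
  have bmP: "bm (cspace V) (P g)" if "bm (cspace V) g" for g
    unfolding P_def using bm_Ks[OF E _ that] is' sub by auto
  \<comment> \<open>Generalised over \<open>g\<close> and \<open>b\<close>, because one sweep
    replaces \<open>g\<close> by \<open>P g\<close> and \<open>b\<close> by
    \<open>(1 - e) * b\<close>.\<close>
  have main: "\<bar>LINT x|\<mu>. g x\<bar> \<le> (1 - e) ^ n * b"
    if "bm (cspace V) g" "\<And>\<zeta>. \<zeta> \<in> X ==> \<bar>g \<zeta>\<bar> \<le> b" "\<And>\<zeta>. \<zeta> \<in> X ==> K V E Y g \<zeta> = 0" for g b n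
    using that
  proof (induction n arbitrary: g b)
    case 0 then show ?case using prob_abs_integral_le[OF p, of g b] bs sp by auto
  next
    case (Suc n)
    have aff: "P (\<lambda>\<zeta>. b + s * g \<zeta>) \<eta> = b + s * P g \<eta>" "K V E Y (\<lambda>\<zeta>. b + s * g \<zeta>) \<eta> = b" if "\<eta> \<in> X" for s \<eta>
      using Ks_shift[OF E _ Suc.prems(1) that, of "is"] is' sub K_shift[OF Suc.prems(1) that, of b s] Suc.prems(3)[OF that]
      unfolding P_def by auto
    have "(LINT x|\<mu>. g x) = (LINT x|\<mu>. P g x)"
      unfolding P_def using invar_Ks[OF inv E _ Suc.prems(1)] is' sub by auto
    moreover have "\<bar>LINT x|\<mu>. P g x\<bar> \<le> (1 - e) ^ n * ((1 - e) * b)"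
    proof (rule Suc.IH[OF bmP[OF Suc.prems(1)]])
      fix \<zeta> assume \<zeta>: "\<zeta> \<in> X"
      \<comment> \<open>\<open>b + g\<close> and \<open>b - g\<close> are nonnegative with block
        average \<open>b\<close>; the minorisation puts \<open>P\<close> of each above
        \<open>e * b\<close>, and these are the two halves of the bound on
        \<open>P g\<close>.\<close>
      have "0 \<le> b + 1 * g x" "0 \<le> b + (-1) * g x" if "x \<in> X" for x using Suc.prems(2)[OF that] by auto
      moreover have "bm (cspace V) (\<lambda>\<zeta>. b + s * g \<zeta>)" for s by (intro bm_add bm_mult bm_const Suc.prems(1))
      ultimately have "e * b \<le> P (\<lambda>\<zeta>. b + 1 * g \<zeta>) \<zeta>" "e * b \<le> P (\<lambda>\<zeta>. b + (-1) * g \<zeta>) \<zeta>"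
        using PK[of "\<lambda>\<zeta>. b + 1 * g \<zeta>" \<zeta>] PK[of "\<lambda>\<zeta>. b + (-1) * g \<zeta>" \<zeta>] \<zeta>
        unfolding aff(2)[OF \<zeta>] by blast+
      then show "\<bar>P g \<zeta>\<bar> \<le> (1 - e) * b" unfolding aff(1)[OF \<zeta>] by (simp add: algebra_simps abs_le_iff)
      show "K V E Y (P g) \<zeta> = 0"
        unfolding P_def using K_Ks[OF E sub fin Suc.prems(1) \<zeta>, of "is"] is' Suc.prems(3)[OF \<zeta>] by auto
    qed
    ultimately show ?case by (simp add: mult_ac)
  qed
  let ?g = "\<lambda>x. f x - K V E Y f x"
  have g: "bm (cspace V) ?g" using f bm_K[OF f] by auto
  obtain b where b: "b > 0" "\<And>x. x \<in> X ==> \<bar>?g x\<bar> \<le> b" using bm_bounded[OF g] by blast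
  have "K V E Y ?g \<zeta> = 0" if "\<zeta> \<in> X" for \<zeta> using K_diff[OF f bm_K[OF f] that] K_idem[OF that, of f] by simp
  then have le: "\<bar>LINT x|\<mu>. ?g x\<bar> \<le> (1 - e) ^ n * b" for n using main[OF g b(2)] by auto
  have "(\<lambda>n. (1 - e) ^ n * b) \<longlonglongrightarrow> 0 * b" using e by (intro tendsto_mult LIMSEQ_power_zero tendsto_const) auto
  then have "\<bar>LINT x|\<mu>. ?g x\<bar> \<le> 0 * b" by (rule LIMSEQ_le_const) (use le in auto)
  moreover have "(LINT x|\<mu>. ?g x) = (LINT x|\<mu>. f x) - (LINT x|\<mu>. K V E Y f x)"
    using f bm_K[OF f] bs by (intro Bochner_Integration.integral_diff prob_integrable[OF p]) auto
  ultimately show ?thesis by simp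
qed

end

section \<open>Quasilocal functions\<close>

text \<open>Uniform approximability by local functions of the configuration on \<open>V\<close>.
  Continuity in the angles is not asked for, since indicators of cells have to qualify.\<close>

definition ql :: "'i set => (('i => real) => real) => bool" where
  "ql V f \<longleftrightarrow> (\<forall>\<epsilon>>0. \<exists>L. finite L \<and> L \<subseteq> V \<and> (\<forall>\<xi>\<in>cs V. \<forall>\<eta>\<in>cs V.
     (\<forall>i\<in>L. \<xi> i = \<eta> i) \<longrightarrow> \<bar>f \<xi> - f \<eta>\<bar> \<le> \<epsilon>))"

lemma qlE:
  assumes "ql V f" "\<epsilon> > 0"
  obtains L where "finite L" "L \<subseteq> V"
    "\<And>\<xi> \<eta>. \<xi> \<in> cs V ==> \<eta> \<in> cs V ==> (\<And>i. i \<in> L ==> \<xi> i = \<eta> i) ==> \<bar>f \<xi> - f \<eta>\<bar> \<le> \<epsilon>"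
  using assms unfolding ql_def by metis

lemma ql_local:
  assumes "finite L" "L \<subseteq> V"
    "\<And>\<xi> \<eta>. \<xi> \<in> cs V ==> \<eta> \<in> cs V ==> (\<And>i. i \<in> L ==> \<xi> i = \<eta> i) ==> f \<xi> = f \<eta>"
  shows "ql V f"
  unfolding ql_def using assms by (metis abs_zero diff_self less_imp_le)

lemma ql_const: "ql V (\<lambda>_. c)" by (rule ql_local[of "{}"]) auto

lemma ql_lipschitz:
  assumes "ql V f" "L > 0" "\<And>\<xi> \<eta>. \<xi> \<in> cs V ==> \<eta> \<in> cs V ==> \<bar>\<phi> (f \<xi>) - \<phi> (f \<eta>)\<bar> \<le> L * \<bar>f \<xi> - f \<eta>\<bar>"
  shows "ql V (\<lambda>x. \<phi> (f x))"
  unfolding ql_def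
proof (intro allI impI)
  fix \<epsilon> :: real assume "\<epsilon> > 0"
  then have "\<epsilon> / L > 0" using assms by simp
  from qlE[OF assms(1) this] obtain M where M: "finite M" "M \<subseteq> V"
    "\<And>\<xi> \<eta>. \<xi> \<in> cs V ==> \<eta> \<in> cs V ==> (\<And>i. i \<in> M ==> \<xi> i = \<eta> i) ==> \<bar>f \<xi> - f \<eta>\<bar> \<le> \<epsilon> / L"
    by metis
  have "\<bar>\<phi> (f \<xi>) - \<phi> (f \<eta>)\<bar> \<le> \<epsilon>" if "\<xi> \<in> cs V" "\<eta> \<in> cs V" "\<forall>i\<in>M. \<xi> i = \<eta> i" for \<xi> \<eta>
  proof -
    have "L * \<bar>f \<xi> - f \<eta>\<bar> \<le> L * (\<epsilon> / L)" using M(3)[OF that(1,2)] that(3) assms(2) by (intro mult_left_mono) auto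
    then show ?thesis using assms(3)[OF that(1,2)] assms(2) by simp
  qed
  then show "\<exists>L. finite L \<and> L \<subseteq> V \<and> (\<forall>\<xi>\<in>cs V. \<forall>\<eta>\<in>cs V. (\<forall>i\<in>L. \<xi> i = \<eta> i) \<longrightarrow> \<bar>\<phi> (f \<xi>) - \<phi> (f \<eta>)\<bar> \<le> \<epsilon>)"
    using M by blast
qed

lemma ql_mult:
  assumes f: "ql V f" "bm (cspace V) f" and g: "ql V g" "bm (cspace V) g"
  shows "ql V (\<lambda>x. f x * g x)"
  unfolding ql_def
proof (intro allI impI)
  fix \<epsilon> :: real assume \<epsilon>: "\<epsilon> > 0"
  obtain a where a: "a > 0" "\<And>x. x \<in> cs V ==> \<bar>f x\<bar> \<le> a" using bm_bounded[OF f(2)] by blast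
  obtain b where b: "b > 0" "\<And>x. x \<in> cs V ==> \<bar>g x\<bar> \<le> b" using bm_bounded[OF g(2)] by blast
  have "\<epsilon> / (a + b) > 0" using \<epsilon> a b by simp
  note q = qlE[OF f(1) this] qlE[OF g(1) this]
  obtain M where M: "finite M" "M \<subseteq> V"
    "\<And>\<xi> \<eta>. \<xi> \<in> cs V ==> \<eta> \<in> cs V ==> (\<And>i. i \<in> M ==> \<xi> i = \<eta> i) ==> \<bar>f \<xi> - f \<eta>\<bar> \<le> \<epsilon> / (a + b)"
    using q(1) by metis
  obtain N where N: "finite N" "N \<subseteq> V"
    "\<And>\<xi> \<eta>. \<xi> \<in> cs V ==> \<eta> \<in> cs V ==> (\<And>i. i \<in> N ==> \<xi> i = \<eta> i) ==> \<bar>g \<xi> - g \<eta>\<bar> \<le> \<epsilon> / (a + b)"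
    using q(2) by metis
  have "\<bar>f \<xi> * g \<xi> - f \<eta> * g \<eta>\<bar> \<le> \<epsilon>" if h: "\<xi> \<in> cs V" "\<eta> \<in> cs V" "\<forall>i\<in>M \<union> N. \<xi> i = \<eta> i" for \<xi> \<eta>
  proof -
    have "f \<xi> * g \<xi> - f \<eta> * g \<eta> = f \<xi> * (g \<xi> - g \<eta>) + (f \<xi> - f \<eta>) * g \<eta>" by (simp add: algebra_simps)
    also have "\<bar>\<dots>\<bar> \<le> \<bar>f \<xi>\<bar> * \<bar>g \<xi> - g \<eta>\<bar> + \<bar>f \<xi> - f \<eta>\<bar> * \<bar>g \<eta>\<bar>" by (metis abs_triangle_ineq abs_mult)
    also have "\<dots> \<le> a * (\<epsilon> / (a + b)) + \<epsilon> / (a + b) * b"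
      using M(3)[OF h(1,2)] N(3)[OF h(1,2)] h(3) a b h by (intro add_mono mult_mono) auto
    also have "\<dots> = \<epsilon> / (a + b) * (a + b)" by (metis distrib_left mult.commute)
    also have "\<dots> = \<epsilon>" using a(1) b(1) by simp
    finally show ?thesis .
  qed
  then show "\<exists>L. finite L \<and> L \<subseteq> V \<and> (\<forall>\<xi>\<in>cs V. \<forall>\<eta>\<in>cs V. (\<forall>i\<in>L. \<xi> i = \<eta> i) \<longrightarrow> \<bar>f \<xi> * g \<xi> - f \<eta> * g \<eta>\<bar> \<le> \<epsilon>)"
    using M(1,2) N(1,2) by (intro exI[of _ "M \<union> N"]) blast
qed

lemma ql_inverse:
  assumes "ql V f" "c > 0" "\<And>x. x \<in> cs V ==> c \<le> f x"
  shows "ql V (\<lambda>x. 1 / f x)"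
proof (rule ql_lipschitz[OF assms(1), of "1 / c\<^sup>2"])
  fix \<xi> \<eta> assume h: "\<xi> \<in> cs V" "\<eta> \<in> cs V"
  have p: "c \<le> f \<xi>" "c \<le> f \<eta>" "0 < f \<xi>" "0 < f \<eta>" using assms(3)[OF h(1)] assms(3)[OF h(2)] assms(2) by auto
  have "c * c \<le> f \<xi> * f \<eta>" using p assms(2) by (intro mult_mono) auto
  have "1 / f \<xi> - 1 / f \<eta> = (f \<eta> - f \<xi>) / (f \<xi> * f \<eta>)" using p by (simp add: field_simps)
  also have "\<bar>\<dots>\<bar> = \<bar>f \<xi> - f \<eta>\<bar> / (f \<xi> * f \<eta>)" using p by (simp add: abs_mult abs_minus_commute)
  also have "\<dots> \<le> \<bar>f \<xi> - f \<eta>\<bar> / (c * c)" using \<open>c * c \<le> f \<xi> * f \<eta>\<close> assms(2) by (intro divide_left_mono) (auto simp: p)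
  finally show "\<bar>1 / f \<xi> - 1 / f \<eta>\<bar> \<le> 1 / c\<^sup>2 * \<bar>f \<xi> - f \<eta>\<bar>" by (simp add: power2_eq_square)
qed (use assms in auto)

lemma ql_exp:
  assumes "ql V f" "bm (cspace V) f" shows "ql V (\<lambda>x. exp (f x))"
proof -
  obtain a where a: "a > 0" "\<And>x. x \<in> cs V ==> \<bar>f x\<bar> \<le> a" using bm_bounded[OF assms(2)] by blast
  have one: "exp x - exp y \<le> exp a * \<bar>x - y\<bar>" if "\<bar>x\<bar> \<le> a" for x y :: real
  proof -
    have "exp x * (1 + (y - x)) \<le> exp x * exp (y - x)" by (intro mult_left_mono exp_ge_add_one_self) auto
    then have "exp x - exp y \<le> exp x * (x - y)" by (simp add: algebra_simps flip: exp_add)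
    also have "\<dots> \<le> exp a * \<bar>x - y\<bar>" using that by (intro order_trans[OF _ mult_right_mono[of "exp x" "exp a"]] mult_left_mono) auto
    finally show ?thesis .
  qed
  show ?thesis
  proof (rule ql_lipschitz[OF assms(1), of "exp a"])
    fix \<xi> \<eta> assume h: "\<xi> \<in> cs V" "\<eta> \<in> cs V"
    show "\<bar>exp (f \<xi>) - exp (f \<eta>)\<bar> \<le> exp a * \<bar>f \<xi> - f \<eta>\<bar>"
      using one[OF a(2)[OF h(1)], of "f \<eta>"] one[OF a(2)[OF h(2)], of "f \<xi>"] by (simp add: abs_minus_commute abs_le_iff)
  qed auto
qed

lemma (in resample) ql_J:
  assumes "ql V f" "bm (cspace V) f" shows "ql V (J E Y f)"
  unfolding ql_def
proof (intro allI impI)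
  fix \<epsilon> :: real assume \<epsilon>: "\<epsilon> > 0"
  define m where "m = measure (lebc Y) (space (lebc Y)) + 1"
  have m: "m > 0" by (simp add: m_def add_nonneg_pos)
  with \<epsilon> have "\<epsilon> / m > 0" by simp
  from qlE[OF assms(1) this] obtain M where M: "finite M" "M \<subseteq> V"
    "\<And>\<xi> \<eta>. \<xi> \<in> cs V ==> \<eta> \<in> cs V ==> (\<And>i. i \<in> M ==> \<xi> i = \<eta> i) ==> \<bar>f \<xi> - f \<eta>\<bar> \<le> \<epsilon> / m"
    by metis
  \<comment> \<open>Agreement on \<open>Y\<close> makes the class indicators coincide; agreement on
    \<open>M\<close> controls the integrand.\<close>
  have "\<bar>J E Y f \<xi> - J E Y f \<eta>\<bar> \<le> \<epsilon>" if h: "\<xi> \<in> cs V" "\<eta> \<in> cs V" "\<forall>i\<in>M \<union> Y. \<xi> i = \<eta> i" for \<xi> \<eta>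
  proof -
    have c: "comp_ind E Y \<xi> \<sigma> = comp_ind E Y \<eta> \<sigma>" for \<sigma> using h(3) by (simp add: comp_ind_def)
    let ?g = "\<lambda>\<sigma>. comp_ind E Y \<xi> \<sigma> * f (override_on \<xi> \<sigma> Y) - comp_ind E Y \<eta> \<sigma> * f (override_on \<eta> \<sigma> Y)"
    have "J E Y f \<xi> - J E Y f \<eta> = (LINT \<sigma>|lebc Y. ?g \<sigma>)"
      unfolding J_def using J_integrable[OF assms(2) h(1)] J_integrable[OF assms(2) h(2)] by simp
    also have "\<bar>\<dots>\<bar> \<le> \<epsilon> / m * measure (lebc Y) (space (lebc Y))"
    proof (rule abs_integral_le[OF finite_measure_lebc[OF fin]])
      show "bm (lebc Y) ?g" using bm_integrand2[OF assms(2) h(1)] bm_integrand2[OF assms(2) h(2)] by (rule bm_diff)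
      fix \<sigma> assume s: "\<sigma> \<in> space (lebc Y)"
      have "\<bar>f (override_on \<xi> \<sigma> Y) - f (override_on \<eta> \<sigma> Y)\<bar> \<le> \<epsilon> / m"
        using h(3) by (intro M(3) override_space[OF h(1) s sub] override_space[OF h(2) s sub]) (auto simp: override_on_def)
      then have "\<bar>comp_ind E Y \<eta> \<sigma>\<bar> * \<bar>f (override_on \<xi> \<sigma> Y) - f (override_on \<eta> \<sigma> Y)\<bar> \<le> 1 * (\<epsilon> / m)"
        using comp_ind_bounds(3) by (intro mult_mono) auto
      then show "\<bar>?g \<sigma>\<bar> \<le> \<epsilon> / m" unfolding c right_diff_distrib[symmetric] abs_mult by simp
    qed
    also have "\<dots> \<le> \<epsilon> / m * m" using \<epsilon> m by (intro mult_left_mono) (auto simp: m_def)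
    finally show ?thesis using m by simp
  qed
  then show "\<exists>L. finite L \<and> L \<subseteq> V \<and> (\<forall>\<xi>\<in>cs V. \<forall>\<eta>\<in>cs V. (\<forall>i\<in>L. \<xi> i = \<eta> i) \<longrightarrow> \<bar>J E Y f \<xi> - J E Y f \<eta>\<bar> \<le> \<epsilon>)"
    using M(1,2) fin sub by (intro exI[of _ "M \<union> Y"]) blast
qed

lemma (in potential) ql_wt: assumes "finite \<Delta>" shows "ql V (wt V \<Delta>)"
proof -
  have "ql V (H V \<Delta>)" unfolding ql_def using H_quasilocal[OF assms] by blast
  then have "ql V (\<lambda>x. - H V \<Delta> x)" by (rule ql_lipschitz[of _ _ 1 uminus]) auto
  then show ?thesis unfolding wt_def[abs_def] by (rule ql_exp) (intro bm_uminus bm_H assms)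
qed

context pot_resample begin

lemma ql_num: "ql V f ==> bm (cspace V) f ==> ql V (num V E Y f)"
  unfolding num_def by (intro ql_J ql_mult ql_wt bm_wt bm_wf fin)

lemma ql_K: assumes "ql V f" "bm (cspace V) f" shows "ql V (K V E Y f)"
proof -
  obtain c where c: "c > 0" "\<And>\<eta>. \<eta> \<in> X ==> c \<le> num V E Y (\<lambda>_. 1) \<eta>" using num_one_lower by blast
  have "bm (cspace V) (\<lambda>x. 1 / num V E Y (\<lambda>_. 1) x)" using c by (intro bm_divide bm_num bm_const)
  moreover have "ql V (\<lambda>x. 1 / num V E Y (\<lambda>_. 1) x)" using c by (intro ql_inverse ql_num ql_const bm_const)
  ultimately have "ql V (\<lambda>x. num V E Y f x * (1 / num V E Y (\<lambda>_. 1) x))" using assms by (intro ql_mult ql_num bm_num)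
  then show ?thesis by (simp add: K_def[abs_def])
qed

end

lemma (in potential) ql_Ks: "fatrel E ==> set is \<subseteq> V ==> ql V f ==> bm (cspace V) f ==> ql V (Ks V E is f)"
proof (induction "is")
  case (Cons i "is")
  interpret pot_resample \<Phi> E V "{i}" using Cons by unfold_locales auto
  show ?case using Cons bm_Ks[of E "is" V f] by (auto intro: ql_K)
qed auto

section \<open>Local laws on boxes\<close>

text \<open>The constrained laws carry their constraint in the reference measure, the operators
  \<open>J\<close> in an indicator. The two measures are identified by comparing them on product
  sets.\<close>

lemma leb_prod_sub:
  assumes fin: "finite Y" and S: "\<And>i. i \<in> Y ==> S i \<in> sets borel \<and> S i \<subseteq> circle"
  shows "distr (leb_prod Y S) (lebc Y) (\<lambda>\<sigma>. \<sigma>) = density (lebc Y) (indicator (PiE Y S))"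
    and "(\<lambda>\<sigma>. \<sigma>) \<in> measurable (leb_prod Y S) (lebc Y)" and "finite_measure (leb_prod Y S)"
    and "PiE Y S \<in> sets (lebc Y)"
proof -
  have fS: "finite_measure (restrict_space lborel (S i))" if "i \<in> Y" for i
  proof (rule finite_measureI)
    have "emeasure lborel (S i) \<le> emeasure lborel circle" using S[OF that] by (intro emeasure_mono) auto
    also have "\<dots> < \<infinity>" by (simp add: circle_def)
    finally show "emeasure (restrict_space lborel (S i)) (space (restrict_space lborel (S i))) \<noteq> \<infinity>"
      using S[OF that] by (simp add: emeasure_restrict_space space_restrict_space)
  qed
  \<comment> \<open>The factors outside \<open>Y\<close> never enter the product; setting them to
    the finite measure \<open>LC\<close> makes the whole family \<sigma>-finite.\<close>
  define M where "M = (\<lambda>i. if i \<in> Y then restrict_space lborel (S i) else LC)"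
  have LM: "leb_prod Y S = PiM Y M" unfolding leb_prod_def M_def by (rule PiM_cong) auto
  interpret p: product_sigma_finite M
    using fS finite_measure_LC by (auto simp: product_sigma_finite_def M_def intro: finite_measure.sigma_finite_measure)
  interpret c: product_sigma_finite "\<lambda>_. LC" by (rule product_sigma_finite_LC)
  show id: "(\<lambda>\<sigma>. \<sigma>) \<in> measurable (leb_prod Y S) (lebc Y)"
  proof -
    have "(\<lambda>\<sigma>. \<sigma>) \<in> measurable (leb_prod Y S) (PiM Y (\<lambda>_. LC))"
    proof (rule measurable_PiM_single')
      fix i assume i: "i \<in> Y"
      have "(\<lambda>x. x) \<in> measurable (restrict_space lborel (S i)) LC"
        using S[OF i] by (intro measurable_restrict_space3) auto
      moreover have "(\<lambda>\<sigma>. \<sigma> i) \<in> measurable (leb_prod Y S) (restrict_space lborel (S i))"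
        unfolding leb_prod_def using i by measurable
      ultimately show "(\<lambda>\<sigma>. \<sigma> i) \<in> measurable (leb_prod Y S) LC" by (rule measurable_compose[rotated])
    next
      have "PiE Y S \<subseteq> PiE Y (\<lambda>_. circle)" using S by (intro PiE_mono) auto
      then show "(\<lambda>\<sigma>. \<sigma>) \<in> space (leb_prod Y S) \<rightarrow> (\<Pi>\<^sub>E i\<in>Y. space LC)" by (auto simp: space_leb_prod)
    qed
    then show ?thesis by (simp add: leb_prod_def)
  qed
  have em: "emeasure (leb_prod Y S) (PiE Y A) = (\<Prod>i\<in>Y. emeasure lborel (A i))"
    if "\<And>i. i \<in> Y ==> A i \<in> sets borel \<and> A i \<subseteq> S i" for A
  proof -
    have "emeasure (leb_prod Y S) (PiE Y A) = (\<Prod>i\<in>Y. emeasure (M i) (A i))"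
      unfolding LM using that S by (intro p.emeasure_PiM[OF fin]) (auto simp: M_def sets_restrict_space_iff)
    also have "\<dots> = (\<Prod>i\<in>Y. emeasure lborel (A i))"
      using that S by (intro prod.cong refl) (auto simp: M_def emeasure_restrict_space)
    finally show ?thesis .
  qed
  have emc: "emeasure (lebc Y) (PiE Y A) = (\<Prod>i\<in>Y. emeasure lborel (A i))"
    if "\<And>i. i \<in> Y ==> A i \<in> sets borel \<and> A i \<subseteq> circle" for A
  proof -
    have "emeasure (lebc Y) (PiE Y A) = (\<Prod>i\<in>Y. emeasure LC (A i))"
      unfolding leb_prod_def using that by (intro c.emeasure_PiM[OF fin]) (auto simp: sets_restrict_space_iff)
    also have "\<dots> = (\<Prod>i\<in>Y. emeasure lborel (A i))"
      using that by (intro prod.cong refl) (auto simp: emeasure_restrict_space)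
    finally show ?thesis .
  qed
  show box: "PiE Y S \<in> sets (lebc Y)"
    unfolding leb_prod_def using S by (intro sets_PiM_I_finite fin) (auto simp: sets_restrict_space_iff)
  show f: "finite_measure (leb_prod Y S)"
  proof (rule finite_measureI)
    have "emeasure (leb_prod Y S) (PiE Y S) = emeasure (lebc Y) (PiE Y S)" using em[of S] emc[of S] S by simp
    also have "\<dots> \<noteq> \<infinity>" using finite_measure.emeasure_finite[OF finite_measure_lebc[OF fin]] by auto
    finally show "emeasure (leb_prod Y S) (space (leb_prod Y S)) \<noteq> \<infinity>" by (simp add: space_leb_prod)
  qed
  show "distr (leb_prod Y S) (lebc Y) (\<lambda>\<sigma>. \<sigma>) = density (lebc Y) (indicator (PiE Y S))" (is "?P = ?Q")
  proof (rule measure_eqI_PiM_finite[OF fin, of _ "\<lambda>_. LC" _ "\<lambda>_. PiE Y (\<lambda>_. circle)"])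
    show "sets ?P = sets (PiM Y (\<lambda>_. LC))" "sets ?Q = sets (PiM Y (\<lambda>_. LC))" by (simp_all add: leb_prod_def)
    fix A assume A: "\<And>i. i \<in> Y ==> A i \<in> sets LC"
    have Ac: "A i \<in> sets borel \<and> A i \<subseteq> circle" if "i \<in> Y" for i using A[OF that] by (auto simp: sets_restrict_space_iff)
    have bA: "PiE Y A \<in> sets (lebc Y)" unfolding leb_prod_def using A by (intro sets_PiM_I_finite fin) auto
    have "emeasure ?P (PiE Y A) = emeasure (leb_prod Y S) (PiE Y (\<lambda>i. A i \<inter> S i))"
      using bA id by (subst emeasure_distr) (auto simp: space_leb_prod PiE_Int[symmetric])
    also have "\<dots> = emeasure (lebc Y) (PiE Y (\<lambda>i. A i \<inter> S i))"     proof -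
      have "A i \<inter> S i \<in> sets borel \<and> A i \<inter> S i \<subseteq> S i" "A i \<inter> S i \<in> sets borel \<and> A i \<inter> S i \<subseteq> circle" if "i \<in> Y" for i
        using Ac[OF that] S[OF that] by auto
      then show ?thesis using em[of "\<lambda>i. A i \<inter> S i"] emc[of "\<lambda>i. A i \<inter> S i"] by simp
    qed
    also have "\<dots> = emeasure ?Q (PiE Y A)"
      using bA box by (subst emeasure_density) (auto simp: PiE_Int[symmetric] nn_integral_cmult_indicator indicator_inter_arith[symmetric] Int_commute)
    finally show "emeasure ?P (PiE Y A) = emeasure ?Q (PiE Y A)" .
  next
    show "emeasure ?P (PiE Y (\<lambda>_. circle)) \<noteq> \<infinity>"
      using finite_measure.emeasure_finite[OF finite_measure.finite_measure_distr[OF f id]] by auto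
    show "range (\<lambda>_::nat. PiE Y (\<lambda>_. circle)) \<subseteq> prod_algebra Y (\<lambda>_. LC)"
      using prod_algebraI_finite[OF fin, of "\<lambda>_. circle" "\<lambda>_. LC"] by (auto simp: sets_restrict_space_iff)
  qed (auto simp: space_PiM)
qed

lemma integral_leb_prod_sub:
  fixes g :: "('i => real) => real"
  assumes fin: "finite Y" and S: "\<And>i. i \<in> Y ==> S i \<in> sets borel \<and> S i \<subseteq> circle"
    and g: "g \<in> borel_measurable (lebc Y)"
  shows "(LINT \<sigma>|leb_prod Y S. g \<sigma>) = (LINT \<sigma>|lebc Y. indicator (PiE Y S) \<sigma> * g \<sigma>)"
proof -
  have "(LINT \<sigma>|leb_prod Y S. g \<sigma>) = (LINT \<sigma>|distr (leb_prod Y S) (lebc Y) (\<lambda>\<sigma>. \<sigma>). g \<sigma>)"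
    using integral_distr[of "\<lambda>\<sigma>. \<sigma>" "leb_prod Y S" "lebc Y" g] leb_prod_sub(2)[OF fin, of S] S g by auto
  also have "\<dots> = (LINT \<sigma>|density (lebc Y) (\<lambda>x. ennreal (indicator (PiE Y S) x)). g \<sigma>)"
    using leb_prod_sub(1)[OF fin, of S] S by (simp add: ennreal_indicator)
  also have "\<dots> = (LINT \<sigma>|lebc Y. indicator (PiE Y S) \<sigma> * g \<sigma>)"
    using leb_prod_sub(4)[OF fin, of S] S g by (subst integral_density) auto
  finally show ?thesis .
qed

lemma (in resample) J_box:
  assumes S: "\<And>i. i \<in> Y ==> S i \<in> sets borel \<and> S i = {y \<in> circle. E (\<eta> i) y}"
    and \<eta>: "\<eta> \<in> cs V" and f: "bm (cspace V) f"
  shows "(LINT \<sigma>|leb_prod Y S. f (override_on \<eta> \<sigma> Y)) = J E Y f \<eta>"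
proof -
  have "(LINT \<sigma>|leb_prod Y S. f (override_on \<eta> \<sigma> Y)) = (LINT \<sigma>|lebc Y. indicator (PiE Y S) \<sigma> * f (override_on \<eta> \<sigma> Y))"
  proof (rule integral_leb_prod_sub[OF fin])
    show "\<And>i. i \<in> Y ==> S i \<in> sets borel \<and> S i \<subseteq> circle" using S by blast
    show "(\<lambda>\<sigma>. f (override_on \<eta> \<sigma> Y)) \<in> borel_measurable (lebc Y)"
      by (rule measurable_compose[OF override_measurable2[OF sub \<eta>] bm_measurable[OF f]])
  qed
  also have "\<dots> = J E Y f \<eta>"
    unfolding J_def
  proof (rule icong[OF refl])
    fix \<sigma> assume s: "\<sigma> \<in> space (lebc Y)"
    have "comp_ind E Y \<eta> \<sigma> = indicator (PiE Y S) \<sigma>"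
      using s S fin by (auto simp: comp_ind_def space_leb_prod PiE_iff indicator_def)
    then show "indicator (PiE Y S) \<sigma> * f (override_on \<eta> \<sigma> Y) = comp_ind E Y \<eta> \<sigma> * f (override_on \<eta> \<sigma> Y)" by simp
  qed
  finally show ?thesis .
qed

context pot_resample begin

text \<open>Dictionary between local laws and operators: when the allowed sets are the classes of
  the spins of \<open>\<eta>\<close>, integrating against the local law is \<open>K\<close>. The
  explicit density is kept for total variation estimates.\<close>

lemma local_law_box:
  assumes S: "\<And>i. i \<in> Y ==> S i \<in> sets borel \<and> S i = {y \<in> circle. E (\<eta> i) y}"
    and \<eta>: "\<eta> \<in> X"
  defines "p \<equiv> (\<lambda>\<sigma>. wt V Y (override_on \<eta> \<sigma> Y) / num V E Y (\<lambda>_. 1) \<eta>)"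
  shows "local_law \<Phi> V S Y \<eta> = density (leb_prod Y S) (\<lambda>\<sigma>. ennreal (p \<sigma>))"
    and "bm (leb_prod Y S) p" and "\<And>\<sigma>. 0 \<le> p \<sigma>" and "finite_measure (leb_prod Y S)"
    and "\<And>f. bm (cspace V) f ==> (LINT \<sigma>|leb_prod Y S. p \<sigma> * f (override_on \<eta> \<sigma> Y)) = K V E Y f \<eta>"
    and "\<And>f. bm (cspace V) f ==> bm (leb_prod Y S) (\<lambda>\<sigma>. f (override_on \<eta> \<sigma> Y))"
    and "\<And>f. bm (cspace V) f ==> (LINT \<sigma>|local_law \<Phi> V S Y \<eta>. f (override_on \<eta> \<sigma> Y)) = K V E Y f \<eta>"
    and "prob_space (local_law \<Phi> V S Y \<eta>)"
proof -
  have S': "\<And>i. i \<in> Y ==> S i \<in> sets borel \<and> S i \<subseteq> circle" using S by blast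
  have Z: "(LINT \<sigma>|leb_prod Y S. exp (- hamiltonian \<Phi> V Y (override_on \<eta> \<sigma> Y))) = num V E Y (\<lambda>_. 1) \<eta>"
    using J_box[OF S \<eta> bm_wt[OF fin]] by (simp add: num_def wt_def[abs_def])
  show law: "local_law \<Phi> V S Y \<eta> = density (leb_prod Y S) (\<lambda>\<sigma>. ennreal (p \<sigma>))"
    unfolding local_law_def Let_def Z p_def wt_def ..
  show bmf: "bm (leb_prod Y S) (\<lambda>\<sigma>. f (override_on \<eta> \<sigma> Y))" if f: "bm (cspace V) f" for f
    using bm_compose[OF bm_compose[OF f override_measurable2[OF sub \<eta>]] leb_prod_sub(2)[OF fin, of S]] S' by simp
  show bmp: "bm (leb_prod Y S) p"
    unfolding p_def using bmf[OF bm_wt[OF fin]] num_one_pos[OF \<eta>] by (intro bm_divide bm_const) auto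
  show p0: "\<And>\<sigma>. 0 \<le> p \<sigma>" unfolding p_def using num_one_pos[OF \<eta>] wt_pos by (simp add: less_imp_le)
  show fm: "finite_measure (leb_prod Y S)" using leb_prod_sub(3)[OF fin, of S] S' by simp
  show int: "(LINT \<sigma>|leb_prod Y S. p \<sigma> * f (override_on \<eta> \<sigma> Y)) = K V E Y f \<eta>" if f: "bm (cspace V) f" for f
  proof -
    have "(LINT \<sigma>|leb_prod Y S. p \<sigma> * f (override_on \<eta> \<sigma> Y)) =
        (LINT \<sigma>|leb_prod Y S. wt V Y (override_on \<eta> \<sigma> Y) * f (override_on \<eta> \<sigma> Y)) / num V E Y (\<lambda>_. 1) \<eta>"
      unfolding p_def by (simp add: mult.commute flip: integral_divide_zero)
    then show ?thesis using J_box[OF S \<eta> bm_wf[OF f]] by (simp add: K_def num_def)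
  qed
  show "(LINT \<sigma>|local_law \<Phi> V S Y \<eta>. f (override_on \<eta> \<sigma> Y)) = K V E Y f \<eta>" if f: "bm (cspace V) f" for f
    unfolding law using bmf[OF f] bmp p0 int[OF f] by (subst integral_density) (auto simp: bm_measurable)
  show "prob_space (local_law \<Phi> V S Y \<eta>)"
  proof (rule prob_spaceI)
    have "emeasure (local_law \<Phi> V S Y \<eta>) (space (local_law \<Phi> V S Y \<eta>)) = (\<integral>\<^sup>+\<sigma>. ennreal (p \<sigma>) \<partial>leb_prod Y S)"
      unfolding law using bmp by (subst emeasure_density) (auto simp: bm_measurable nn_integral_set_ennreal intro!: nn_integral_cong)
    also have "\<dots> = ennreal (LINT \<sigma>|leb_prod Y S. p \<sigma>)"
      using bm_integrable[OF fm bmp] p0 by (intro nn_integral_eq_integral) auto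
    also have "(LINT \<sigma>|leb_prod Y S. p \<sigma>) = 1" using int[OF bm_const, of 1] K_const[OF \<eta>, of 1] by simp
    finally show "emeasure (local_law \<Phi> V S Y \<eta>) (space (local_law \<Phi> V S Y \<eta>)) = 1" by simp
  qed
qed

end

section \<open>Dobrushin contraction\<close>

lemma arc_of_circle: assumes "k < q" shows "arc_of q k \<subseteq> circle"
proof
  fix x assume "x \<in> arc_of q k"
  then have x: "2 * pi * real k / real q \<le> x" "x < 2 * pi * (real k + 1) / real q" by (auto simp: arc_of_def)
  have "0 \<le> x" by (rule order_trans[OF _ x(1)]) simp
  moreover have "2 * pi * (real k + 1) / real q \<le> 2 * pi"
    using assms by (simp add: pos_divide_le_eq)
  ultimately show "x \<in> circle" using x unfolding circle_def by auto
qed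

lemma coarse_less: assumes "0 < q" "x \<in> circle" shows "coarse q x < q"
proof -
  have "real q * x / (2 * pi) < real q" using assms by (simp add: circle_def divide_less_eq)
  then have "\<lfloor>real q * x / (2 * pi)\<rfloor> < int q" by (simp add: floor_less_iff)
  then show ?thesis using assms(1) by (simp add: coarse_def)
qed

lemma coarse_arc: "0 < q ==> k < q ==> x \<in> arc_of q k ==> coarse q x = k"
  using coarse_eq_iff arc_of_circle by blast

lemma coarse_borel [measurable]: "coarse q \<in> measurable borel (count_space UNIV)"
  unfolding coarse_def[abs_def] by measurable

lemma coarse_LC: "coarse q \<in> measurable LC (count_space UNIV)"
  using coarse_borel measurable_restrict_space1[of "coarse q" lborel "count_space UNIV" circle] by simp

lemma arc_measure: assumes "0 < q" "k < q" shows "(LINT y|LC. of_bool (coarse q y = k)) = 2 * pi / real q"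
proof -
  have "(LINT y|LC. of_bool (coarse q y = k)) = (LINT y|LC. indicator (arc_of q k) y)"
    using coarse_eq_iff[OF assms(1)] by (intro icong) (auto simp: indicator_def)
  also have "\<dots> = measure LC (arc_of q k)"
    using arc_of_circle[OF assms(2)] by (simp add: space_restrict_space Int_absorb1 Int_absorb2 Int_commute)
  also have "\<dots> = measure lborel (arc_of q k)"
    using arc_of_circle[OF assms(2)] by (subst measure_restrict_space) (auto simp: arc_of_def)
  also have "\<dots> = 2 * pi * (real k + 1) / real q - 2 * pi * real k / real q"
    unfolding arc_of_def using assms by (subst measure_lborel_Ico) (auto intro!: divide_right_mono)
  finally show ?thesis by (simp add: distrib_left add_divide_distrib)
qed

definition cellrel :: "nat => real => real => bool" where
  "cellrel q x y \<longleftrightarrow> coarse q x = coarse q y"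

lemma measurable_eq_rel:
  assumes "f \<in> measurable LC (count_space (UNIV :: nat set))"
  shows "(\<lambda>(x, y). (of_bool (f x = f y) :: real)) \<in> borel_measurable (LC \<Otimes>\<^sub>M LC)"
proof -
  have 1: "(\<lambda>z. f (fst z)) \<in> measurable (LC \<Otimes>\<^sub>M LC) (count_space UNIV)"
    "(\<lambda>z. f (snd z)) \<in> measurable (LC \<Otimes>\<^sub>M LC) (count_space UNIV)"
    using measurable_compose[OF measurable_fst assms] measurable_compose[OF measurable_snd assms] by auto
  have "(\<lambda>z. (f (fst z), f (snd z))) \<in> measurable (LC \<Otimes>\<^sub>M LC) (count_space UNIV \<Otimes>\<^sub>M count_space UNIV)"
    using 1 by (rule measurable_Pair)
  then have "(\<lambda>z. (f (fst z), f (snd z))) \<in> measurable (LC \<Otimes>\<^sub>M LC) (count_space UNIV)"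
    by (simp add: pair_measure_countable)
  then have "(\<lambda>z. (\<lambda>(a, b). of_bool (a = b) :: real) (f (fst z), f (snd z))) \<in> borel_measurable (LC \<Otimes>\<^sub>M LC)"
    by (rule measurable_compose) simp
  then show ?thesis by (simp add: split_beta')
qed

lemma fatrel_cellrel: assumes "0 < q" shows "fatrel (cellrel q)"
  unfolding fatrel_def cellrel_def
proof (intro conjI)
  show "\<exists>c>0. \<forall>x\<in>circle. c \<le> (LINT y|LC. (of_bool (coarse q x = coarse q y) :: real))"
  proof (intro exI[of _ "2 * pi / real q"] conjI ballI)
    fix x assume "x \<in> circle"
    then have "coarse q x < q" using coarse_less assms by blast
    then show "2 * pi / real q \<le> (LINT y|LC. of_bool (coarse q x = coarse q y))"
      using arc_measure[OF assms, of "coarse q x"] by (simp add: eq_commute)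
  qed (use assms in simp)
  show "(\<lambda>(x, y). (of_bool (coarse q x = coarse q y) :: real)) \<in> borel_measurable (LC \<Otimes>\<^sub>M LC)"
    by (rule measurable_eq_rel[OF coarse_LC])
qed auto

lemma cell_class: assumes "0 < q" "x \<in> circle"
  shows "arc_of q (coarse q x) \<in> sets borel \<and> arc_of q (coarse q x) = {y \<in> circle. cellrel q x y}"
proof
  show "arc_of q (coarse q x) \<in> sets borel" by (simp add: arc_of_def)
  show "arc_of q (coarse q x) = {y \<in> circle. cellrel q x y}"
    using coarse_eq_iff[OF assms(1), of _ "coarse q x"] arc_of_circle[OF coarse_less[OF assms]]
    by (auto simp: cellrel_def eq_commute)
qed

text \<open>The extremal event is where one density exceeds the other.\<close>

lemma integral_diff_le_tv:
  assumes L: "finite_measure L" and p: "bm L p" "\<And>x. 0 \<le> p x" "(LINT x|L. p x) = 1"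
    and r: "bm L r" "\<And>x. 0 \<le> r x" "(LINT x|L. r x) = 1"
    and h: "bm L h" "\<And>x y. x \<in> space L ==> y \<in> space L ==> h x - h y \<le> w" and w: "0 \<le> w"
    and tv: "tv_dist (density L (\<lambda>x. ennreal (p x))) (density L (\<lambda>x. ennreal (r x))) \<le> ennreal t" and t: "0 \<le> t"
  shows "(LINT x|L. p x * h x) - (LINT x|L. r x * h x) \<le> w * t"
proof -
  note [measurable] = bm_measurable[OF p(1)] bm_measurable[OF r(1)] bm_measurable[OF h(1)]
  obtain b where b: "\<And>x. x \<in> space L ==> \<bar>h x\<bar> \<le> b" using bm_bounded[OF h(1)] by blast
  have ne: "space L \<noteq> {}"
  proof
    assume "space L = {}"
    then have "(LINT x|L. p x) = (LINT x|L. 0)" by (intro icong) auto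
    then show False using p(3) by simp
  qed
  \<comment> \<open>Shifting by the infimum changes nothing because both densities have mass 1, and
    it makes the integrand lie between 0 and \<open>w\<close>.\<close>
  define a where "a = (INF x\<in>space L. h x)"
  have bdd: "bdd_below (h ` space L)" by (rule bdd_belowI2[of _ "- b"]) (use b in \<open>force simp: abs_le_iff\<close>)
  have a: "a \<le> h x" "h x - a \<le> w" if "x \<in> space L" for x
  proof -
    show "a \<le> h x" unfolding a_def using bdd that by (rule cINF_lower)
    have "h x - w \<le> a" unfolding a_def
    proof (rule cINF_greatest[OF ne])
      fix y assume "y \<in> space L"
      from h(2)[OF that this] show "h x - w \<le> h y" by linarith
    qed
    then show "h x - a \<le> w" by simp
  qed
  define B where "B = {x \<in> space L. r x < p x}"
  have B [measurable]: "B \<in> sets L" unfolding B_def by measurable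
  have int: "integrable L f" if "bm L f" for f :: "_ => real" using bm_integrable[OF L that] .
  have mB: "measure (density L (\<lambda>x. ennreal (g x))) B = (LINT x|L. indicator B x * g x)"
    if g: "bm L g" "\<And>x. 0 \<le> g x" for g
  proof -
    have gm [measurable]: "g \<in> borel_measurable L" using g(1) by (rule bm_measurable)
    have "measure (density L (\<lambda>x. ennreal (g x))) B = (LINT x|density L (\<lambda>x. ennreal (g x)). indicator B x)"
      using B by (simp add: Int_absorb2 sets.sets_into_space)
    also have "\<dots> = (LINT x|L. g x * indicator B x)"
      using g by (subst integral_density) auto
    finally show ?thesis by (simp add: mult.commute)
  qed
  have "ennreal \<bar>measure (density L (\<lambda>x. ennreal (p x))) B - measure (density L (\<lambda>x. ennreal (r x))) B\<bar> \<le> ennreal t"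
    using tv unfolding tv_dist_def SUP_le_iff by (metis B sets_density)
  then have tB: "(LINT x|L. indicator B x * p x) - (LINT x|L. indicator B x * r x) \<le> t"
    unfolding mB[OF p(1,2)] mB[OF r(1,2)] using t by simp
  have iB: "bm L (indicator B)" using B by (rule bm_indicator)
  have "(LINT x|L. p x * h x) - (LINT x|L. r x * h x) = (LINT x|L. (h x - a) * (p x - r x))"
  proof -
    have "(LINT x|L. (h x - a) * (p x - r x)) = (LINT x|L. (p x * h x - r x * h x) - (a * p x - a * r x))"
      by (simp add: algebra_simps)
    also have "\<dots> = (LINT x|L. p x * h x - r x * h x) - (LINT x|L. a * p x - a * r x)"
      by (intro Bochner_Integration.integral_diff int bm_diff bm_mult p r h bm_const)
    also have "(LINT x|L. a * p x - a * r x) = (LINT x|L. a * p x) - (LINT x|L. a * r x)"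
      by (intro Bochner_Integration.integral_diff int bm_mult p r bm_const)
    also have "\<dots> = 0" using p(3) r(3) by simp
    also have "(LINT x|L. p x * h x - r x * h x) = (LINT x|L. p x * h x) - (LINT x|L. r x * h x)"
      by (intro Bochner_Integration.integral_diff int bm_mult p r h)
    finally show ?thesis by simp
  qed
  also have "\<dots> \<le> (LINT x|L. w * (indicator B x * p x - indicator B x * r x))"
  proof (rule integral_mono)
    show "integrable L (\<lambda>x. (h x - a) * (p x - r x))" "integrable L (\<lambda>x. w * (indicator B x * p x - indicator B x * r x))"
      by (intro int bm_mult bm_diff bm_const p r h iB)+
    fix x assume x: "x \<in> space L"
    show "(h x - a) * (p x - r x) \<le> w * (indicator B x * p x - indicator B x * r x)"
    proof (cases "x \<in> B")
      case True then show ?thesis using a[OF x] by (auto simp: B_def intro!: mult_right_mono)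
    next
      case False
      then have "p x - r x \<le> 0" using x by (auto simp: B_def)
      then show ?thesis using a[OF x] False by (simp add: mult_nonneg_nonpos)
    qed
  qed
  also have "\<dots> = w * ((LINT x|L. indicator B x * p x) - (LINT x|L. indicator B x * r x))"
  proof -
    have "(LINT x|L. indicator B x * p x - indicator B x * r x) = (LINT x|L. indicator B x * p x) - (LINT x|L. indicator B x * r x)"
      by (intro Bochner_Integration.integral_diff int bm_mult p r iB)
    then show ?thesis by simp
  qed
  also have "\<dots> \<le> w * t" using tB w by (rule mult_left_mono)
  finally show ?thesis .
qed

lemma sum_le_infsum_ennreal:
  fixes f :: "'a => ennreal"
  shows "finite F ==> (\<Sum>j\<in>F. f j) \<le> (\<Sum>\<^sub>\<infinity>j. f j)"
proof -
  assume F: "finite F"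
  have "infsum f F \<le> infsum f UNIV" by (rule infsum_mono_neutral) (auto intro: nonneg_summable_on_complete)
  then show ?thesis using F by simp
qed

locale dobrushin_potential = potential \<Phi> for \<Phi> :: "('d::finite) potential" +
  fixes q :: nat
  assumes q: "0 < q" and dob: "dobrushin_condition \<Phi> q"
begin

abbreviation C1 :: "real => real => bool" where "C1 \<equiv> cellrel q"

lemma fat: "fatrel C1" by (rule fatrel_cellrel[OF q])

section \<open>Oscillations and influence coefficients\<close>

definition same :: "'d site set => ('d, real) conf => ('d, real) conf => bool" where
  "same V \<xi> \<eta> \<longleftrightarrow> (\<forall>i\<in>V. C1 (\<xi> i) (\<eta> i))"

definition infl :: "'d site => 'd site => real" where
  "infl i j = enn2real (dobrushin_coeff \<Phi> q i j)"

definition cst :: real where "cst = enn2real (SUP i. \<Sum>\<^sub>\<infinity>j. dobrushin_coeff \<Phi> q i j)"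

lemma cst: "0 \<le> cst" "cst < 1"
proof -
  show "0 \<le> cst" by (simp add: cst_def)
  show "cst < 1" using dob unfolding dobrushin_condition_def cst_def
    by (cases "SUP i. \<Sum>\<^sub>\<infinity>j. dobrushin_coeff \<Phi> q i j") auto
qed

lemma coeff_sum_le: "finite F ==> (\<Sum>j\<in>F. dobrushin_coeff \<Phi> q i j) \<le> ennreal cst"
proof -
  assume F: "finite F"
  have "(\<Sum>j\<in>F. dobrushin_coeff \<Phi> q i j) \<le> (\<Sum>\<^sub>\<infinity>j. dobrushin_coeff \<Phi> q i j)" by (rule sum_le_infsum_ennreal[OF F])
  also have "\<dots> \<le> (SUP i. \<Sum>\<^sub>\<infinity>j. dobrushin_coeff \<Phi> q i j)" by (rule SUP_upper) simp
  also have "\<dots> = ennreal cst" unfolding cst_def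
    using dob unfolding dobrushin_condition_def by (intro ennreal_enn2real[symmetric]) (auto intro: less_trans)
  finally show ?thesis .
qed

lemma infl: "0 \<le> infl i j" "dobrushin_coeff \<Phi> q i j = ennreal (infl i j)"
proof -
  show "0 \<le> infl i j" by (simp add: infl_def)
  have "dobrushin_coeff \<Phi> q i j < \<top>" using coeff_sum_le[of "{j}" i] by (simp add: le_less_trans)
  then show "dobrushin_coeff \<Phi> q i j = ennreal (infl i j)" by (simp add: infl_def)
qed

lemma infl_sum: "finite F ==> (\<Sum>j\<in>F. infl i j) \<le> cst"
  using coeff_sum_le[of F i] infl(1)[of i] cst by (simp add: infl(2) sum_ennreal)

text \<open>\<open>d j\<close> bounds the oscillation at \<open>j\<close> between configurations
  with the same cells; resampling inside cells never smooths a function across different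
  ones.\<close>

definition osc_le :: "'d site set => (('d, real) conf => real) => ('d site => real) => bool" where
  "osc_le V f d \<longleftrightarrow> (\<forall>j\<in>V. \<forall>\<xi>\<in>cs V. \<forall>\<eta>\<in>cs V. same V \<xi> \<eta> \<longrightarrow>
     (\<forall>i\<in>V - {j}. \<xi> i = \<eta> i) \<longrightarrow> \<bar>f \<xi> - f \<eta>\<bar> \<le> d j)"

text \<open>Quasilocality reduces the comparison to a finite window up to \<open>\<epsilon>\<close>;
  there the two configurations are interpolated one site at a time.\<close>

lemma osc_total:
  assumes "osc_le V f d" "ql V f" "\<And>j. 0 \<le> d j" "\<And>F. finite F ==> sum d F \<le> B"
    and h: "\<xi> \<in> cs V" "\<eta> \<in> cs V" "same V \<xi> \<eta>"
  shows "\<bar>f \<xi> - f \<eta>\<bar> \<le> B"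
proof (rule field_le_epsilon)
  fix \<epsilon> :: real assume "\<epsilon> > 0"
  from qlE[OF assms(2) this] obtain L where L: "finite L" "L \<subseteq> V"
    "\<And>\<xi> \<eta>. \<xi> \<in> cs V ==> \<eta> \<in> cs V ==> (\<And>i. i \<in> L ==> \<xi> i = \<eta> i) ==> \<bar>f \<xi> - f \<eta>\<bar> \<le> \<epsilon>"
    by metis
  have sp: "override_on \<eta> \<xi> M \<in> cs V" if "M \<subseteq> V" for M
    using h that by (auto simp: space_conf_space override_on_def PiE_iff extensional_def)
  have step: "\<bar>f (override_on \<eta> \<xi> M) - f \<eta>\<bar> \<le> sum d M" if "finite M" "M \<subseteq> V" for M
    using that
  proof (induction M)
    case (insert j M)
    have "\<bar>f (override_on \<eta> \<xi> (insert j M)) - f (override_on \<eta> \<xi> M)\<bar> \<le> d j"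
      using assms(1)[unfolded osc_le_def, rule_format, of j "override_on \<eta> \<xi> (insert j M)" "override_on \<eta> \<xi> M"]
        insert.prems h(3) sp[of "insert j M"] sp[of M] by (auto simp: same_def override_on_def cellrel_def)
    then show ?case using insert by simp
  qed auto
  have "\<bar>f \<xi> - f (override_on \<eta> \<xi> L)\<bar> \<le> \<epsilon>" using L sp h by (intro L(3)) auto
  moreover have "\<bar>f (override_on \<eta> \<xi> L) - f \<eta>\<bar> \<le> B" using step[OF L(1,2)] assms(4)[OF L(1)] by linarith
  ultimately show "\<bar>f \<xi> - f \<eta>\<bar> \<le> B + \<epsilon>" by linarith
qed

text \<open>Dobrushin's dusting: averaging over the spin at \<open>i\<close> removes its oscillation
  and passes at most the fraction \<open>infl i j\<close> of it to each other site
  \<open>j\<close>.\<close>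

definition stepv :: "'d site set => 'd site => ('d site => real) => 'd site => real" where
  "stepv V i d = (\<lambda>j. if j = i \<or> j \<notin> V then 0 else d j + infl i j * d i)"

text \<open>The constraint consists of the full arcs containing the spins of \<open>\<xi>\<close>;
  since \<open>\<eta>\<close> lies in the same arcs, the pair is admissible in the supremum defining
  the coefficient.\<close>

lemma tv_local_law:
  assumes V: "i \<in> V" and h: "\<xi> \<in> cs V" "\<eta> \<in> cs V" "same V \<xi> \<eta>" "\<forall>k\<in>V - {j}. \<xi> k = \<eta> k"
  defines "S \<equiv> \<lambda>k. arc_of q (coarse q (\<xi> k))"
  shows "tv_dist (local_law \<Phi> V S {i} \<xi>) (local_law \<Phi> V S {i} \<eta>) \<le> ennreal (infl i j)"
  unfolding infl(2)[symmetric] dobrushin_coeff_def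
proof (rule SUP_upper2[of "(V, S, \<xi>, \<eta>)"])
  have c: "\<xi> k \<in> circle" "\<eta> k \<in> circle" if "k \<in> V" for k using cspaceD[OF h(1) that] cspaceD[OF h(2) that] by auto
  have "arc_constraint q V S" unfolding arc_constraint_def
  proof (intro ballI)
    fix k assume "k \<in> V"
    then have "coarse q (\<xi> k) < q" using c coarse_less[OF q] by blast
    moreover have "2 * pi * real (coarse q (\<xi> k)) / real q < 2 * pi * (real (coarse q (\<xi> k)) + 1) / real q"
      using q by (intro divide_strict_right_mono) auto
    ultimately show "\<exists>k'<q. \<exists>a b. a < b \<and> S k = {a..<b} \<and> {a..<b} \<subseteq> arc_of q k'"
      unfolding S_def arc_of_def by (intro exI[of _ "coarse q (\<xi> k)"] conjI exI[of _ "2 * pi * real (coarse q (\<xi> k)) / real q"] exI[of _ "2 * pi * (real (coarse q (\<xi> k)) + 1) / real q"] order_refl refl)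
  qed
  moreover have "\<xi> \<in> PiE V S" "\<eta> \<in> PiE V S"
    using h c cell_class[OF q] unfolding S_def by (auto simp: space_conf_space same_def PiE_iff cellrel_def)
  ultimately show "(V, S, \<xi>, \<eta>) \<in> {(V, S, \<eta>, \<zeta>). i \<in> V \<and> arc_constraint q V S \<and>
          \<eta> \<in> PiE V S \<and> \<zeta> \<in> PiE V S \<and> (\<forall>k\<in>V - {j}. \<eta> k = \<zeta> k)}" using V h(4) by simp
qed simp

text \<open>At \<open>j = i\<close> the average is constant on cells. At another site the difference
  splits into two integrands under one law, costing \<open>d j\<close>, and two laws for one
  integrand, costing the total variation \<open>infl i j\<close> times the oscillation
  \<open>d i\<close>.\<close>

lemma osc_step:
  assumes "i \<in> V" "bm (cspace V) f" "osc_le V f d" "\<And>j. 0 \<le> d j"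
  shows "osc_le V (K V C1 {i} f) (stepv V i d)"
  unfolding osc_le_def
proof (intro ballI impI)
  fix j \<xi> \<eta> assume j: "j \<in> V" and h: "\<xi> \<in> cs V" "\<eta> \<in> cs V" "same V \<xi> \<eta>" "\<forall>k\<in>V - {j}. \<xi> k = \<eta> k"
  interpret pot_resample \<Phi> C1 V "{i}" using assms fat by unfold_locales auto
  show "\<bar>K V C1 {i} f \<xi> - K V C1 {i} f \<eta>\<bar> \<le> stepv V i d j"
  proof (cases "j = i")
    case True
    have "\<eta> = override_on \<xi> (\<lambda>_\<in>{i}. \<eta> i) {i}"
    proof
      fix x show "\<eta> x = override_on \<xi> (\<lambda>_\<in>{i}. \<eta> i) {i} x"
        using h(1,2,4) True by (cases "x \<in> V") (auto simp: override_on_def space_conf_space PiE_iff extensional_def)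
    qed
    moreover have "K V C1 {i} f (override_on \<xi> (\<lambda>_\<in>{i}. \<eta> i) {i}) = K V C1 {i} f \<xi>"
      using h assms(1) cspaceD[OF h(2) assms(1)] by (intro K_self) (auto simp: same_def space_leb_prod)
    ultimately show ?thesis using True by (simp add: stepv_def)
  next
    case False
    let ?S = "\<lambda>k. arc_of q (coarse q (\<xi> k))"
    have Sx: "\<And>k. k \<in> {i} ==> ?S k \<in> sets borel \<and> ?S k = {y \<in> circle. C1 (\<xi> k) y}"
      using cell_class[OF q cspaceD[OF h(1) assms(1)]] by blast
    moreover have "coarse q (\<xi> i) = coarse q (\<eta> i)" using h(3) assms(1) by (auto simp: same_def cellrel_def)
    ultimately have Sy: "\<And>k. k \<in> {i} ==> ?S k \<in> sets borel \<and> ?S k = {y \<in> circle. C1 (\<eta> k) y}"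
      by (auto simp: cellrel_def)
    let ?L = "leb_prod {i} ?S"
    define p where "p = (\<lambda>\<sigma>. wt V {i} (override_on \<xi> \<sigma> {i}) / num V C1 {i} (\<lambda>_. 1) \<xi>)"
    define r where "r = (\<lambda>\<sigma>. wt V {i} (override_on \<eta> \<sigma> {i}) / num V C1 {i} (\<lambda>_. 1) \<eta>)"
    let ?f = "\<lambda>\<sigma>. f (override_on \<xi> \<sigma> {i})" and ?h = "\<lambda>\<sigma>. f (override_on \<eta> \<sigma> {i})"
    have lx: "local_law \<Phi> V ?S {i} \<xi> = density ?L (\<lambda>\<sigma>. ennreal (p \<sigma>))" "bm ?L p" "\<And>\<sigma>. 0 \<le> p \<sigma>" "finite_measure ?L"
      "bm (cspace V) g ==> (LINT \<sigma>|?L. p \<sigma> * g (override_on \<xi> \<sigma> {i})) = K V C1 {i} g \<xi>" "bm ?L ?f" for g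
      unfolding p_def using local_law_box[where S = ?S, OF Sx h(1)] assms(2) by simp_all
    have ly: "local_law \<Phi> V ?S {i} \<eta> = density ?L (\<lambda>\<sigma>. ennreal (r \<sigma>))" "bm ?L r" "\<And>\<sigma>. 0 \<le> r \<sigma>"
      "bm (cspace V) g ==> (LINT \<sigma>|?L. r \<sigma> * g (override_on \<eta> \<sigma> {i})) = K V C1 {i} g \<eta>" "bm ?L ?h" for g
      unfolding r_def using local_law_box[where S = ?S, OF Sy h(2)] assms(2) by simp_all
    have p1: "(LINT x|?L. p x) = 1" using lx(5)[OF bm_const, of 1] K_const[OF h(1), of 1] by simp
    have r1: "(LINT x|?L. r x) = 1" using ly(4)[OF bm_const, of 1] K_const[OF h(2), of 1] by simp
    note L = lx(4) and bp = lx(2) ly(2) lx(6) ly(5) and p0 = lx(3) ly(3)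
    have tv: "tv_dist (density ?L (\<lambda>x. ennreal (p x))) (density ?L (\<lambda>x. ennreal (r x))) \<le> ennreal (infl i j)"
      using tv_local_law[OF assms(1) h] lx(1) ly(1) by simp
    have tv': "tv_dist (density ?L (\<lambda>x. ennreal (r x))) (density ?L (\<lambda>x. ennreal (p x))) \<le> ennreal (infl i j)"
      using tv by (simp add: tv_dist_def abs_minus_commute)
    have sL: "\<sigma> \<in> space (lebc {i})" "C1 (\<eta> i) (\<sigma> i)" "C1 (\<xi> i) (\<sigma> i)" if "\<sigma> \<in> space ?L" for \<sigma>
      using that Sx[of i] Sy[of i] by (auto simp: space_leb_prod PiE_iff)
    have ov: "override_on \<zeta> \<sigma> {i} \<in> cs V" if "\<sigma> \<in> space ?L" "\<zeta> \<in> cs V" for \<sigma> \<zeta>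
      using override_space[OF that(2) sL(1)[OF that(1)]] assms(1) by auto
    have osch: "?h \<sigma> - ?h \<sigma>' \<le> d i" if "\<sigma> \<in> space ?L" "\<sigma>' \<in> space ?L" for \<sigma> \<sigma>'
    proof -
      have "same V (override_on \<eta> \<sigma> {i}) (override_on \<eta> \<sigma>' {i})"
        using sL[OF that(1)] sL[OF that(2)] by (auto simp: same_def override_on_def cellrel_def)
      then have "\<bar>?h \<sigma> - ?h \<sigma>'\<bar> \<le> d i"
        using assms(3)[unfolded osc_le_def, rule_format, OF assms(1) ov[OF that(1) h(2)] ov[OF that(2) h(2)]] by (auto simp: override_on_def)
      then show ?thesis by simp
    qed
    have oscf: "\<bar>?f \<sigma> - ?h \<sigma>\<bar> \<le> d j" if "\<sigma> \<in> space ?L" for \<sigma>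
    proof -
      have "same V (override_on \<xi> \<sigma> {i}) (override_on \<eta> \<sigma> {i})"
        using h(3) by (auto simp: same_def override_on_def cellrel_def)
      then show ?thesis
        using assms(3)[unfolded osc_le_def, rule_format, OF j ov[OF that h(1)] ov[OF that h(2)]] h(4) by (auto simp: override_on_def)
    qed
    have int: "integrable ?L g" if "bm ?L g" for g :: "_ => real" using bm_integrable[OF L that] .
    have 1: "\<bar>(LINT x|?L. p x * ?h x) - (LINT x|?L. r x * ?h x)\<bar> \<le> d i * infl i j"
      using integral_diff_le_tv[OF L bp(1) p0(1) p1 bp(2) p0(2) r1 bp(4) osch assms(4) tv infl(1)]
        integral_diff_le_tv[OF L bp(2) p0(2) r1 bp(1) p0(1) p1 bp(4) osch assms(4) tv' infl(1)]
      by (simp add: abs_le_iff)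
    have "(LINT x|?L. p x * ?f x) - (LINT x|?L. p x * ?h x) = (LINT x|?L. p x * (?f x - ?h x))"
      using int[OF bm_mult[OF bp(1,3)]] int[OF bm_mult[OF bp(1,4)]] by (simp add: right_diff_distrib)
    also have "\<bar>\<dots>\<bar> \<le> (LINT x|?L. \<bar>p x * (?f x - ?h x)\<bar>)" by (rule integral_abs_bound)
    also have "\<dots> \<le> (LINT x|?L. p x * d j)"
    proof (rule integral_mono)
      show "integrable ?L (\<lambda>x. \<bar>p x * (?f x - ?h x)\<bar>)" by (intro integrable_abs int bm_mult bm_diff bp)
      show "integrable ?L (\<lambda>x. p x * d j)" by (intro int bm_mult bp bm_const)
    qed (use p0 oscf in \<open>auto simp: abs_mult intro!: mult_left_mono\<close>)
    also have "\<dots> = d j" using p1 by simp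
    finally have "\<bar>(LINT x|?L. p x * ?f x) - (LINT x|?L. r x * ?h x)\<bar> \<le> d j + infl i j * d i"
      using 1 by (simp add: mult.commute)
    then show ?thesis using lx(5)[OF assms(2)] ly(4)[OF assms(2)] False j by (simp add: stepv_def)
  qed
qed

definition steps :: "'d site set => 'd site list => ('d site => real) => 'd site => real" where
  "steps V is = foldr (stepv V) is"

lemma steps_simps [simp]: "steps V [] d = d" "steps V (i # is) d = stepv V i (steps V is d)"
  "steps V (is @ js) d = steps V is (steps V js d)"
  by (auto simp: steps_def)

lemma stepv_nonneg: "(\<And>j. 0 \<le> d j) ==> 0 \<le> stepv V i d j"
  using infl(1) by (auto simp: stepv_def)

lemma steps_nonneg: "(\<And>j. 0 \<le> d j) ==> 0 \<le> steps V is d j"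
  by (induction "is" arbitrary: j) (auto intro: stepv_nonneg)

lemma steps_supp: "(\<And>j. j \<notin> V ==> d j = 0) ==> j \<notin> V ==> steps V is d j = 0"
  by (induction "is") (auto simp: stepv_def)

lemma osc_steps:
  "set is \<subseteq> V ==> bm (cspace V) f ==> osc_le V f d ==> (\<And>j. 0 \<le> d j) ==> osc_le V (Ks V C1 is f) (steps V is d)"
proof (induction "is")
  case (Cons i "is")
  then show ?case using bm_Ks[OF fat, of "is" V f] by (auto intro!: osc_step steps_nonneg)
qed auto

text \<open>The site treated first is the last of the list. Its oscillation \<open>d i\<close> is
  spread with total at most \<open>cst * d i\<close>, which is exactly what the weight
  \<open>cst\<close> at \<open>i\<close> pays for; the rest of the list then acts on the updated
  vector with its own weights.\<close>

lemma sweep: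
  assumes "distinct is" "\<And>j. 0 \<le> d j" "\<And>F. finite F ==> (\<Sum>j\<in>F. (if j \<in> set is then cst else 1) * d j) \<le> B"
  shows "finite F ==> sum (steps V is d) F \<le> B"
  using assms
proof (induction "is" arbitrary: d F rule: rev_induct)
  case (snoc i "is")
  let ?w = "\<lambda>I j. (if j \<in> I then cst else 1 :: real)"
  have i: "i \<notin> set is" "distinct is" using snoc.prems by auto
  have "sum (steps V is (stepv V i d)) F \<le> B"
  proof (rule snoc.IH[OF \<open>finite F\<close> i(2)])
    show "\<And>j. 0 \<le> stepv V i d j" using snoc.prems by (auto intro: stepv_nonneg)
    fix G :: "'d site set" assume G: "finite G"
    \<comment> \<open>The site \<open>i\<close> must belong to the summation range for its term
      \<open>cst * d i\<close> to be available.\<close>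
    let ?G = "insert i G"
    have fG: "finite ?G" using G by simp
    have w: "0 \<le> ?w (set is) j" "?w (set is) j \<le> 1" for j using cst by auto
    have t: "?w (set is) j * stepv V i d j \<le> ?w (set is) j * (if j = i then 0 else d j) + infl i j * d i" for j
    proof -
      have "?w (set is) j * stepv V i d j \<le> ?w (set is) j * ((if j = i then 0 else d j) + infl i j * d i)"
        using w infl(1) snoc.prems(3) by (intro mult_left_mono) (auto simp: stepv_def)
      also have "\<dots> \<le> ?w (set is) j * (if j = i then 0 else d j) + 1 * (infl i j * d i)"
        unfolding distrib_left using w infl(1) snoc.prems(3) by (intro add_left_mono mult_right_mono) auto
      finally show ?thesis by simp
    qed
    have "(\<Sum>j\<in>G. ?w (set is) j * stepv V i d j) \<le> (\<Sum>j\<in>?G. ?w (set is) j * stepv V i d j)"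
      using fG w stepv_nonneg[OF snoc.prems(3)] by (intro sum_mono2) auto
    also have "\<dots> \<le> (\<Sum>j\<in>?G. ?w (set is) j * (if j = i then 0 else d j) + infl i j * d i)"
      by (rule sum_mono) (rule t)
    also have "\<dots> = (\<Sum>j\<in>?G. ?w (set is) j * (if j = i then 0 else d j)) + (\<Sum>j\<in>?G. infl i j) * d i"
      by (simp only: sum.distrib sum_distrib_right)
    also have "(\<Sum>j\<in>?G. infl i j) * d i \<le> cst * d i"
      using infl_sum[OF fG] snoc.prems(3) by (intro mult_right_mono) auto
    also have "(\<Sum>j\<in>?G. ?w (set is) j * (if j = i then 0 else d j)) + cst * d i = (\<Sum>j\<in>?G. ?w (set (is @ [i])) j * d j)"
      unfolding sum.remove[OF fG insertI1] by (auto intro!: sum.cong)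
    also have "\<dots> \<le> B" by (rule snoc.prems(4)[OF fG])
    finally show "(\<Sum>j\<in>G. ?w (set is) j * stepv V i d j) \<le> B" by simp
  qed
  then show ?case by simp
next
  case Nil then show ?case by simp
qed

text \<open>On an infinite \<open>V\<close> no finite list need reach every site that carries
  oscillation. A finite set holding almost all of the mass is swept instead, which multiplies the
  total by \<open>cst\<close> up to an arbitrarily small error; this is repeated \<open>n\<close>
  times.\<close>

lemma steps_small:
  assumes "\<And>j. 0 \<le> d j" "\<And>j. j \<notin> V ==> d j = 0" "\<And>F. finite F ==> sum d F \<le> B" "\<epsilon> > 0"
  shows "\<exists>is. set is \<subseteq> V \<and> (\<forall>F. finite F \<longrightarrow> sum (steps V is d) F \<le> cst ^ n * B + \<epsilon>)"
  using assms(4)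
proof (induction n arbitrary: \<epsilon>)
  case 0 then show ?case using assms(3) by (intro exI[of _ "[]"]) (auto intro: add_increasing2)
next
  case (Suc n)
  then obtain "is" where is': "set is \<subseteq> V" "\<And>F. finite F ==> sum (steps V is d) F \<le> cst ^ n * B + \<epsilon> / 2"
    by (metis half_gt_zero)
  let ?d = "steps V is d"
  have d0: "\<And>j. 0 \<le> ?d j" using assms(1) by (rule steps_nonneg)
  define s where "s = (SUP F\<in>Collect finite. sum ?d F)"
  have bdd: "bdd_above (sum ?d ` Collect finite)" by (rule bdd_aboveI2) (use is'(2) in auto)
  have s: "sum ?d F \<le> s" if "finite F" for F unfolding s_def using that by (intro cSUP_upper bdd) auto
  have sB: "s \<le> cst ^ n * B + \<epsilon> / 2" unfolding s_def by (rule cSUP_least) (use is'(2) in auto)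
  \<comment> \<open>A finite set carrying the total mass \<open>s\<close> up to
    \<open>\<epsilon> / 2\<close>; the complement is not contracted and contributes at most that
    much.\<close>
  have "\<exists>I\<in>Collect finite. s - \<epsilon> / 2 < sum ?d I"
    unfolding s_def by (subst less_cSUP_iff[symmetric]) (use bdd Suc.prems in auto)
  then obtain I where I: "finite I" "s - \<epsilon> / 2 < sum ?d I" by auto
  obtain js where js: "set js = I \<inter> V" "distinct js" using finite_distinct_list[of "I \<inter> V"] I(1) by auto
  have key: "sum (steps V js ?d) F \<le> cst * s + \<epsilon> / 2" if "finite F" for F
  proof (rule sweep[OF js(2) d0 _ that])
    fix G :: "'d site set" assume G: "finite G"
    have z: "?d j = 0" if "j \<notin> V" for j using steps_supp[OF assms(2) that] by simp
    have "(\<Sum>j\<in>G. (if j \<in> set js then cst else 1) * ?d j) \<le> (\<Sum>j\<in>G \<union> I. (if j \<in> set js then cst else 1) * ?d j)"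
      using G I(1) d0 cst by (intro sum_mono2) auto
    also have "\<dots> = (\<Sum>j\<in>G \<union> I. (if j \<in> I then cst else 1) * ?d j)"
      using z js(1) by (intro sum.cong) auto
    also have "\<dots> = (\<Sum>j\<in>I. cst * ?d j) + (\<Sum>j\<in>G - I. ?d j)"
    proof -
      have "G \<union> I = I \<union> (G - I)" by auto
      then show ?thesis using G I(1) by (simp only:) (subst sum.union_disjoint, auto intro!: arg_cong2[of _ _ _ _ "(+)"] sum.cong)
    qed
    also have "(\<Sum>j\<in>G - I. ?d j) \<le> s - sum ?d I"
    proof -
      have "sum ?d (I \<union> (G - I)) = sum ?d I + sum ?d (G - I)" using G I(1) by (intro sum.union_disjoint) auto
      then show ?thesis using s[of "I \<union> (G - I)"] G I(1) by simp
    qed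
    also have "(\<Sum>j\<in>I. cst * ?d j) \<le> cst * s"
      unfolding sum_distrib_left[symmetric] using s[OF I(1)] cst by (intro mult_left_mono) auto
    finally show "(\<Sum>j\<in>G. (if j \<in> set js then cst else 1) * ?d j) \<le> cst * s + \<epsilon> / 2" using I(2) by simp
  qed
  have "cst * s \<le> cst * (cst ^ n * B + \<epsilon> / 2)" using sB cst by (intro mult_left_mono) auto
  moreover have "cst * (\<epsilon> / 2) \<le> 1 * (\<epsilon> / 2)" using cst Suc.prems by (intro mult_right_mono) auto
  ultimately have "cst * s + \<epsilon> / 2 \<le> cst ^ Suc n * B + \<epsilon>" by (simp add: algebra_simps)
  then have "set (js @ is) \<subseteq> V \<and> (\<forall>F. finite F \<longrightarrow> sum (steps V (js @ is) d) F \<le> cst ^ Suc n * B + \<epsilon>)"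
    using key js(1) is'(1) by (auto intro: order_trans)
  then show ?case by blast
qed

text \<open>The list of moves depends on the window, the bound and \<open>\<epsilon>\<close>, not on
  \<open>f\<close>. This uniformity over all observables of a window later gives convergence uniform
  in events.\<close>

lemma dobrushin_local:
  assumes "finite L" "L \<subseteq> V" "0 \<le> b" "\<epsilon> > 0"
  shows "\<exists>is. set is \<subseteq> V \<and> (\<forall>f. bm (cspace V) f \<longrightarrow> (\<forall>\<xi>\<in>cs V. \<bar>f \<xi>\<bar> \<le> b) \<longrightarrow>
    (\<forall>\<xi>\<in>cs V. \<forall>\<eta>\<in>cs V. (\<forall>i\<in>L. \<xi> i = \<eta> i) \<longrightarrow> f \<xi> = f \<eta>) \<longrightarrow>
    (\<forall>\<xi>\<in>cs V. \<forall>\<eta>\<in>cs V. same V \<xi> \<eta> \<longrightarrow> \<bar>Ks V C1 is f \<xi> - Ks V C1 is f \<eta>\<bar> \<le> \<epsilon>))"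
proof -
  define d where "d = (\<lambda>j. if j \<in> L then 2 * b else 0 :: real)"
  \<comment> \<open>The summand 1 keeps \<open>B\<close> positive even when \<open>b\<close> is 0 or
    \<open>L\<close> is empty, since \<open>\<epsilon>\<close> is divided by it.\<close>
  define B where "B = 2 * b * real (card L) + 1"
  have d: "\<And>j. 0 \<le> d j" "\<And>j. j \<notin> V ==> d j = 0" using assms by (auto simp: d_def)
  have dB: "sum d F \<le> B" if "finite F" for F
  proof -
    have "sum d F \<le> sum d (F \<union> L)" using that assms d by (intro sum_mono2) auto
    also have "\<dots> = sum d L" using that assms by (intro sum.mono_neutral_right) (auto simp: d_def)
    also have "\<dots> \<le> B" by (simp add: d_def B_def)
    finally show ?thesis .
  qed
  have B: "B > 0" using assms by (simp add: B_def add_nonneg_pos)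
  have "\<epsilon> / (2 * B) > 0" using assms B by simp
  then obtain n where n: "cst ^ n < \<epsilon> / (2 * B)" using cst real_arch_pow_inv by blast
  then have "cst ^ n * B \<le> \<epsilon> / 2" using B by (simp add: field_simps)
  moreover obtain "is" where is': "set is \<subseteq> V" "\<And>F. finite F ==> sum (steps V is d) F \<le> cst ^ n * B + \<epsilon> / 2"
    using steps_small[of d V B "\<epsilon> / 2" n] d dB assms by auto
  ultimately have small: "\<And>F. finite F ==> sum (steps V is d) F \<le> \<epsilon>" by fastforce
  show ?thesis
  proof (intro exI[of _ "is"] conjI allI impI ballI is'(1))
    fix f \<xi> \<eta> assume f: "bm (cspace V) f" "\<forall>\<xi>\<in>cs V. \<bar>f \<xi>\<bar> \<le> b"
      "\<forall>\<xi>\<in>cs V. \<forall>\<eta>\<in>cs V. (\<forall>i\<in>L. \<xi> i = \<eta> i) \<longrightarrow> f \<xi> = f \<eta>"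
      and h: "\<xi> \<in> cs V" "\<eta> \<in> cs V" "same V \<xi> \<eta>"
    have "osc_le V f d" unfolding osc_le_def
    proof (intro ballI impI)
      fix j x y assume xy: "j \<in> V" "x \<in> cs V" "y \<in> cs V" "\<forall>i\<in>V - {j}. x i = y i"
      show "\<bar>f x - f y\<bar> \<le> d j"
      proof (cases "j \<in> L")
        case True then show ?thesis using f(2)[rule_format, OF xy(2)] f(2)[rule_format, OF xy(3)] by (simp add: d_def)
      next
        case False
        then have "f x = f y" using xy assms(2) by (intro f(3)[rule_format]) auto
        then show ?thesis using False by (simp add: d_def)
      qed
    qed
    then have "osc_le V (Ks V C1 is f) (steps V is d)" using osc_steps[OF is'(1) f(1)] d by blast
    moreover have "ql V (Ks V C1 is f)"
      using f assms by (intro ql_Ks fat is' ql_local[of L]) blast+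
    ultimately show "\<bar>Ks V C1 is f \<xi> - Ks V C1 is f \<eta>\<bar> \<le> \<epsilon>"
      using osc_total[OF _ _ steps_nonneg[OF d(1)] small h] by blast
  qed
qed

lemma Ks_close:
  assumes "set is \<subseteq> V" "bm (cspace V) f" "bm (cspace V) g" "\<And>\<zeta>. \<zeta> \<in> cs V ==> \<bar>f \<zeta> - g \<zeta>\<bar> \<le> e"
    "\<eta> \<in> cs V"
  shows "\<bar>Ks V C1 is f \<eta> - Ks V C1 is g \<eta>\<bar> \<le> e"
  using assms
proof (induction "is" arbitrary: \<eta>)
  case (Cons i "is")
  interpret pot_resample \<Phi> C1 V "{i}" using Cons fat by unfold_locales auto
  have b: "bm (cspace V) (Ks V C1 is f)" "bm (cspace V) (Ks V C1 is g)" using bm_Ks[OF fat] Cons by auto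
  have "\<bar>K V C1 {i} (\<lambda>\<zeta>. Ks V C1 is f \<zeta> - Ks V C1 is g \<zeta>) \<eta>\<bar> \<le> e"
    using Cons by (intro K_abs_le bm_diff b) auto
  then show ?case using K_diff[OF b, of \<eta>] Cons by simp
qed auto

text \<open>Freezing all spins outside a window at the angle 0 gives a function that is local
  without any restriction to configurations of angles.\<close>

lemma local_approx:
  assumes f: "bm (cspace V) f" "ql V f" and "\<epsilon> > 0"
  shows "\<exists>L g. finite L \<and> L \<subseteq> V \<and> bm (cspace V) g \<and> (\<forall>\<xi>\<in>cs V. \<bar>f \<xi> - g \<xi>\<bar> \<le> \<epsilon>) \<and>
    (\<forall>\<xi> \<eta> :: ('d, real) conf. (\<forall>i\<in>L. \<xi> i = \<eta> i) \<longrightarrow> g \<xi> = g \<eta>)"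
proof -
  from qlE[OF f(2) \<open>\<epsilon> > 0\<close>] obtain L where L: "finite L" "L \<subseteq> V"
    "\<And>\<xi> \<eta>. \<xi> \<in> cs V ==> \<eta> \<in> cs V ==> (\<And>i. i \<in> L ==> \<xi> i = \<eta> i) ==> \<bar>f \<xi> - f \<eta>\<bar> \<le> \<epsilon>"
    by metis
  let ?r = "\<lambda>\<xi>. \<lambda>i\<in>V. if i \<in> L then \<xi> i else 0"
  have r: "?r \<in> measurable (cspace V) (cspace V)"
  proof (rule measurable_cspaceI)
    fix i assume "i \<in> V"
    then show "(\<lambda>x. ?r x i) \<in> measurable (cspace V) (restrict_space borel circle)"
      by (cases "i \<in> L") (auto intro!: measurable_restrict_space2)
  qed auto
  show ?thesis
  proof (intro exI[of _ L] exI[of _ "\<lambda>\<xi>. f (?r \<xi>)"] conjI ballI allI impI L(1,2))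
    show "bm (cspace V) (\<lambda>\<xi>. f (?r \<xi>))" by (rule bm_compose[OF f(1) r])
    fix \<xi> assume h: "\<xi> \<in> cs V"
    show "\<bar>f \<xi> - f (?r \<xi>)\<bar> \<le> \<epsilon>"
      using L(2) by (intro L(3) h measurable_space[OF r h]) auto
  next
    fix \<xi> \<eta> :: "'d site => real" assume "\<forall>i\<in>L. \<xi> i = \<eta> i"
    then have "?r \<xi> = ?r \<eta>" by (auto simp: restrict_def)
    then show "f (?r \<xi>) = f (?r \<eta>)" by (rule arg_cong)
  qed
qed

text \<open>A local approximation is flattened, and averages do not increase uniform distances:
  three errors of \<open>\<epsilon> / 3\<close>.\<close>

lemma dobrushin_ql:
  assumes f: "bm (cspace V) f" "ql V f" and "\<epsilon> > 0"
  shows "\<exists>is. set is \<subseteq> V \<and> (\<forall>\<xi>\<in>cs V. \<forall>\<eta>\<in>cs V. same V \<xi> \<eta> \<longrightarrow>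
    \<bar>Ks V C1 is f \<xi> - Ks V C1 is f \<eta>\<bar> \<le> \<epsilon>)"
proof -
  have "\<epsilon> / 3 > 0" using assms by simp
  from local_approx[OF f this] obtain L g where L: "finite L" "L \<subseteq> V" and g: "bm (cspace V) g"
    "\<And>\<xi>. \<xi> \<in> cs V ==> \<bar>f \<xi> - g \<xi>\<bar> \<le> \<epsilon> / 3" "\<And>\<xi> \<eta>. (\<forall>i\<in>L. \<xi> i = \<eta> i) ==> g \<xi> = g \<eta>"
    by metis
  obtain b where b: "b > 0" "\<And>x. x \<in> cs V ==> \<bar>g x\<bar> \<le> b" using bm_bounded[OF g(1)] by blast
  from dobrushin_local[OF L, of b "\<epsilon> / 3"] obtain "is" where is': "set is \<subseteq> V"
    "\<And>\<xi> \<eta>. \<xi> \<in> cs V ==> \<eta> \<in> cs V ==> same V \<xi> \<eta> ==> \<bar>Ks V C1 is g \<xi> - Ks V C1 is g \<eta>\<bar> \<le> \<epsilon> / 3"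
    using g b \<open>\<epsilon> / 3 > 0\<close> by (metis less_imp_le)
  show ?thesis
  proof (intro exI[of _ "is"] conjI ballI impI is'(1))
    fix \<xi> \<eta> assume h: "\<xi> \<in> cs V" "\<eta> \<in> cs V" "same V \<xi> \<eta>"
    show "\<bar>Ks V C1 is f \<xi> - Ks V C1 is f \<eta>\<bar> \<le> \<epsilon>"
      using is'(2)[OF h] Ks_close[OF is'(1) f(1) g(1,2) h(1)] Ks_close[OF is'(1) f(1) g(1,2) h(2)] by linarith
  qed
qed

end

section \<open>Setwise limits of probability measures\<close>

text \<open>The Cauchy condition is uniform over events, so the limit set function is a uniform
  limit of measures, and countable additivity survives directly.\<close>

lemma setwise_limit_prob:
  fixes M :: "nat => 'a measure"
  assumes M: "\<And>n. prob_space (M n)" "\<And>n. sets (M n) = sets N"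
    and C: "\<And>e. 0 < e ==> \<exists>k. \<forall>n\<ge>k. \<forall>m\<ge>k. \<forall>B\<in>sets N. \<bar>measure (M n) B - measure (M m) B\<bar> \<le> e"
  shows "\<exists>P. prob_space P \<and> sets P = sets N \<and> (\<forall>B\<in>sets N. (\<lambda>n. measure (M n) B) \<longlonglongrightarrow> measure P B)"
proof -
  have sp: "space (M n) = space N" for n using M(2) by (rule sets_eq_imp_space_eq)
  define l where "l B = lim (\<lambda>n. measure (M n) B)" for B
  have l: "(\<lambda>n. measure (M n) B) \<longlonglongrightarrow> l B" if "B \<in> sets N" for B
  proof -
    have "Cauchy (\<lambda>n. measure (M n) B)"
    proof (rule metric_CauchyI)
      fix e :: real assume "0 < e"
      then obtain k where "\<forall>n\<ge>k. \<forall>m\<ge>k. \<forall>B\<in>sets N. \<bar>measure (M n) B - measure (M m) B\<bar> \<le> e / 2" using C[of "e / 2"] by auto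
      then show "\<exists>k. \<forall>m\<ge>k. \<forall>n\<ge>k. dist (measure (M m) B) (measure (M n) B) < e"
        using that \<open>0 < e\<close> by (intro exI[of _ k]) (force simp: dist_real_def)
    qed
    then show ?thesis unfolding l_def by (simp add: Cauchy_convergent_iff convergent_LIMSEQ_iff)
  qed
  have unif: "\<exists>k. \<forall>B\<in>sets N. \<bar>l B - measure (M k) B\<bar> \<le> e" if e: "0 < e" for e
  proof -
    obtain k where k: "\<forall>n\<ge>k. \<forall>m\<ge>k. \<forall>B\<in>sets N. \<bar>measure (M n) B - measure (M m) B\<bar> \<le> e" using C[OF e] by auto
    have "\<bar>l B - measure (M k) B\<bar> \<le> e" if "B \<in> sets N" for B
    proof (rule LIMSEQ_le_const2)
      show "(\<lambda>n. \<bar>measure (M n) B - measure (M k) B\<bar>) \<longlonglongrightarrow> \<bar>l B - measure (M k) B\<bar>" by (intro tendsto_intros l that)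
      show "\<exists>j. \<forall>n\<ge>j. \<bar>measure (M n) B - measure (M k) B\<bar> \<le> e" using k that by blast
    qed
    then show ?thesis by blast
  qed
  have l0: "0 \<le> l B" if "B \<in> sets N" for B by (rule LIMSEQ_le_const[OF l[OF that]]) auto
  have ladd: "l (A \<union> B) = l A + l B" if "A \<in> sets N" "B \<in> sets N" "A \<inter> B = {}" for A B
  proof (rule LIMSEQ_unique[OF l])
    have "measure (M n) (A \<union> B) = measure (M n) A + measure (M n) B" for n
      using that M by (intro finite_measure.finite_measure_Union prob_space.finite_measure) auto
    then show "(\<lambda>n. measure (M n) (A \<union> B)) \<longlonglongrightarrow> l A + l B" using tendsto_add[OF l[OF that(1)] l[OF that(2)]] by simp
  qed (use that in auto)
  have le: "l {} = 0" by (rule LIMSEQ_unique[OF l]) auto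
  have lsum: "(\<Sum>i<k. l (A i)) = l (\<Union>i<k. A i)" if "range A \<subseteq> sets N" "disjoint_family A" for A :: "nat => _" and k
  proof (induction k)
    case (Suc k)
    have "(\<Union>i<k. A i) \<inter> A k = {}"     proof -
      have "A i \<inter> A k = {}" if "i < k" for i
        using disjoint_family_onD[OF \<open>disjoint_family A\<close>, of i k] that by simp
      then show ?thesis by blast
    qed
    then have "l ((\<Union>i<k. A i) \<union> A k) = l (\<Union>i<k. A i) + l (A k)" using that(1) by (intro ladd) auto
    moreover have "(\<Union>i<Suc k. A i) = (\<Union>i<k. A i) \<union> A k" by (auto simp: lessThan_Suc)
    ultimately show ?case using Suc by simp
  qed (simp add: le)
  have sums: "(\<lambda>i. l (A i)) sums l (\<Union>i. A i)" if A: "range A \<subseteq> sets N" "disjoint_family A" for A :: "nat => _"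
    unfolding sums_def LIMSEQ_iff
  proof (intro allI impI)
    fix e :: real assume e: "0 < e"
    obtain n where n: "\<And>B. B \<in> sets N ==> \<bar>l B - measure (M n) B\<bar> \<le> e / 4" using unif[of "e / 4"] e by auto
    have "(\<lambda>i. measure (M n) (A i)) sums measure (M n) (\<Union>i. A i)"
      using A M by (intro finite_measure.finite_measure_UNION prob_space.finite_measure) auto
    then obtain k where k: "\<And>j. j \<ge> k ==> \<bar>(\<Sum>i<j. measure (M n) (A i)) - measure (M n) (\<Union>i. A i)\<bar> < e / 4"
      unfolding sums_def LIMSEQ_iff using e by (metis real_norm_def zero_less_divide_iff zero_less_numeral)
    have "norm ((\<Sum>i<j. l (A i)) - l (\<Union>i. A i)) < e" if "j \<ge> k" for j
    proof -
      have "(\<Sum>i<j. measure (M n) (A i)) = measure (M n) (\<Union>i<j. A i)"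
        using A M by (intro finite_measure.finite_measure_finite_Union[symmetric] prob_space.finite_measure)
          (auto simp: disjoint_family_on_def)
      moreover have "\<bar>l (\<Union>i<j. A i) - measure (M n) (\<Union>i<j. A i)\<bar> \<le> e / 4" using A by (intro n) auto
      moreover have "\<bar>l (\<Union>i. A i) - measure (M n) (\<Union>i. A i)\<bar> \<le> e / 4" using A by (intro n) auto
      ultimately show ?thesis using k[OF that] e unfolding lsum[OF A] real_norm_def by linarith
    qed
    then show "\<exists>no. \<forall>j\<ge>no. norm ((\<Sum>i<j. l (A i)) - l (\<Union>i. A i)) < e" by blast
  qed
  define P where "P = measure_of (space N) (sets N) (\<lambda>B. ennreal (l B))"
  have eP: "emeasure P B = ennreal (l B)" if "B \<in> sets N" for B
    unfolding P_def
  proof (rule emeasure_measure_of_sigma[OF sets.sigma_algebra_axioms _ _ that])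
    show "positive (sets N) (\<lambda>B. ennreal (l B))" by (simp add: positive_def le)
    show "countably_additive (sets N) (\<lambda>B. ennreal (l B))"
      unfolding countably_additive_def
    proof (intro allI impI)
      fix A :: "nat => _" assume A: "range A \<subseteq> sets N" "disjoint_family A"
      show "(\<Sum>i. ennreal (l (A i))) = ennreal (l (\<Union>i. A i))"
        using sums[OF A] l0 A by (subst suminf_ennreal2) (auto simp: sums_iff)
    qed
  qed
  have sP: "sets P = sets N" unfolding P_def by simp
  have "measure P B = l B" if "B \<in> sets N" for B using eP[OF that] l0[OF that] by (simp add: measure_def)
  moreover have "prob_space P"
  proof (rule prob_spaceI)
    have "l (space N) = 1"
      by (rule LIMSEQ_unique[OF l]) (use prob_space.prob_space[OF M(1)] sp in auto)
    then show "emeasure P (space P) = 1" using eP[of "space N"] sets_eq_imp_space_eq[OF sP] by simp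
  qed
  ultimately show ?thesis using sP l by auto
qed

text \<open>\<open>f\<close> is replaced by a function with finitely many values, whose integral is
  a finite combination of measures of level sets.\<close>

lemma setwise_integral:
  assumes M: "\<And>n. prob_space (M n)" "\<And>n. sets (M n) = sets N" and P: "prob_space P" "sets P = sets N"
    and l: "\<And>B. B \<in> sets N ==> (\<lambda>n. measure (M n) B) \<longlonglongrightarrow> measure P B" and f: "bm N f"
  shows "(\<lambda>n. LINT x|M n. f x) \<longlonglongrightarrow> (LINT x|P. f x)"
proof (rule LIMSEQ_I)
  fix e :: real assume e: "0 < e"
  obtain b where b: "b > 0" "\<And>x. x \<in> space N ==> \<bar>f x\<bar> \<le> b" using bm_bounded[OF f] by blast
  \<comment> \<open>Mesh \<open>1 / k = e / 4\<close>: rounding \<open>k * f\<close> down moves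
    \<open>f\<close> by at most a quarter of the tolerance.\<close>
  define k where "k = 4 / e"
  have k: "k > 0" "1 / k = e / 4" using e by (auto simp: k_def)
  define g where "g x = \<lfloor>k * f x\<rfloor>" for x
  define m where "m = \<lceil>k * b\<rceil> + 1"
  have fm [measurable]: "f \<in> borel_measurable N" using f by (rule bm_measurable)
  have gm [measurable]: "g \<in> measurable N (count_space UNIV)" unfolding g_def[abs_def] by measurable
  have gB: "g x \<in> {-m..m}" if "x \<in> space N" for x
  proof -
    have "\<bar>k * f x\<bar> \<le> k * b" using b(2)[OF that] k by (simp add: abs_mult)
    then show ?thesis unfolding g_def m_def by (simp add: abs_le_iff) linarith
  qed
  have close: "\<bar>f x - real_of_int (g x) / k\<bar> \<le> e / 4" for x
  proof -
    have "\<bar>k * f x - real_of_int (g x)\<bar> \<le> 1" unfolding g_def by linarith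
    moreover have "k * f x - real_of_int (g x) = k * (f x - real_of_int (g x) / k)" using k by (simp add: right_diff_distrib)
    ultimately have "k * \<bar>f x - real_of_int (g x) / k\<bar> \<le> 1" using k(1) by (simp add: abs_mult)
    then have "\<bar>f x - real_of_int (g x) / k\<bar> \<le> 1 / k" using k(1) by (simp add: pos_le_divide_eq mult.commute)
    then show ?thesis using k by simp
  qed
  have set_g: "{x \<in> space N. g x = v} \<in> sets N" for v by measurable
  have gi: "(LINT x|Q. real_of_int (g x) / k) = (\<Sum>v\<in>{-m..m}. real_of_int v / k * measure Q {x \<in> space N. g x = v})"
    if Q: "prob_space Q" "sets Q = sets N" for Q
  proof -
    have sQ: "space Q = space N" using Q(2) by (rule sets_eq_imp_space_eq)
    have bi: "bm Q (indicator {x \<in> space N. g x = v})" for v using set_g Q(2) by (intro bm_indicator) auto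
    have "(LINT x|Q. real_of_int (g x) / k) = (LINT x|Q. (\<Sum>v\<in>{-m..m}. real_of_int v / k * indicator {x \<in> space N. g x = v} x))"
    proof (rule icong[OF refl])
      fix x assume "x \<in> space Q"
      then have x: "x \<in> space N" using sQ by simp
      have "(\<Sum>v\<in>{-m..m}. real_of_int v / k * indicator {x \<in> space N. g x = v} x) = (\<Sum>v\<in>{-m..m}. if v = g x then real_of_int v / k else 0)"
        using x by (intro sum.cong) auto
      then show "real_of_int (g x) / k = (\<Sum>v\<in>{-m..m}. real_of_int v / k * indicator {x \<in> space N. g x = v} x)" using gB[OF x] by simp
    qed
    also have "\<dots> = (\<Sum>v\<in>{-m..m}. LINT x|Q. real_of_int v / k * indicator {x \<in> space N. g x = v} x)"
      by (intro Bochner_Integration.integral_sum prob_integrable[OF Q(1)] bm_mult bm_const bi)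
    also have "\<dots> = (\<Sum>v\<in>{-m..m}. real_of_int v / k * measure Q {x \<in> space N. g x = v})"
      using set_g Q(2) sQ by (intro sum.cong refl) (auto simp: Int_absorb2 Collect_restrict)
    finally show ?thesis .
  qed
  have bg: "bm N (\<lambda>x. real_of_int (g x) / k)"
  proof (rule bmI)
    fix x assume "x \<in> space N"
    from b(2)[OF this] close[of x] show "\<bar>real_of_int (g x) / k\<bar> \<le> b + e / 4" by linarith
  qed measurable
  have cl: "\<bar>(LINT x|Q. f x) - (LINT x|Q. real_of_int (g x) / k)\<bar> \<le> e / 4" if Q: "prob_space Q" "sets Q = sets N" for Q
  proof -
    have "(LINT x|Q. f x) - (LINT x|Q. real_of_int (g x) / k) = (LINT x|Q. f x - real_of_int (g x) / k)"
      using f bg bm_sets_cong[OF Q(2)] by (intro Bochner_Integration.integral_diff[symmetric] prob_integrable[OF Q(1)]) auto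
    also have "\<bar>\<dots>\<bar> \<le> e / 4"
      using bm_diff[OF f bg] close bm_sets_cong[OF Q(2)] by (intro prob_abs_integral_le[OF Q(1)]) auto
    finally show ?thesis .
  qed
  have "(\<lambda>n. LINT x|M n. real_of_int (g x) / k) \<longlonglongrightarrow> (LINT x|P. real_of_int (g x) / k)"
    unfolding gi[OF M] gi[OF P] by (intro tendsto_sum tendsto_mult tendsto_const l set_g)
  then obtain n0 where n0: "\<And>n. n \<ge> n0 ==> \<bar>(LINT x|M n. real_of_int (g x) / k) - (LINT x|P. real_of_int (g x) / k)\<bar> < e / 4"
    unfolding LIMSEQ_iff using e by (metis real_norm_def zero_less_divide_iff zero_less_numeral)
  have "norm ((LINT x|M n. f x) - (LINT x|P. f x)) < e" if "n \<ge> n0" for n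
    using n0[OF that] cl[OF M, of n] cl[OF P] e unfolding real_norm_def by linarith
  then show "\<exists>no. \<forall>n\<ge>no. norm ((LINT x|M n. f x) - (LINT x|P. f x)) < e" by blast
qed

text \<open>Window marginals converge setwise, their limits inherit consistency, and Kolmogorov's
  extension theorem assembles them. The factors are the whole real line because the extension works
  with Polish spaces and their Borel sets; the return to the circle happens afterwards.\<close>

lemma kolmogorov_limit:
  fixes M :: "nat => ('i => real) measure"
  assumes M: "\<And>n. prob_space (M n)" "\<And>n. sets (M n) = sets (PiM V (\<lambda>_. borel))"
    and C: "\<And>L e. finite L ==> L \<subseteq> V ==> 0 < e ==> \<exists>k. \<forall>n\<ge>k. \<forall>m\<ge>k. \<forall>B\<in>sets (PiM L (\<lambda>_. borel)).
      \<bar>(LINT x|M n. indicator B (restrict x L)) - (LINT x|M m. indicator B (restrict x L))\<bar> \<le> (e :: real)"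
  shows "\<exists>\<mu>. prob_space \<mu> \<and> sets \<mu> = sets (PiM V (\<lambda>_. borel)) \<and>
    (\<forall>L g. finite L \<longrightarrow> L \<subseteq> V \<longrightarrow> bm (PiM L (\<lambda>_. borel)) g \<longrightarrow>
      (\<lambda>n. LINT x|M n. g (restrict x L)) \<longlonglongrightarrow> (LINT x|\<mu>. g (restrict x L)))"
proof -
  let ?B = "\<lambda>L. PiM L (\<lambda>_::'i. borel :: real measure)"
  define R where "R L n = distr (M n) (?B L) (\<lambda>x. restrict x L)" for L n
  have r: "(\<lambda>x. restrict x L) \<in> measurable (?B H) (?B L)" if "L \<subseteq> H" for L H
    using that by (rule measurable_restrict_subset)
  have r': "(\<lambda>x. restrict x L) \<in> measurable (M n) (?B L)" if "L \<subseteq> V" for L n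
    using r[OF that] by (simp add: measurable_cong_sets[OF M(2) refl])
  have RP: "prob_space (R L n)" "sets (R L n) = sets (?B L)" if "L \<subseteq> V" for L n
    unfolding R_def using prob_space.prob_space_distr[OF M(1) r'[OF that]] by auto
  have Ri: "(LINT x|R L n. g x) = (LINT x|M n. g (restrict x L))" if "g \<in> borel_measurable (?B L)" "L \<subseteq> V" for L n and g :: "_ => real"
    unfolding R_def using integral_distr[OF r'[OF that(2)] that(1)] .
  have Rm: "measure (R L n) B = (LINT x|M n. indicator B (restrict x L))" if "B \<in> sets (?B L)" "L \<subseteq> V" for L n B
  proof -
    have "measure (R L n) B = (LINT x|R L n. indicator B x)" using that RP(2)[OF that(2)] by (simp add: Int_absorb2 sets.sets_into_space)
    then show ?thesis using Ri[OF _ that(2), of "indicator B"] that(1) by simp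
  qed
  have "\<exists>P. prob_space P \<and> sets P = sets (?B L) \<and> (\<forall>B\<in>sets (?B L). (\<lambda>n. measure (R L n) B) \<longlonglongrightarrow> measure P B)"
    if "finite L" "L \<subseteq> V" for L
    by (rule setwise_limit_prob[OF RP[OF that(2)]]) (use C[OF that] Rm[OF _ that(2)] in auto)
  then obtain P where P: "\<And>L. finite L ==> L \<subseteq> V ==> prob_space (P L)" "\<And>L. finite L ==> L \<subseteq> V ==> sets (P L) = sets (?B L)"
    "\<And>L B. finite L ==> L \<subseteq> V ==> B \<in> sets (?B L) ==> (\<lambda>n. measure (R L n) B) \<longlonglongrightarrow> measure (P L) B"
    by metis
  interpret p: polish_projective V P
  proof (rule polish_projective.intro, rule projective_family.intro)
    fix L H assume h: "L \<subseteq> H" "finite H" "H \<subseteq> V"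
    then have L: "finite L" "L \<subseteq> V" by (auto intro: finite_subset)
    interpret pl: prob_space "P L" by (rule P(1)[OF L])
    interpret ph: prob_space "P H" by (rule P(1)[OF h(2,3)])
    have rH: "(\<lambda>f. restrict f L) \<in> measurable (P H) (?B L)"
      using r[OF h(1)] by (simp add: measurable_cong_sets[OF P(2)[OF h(2,3)] refl])
    interpret pd: prob_space "distr (P H) (?B L) (\<lambda>f. restrict f L)" by (rule ph.prob_space_distr[OF rH])
    show "P L = distr (P H) (?B L) (\<lambda>f. restrict f L)"
    proof (rule measure_eqI)
      fix B assume "B \<in> sets (P L)"
      then have B: "B \<in> sets (?B L)" using P(2)[OF L] by simp
      let ?A = "(\<lambda>f. restrict f L) -` B \<inter> space (?B H)"
      have A: "?A \<in> sets (?B H)" by (rule measurable_sets[OF r[OF h(1)] B])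
      have "measure (R H n) ?A = measure (R L n) B" for n
      proof -
        have "space (M n) = space (?B V)" using M(2) by (rule sets_eq_imp_space_eq)
        then have "indicator ?A (restrict x H) = (indicator B (restrict x L) :: real)" if "x \<in> space (M n)" for x
          using that h by (auto simp: indicator_def space_PiM Int_absorb1 Int_absorb2 restrict_restrict)
        then show ?thesis unfolding Rm[OF A h(3)] Rm[OF B L(2)] by (intro icong) auto
      qed
      then have "measure (P H) ?A = measure (P L) B"
        using P(3)[OF h(2,3) A] P(3)[OF L B] LIMSEQ_unique by simp
      then show "emeasure (P L) B = emeasure (distr (P H) (?B L) (\<lambda>f. restrict f L)) B"
        using B rH sets_eq_imp_space_eq[OF P(2)[OF h(2,3)]]
        by (simp add: pl.emeasure_eq_measure pd.emeasure_eq_measure measure_distr)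
    qed (use P(2)[OF L] in simp)
  next
    fix L assume "finite L" "L \<subseteq> V"
    then show "prob_space (P L)" by (rule P(1))
  qed
  show ?thesis
  proof (intro exI[of _ p.lim] conjI allI impI)
    show "prob_space p.lim" by (rule p.P.prob_space_axioms)
    show sl: "sets p.lim = sets (?B V)" by simp
    fix L g assume L: "finite L" "L \<subseteq> V" and g: "bm (?B L) g"
    have gm: "g \<in> borel_measurable (?B L)" using g by (rule bm_measurable)
    have rl: "(\<lambda>x. restrict x L) \<in> measurable p.lim (?B L)" using r[OF L(2)] by (simp add: measurable_cong_sets[OF sl refl])
    have "P L = distr p.lim (?B L) (\<lambda>x. restrict x L)"
    proof (rule measure_eqI)
      fix B assume "B \<in> sets (P L)"
      then have B: "B \<in> sets (?B L)" using P(2)[OF L] by simp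
      have "(\<lambda>x. restrict x L) -` B \<inter> space p.lim = prod_emb V (\<lambda>_. borel) L B"
        by (simp add: prod_emb_def space_PiM)
      then show "emeasure (P L) B = emeasure (distr p.lim (?B L) (\<lambda>x. restrict x L)) B"
        using p.emeasure_lim_emb[OF L(2,1) B] emeasure_distr[OF rl B] by simp
    qed (use P(2)[OF L] in simp)
    then have "(LINT x|P L. g x) = (LINT x|p.lim. g (restrict x L))" using integral_distr[OF rl gm] by simp
    moreover have "(\<lambda>n. LINT x|R L n. g x) \<longlonglongrightarrow> (LINT x|P L. g x)"
      by (rule setwise_integral[OF RP[OF L(2)] P(1)[OF L] P(2)[OF L] P(3)[OF L] g])
    ultimately show "(\<lambda>n. LINT x|M n. g (restrict x L)) \<longlonglongrightarrow> (LINT x|p.lim. g (restrict x L))" using Ri[OF gm L(2)] by simp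
  qed
qed

text \<open>Indicators of finite-dimensional cylinders are quasilocal, and they determine a
  probability measure.\<close>

lemma cspace_eqI:
  assumes P: "prob_space P" "sets P = sets (cspace V)" and Q: "prob_space Q" "sets Q = sets (cspace V)"
    and eq: "\<And>f. bm (cspace V) f ==> ql V f ==> (LINT x|P. f x) = (LINT x|Q. f x)"
  shows "P = Q"
proof (rule measure_eqI_PiM_infinite)
  let ?M = "\<lambda>_. restrict_space borel circle :: real measure"
  show "sets P = PiM V ?M" "sets Q = PiM V ?M" using P Q by (simp_all add: conf_space_def)
  show "finite_measure P" using P(1) by (rule prob_space.finite_measure)
  interpret p: prob_space P by fact
  interpret q: prob_space Q by fact
  fix A and L assume L: "finite L" "L \<subseteq> V" and A: "\<And>i. i \<in> L ==> A i \<in> sets (restrict_space borel circle)"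
  let ?B = "prod_emb V ?M L (Pi\<^sub>E L A)"
  have B: "?B \<in> sets (cspace V)" unfolding conf_space_def using L A by (intro sets_PiM_I) auto
  have "ql V (indicator ?B)"
  proof (rule ql_local[OF L])
    fix \<xi> \<eta> assume h: "\<xi> \<in> cs V" "\<eta> \<in> cs V" "\<And>i. i \<in> L ==> \<xi> i = \<eta> i"
    have "restrict \<xi> L = restrict \<eta> L" using h(3) by auto
    then show "indicator ?B \<xi> = (indicator ?B \<eta> :: real)"
      using h(1,2) by (auto simp: indicator_def prod_emb_def space_conf_space space_restrict_space)
  qed
  from eq[OF bm_indicator[OF B] this] show "emeasure P ?B = emeasure Q ?B"
    using B P(2) Q(2) sets.sets_into_space[OF B] sets_eq_imp_space_eq[OF P(2)] sets_eq_imp_space_eq[OF Q(2)]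
    by (simp add: p.emeasure_eq_measure q.emeasure_eq_measure Int_absorb2)
qed

section \<open>Resampling kernels\<close>

context pot_resample begin

definition kern :: "('d, real) conf => ('d, real) conf measure" where
  "kern \<eta> = distr (density (lebc Y) (\<lambda>\<sigma>. ennreal (comp_ind E Y \<eta> \<sigma> * wt V Y (override_on \<eta> \<sigma> Y) / num V E Y (\<lambda>_. 1) \<eta>)))
     (cspace V) (\<lambda>\<sigma>. override_on \<eta> \<sigma> Y)"

lemma kern:
  assumes "\<eta> \<in> X"
  shows "sets (kern \<eta>) = sets (cspace V)" "prob_space (kern \<eta>)"
    "\<And>f. bm (cspace V) f ==> (LINT x|kern \<eta>. f x) = K V E Y f \<eta>"
proof -
  let ?p = "\<lambda>\<sigma>. comp_ind E Y \<eta> \<sigma> * wt V Y (override_on \<eta> \<sigma> Y) / num V E Y (\<lambda>_. 1) \<eta>"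
  have bp: "bm (lebc Y) ?p"
    using num_one_pos[OF assms] by (intro bm_divide[OF bm_integrand2[OF bm_wt[OF fin] assms] bm_const]) auto
  have p0: "0 \<le> ?p \<sigma>" for \<sigma> by (intro divide_nonneg_pos mult_nonneg_nonneg comp_ind_bounds less_imp_le[OF wt_pos] num_one_pos[OF assms])
  note ov = override_measurable2[OF sub assms]
  show "sets (kern \<eta>) = sets (cspace V)" by (simp add: kern_def)
  show int: "(LINT x|kern \<eta>. f x) = K V E Y f \<eta>" if f: "bm (cspace V) f" for f
  proof -
    have "(LINT x|kern \<eta>. f x) = (LINT \<sigma>|lebc Y. ?p \<sigma> * f (override_on \<eta> \<sigma> Y))"
      unfolding kern_def using bp p0 bm_measurable[OF f] ov
      by (subst integral_distr) (auto simp: bm_measurable integral_density[where f = "\<lambda>\<sigma>. f (override_on \<eta> \<sigma> Y)"])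
    also have "\<dots> = (LINT \<sigma>|lebc Y. comp_ind E Y \<eta> \<sigma> * (wt V Y (override_on \<eta> \<sigma> Y) * f (override_on \<eta> \<sigma> Y)) / num V E Y (\<lambda>_. 1) \<eta>)"
      by (simp add: mult.assoc)
    finally show ?thesis by (simp add: K_def num_def J_def)
  qed
  show "prob_space (kern \<eta>)"
  proof (rule prob_spaceI)
    have "emeasure (kern \<eta>) (space (kern \<eta>)) = (\<integral>\<^sup>+\<sigma>. ennreal (?p \<sigma>) \<partial>lebc Y)"
      unfolding kern_def using ov bp by (subst emeasure_distr) (auto simp: emeasure_density bm_measurable Int_absorb1 measurable_space[OF ov] intro!: nn_integral_cong)
    also have "\<dots> = ennreal (LINT \<sigma>|lebc Y. ?p \<sigma>)"
      using bm_integrable[OF finite_measure_lebc[OF fin] bp] p0 by (intro nn_integral_eq_integral) auto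
    also have "(LINT \<sigma>|lebc Y. ?p \<sigma>) = 1"
      using num_one_pos[OF assms] by (simp add: num_def J_def)
    finally show "emeasure (kern \<eta>) (space (kern \<eta>)) = 1" by simp
  qed
qed

lemma kern_emeasure: assumes "\<eta> \<in> X" "B \<in> sets (cspace V)" shows "emeasure (kern \<eta>) B = ennreal (K V E Y (indicator B) \<eta>)"
proof -
  interpret prob_space "kern \<eta>" by (rule kern(2)[OF assms(1)])
  have "K V E Y (indicator B) \<eta> = measure (kern \<eta>) B"
    using kern(3)[OF assms(1) bm_indicator[OF assms(2)]] assms kern(1)[OF assms(1)] sets_eq_imp_space_eq[OF kern(1)[OF assms(1)]]
      sets.sets_into_space[OF assms(2)] by (simp add: Int_absorb2)
  then show ?thesis by (simp add: emeasure_eq_measure)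
qed

lemma kern_measurable: "kern \<in> measurable (cspace V) (prob_algebra (cspace V))"
proof (intro measurable_prob_algebraI measurable_subprob_algebra)
  fix B assume B: "B \<in> sets (cspace V)"
  have "(\<lambda>\<eta>. ennreal (K V E Y (indicator B) \<eta>)) \<in> borel_measurable (cspace V)"
    using bm_measurable[OF bm_K[OF bm_indicator[OF B]]] by measurable
  then show "(\<lambda>\<eta>. emeasure (kern \<eta>) B) \<in> borel_measurable (cspace V)"
    by (subst measurable_cong[OF kern_emeasure[OF _ B]])
qed (auto simp: kern prob_space_imp_subprob_space)

lemma bind_kern:
  assumes \<mu>: "prob_space \<mu>" "sets \<mu> = sets (cspace V)"
  shows "prob_space (bind \<mu> kern)" "sets (bind \<mu> kern) = sets (cspace V)"
    "\<And>f. bm (cspace V) f ==> (LINT x|bind \<mu> kern. f x) = (LINT x|\<mu>. K V E Y f x)"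
    "\<And>B. B \<in> sets (cspace V) ==> emeasure (bind \<mu> kern) B = (\<integral>\<^sup>+x. ennreal (K V E Y (indicator B) x) \<partial>\<mu>)"
proof -
  have m: "\<mu> \<in> space (prob_algebra (cspace V))" using \<mu> by (simp add: space_prob_algebra)
  show "prob_space (bind \<mu> kern)" by (rule prob_space_bind'[OF m kern_measurable])
  show "sets (bind \<mu> kern) = sets (cspace V)" by (rule sets_bind'[OF m kern_measurable])
  have sp: "space \<mu> = X" using \<mu>(2) by (rule sets_eq_imp_space_eq)
  have k: "kern \<in> measurable \<mu> (subprob_algebra (cspace V))"
    using measurable_prob_algebraD[OF kern_measurable] by (simp add: measurable_cong_sets[OF \<mu>(2) refl])
  show "(LINT x|bind \<mu> kern. f x) = (LINT x|\<mu>. K V E Y f x)" if f: "bm (cspace V) f" for f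
  proof -
    obtain b where b: "\<And>x. x \<in> X ==> \<bar>f x\<bar> \<le> b" using bm_bounded[OF f] by blast
    have "(LINT x|bind \<mu> kern. f x) = (LINT x|\<mu>. LINT y|kern x. f y)"
    proof (rule integral_bind[where K = "cspace V" and B' = 1 and B = b])
      show "finite_measure \<mu>" using \<mu>(1) by (rule prob_space.finite_measure)
      show "f \<in> borel_measurable (cspace V)" using f by (rule bm_measurable)
      show "kern \<in> measurable \<mu> (subprob_algebra (cspace V))" by (rule k)
      show "AE x in \<mu>. emeasure (kern x) (space (kern x)) \<le> ennreal 1"
        using sp prob_space.emeasure_space_1[OF kern(2)] by (auto intro!: AE_I2)
    qed (rule b)
    also have "\<dots> = (LINT x|\<mu>. K V E Y f x)" using sp kern(3)[OF _ f] by (intro icong) auto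
    finally show ?thesis .
  qed
  show "emeasure (bind \<mu> kern) B = (\<integral>\<^sup>+x. ennreal (K V E Y (indicator B) x) \<partial>\<mu>)" if "B \<in> sets (cspace V)" for B
    using emeasure_bind[OF prob_space.not_empty[OF \<mu>(1)] k that] kern_emeasure[OF _ that] sp by (auto intro!: nn_integral_cong)
qed

text \<open>Only configurations in the classes enter, so \<open>f\<close> may be truncated to the
  band between \<open>a - e\<close> and \<open>a + e\<close> without changing the average; then the
  global bound applies.\<close>

lemma K_local_bound:
  assumes f: "bm (cspace V) f" and \<eta>: "\<eta> \<in> X"
    and b: "\<And>\<sigma>. \<sigma> \<in> space (lebc Y) ==> (\<And>i. i \<in> Y ==> E (\<eta> i) (\<sigma> i)) ==> \<bar>f (override_on \<eta> \<sigma> Y) - a\<bar> \<le> e" and e: "0 \<le> e"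
  shows "\<bar>K V E Y f \<eta> - a\<bar> \<le> e"
proof -
  let ?g = "\<lambda>x. max (a - e) (min (a + e) (f x))"
  have g: "bm (cspace V) ?g"
    using bm_measurable[OF f] e by (intro bmI[of _ _ "\<bar>a\<bar> + e"]) auto
  have eq: "K V E Y f \<eta> = K V E Y ?g \<eta>"
  proof -
    have "num V E Y f \<eta> = num V E Y ?g \<eta>" unfolding num_def
    proof (rule J_cong[OF \<eta>])
      fix \<sigma> assume "\<sigma> \<in> space (lebc Y)" "\<And>i. i \<in> Y ==> E (\<eta> i) (\<sigma> i)"
      from b[OF this] show "wt V Y (override_on \<eta> \<sigma> Y) * f (override_on \<eta> \<sigma> Y) = wt V Y (override_on \<eta> \<sigma> Y) * ?g (override_on \<eta> \<sigma> Y)"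
        by auto
    qed
    then show ?thesis by (simp add: K_def)
  qed
  have "\<bar>K V E Y (\<lambda>x. - a + 1 * ?g x) \<eta>\<bar> \<le> e"
    using e by (intro K_abs_le[OF bm_add[OF bm_const bm_mult[OF bm_const g]] \<eta>]) auto
  then show ?thesis unfolding eq K_shift[OF g \<eta>] by simp
qed

end

text \<open>Applying the kernel to \<open>\<mu>\<close> gives a probability measure that agrees with
  \<open>\<mu>\<close> on quasilocal functions and hence equals it; the equation then holds for all
  bounded functions.\<close>

lemma (in potential) invar_from_ql:
  assumes E: "fatrel E" and \<mu>: "prob_space \<mu>" "sets \<mu> = sets (cspace V)"
    and inv: "\<And>i f. i \<in> V ==> bm (cspace V) f ==> ql V f ==> (LINT x|\<mu>. K V E {i} f x) = (LINT x|\<mu>. f x)"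
  shows "invar V E \<mu>"
  unfolding invar_def
proof (intro conjI ballI allI impI \<mu>)
  fix i f assume i: "i \<in> V" and f: "bm (cspace V) f"
  interpret pot_resample \<Phi> E V "{i}" using E i by unfold_locales auto
  have "bind \<mu> kern = \<mu>"
    by (rule cspace_eqI[OF bind_kern(1,2)[OF \<mu>] \<mu>]) (simp add: bind_kern(3)[OF \<mu>] inv[OF i])
  then show "(LINT x|\<mu>. K V E {i} f x) = (LINT x|\<mu>. f x)" using bind_kern(3)[OF \<mu> f] by simp
qed

section \<open>Constrained Gibbs measures\<close>

lemma finite_hypercube: "finite (hypercube n :: ('d::finite) site set)"
proof -
  have "finite (vec_nth ` (hypercube n :: 'd site set))"
    by (rule finite_subset[of _ "PiE UNIV (\<lambda>_. {- int n .. int n})"])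
      (auto simp: hypercube_def abs_le_iff neg_le_iff_le minus_le_iff intro!: finite_PiE)
  then show ?thesis by (rule finite_imageD) (auto simp: inj_on_def vec_eq_iff)
qed

lemma hypercube_mono: "n \<le> m ==> hypercube n \<subseteq> hypercube m"
  unfolding hypercube_def using of_nat_mono[of n m, where 'a = int] by (auto intro: order_trans)

lemma hypercube_exhausts:
  fixes L :: "('d::finite) site set"
  assumes "finite L" shows "\<exists>n. L \<subseteq> hypercube n"
proof -
  define N where "N = Max (insert 0 ((\<lambda>(i, k). \<bar>i $ k\<bar>) ` (L \<times> UNIV)))"
  have fin: "finite (insert 0 ((\<lambda>(i, k). \<bar>i $ k\<bar>) ` (L \<times> (UNIV :: 'd set))))" using assms by auto
  have "\<bar>i $ k\<bar> \<le> N" if "i \<in> L" for i k unfolding N_def using that by (intro Max_ge[OF fin]) force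
  moreover have "0 \<le> N" unfolding N_def by (rule Max_ge[OF fin]) simp
  ultimately show ?thesis by (intro exI[of _ "nat N"]) (auto simp: hypercube_def)
qed

lemma hypercube_eventually:
  fixes L :: "('d::finite) site set"
  assumes "finite L" shows "\<exists>n. \<forall>m\<ge>n. L \<subseteq> hypercube m"
  using hypercube_exhausts[OF assms] hypercube_mono by blast

lemma prob_integral_one_AE:
  assumes "prob_space M" "bm M f" "\<And>x. x \<in> space M ==> f x \<le> 1" "(LINT x|M. f x) = (1::real)"
  shows "AE x in M. f x = 1"
proof -
  interpret prob_space M by fact
  have i: "integrable M f" using assms by (intro prob_integrable) auto
  have "(LINT x|M. 1 - f x) = 0" using i assms(4) by (simp add: prob_space)
  moreover have "integrable M (\<lambda>x. 1 - f x)" using i by auto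
  moreover have "AE x in M. 0 \<le> 1 - f x" using assms(3) by (auto intro!: AE_I2)
  ultimately have "AE x in M. 1 - f x = 0" using integral_nonneg_eq_0_iff_AE by blast
  then show ?thesis by auto
qed

context dobrushin_potential
begin

lemma bm_cell_indicator:
  assumes "i \<in> V" shows "bm (cspace V) (\<lambda>x. of_bool (coarse q (x i) = k))" "ql V (\<lambda>x. of_bool (coarse q (x i) = k))"
proof -
  have "(\<lambda>x. coarse q (x i)) \<in> measurable (cspace V) (count_space UNIV)"
    using measurable_compose[OF cspace_component[OF assms] measurable_restrict_space1[OF coarse_borel]] .
  then have "(\<lambda>x. of_bool (coarse q (x i) = k) :: real) \<in> borel_measurable (cspace V)" by measurable
  then show "bm (cspace V) (\<lambda>x. of_bool (coarse q (x i) = k))" by (rule bmI[of _ _ 1]) auto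
  show "ql V (\<lambda>x. of_bool (coarse q (x i) = k))" by (rule ql_local[of "{i}"]) (use assms in auto)
qed

text \<open>The constrained kernels on growing pieces of \<open>V\<close>, all started from
  \<open>\<eta>0\<close>, form a Cauchy sequence on every window, uniformly in events: a fixed sweep
  flattens the indicators and is absorbed by large blocks. Invariance and the cells of
  \<open>\<eta>0\<close> pass to the limit.\<close>

lemma invar_exists:
  assumes \<eta>0: "\<eta>0 \<in> cs V"
  shows "\<exists>\<mu>. invar V C1 \<mu> \<and> (AE x in \<mu>. same V \<eta>0 x)"
proof -
  define \<Delta> where "\<Delta> n = V \<inter> hypercube n" for n
  have \<Delta>: "finite (\<Delta> n)" "\<Delta> n \<subseteq> V" for n unfolding \<Delta>_def using finite_hypercube by auto
  have \<Delta>L: "\<exists>k. \<forall>n\<ge>k. L \<subseteq> \<Delta> n" if "finite L" "L \<subseteq> V" for L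
    using hypercube_eventually[OF that(1)] that(2) unfolding \<Delta>_def by blast
  have pr: "pot_resample \<Phi> C1 V (\<Delta> n)" for n using fat \<Delta> by unfold_locales auto
  let ?B = "PiM V (\<lambda>_. borel :: real measure)"
  have inc: "(\<lambda>x. x) \<in> measurable (cspace V) ?B"
  proof (rule measurable_PiM_single')
    fix i assume "i \<in> V"
    from cspace_component[OF this] show "(\<lambda>x. x i) \<in> borel_measurable (cspace V)"
      by (simp add: measurable_restrict_space2_iff)
  qed (auto simp: space_conf_space PiE_iff)
  define M where "M n = distr (pot_resample.kern \<Phi> C1 V (\<Delta> n) \<eta>0) ?B (\<lambda>x. x)" for n
  note kern = pot_resample.kern[OF pr \<eta>0]
  have incn: "(\<lambda>x. x) \<in> measurable (pot_resample.kern \<Phi> C1 V (\<Delta> n) \<eta>0) ?B" for n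
    using inc by (simp add: measurable_cong_sets[OF kern(1) refl])
  have M: "prob_space (M n)" "sets (M n) = sets ?B" for n
    unfolding M_def using prob_space.prob_space_distr[OF kern(2) incn] by auto
  have Mi: "(LINT x|M n. g x) = K V C1 (\<Delta> n) g \<eta>0" if "bm ?B g" for g n
  proof -
    have "(LINT x|M n. g x) = (LINT x|pot_resample.kern \<Phi> C1 V (\<Delta> n) \<eta>0. g x)"
      unfolding M_def using integral_distr[OF incn bm_measurable[OF that]] by simp
    also have "\<dots> = K V C1 (\<Delta> n) g \<eta>0" using bm_compose[OF that inc] by (rule kern(3))
    finally show ?thesis .
  qed
  have cauchy: "\<exists>k. \<forall>n\<ge>k. \<forall>m\<ge>k. \<forall>B\<in>sets (PiM L (\<lambda>_. borel)).
      \<bar>(LINT x|M n. indicator B (restrict x L)) - (LINT x|M m. indicator B (restrict x L))\<bar> \<le> e"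
    if L: "finite L" "L \<subseteq> V" and e: "0 < e" for L and e :: real
  proof -
    have "0 \<le> (1 :: real)" "0 < e / 2" using e by auto
    from dobrushin_local[OF L this] obtain "is" where is': "set is \<subseteq> V"
      and osc: "\<forall>f. bm (cspace V) f \<longrightarrow> (\<forall>\<xi>\<in>cs V. \<bar>f \<xi>\<bar> \<le> 1) \<longrightarrow>
    (\<forall>\<xi>\<in>cs V. \<forall>\<eta>\<in>cs V. (\<forall>i\<in>L. \<xi> i = \<eta> i) \<longrightarrow> f \<xi> = f \<eta>) \<longrightarrow>
    (\<forall>\<xi>\<in>cs V. \<forall>\<eta>\<in>cs V. same V \<xi> \<eta> \<longrightarrow> \<bar>Ks V C1 is f \<xi> - Ks V C1 is f \<eta>\<bar> \<le> e / 2)"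
      by (elim exE conjE) (rule that)
    obtain k where k: "\<And>n. n \<ge> k ==> set is \<subseteq> \<Delta> n" using \<Delta>L[of "set is"] is' by auto
    have "\<bar>(LINT x|M n. indicator B (restrict x L)) - (LINT x|M m. indicator B (restrict x L))\<bar> \<le> e"
      if n: "n \<ge> k" "m \<ge> k" and B: "B \<in> sets (PiM L (\<lambda>_. borel))" for n m B
    proof -
      let ?f = "\<lambda>x. indicator B (restrict x L) :: real"
      have f0: "bm ?B ?f" by (rule bm_compose[OF bm_indicator[OF B] measurable_restrict_subset[OF L(2)]])
      have f: "bm (cspace V) ?f" by (rule bm_compose[OF f0 inc])
      have loc: "\<forall>\<xi>\<in>cs V. \<forall>\<eta>\<in>cs V. (\<forall>i\<in>L. \<xi> i = \<eta> i) \<longrightarrow> ?f \<xi> = ?f \<eta>"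
      proof (intro ballI impI)
        fix \<xi> \<eta> :: "('d, real) conf" assume "\<forall>i\<in>L. \<xi> i = \<eta> i"
        then have "restrict \<xi> L = restrict \<eta> L" by (simp cong: restrict_cong)
        then show "?f \<xi> = ?f \<eta>" by (rule arg_cong)
      qed
      have close: "\<bar>(LINT x|M n. ?f x) - Ks V C1 is ?f \<eta>0\<bar> \<le> e / 2" if "n \<ge> k" for n
      proof -
        interpret pot_resample \<Phi> C1 V "\<Delta> n" by (rule pr)
        \<comment> \<open>Once the block contains the sites of the sweep, consistency lets the sweep
          be inserted without changing the value.\<close>
        have "(LINT x|M n. ?f x) = K V C1 (\<Delta> n) (Ks V C1 is ?f) \<eta>0"
          using Mi[OF f0] K_Ks[OF fat \<Delta>(2,1) f \<eta>0 k[OF that]] by simp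
        also have "\<bar>\<dots> - Ks V C1 is ?f \<eta>0\<bar> \<le> e / 2"
        proof (rule K_local_bound[OF bm_Ks[OF fat is' f] \<eta>0])
          fix \<sigma> assume s: "\<sigma> \<in> space (lebc (\<Delta> n))" "\<And>i. i \<in> \<Delta> n ==> C1 (\<eta>0 i) (\<sigma> i)"
          have "same V (override_on \<eta>0 \<sigma> (\<Delta> n)) \<eta>0" using s(2) by (auto simp: same_def override_on_def cellrel_def)
          then show "\<bar>Ks V C1 is ?f (override_on \<eta>0 \<sigma> (\<Delta> n)) - Ks V C1 is ?f \<eta>0\<bar> \<le> e / 2"
            using osc[THEN spec, THEN mp, OF f, THEN mp, THEN mp, OF _ loc] override_space[OF \<eta>0 s(1) \<Delta>(2)] \<eta>0
            by (simp add: indicator_def)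
        qed (use e in simp)
        finally show ?thesis .
      qed
      show ?thesis using close[OF n(1)] close[OF n(2)] by linarith
    qed
    then show ?thesis by blast
  qed
  obtain \<mu> where \<mu>: "prob_space \<mu>" "sets \<mu> = sets ?B"
    "\<And>L g. finite L ==> L \<subseteq> V ==> bm (PiM L (\<lambda>_. borel)) g ==>
      (\<lambda>n. LINT x|M n. g (restrict x L)) \<longlonglongrightarrow> (LINT x|\<mu>. g (restrict x L))"
    using kolmogorov_limit[OF M cauchy] by blast
  \<comment> \<open>The limit lives on real-valued configurations. Sending coordinates that are not
    angles to 0 is the identity on \<open>cs V\<close> and moves the measure back to the
    circle.\<close>
  define \<rho> :: "('d, real) conf => ('d, real) conf" where "\<rho> x = (\<lambda>i\<in>V. if x i \<in> circle then x i else 0)" for x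
  have clip: "(\<lambda>x. \<lambda>i\<in>V. if i \<in> L \<and> x i \<in> circle then x i else 0) \<in> measurable (PiM L (\<lambda>_. borel)) (cspace V)" for L
  proof (rule measurable_cspaceI)
    fix i assume "i \<in> V"
    show "(\<lambda>x. (\<lambda>i\<in>V. if i \<in> L \<and> x i \<in> circle then x i else 0) i) \<in> measurable (PiM L (\<lambda>_. borel)) (restrict_space borel circle)"
    proof (cases "i \<in> L")
      case True
      have "(\<lambda>x. x i) \<in> borel_measurable (PiM L (\<lambda>_. borel :: real measure))" using True by measurable
      then have "(\<lambda>x. if x i \<in> circle then x i else 0) \<in> borel_measurable (PiM L (\<lambda>_. borel :: real measure))"
        by measurable
      then show ?thesis using \<open>i \<in> V\<close> True by (auto intro!: measurable_restrict_space2)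
    qed (use \<open>i \<in> V\<close> in \<open>auto intro!: measurable_restrict_space2\<close>)
  qed auto
  have \<rho>: "\<rho> \<in> measurable ?B (cspace V)" using clip[of V] unfolding \<rho>_def[abs_def] by (simp cong: restrict_cong)
  have \<rho>id: "\<rho> x = x" if "x \<in> cs V" for x
    using that by (auto simp: \<rho>_def space_conf_space PiE_iff extensional_def fun_eq_iff)
  have \<rho>\<mu>: "\<rho> \<in> measurable \<mu> (cspace V)" using \<rho> by (simp add: measurable_cong_sets[OF \<mu>(2) refl])
  define \<mu>1 where "\<mu>1 = distr \<mu> (cspace V) \<rho>"
  have \<mu>1: "prob_space \<mu>1" "sets \<mu>1 = sets (cspace V)" unfolding \<mu>1_def using prob_space.prob_space_distr[OF \<mu>(1) \<rho>\<mu>] by auto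
  have bs: "bm \<mu>1 f = bm (cspace V) f" for f by (rule bm_sets_cong[OF \<mu>1(2)])
  have sp1: "space \<mu>1 = cs V" using \<mu>1(2) by (rule sets_eq_imp_space_eq)
  have lim_local: "(\<lambda>n. K V C1 (\<Delta> n) f \<eta>0) \<longlonglongrightarrow> (LINT x|\<mu>1. f x)"
    if f: "bm (cspace V) f" and L: "finite L" "L \<subseteq> V" and loc: "\<And>\<xi> \<eta>. (\<forall>i\<in>L. \<xi> i = \<eta> i) ==> f \<xi> = f \<eta>" for f L
  proof -
    define g where "g x = f (\<lambda>i\<in>V. if i \<in> L \<and> x i \<in> circle then x i else 0)" for x
    have g: "bm (PiM L (\<lambda>_. borel)) g" unfolding g_def[abs_def] by (rule bm_compose[OF f clip])
    have eq: "g (restrict x L) = f (\<rho> x)" for x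
      unfolding g_def \<rho>_def using L(2) by (intro loc) auto
    have 1: "(LINT x|\<mu>. g (restrict x L)) = (LINT x|\<mu>1. f x)"
      unfolding eq \<mu>1_def using integral_distr[OF \<rho>\<mu> bm_measurable[OF f]] by simp
    have "(LINT x|M n. g (restrict x L)) = K V C1 (\<Delta> n) f \<eta>0" for n
    proof -
      interpret pot_resample \<Phi> C1 V "\<Delta> n" by (rule pr)
      have "(LINT x|M n. g (restrict x L)) = K V C1 (\<Delta> n) (\<lambda>x. f (\<rho> x)) \<eta>0"
        unfolding eq by (rule Mi) (rule bm_compose[OF f \<rho>])
      also have "\<dots> = K V C1 (\<Delta> n) f \<eta>0" by (rule K_cong[OF \<eta>0]) (simp add: \<rho>id)
      finally show ?thesis .
    qed
    then show ?thesis using \<mu>(3)[OF L g] 1 by simp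
  qed
  have lim_ql: "(\<lambda>n. K V C1 (\<Delta> n) f \<eta>0) \<longlonglongrightarrow> (LINT x|\<mu>1. f x)" if f: "bm (cspace V) f" "ql V f" for f
  proof (rule LIMSEQ_I)
    fix e :: real assume e: "0 < e"
    from local_approx[OF f, of "e / 4"] e obtain L g where L: "finite L" "L \<subseteq> V" and g: "bm (cspace V) g"
      "\<And>\<xi>. \<xi> \<in> cs V ==> \<bar>f \<xi> - g \<xi>\<bar> \<le> e / 4" "\<And>\<xi> \<eta>. (\<forall>i\<in>L. \<xi> i = \<eta> i) ==> g \<xi> = g \<eta>"
      by (metis zero_less_divide_iff zero_less_numeral)
    obtain n0 where n0: "\<And>n. n \<ge> n0 ==> \<bar>K V C1 (\<Delta> n) g \<eta>0 - (LINT x|\<mu>1. g x)\<bar> < e / 4"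
      using LIMSEQ_D[OF lim_local[OF g(1) L g(3)], of "e / 4"] e by auto
    have 1: "\<bar>(LINT x|\<mu>1. f x) - (LINT x|\<mu>1. g x)\<bar> \<le> e / 4"
    proof -
      have "(LINT x|\<mu>1. f x) - (LINT x|\<mu>1. g x) = (LINT x|\<mu>1. f x - g x)"
        using f g by (intro Bochner_Integration.integral_diff[symmetric] prob_integrable[OF \<mu>1(1)]) (auto simp: bs)
      also have "\<bar>\<dots>\<bar> \<le> e / 4" using f g sp1 by (intro prob_abs_integral_le[OF \<mu>1(1)]) (auto simp: bs)
      finally show ?thesis .
    qed
    have "norm (K V C1 (\<Delta> n) f \<eta>0 - (LINT x|\<mu>1. f x)) < e" if "n \<ge> n0" for n
    proof -
      interpret pot_resample \<Phi> C1 V "\<Delta> n" by (rule pr)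
      have "\<bar>K V C1 (\<Delta> n) f \<eta>0 - K V C1 (\<Delta> n) g \<eta>0\<bar> \<le> e / 4"
        using K_abs_le[OF bm_diff[OF f(1) g(1)] \<eta>0 g(2)] K_diff[OF f(1) g(1) \<eta>0] by simp
      then show ?thesis using n0[OF that] 1 unfolding real_norm_def by linarith
    qed
    then show "\<exists>no. \<forall>n\<ge>no. norm (K V C1 (\<Delta> n) f \<eta>0 - (LINT x|\<mu>1. f x)) < e" by blast
  qed
  have "invar V C1 \<mu>1"
  proof (rule invar_from_ql[OF fat \<mu>1])
    fix i f assume i: "i \<in> V" and f: "bm (cspace V) f" "ql V f"
    interpret pot_resample \<Phi> C1 V "{i}" using i fat by unfold_locales auto
    obtain k where k: "\<And>n. n \<ge> k ==> {i} \<subseteq> \<Delta> n" using \<Delta>L[of "{i}"] i by auto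
    have "(\<lambda>n. K V C1 (\<Delta> n) (K V C1 {i} f) \<eta>0) \<longlonglongrightarrow> (LINT x|\<mu>1. f x)"
    proof (rule Lim_transform_eventually[OF lim_ql[OF f]])
      show "\<forall>\<^sub>F n in sequentially. K V C1 (\<Delta> n) f \<eta>0 = K V C1 (\<Delta> n) (K V C1 {i} f) \<eta>0"
        using k K_consistent[OF fat \<Delta>(2,1) _ f(1) \<eta>0] by (intro eventually_sequentiallyI[of k]) auto
    qed
    then show "(LINT x|\<mu>1. K V C1 {i} f x) = (LINT x|\<mu>1. f x)"
      using LIMSEQ_unique lim_ql[OF bm_K[OF f(1)] ql_K[OF f(2,1)]] by blast
  qed
  moreover have "AE x in \<mu>1. same V \<eta>0 x"
  proof -
    have "AE x in \<mu>1. i \<in> V \<longrightarrow> C1 (\<eta>0 i) (x i)" for i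
    proof (cases "i \<in> V")
      case True
      let ?f = "\<lambda>x. of_bool (coarse q (x i) = coarse q (\<eta>0 i)) :: real"
      note f = bm_cell_indicator[OF True, of "coarse q (\<eta>0 i)"]
      obtain k where k: "\<And>n. n \<ge> k ==> {i} \<subseteq> \<Delta> n" using \<Delta>L[of "{i}"] True by auto
      \<comment> \<open>The cell of a single site is a local event of probability 1 in every large
        block, so it keeps probability 1; countability of the lattice then treats all sites at
        once.\<close>
      have "(\<lambda>n. 1) \<longlonglongrightarrow> (LINT x|\<mu>1. ?f x)"
      proof (rule Lim_transform_eventually[OF lim_ql[OF f]], rule eventually_sequentiallyI[of k])
        fix n assume "n \<ge> k"
        then have i: "i \<in> \<Delta> n" using k by auto
        interpret pot_resample \<Phi> C1 V "\<Delta> n" by (rule pr)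
        have "\<bar>K V C1 (\<Delta> n) ?f \<eta>0 - 1\<bar> \<le> 0"
          by (rule K_local_bound[OF f(1) \<eta>0]) (use i in \<open>auto simp: override_on_def cellrel_def\<close>)
        then show "K V C1 (\<Delta> n) ?f \<eta>0 = 1" by simp
      qed
      then have "(LINT x|\<mu>1. ?f x) = 1" using LIMSEQ_unique tendsto_const by blast
      then have "AE x in \<mu>1. ?f x = 1" using f by (intro prob_integral_one_AE[OF \<mu>1(1)]) (auto simp: bs)
      then show ?thesis by (rule AE_mp) (auto intro!: AE_I2 simp: cellrel_def)
    qed auto
    then have "AE x in \<mu>1. \<forall>i. i \<in> V \<longrightarrow> C1 (\<eta>0 i) (x i)" by (simp add: AE_all_countable)
    then show ?thesis by (simp add: same_def Ball_def)
  qed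
  ultimately show ?thesis by blast
qed

lemma invarD: "invar V C1 \<mu> ==> prob_space \<mu>" "invar V C1 \<mu> ==> sets \<mu> = sets (cspace V)"
  "invar V C1 \<mu> ==> space \<mu> = cs V"
  by (auto simp: invar_def dest: sets_eq_imp_space_eq)

text \<open>Invariance replaces \<open>f\<close> by its sweep, which is nearly constant on the cells
  carrying \<open>\<mu>\<close>.\<close>

lemma invar_close:
  assumes inv: "invar V C1 \<mu>" and ae: "AE x in \<mu>. same V \<eta>0 x" and \<eta>0: "\<eta>0 \<in> cs V"
    and "set is \<subseteq> V" "bm (cspace V) f"
    and osc: "\<And>\<xi> \<eta>. \<xi> \<in> cs V ==> \<eta> \<in> cs V ==> same V \<xi> \<eta> ==> \<bar>Ks V C1 is f \<xi> - Ks V C1 is f \<eta>\<bar> \<le> e"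
  shows "\<bar>(LINT x|\<mu>. f x) - Ks V C1 is f \<eta>0\<bar> \<le> e"
proof -
  interpret prob_space \<mu> using inv by (rule invarD)
  have b: "bm \<mu> (Ks V C1 is f)" using bm_Ks[OF fat assms(4,5)] bm_sets_cong[OF invarD(2)[OF inv]] by simp
  have i: "integrable \<mu> (Ks V C1 is f)" by (rule prob_integrable[OF prob_space_axioms b])
  have eq: "(LINT x|\<mu>. f x) - Ks V C1 is f \<eta>0 = (LINT x|\<mu>. Ks V C1 is f x - Ks V C1 is f \<eta>0)"
    using invar_Ks[OF inv fat assms(4,5)] i by (simp add: prob_space)
  have "\<bar>LINT x|\<mu>. Ks V C1 is f x - Ks V C1 is f \<eta>0\<bar> \<le> (LINT x|\<mu>. \<bar>Ks V C1 is f x - Ks V C1 is f \<eta>0\<bar>)"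
    by (rule integral_abs_bound)
  also have "\<dots> \<le> (LINT x|\<mu>. e)"
  proof (rule integral_mono_AE)
    have "AE x in \<mu>. x \<in> space \<mu>" by (rule AE_space)
    then show "AE x in \<mu>. \<bar>Ks V C1 is f x - Ks V C1 is f \<eta>0\<bar> \<le> e"
      using ae
    proof eventually_elim
      case (elim x)
      then show ?case using osc[OF \<eta>0, of x] invarD(3)[OF inv] by (simp add: abs_minus_commute)
    qed
  qed (use i in auto)
  finally show ?thesis unfolding eq by (simp add: prob_space)
qed

lemma invar_unique:
  assumes "invar V C1 \<mu>" "AE x in \<mu>. same V \<eta>0 x" "invar V C1 \<nu>" "AE x in \<nu>. same V \<eta>0 x" "\<eta>0 \<in> cs V"
  shows "\<mu> = \<nu>"
proof (rule cspace_eqI)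
  fix f assume f: "bm (cspace V) f" "ql V f"
  have "\<bar>(LINT x|\<mu>. f x) - (LINT x|\<nu>. f x)\<bar> \<le> 0"
  proof (rule field_le_epsilon)
    fix e :: real assume "0 < e"
    with dobrushin_ql[OF f, of "e / 2"] obtain "is" where is': "set is \<subseteq> V"
      "\<And>\<xi> \<eta>. \<xi> \<in> cs V ==> \<eta> \<in> cs V ==> same V \<xi> \<eta> ==> \<bar>Ks V C1 is f \<xi> - Ks V C1 is f \<eta>\<bar> \<le> e / 2"
      by (metis half_gt_zero)
    show "\<bar>(LINT x|\<mu>. f x) - (LINT x|\<nu>. f x)\<bar> \<le> 0 + e"
      using invar_close[OF assms(1,2,5) is'(1) f(1) is'(2)] invar_close[OF assms(3,4,5) is'(1) f(1) is'(2)] by linarith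
  qed
  then show "(LINT x|\<mu>. f x) = (LINT x|\<nu>. f x)" by simp
qed (use assms in \<open>auto dest: invarD\<close>)

section \<open>Identification with the constrained Gibbs measures on boxes of cells\<close>

definition cellpt :: "'d site set => ('d, nat) conf => ('d, real) conf" where
  "cellpt V s = (\<lambda>i\<in>V. 2 * pi * real (s i) / real q)"

lemma cellpt_arc: "i \<in> V ==> cellpt V s i \<in> arc_of q (s i)"
  using q by (auto simp: cellpt_def arc_of_def intro!: divide_strict_right_mono)

lemma cellpt: assumes "\<And>i. i \<in> V ==> s i < q"
  shows "cellpt V s \<in> cs V" "\<And>i. i \<in> V ==> coarse q (cellpt V s i) = s i"
    "PiE V (cells q s) = {x \<in> cs V. same V (cellpt V s) x}"
proof -
  have c: "cellpt V s i \<in> circle" if "i \<in> V" for i using cellpt_arc[OF that] arc_of_circle assms[OF that] by blast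
  then show "cellpt V s \<in> cs V" by (auto simp: space_conf_space cellpt_def)
  show co: "coarse q (cellpt V s i) = s i" if "i \<in> V" for i
    using coarse_arc[OF q assms[OF that] cellpt_arc[OF that, of s]] .
  show "PiE V (cells q s) = {x \<in> cs V. same V (cellpt V s) x}"
  proof (intro set_eqI)
    fix x
    have "x i \<in> arc_of q (s i) \<longleftrightarrow> x i \<in> circle \<and> coarse q (x i) = s i" if "i \<in> V" for i
      using coarse_eq_iff[OF q] arc_of_circle[OF assms[OF that]] coarse_arc[OF q assms[OF that]] by blast
    then show "x \<in> PiE V (cells q s) \<longleftrightarrow> x \<in> {x \<in> cs V. same V (cellpt V s) x}"
      using co by (auto simp: cells_def space_conf_space PiE_iff same_def cellrel_def)
  qed
qed

context
  fixes V :: "'d site set" and s :: "('d, nat) conf"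
  assumes s: "\<And>i. i \<in> V ==> s i < q"
begin

abbreviation (input) "S \<equiv> cells q s"
abbreviation (input) "N \<equiv> conf_space V (cells q s)"

text \<open>Measurable retraction of all angle configurations onto the box of cells, with left
  endpoints as default values. Constrained measures live on the box as a space of its own, invariant
  ones on the full circle; the retraction and the inclusion move between them.\<close>

definition retr :: "('d, real) conf => ('d, real) conf" where
  "retr x = (\<lambda>i\<in>V. if x i \<in> cells q s i then x i else cellpt V s i)"

lemma cells_class: assumes "i \<in> V" "C1 (cellpt V s i) a" "a \<in> circle"
  shows "cells q s i \<in> sets borel \<and> cells q s i = {y \<in> circle. C1 a y}"
  using cell_class[OF q assms(3)] assms(2) cellpt(2)[OF s assms(1)] by (simp add: cells_def cellrel_def)

lemma box: "PiE V (cells q s) = {x \<in> cs V. same V (cellpt V s) x}"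
  by (rule cellpt(3)) (rule s)

lemma cells_sets: "cells q s i \<in> sets borel" by (simp add: cells_def arc_of_def)

lemma retr_id: "x \<in> PiE V S ==> retr x = x"
  by (auto simp: retr_def PiE_iff extensional_def fun_eq_iff)

lemma retr_measurable: "retr \<in> measurable (cspace V) N"
  unfolding conf_space_def[of V S]
proof (rule measurable_PiM_single')
  fix i assume i: "i \<in> V"
  have c: "cellpt V s i \<in> S i" using cellpt_arc[OF i] by (simp add: cells_def)
  have "(\<lambda>x. x i) \<in> borel_measurable (cspace V)"
    using cspace_component[OF i] by (simp add: measurable_restrict_space2_iff)
  then have "(\<lambda>x. if x i \<in> S i then x i else cellpt V s i) \<in> borel_measurable (cspace V)"
    using cells_sets by measurable
  then show "(\<lambda>x. retr x i) \<in> measurable (cspace V) (restrict_space borel (S i))"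
    using i c by (auto simp: retr_def intro!: measurable_restrict_space2)
qed (use cellpt_arc in \<open>auto simp: retr_def PiE_iff space_restrict_space cells_def\<close>)

lemma incl_measurable: "(\<lambda>x. x) \<in> measurable N (cspace V)"
proof (rule measurable_cspaceI)
  fix i assume i: "i \<in> V"
  have "(\<lambda>x. x i) \<in> measurable N (restrict_space borel (S i))" unfolding conf_space_def using i by measurable
  moreover have "S i \<subseteq> circle" using arc_of_circle[OF s[OF i]] by (simp add: cells_def)
  ultimately show "(\<lambda>x. x i) \<in> measurable N (restrict_space borel circle)"
    by (auto simp: measurable_restrict_space2_iff)
qed (auto simp: space_conf_space PiE_iff)

lemma spec_kernel_box:
  assumes fin: "finite Y" and sub: "Y \<subseteq> V" and \<eta>: "\<eta> \<in> PiE V S"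
  shows "prob_space (spec_kernel \<Phi> V S Y \<eta>)"
    and "B \<in> sets N ==> emeasure (spec_kernel \<Phi> V S Y \<eta>) B = ennreal (K V C1 Y (\<lambda>x. indicator B (retr x)) \<eta>)"
proof -
  interpret pot_resample \<Phi> C1 V Y using fat fin sub by unfold_locales auto
  have \<eta>X: "\<eta> \<in> X" and sm: "same V (cellpt V s) \<eta>" using \<eta> cellpt(3)[OF s] by auto
  have SE: "\<And>i. i \<in> Y ==> S i \<in> sets borel \<and> S i = {y \<in> circle. C1 (\<eta> i) y}"
  proof -
    fix i assume "i \<in> Y"
    then have "i \<in> V" using sub by auto
    then show "S i \<in> sets borel \<and> S i = {y \<in> circle. C1 (\<eta> i) y}"
      using sm cspaceD[OF \<eta>X] by (intro cells_class) (auto simp: same_def)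
  qed
  note ll = local_law_box[where S = S, OF SE \<eta>X]
  have S': "\<And>i. i \<in> Y ==> S i \<in> sets borel \<and> S i \<subseteq> circle" using SE by blast
  have ovS: "override_on \<eta> \<sigma> Y \<in> PiE V S" if "\<sigma> \<in> space (leb_prod Y S)" for \<sigma>
    using that \<eta> sub by (auto simp: space_leb_prod override_on_def PiE_iff extensional_def)
  have 1: "(\<lambda>\<sigma>. override_on \<eta> \<sigma> Y) \<in> measurable (leb_prod Y S) (cspace V)"
    using measurable_compose[OF leb_prod_sub(2)[OF fin, of S] override_measurable2[OF sub \<eta>X]] S' by simp
  have "(\<lambda>\<sigma>. retr (override_on \<eta> \<sigma> Y)) \<in> measurable (leb_prod Y S) N"
    using measurable_compose[OF 1 retr_measurable] .
  then have "(\<lambda>\<sigma>. override_on \<eta> \<sigma> Y) \<in> measurable (leb_prod Y S) N"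
    by (rule measurable_cong[THEN iffD1, rotated]) (simp add: retr_id ovS)
  moreover have sl: "sets (local_law \<Phi> V S Y \<eta>) = sets (leb_prod Y S)" by (simp add: local_law_def Let_def)
  ultimately have m: "(\<lambda>\<sigma>. override_on \<eta> \<sigma> Y) \<in> measurable (local_law \<Phi> V S Y \<eta>) N"
    by (simp add: measurable_cong_sets[OF sl refl])
  show p: "prob_space (spec_kernel \<Phi> V S Y \<eta>)"
    unfolding spec_kernel_def using ll(8) prob_space.prob_space_distr[OF _ m] by simp
  interpret p: prob_space "spec_kernel \<Phi> V S Y \<eta>" by (rule p)
  show "emeasure (spec_kernel \<Phi> V S Y \<eta>) B = ennreal (K V C1 Y (\<lambda>x. indicator B (retr x)) \<eta>)" if B: "B \<in> sets N"
  proof -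
    have "measure (spec_kernel \<Phi> V S Y \<eta>) B = (LINT x|spec_kernel \<Phi> V S Y \<eta>. indicator B x)"
      using sets.sets_into_space[OF B] by (simp add: spec_kernel_def Int_absorb2)
    also have "\<dots> = (LINT \<sigma>|local_law \<Phi> V S Y \<eta>. indicator B (override_on \<eta> \<sigma> Y))"
      unfolding spec_kernel_def using B by (intro integral_distr[OF m]) auto
    also have "\<dots> = (LINT \<sigma>|local_law \<Phi> V S Y \<eta>. indicator B (retr (override_on \<eta> \<sigma> Y)))"
      using sets_eq_imp_space_eq[OF sl] by (intro icong refl) (simp add: retr_id ovS)
    also have "\<dots> = K V C1 Y (\<lambda>x. indicator B (retr x)) \<eta>"
      using ll(7)[OF _ bm_compose[OF bm_indicator[OF B] retr_measurable]] by simp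
    finally show ?thesis by (simp add: p.emeasure_eq_measure)
  qed
qed

lemma AE_box: assumes "invar V C1 \<mu>" "AE x in \<mu>. same V (cellpt V s) x" shows "AE x in \<mu>. x \<in> PiE V S"
  using assms(2) AE_space by eventually_elim (use cellpt(3)[OF s] invarD(3)[OF assms(1)] in auto)

text \<open>The DLR equations of all finite blocks come from one-site invariance through
  \<open>invar_block\<close>; the retraction is almost surely the identity.\<close>

lemma gibbs_of_invar:
  assumes inv: "invar V C1 \<mu>" and ae: "AE x in \<mu>. same V (cellpt V s) x"
  shows "distr \<mu> N retr \<in> gibbs_measures V N (spec_kernel \<Phi> V S)"
  unfolding gibbs_measures_def
proof (intro CollectI conjI allI impI)
  have rm: "retr \<in> measurable \<mu> N" using retr_measurable by (simp add: measurable_cong_sets[OF invarD(2)[OF inv] refl])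
  interpret prob_space \<mu> using inv by (rule invarD)
  show "prob_space (distr \<mu> N retr)" by (rule prob_space_distr[OF rm])
  show "sets (distr \<mu> N retr) = sets N" by simp
  fix Y B assume fin: "finite Y" and sub: "Y \<subseteq> V" and B: "B \<in> sets N"
  interpret pot_resample \<Phi> C1 V Y using fat fin sub by unfold_locales auto
  let ?f = "\<lambda>x. indicator B (retr x) :: real"
  have f: "bm (cspace V) ?f" by (rule bm_compose[OF bm_indicator[OF B] retr_measurable])
  note bs = bm_sets_cong[OF invarD(2)[OF inv]]
  have kr: "AE x in \<mu>. ennreal (K V C1 Y ?f x) = emeasure (spec_kernel \<Phi> V S Y (retr x)) B"
    using AE_box[OF inv ae] by eventually_elim (simp add: retr_id spec_kernel_box(2)[OF fin sub _ B])
  have "emeasure (distr \<mu> N retr) B = ennreal (LINT x|\<mu>. ?f x)"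
  proof -
    interpret d: prob_space "distr \<mu> N retr" by (rule prob_space_distr[OF rm])
    have "(LINT x|\<mu>. ?f x) = (LINT x|distr \<mu> N retr. indicator B x)" using B by (intro integral_distr[symmetric, OF rm]) auto
    then show ?thesis using B by (simp add: d.emeasure_eq_measure Int_absorb2 sets.sets_into_space)
  qed
  also have "(LINT x|\<mu>. ?f x) = (LINT x|\<mu>. K V C1 Y ?f x)" using invar_block[OF inv fat sub fin f] by simp
  also have "ennreal \<dots> = (\<integral>\<^sup>+x. ennreal (K V C1 Y ?f x) \<partial>\<mu>)"
  proof (rule nn_integral_eq_integral[symmetric])
    show "integrable \<mu> (K V C1 Y ?f)" using bm_K[OF f] bs by (intro prob_integrable prob_space_axioms) simp
    show "AE x in \<mu>. 0 \<le> K V C1 Y ?f x"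
    proof (rule AE_I2)
      fix x assume "x \<in> space \<mu>"
      then have "x \<in> X" using invarD(3)[OF inv] by simp
      then show "0 \<le> K V C1 Y ?f x" using K_mono[OF bm_const f, of x 0] K_const by auto
    qed
  qed
  also have "\<dots> = (\<integral>\<^sup>+x. emeasure (spec_kernel \<Phi> V S Y (retr x)) B \<partial>\<mu>)"
    by (rule nn_integral_cong_AE[OF kr])
  also have "\<dots> = (\<integral>\<^sup>+\<eta>. emeasure (spec_kernel \<Phi> V S Y \<eta>) B \<partial>distr \<mu> N retr)"
  proof (rule nn_integral_distr[symmetric, OF rm])
    have "(\<lambda>\<eta>. ennreal (K V C1 Y ?f \<eta>)) \<in> borel_measurable N"
      using measurable_compose[OF incl_measurable bm_measurable[OF bm_K[OF f]]] by measurable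
    then have "(\<lambda>\<eta>. emeasure (spec_kernel \<Phi> V S Y \<eta>) B) \<in> borel_measurable N"
      by (rule measurable_cong[THEN iffD1, rotated]) (simp add: space_conf_space spec_kernel_box(2)[OF fin sub _ B])
    then show "(\<lambda>\<eta>. emeasure (spec_kernel \<Phi> V S Y \<eta>) B) \<in> borel_measurable (distr \<mu> N retr)"
      by simp
  qed
  finally show "emeasure (distr \<mu> N retr) B = (\<integral>\<^sup>+\<eta>. emeasure (spec_kernel \<Phi> V S Y \<eta>) B \<partial>distr \<mu> N retr)" .
qed

text \<open>The one-site DLR equations are tested on the intersection of an event with the box,
  which resampling within cells does not leave.\<close>

lemma invar_of_gibbs:
  assumes g: "\<mu>0 \<in> gibbs_measures V N (spec_kernel \<Phi> V S)"
  shows "invar V C1 (distr \<mu>0 (cspace V) (\<lambda>x. x))" "AE x in distr \<mu>0 (cspace V) (\<lambda>x. x). same V (cellpt V s) x"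
    "distr (distr \<mu>0 (cspace V) (\<lambda>x. x)) N retr = \<mu>0"
proof -
  have p: "prob_space \<mu>0" and sN: "sets \<mu>0 = sets N" using g by (auto simp: gibbs_measures_def)
  have sp: "space \<mu>0 = PiE V S" using sets_eq_imp_space_eq[OF sN] by (simp add: space_conf_space)
  interpret prob_space \<mu>0 by (rule p)
  have im: "(\<lambda>x. x) \<in> measurable \<mu>0 (cspace V)" using incl_measurable by (simp add: measurable_cong_sets[OF sN refl])
  let ?\<mu> = "distr \<mu>0 (cspace V) (\<lambda>x. x)"
  have \<mu>: "prob_space ?\<mu>" "sets ?\<mu> = sets (cspace V)" using prob_space_distr[OF im] by auto
  show "AE x in ?\<mu>. same V (cellpt V s) x"
  proof -
    have "AE x in ?\<mu>. coarse q (x i) = s i" if i: "i \<in> V" for i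
    proof -
      have "(LINT x|?\<mu>. (of_bool (coarse q (x i) = s i) :: real)) = (LINT x|\<mu>0. of_bool (coarse q (x i) = s i))"
        using bm_measurable[OF bm_cell_indicator(1)[OF i, of "s i"]] by (rule integral_distr[OF im])
      also have "\<dots> = (LINT x|\<mu>0. 1)"
        using sp cellpt[OF s] i by (intro icong refl) (auto simp: same_def cellrel_def)
      finally have "AE x in ?\<mu>. of_bool (coarse q (x i) = s i) = (1 :: real)"
        using bm_cell_indicator(1)[OF i] bm_sets_cong[OF \<mu>(2)] by (intro prob_integral_one_AE[OF \<mu>(1)]) (auto simp: prob_space)
      then show ?thesis by (rule AE_mp) (auto intro!: AE_I2)
    qed
    then have "AE x in ?\<mu>. \<forall>i. i \<in> V \<longrightarrow> coarse q (x i) = s i" by (auto simp: AE_all_countable)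
    then show ?thesis by (rule AE_mp) (auto intro!: AE_I2 simp: same_def cellrel_def cellpt(2)[OF s])
  qed
  have "distr ?\<mu> N retr = distr \<mu>0 N retr"
    using im retr_measurable by (subst distr_distr) (auto simp: comp_def)
  also have "\<dots> = distr \<mu>0 N (\<lambda>x. x)" using sp by (intro distr_cong) (auto simp: retr_id)
  also have "\<dots> = \<mu>0" using sN by (rule distr_id2[OF sym])
  finally show "distr ?\<mu> N retr = \<mu>0" .
  show "invar V C1 ?\<mu>"
    unfolding invar_def
  proof (intro conjI ballI allI impI \<mu>)
    fix i f assume i: "i \<in> V" and f: "bm (cspace V) f"
    interpret pot_resample \<Phi> C1 V "{i}" using fat i by unfold_locales auto
    note bk = bind_kern[OF \<mu>]
    have "bind ?\<mu> kern = ?\<mu>"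
    proof (rule measure_eqI)
      fix B assume "B \<in> sets (bind ?\<mu> kern)"
      then have B: "B \<in> sets (cspace V)" using bk(2) by simp
      let ?B = "B \<inter> PiE V S"
      have B': "?B \<in> sets N"
        using measurable_sets[OF incl_measurable B] by (simp add: space_conf_space)
      have "emeasure ?\<mu> B = emeasure \<mu>0 ?B" using sp by (simp add: emeasure_distr[OF im B] Int_commute)
      also have "\<dots> = (\<integral>\<^sup>+\<eta>. emeasure (spec_kernel \<Phi> V S {i} \<eta>) ?B \<partial>\<mu>0)"
        using g i B' unfolding gibbs_measures_def by blast
      also have "\<dots> = (\<integral>\<^sup>+\<eta>. ennreal (K V C1 {i} (indicator B) \<eta>) \<partial>\<mu>0)"
      proof (rule nn_integral_cong)
        fix \<eta> assume "\<eta> \<in> space \<mu>0"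
        then have \<eta>: "\<eta> \<in> PiE V S" "\<eta> \<in> X" using sp cellpt(3)[OF s] by auto
        have "K V C1 {i} (\<lambda>x. indicator ?B (retr x)) \<eta> = K V C1 {i} (indicator B) \<eta>"
        proof -
          have "num V C1 {i} (\<lambda>x. indicator ?B (retr x)) \<eta> = num V C1 {i} (indicator B) \<eta>"
            unfolding num_def
          proof (rule J_cong[OF \<eta>(2)])
            fix \<sigma> assume \<sigma>: "\<sigma> \<in> space (lebc {i})" "\<And>j. j \<in> {i} ==> C1 (\<eta> j) (\<sigma> j)"
            have "override_on \<eta> \<sigma> {i} \<in> PiE V S"
            proof -
              have "same V (cellpt V s) \<eta>" using \<eta>(1) box by auto
              then have "same V (cellpt V s) (override_on \<eta> \<sigma> {i})" using \<sigma>(2) by (auto simp: same_def override_on_def cellrel_def)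
              then show ?thesis unfolding box using override_space[OF \<eta>(2) \<sigma>(1) sub] by simp
            qed
            then show "wt V {i} (override_on \<eta> \<sigma> {i}) * indicator ?B (retr (override_on \<eta> \<sigma> {i})) =
                wt V {i} (override_on \<eta> \<sigma> {i}) * indicator B (override_on \<eta> \<sigma> {i})"
              by (simp add: retr_id indicator_def)
          qed
          then show ?thesis by (simp add: K_def)
        qed
        then show "emeasure (spec_kernel \<Phi> V S {i} \<eta>) ?B = ennreal (K V C1 {i} (indicator B) \<eta>)"
          using spec_kernel_box(2)[OF _ _ \<eta>(1) B', of "{i}"] i by simp
      qed
      also have "\<dots> = (\<integral>\<^sup>+\<eta>. ennreal (K V C1 {i} (indicator B) \<eta>) \<partial>?\<mu>)"
        using bm_measurable[OF bm_K[OF bm_indicator[OF B]]] by (intro nn_integral_distr[symmetric, OF im]) auto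
      also have "\<dots> = emeasure (bind ?\<mu> kern) B" by (rule bk(4)[OF B, symmetric])
      finally show "emeasure (bind ?\<mu> kern) B = emeasure ?\<mu> B" by simp
    qed (use bk(2) in simp)
    then show "(LINT x|?\<mu>. K V C1 {i} f x) = (LINT x|?\<mu>. f x)" using bk(3)[OF f] by simp
  qed
qed

text \<open>Existence and uniqueness are transported from invariant measures, which makes the
  definite description meaningful.\<close>

lemma constr_gibbs_gibbs: "constr_gibbs \<Phi> q V s \<in> gibbs_measures V N (spec_kernel \<Phi> V S)"
  unfolding constr_gibbs_def
proof (rule theI', rule ex_ex1I)
  have c1: "cellpt V s \<in> cs V" by (rule cellpt(1)) (rule s)
  from invar_exists[OF this] obtain \<mu> where "invar V C1 \<mu>" "AE x in \<mu>. same V (cellpt V s) x" by blast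
  from gibbs_of_invar[OF this] show "\<exists>\<mu>. \<mu> \<in> gibbs_measures V N (spec_kernel \<Phi> V S)" by blast
  fix \<mu> \<nu> assume h: "\<mu> \<in> gibbs_measures V N (spec_kernel \<Phi> V S)" "\<nu> \<in> gibbs_measures V N (spec_kernel \<Phi> V S)"
  have "distr \<mu> (cspace V) (\<lambda>x. x) = distr \<nu> (cspace V) (\<lambda>x. x)"
    by (rule invar_unique[OF invar_of_gibbs(1,2)[OF h(1)] invar_of_gibbs(1,2)[OF h(2)] c1])
  then show "\<mu> = \<nu>" using invar_of_gibbs(3)[OF h(1)] invar_of_gibbs(3)[OF h(2)] by metis
qed

end

section \<open>The constrained measure as a kernel from discrete to continuous
  configurations\<close>

definition cg :: "'d site set => ('d, nat) conf => ('d, real) conf measure" where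
  "cg V s = distr (constr_gibbs \<Phi> q V s) (cspace V) (\<lambda>x. x)"

text \<open>The last clause is the tool for later identifications: whatever is invariant and sits in
  the right cells is the constrained measure.\<close>

lemma cg:
  assumes s: "\<And>i. i \<in> V ==> s i < q"
  shows "invar V C1 (cg V s)" "AE x in cg V s. same V (cellpt V s) x"
    "prob_space (constr_gibbs \<Phi> q V s)" "sets (constr_gibbs \<Phi> q V s) = sets (conf_space V (cells q s))"
    "(\<lambda>x. x) \<in> measurable (constr_gibbs \<Phi> q V s) (cspace V)"
    "\<And>f. f \<in> borel_measurable (cspace V) ==> (LINT x|constr_gibbs \<Phi> q V s. f x) = (LINT x|cg V s. (f x :: real))"
    "\<And>\<mu>. invar V C1 \<mu> ==> AE x in \<mu>. same V (cellpt V s) x ==> \<mu> = cg V s"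
proof -
  note g = constr_gibbs_gibbs[OF s]
  show 1: "invar V C1 (cg V s)" "AE x in cg V s. same V (cellpt V s) x"
    unfolding cg_def using invar_of_gibbs(1,2)[OF s g] by auto
  show "prob_space (constr_gibbs \<Phi> q V s)" and s4: "sets (constr_gibbs \<Phi> q V s) = sets (conf_space V (cells q s))"
    using g by (auto simp: gibbs_measures_def)
  show im: "(\<lambda>x. x) \<in> measurable (constr_gibbs \<Phi> q V s) (cspace V)"
    using incl_measurable[OF s] by (simp add: measurable_cong_sets[OF s4 refl])
  show "(LINT x|constr_gibbs \<Phi> q V s. f x) = (LINT x|cg V s. f x)" if "f \<in> borel_measurable (cspace V)" for f :: "_ => real"
    unfolding cg_def using integral_distr[OF im that] by simp
  show "\<mu> = cg V s" if "invar V C1 \<mu>" "AE x in \<mu>. same V (cellpt V s) x" for \<mu>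
    using invar_unique[OF that 1 cellpt(1)[OF s]] .
qed

lemma space_Omega: "space (Omega q) = UNIV \<rightarrow>\<^sub>E {..<q}" by (simp add: Omega_def space_PiM)

lemma OmegaD: "s \<in> space (Omega q) ==> s i < q" by (auto simp: space_Omega)

lemma Omega_component: "(\<lambda>s. s i) \<in> measurable (Omega q) (count_space UNIV)"
proof -
  have "(\<lambda>s. s i) \<in> measurable (Omega q) (count_space {..<q})" unfolding Omega_def by measurable
  then show ?thesis by (rule measurable_compose) auto
qed

lemma cellpt_measurable: "cellpt V \<in> measurable (Omega q) (cspace V)"
proof (rule measurable_cspaceI)
  fix i assume i: "i \<in> V"
  have "(\<lambda>s. 2 * pi * real (s i) / real q) \<in> borel_measurable (Omega q)"
    using measurable_compose[OF Omega_component, of "\<lambda>k. 2 * pi * real k / real q" borel i] by simp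
  then have "(\<lambda>s. cellpt V s i) \<in> borel_measurable (Omega q)" using i by (simp add: cellpt_def)
  moreover have "cellpt V s i \<in> circle" if "s \<in> space (Omega q)" for s
    using cellpt(1)[of V s] OmegaD[OF that] i by (auto simp: space_conf_space)
  ultimately show "(\<lambda>s. cellpt V s i) \<in> measurable (Omega q) (restrict_space borel circle)"
    by (auto intro!: measurable_restrict_space2)
qed (simp add: cellpt_def)

text \<open>The expectation is the limit of swept functions evaluated at the reference point of the
  cells, and these values are measurable in the discrete configuration.\<close>

lemma cg_ql_measurable:
  assumes f: "bm (cspace V) f" "ql V f" shows "(\<lambda>s. LINT x|cg V s. f x) \<in> borel_measurable (Omega q)"
proof -
  have "\<exists>is. set is \<subseteq> V \<and> (\<forall>\<xi>\<in>cs V. \<forall>\<eta>\<in>cs V. same V \<xi> \<eta> \<longrightarrow>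
    \<bar>Ks V C1 is f \<xi> - Ks V C1 is f \<eta>\<bar> \<le> 1 / Suc n)" for n by (rule dobrushin_ql[OF f]) simp
  then obtain L where L: "\<And>n. set (L n) \<subseteq> V" "\<And>n \<xi> \<eta>. \<xi> \<in> cs V ==> \<eta> \<in> cs V ==> same V \<xi> \<eta> ==>
    \<bar>Ks V C1 (L n) f \<xi> - Ks V C1 (L n) f \<eta>\<bar> \<le> 1 / Suc n" by metis
  show ?thesis
  proof (rule borel_measurable_LIMSEQ_real)
    fix s :: "('d, nat) conf" assume "s \<in> space (Omega q)"
    then have s: "\<And>i. i \<in> V ==> s i < q" using OmegaD by blast
    have le: "\<bar>(LINT x|cg V s. f x) - Ks V C1 (L n) f (cellpt V s)\<bar> \<le> 1 / Suc n" for n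
      by (rule invar_close[OF cg(1,2)[OF s] cellpt(1)[OF s] L(1) f(1) L(2)])
    have "(\<lambda>n. (LINT x|cg V s. f x) - Ks V C1 (L n) f (cellpt V s)) \<longlonglongrightarrow> 0"
      by (rule Lim_null_comparison[OF _ LIMSEQ_inverse_real_of_nat]) (use le in \<open>auto simp: inverse_eq_divide\<close>)
    from tendsto_diff[OF tendsto_const[of "LINT x|cg V s. f x"] this]
    show "(\<lambda>n. Ks V C1 (L n) f (cellpt V s)) \<longlonglongrightarrow> (LINT x|cg V s. f x)" by simp
  next
    fix n show "(\<lambda>s. Ks V C1 (L n) f (cellpt V s)) \<in> borel_measurable (Omega q)"
      using measurable_compose[OF cellpt_measurable bm_measurable[OF bm_Ks[OF fat L(1) f(1)]]] .
  qed
qed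

lemma cg_measurable: "cg V \<in> measurable (Omega q) (prob_algebra (cspace V))"
proof (rule measurable_prob_algebra_generated)
  let ?M = "\<lambda>_ :: 'd site. restrict_space borel circle :: real measure"
  show "sets (cspace V) = sigma_sets (\<Pi>\<^sub>E i\<in>V. space (?M i)) (prod_algebra V ?M)" unfolding conf_space_def by (rule sets_PiM)
  show "Int_stable (prod_algebra V ?M)" by (rule Int_stable_prod_algebra)
  show "prod_algebra V ?M \<subseteq> Pow (\<Pi>\<^sub>E i\<in>V. space (?M i))" by (rule prod_algebra_sets_into_space)
  fix s :: "('d, nat) conf" assume "s \<in> space (Omega q)"
  then have s: "\<And>i. i \<in> V ==> s i < q" using OmegaD by blast
  show "prob_space (cg V s)" "sets (cg V s) = sets (cspace V)" using invarD[OF cg(1)[OF s]] by auto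
next
  let ?M = "\<lambda>_ :: 'd site. restrict_space borel circle :: real measure"
  fix A assume "A \<in> prod_algebra V ?M"
  then obtain L E where A: "A = prod_emb V ?M L (Pi\<^sub>E L E)" and L: "finite L" "L \<subseteq> V" and E: "\<And>i. i \<in> L ==> E i \<in> sets (?M i)"
    by (rule prod_algebraE) blast
  have B: "A \<in> sets (cspace V)" unfolding conf_space_def A using L E by (intro sets_PiM_I) auto
  have "ql V (indicator A)"
  proof (rule ql_local[OF L])
    fix \<xi> \<eta> assume h: "\<xi> \<in> cs V" "\<eta> \<in> cs V" "\<And>i. i \<in> L ==> \<xi> i = \<eta> i"
    have "restrict \<xi> L = restrict \<eta> L" using h(3) by auto
    then show "indicator A \<xi> = (indicator A \<eta> :: real)"
      using h(1,2) by (auto simp: A indicator_def prod_emb_def space_conf_space space_restrict_space)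
  qed
  from cg_ql_measurable[OF bm_indicator[OF B] this]
  have "(\<lambda>s. ennreal (LINT x|cg V s. indicator A x)) \<in> borel_measurable (Omega q)" by measurable
  then show "(\<lambda>s. emeasure (cg V s) A) \<in> borel_measurable (Omega q)"
  proof (rule measurable_cong[THEN iffD1, rotated])
    fix s :: "('d, nat) conf" assume "s \<in> space (Omega q)"
    then have s: "\<And>i. i \<in> V ==> s i < q" using OmegaD by blast
    interpret prob_space "cg V s" by (rule invarD(1)[OF cg(1)[OF s]])
    show "ennreal (LINT x|cg V s. indicator A x) = emeasure (cg V s) A"
      using sets.sets_into_space[OF B] invarD(2,3)[OF cg(1)[OF s]] by (simp add: emeasure_eq_measure Int_absorb2)
  qed
qed

end

section \<open>Symmetries of the model\<close>

abbreviation Full :: "real => real => bool" where "Full \<equiv> \<lambda>_ _. True"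

lemma fatrel_Full: "fatrel Full"
  unfolding fatrel_def
proof (intro conjI)
  show "\<exists>c>0. \<forall>x\<in>circle. c \<le> (LINT y|LC. (of_bool True :: real))"
    by (intro exI[of _ "2 * pi"]) (auto simp: measure_LC)
qed auto

lemma lebc_single:
  assumes "g \<in> borel_measurable LC"
  shows "(LINT \<sigma>|lebc {i}. g (\<sigma> i)) = (LINT y|LC. (g y :: real))"
proof -
  interpret product_sigma_finite "\<lambda>_. LC" by (rule product_sigma_finite_LC)
  show ?thesis unfolding leb_prod_def by (rule product_integral_singleton[OF assms])
qed

lemma upd_measurable:
  assumes "i \<in> V" shows "(\<lambda>(\<eta>, y). \<eta>(i := y)) \<in> measurable (cspace V \<Otimes>\<^sub>M LC) (cspace V)"
proof (rule measurable_cspaceI)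
  fix j assume j: "j \<in> V"
  have 1: "(\<lambda>z. snd z) \<in> measurable (cspace V \<Otimes>\<^sub>M LC) (restrict_space borel circle)"
    using measurable_snd[of "cspace V" LC] by (simp add: measurable_cong_sets[OF refl sets_LC])
  have 2: "(\<lambda>z. fst z j) \<in> measurable (cspace V \<Otimes>\<^sub>M LC) (restrict_space borel circle)"
    using measurable_compose[OF measurable_fst cspace_component[OF j]] .
  show "(\<lambda>x. (case x of (\<eta>, y) => \<eta>(i := y)) j) \<in> measurable (cspace V \<Otimes>\<^sub>M LC) (restrict_space borel circle)"
    using 1 2 by (cases "j = i") (auto simp: split_beta')
qed (use assms in \<open>auto simp: space_pair_measure space_conf_space PiE_iff extensional_def\<close>)

lemma upd_space: "\<eta> \<in> cs V ==> i \<in> V ==> y \<in> circle ==> \<eta>(i := y) \<in> cs V"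
  by (auto simp: space_conf_space PiE_iff extensional_def)

lemma bm_rel: "fatrel E ==> bm (LC \<Otimes>\<^sub>M LC) (\<lambda>(x, y). of_bool (E x y))"
  by (intro bmI[of _ _ 1]) (auto simp: fatrel_def)

lemma bm_rel_section: "fatrel E ==> x \<in> circle ==> bm LC (\<lambda>y. of_bool (E x y))"
  using bm_section[OF bm_rel, of E x] by simp

lemma bm_upd: "bm (cspace V) f ==> \<eta> \<in> cs V ==> i \<in> V ==> bm LC (\<lambda>y. f (\<eta>(i := y)))"
  using bm_compose[OF _ measurable_compose[OF measurable_Pair1' upd_measurable], of V f \<eta> i] by simp

lemma J_single:
  assumes E: "fatrel E" and i: "i \<in> V" and f: "bm (cspace V) f" and \<eta>: "\<eta> \<in> cs V"
  shows "J E {i} f \<eta> = (LINT y|LC. of_bool (E (\<eta> i) y) * f (\<eta>(i := y)))"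
proof -
  have "bm LC (\<lambda>y. of_bool (E (\<eta> i) y) * f (\<eta>(i := y)))"
    using cspaceD[OF \<eta> i] by (intro bm_mult bm_rel_section[OF E] bm_upd[OF f \<eta> i])
  from lebc_single[OF bm_measurable[OF this], of i]
  show ?thesis unfolding J_def by (simp add: comp_ind_def override_on_insert)
qed

lemma J_swap:
  assumes E: "fatrel E" and sub: "insert i Y \<subseteq> V" and fin: "finite Y" "i \<notin> Y" and f: "bm (cspace V) f"
    and \<eta>: "\<eta> \<in> cs V"
  shows "J E {i} (J E Y f) \<eta> = J E Y (J E {i} f) \<eta>"
proof -
  interpret rl: resample E V Y using assms by unfold_locales auto
  interpret ri: resample E V "{i}" using assms by unfold_locales auto
  have i: "i \<in> V" and L: "Y \<subseteq> V" using sub by auto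
  let ?h = "\<lambda>y \<sigma>. of_bool (E (\<eta> i) y) * (comp_ind E Y \<eta> \<sigma> * f ((override_on \<eta> \<sigma> Y)(i := y)))"
  have com: "override_on (\<eta>(i := y)) \<sigma> Y = (override_on \<eta> \<sigma> Y)(i := y)" for y \<sigma>
    using fin(2) by (auto simp: override_on_def)
  have ci: "comp_ind E Y (\<eta>(i := y)) \<sigma> = comp_ind E Y \<eta> \<sigma>" for y \<sigma>
    unfolding comp_ind_def using fin(2) by (intro prod.cong) auto
  have b: "bm (LC \<Otimes>\<^sub>M lebc Y) (\<lambda>(y, \<sigma>). ?h y \<sigma>)"
  proof -
    have m1: "fst \<in> measurable (LC \<Otimes>\<^sub>M lebc Y) LC" by simp
    have m2: "snd \<in> measurable (LC \<Otimes>\<^sub>M lebc Y) (lebc Y)" by simp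
    have b1: "bm (LC \<Otimes>\<^sub>M lebc Y) (\<lambda>z. of_bool (E (\<eta> i) (fst z)))"
      by (rule bm_compose[OF bm_rel_section[OF E cspaceD[OF \<eta> i]] m1])
    have b2: "bm (LC \<Otimes>\<^sub>M lebc Y) (\<lambda>z. comp_ind E Y \<eta> (snd z))"
      by (rule bm_compose[OF bm_section[OF bm_comp_ind[OF E L fin(1)] \<eta>] m2])
    have "(\<lambda>z. (override_on \<eta> (snd z) Y, fst z)) \<in> measurable (LC \<Otimes>\<^sub>M lebc Y) (cspace V \<Otimes>\<^sub>M LC)"
      by (rule measurable_Pair[OF measurable_compose[OF m2 override_measurable2[OF L \<eta>]] m1])
    from bm_compose[OF f measurable_compose[OF this upd_measurable[OF i]]]
    have b3: "bm (LC \<Otimes>\<^sub>M lebc Y) (\<lambda>z. f ((override_on \<eta> (snd z) Y)(i := fst z)))" by simp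
    from bm_mult[OF b1 bm_mult[OF b2 b3]] show ?thesis by (simp add: split_beta')
  qed
  interpret p: pair_sigma_finite LC "lebc Y"
    using finite_measure.sigma_finite_measure[OF finite_measure_LC] finite_measure.sigma_finite_measure[OF finite_measure_lebc[OF fin(1)]]
    by (simp add: pair_sigma_finite_def)
  have fp: "finite_measure (LC \<Otimes>\<^sub>M lebc Y)"
    by (rule finite_measure_pair_measure[OF finite_measure_lebc[OF fin(1)] finite_measure_LC])
  have "J E {i} (J E Y f) \<eta> = (LINT y|LC. (LINT \<sigma>|lebc Y. ?h y \<sigma>))"
    unfolding J_single[OF E i rl.bm_J[OF f] \<eta>] unfolding J_def com ci by simp
  also have "\<dots> = (LINT \<sigma>|lebc Y. (LINT y|LC. ?h y \<sigma>))"
    by (rule p.Fubini_integral[symmetric]) (rule bm_integrable[OF fp b])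
  also have "\<dots> = J E Y (J E {i} f) \<eta>"
    unfolding J_def[of E Y]
  proof (rule icong[OF refl])
    fix \<sigma> assume "\<sigma> \<in> space (lebc Y)"
    note J = J_single[OF E i f override_space[OF \<eta> this L], unfolded override_on_apply_notin[OF fin(2)]]
    show "(LINT y|LC. ?h y \<sigma>) = comp_ind E Y \<eta> \<sigma> * J E {i} f (override_on \<eta> \<sigma> Y)"
      unfolding J mult.left_commute[of _ "comp_ind E Y \<eta> \<sigma>"] by simp
  qed
  finally show ?thesis .
qed

section \<open>Rotations and translations of configurations\<close>

definition rot1 :: "real => real => real" where "rot1 \<tau> x = (x + \<tau>) rmod (2 * pi)"

lemma rotate_conf_alt: "rotate_conf \<tau> x = (\<lambda>i. rot1 \<tau> (x i))"
  by (simp add: rotate_conf_def rot1_def)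

lemma rot1_circle: "rot1 \<tau> x \<in> circle"
  using rmod_nonneg[of "2 * pi" "x + \<tau>"] rmod_less[of "2 * pi" "x + \<tau>"] by (simp add: rot1_def circle_def)

lemma rot1_inverse: assumes "x \<in> circle" shows "rot1 (- \<tau>) (rot1 \<tau> x) = x" "rot1 \<tau> (rot1 (- \<tau>) x) = x"
proof -
  have id: "x rmod (2 * pi) = x" using assms by (intro rmod_idem) (auto simp: circle_def)
  have "((x + \<tau>) rmod (2 * pi) + (- \<tau>) rmod (2 * pi)) rmod (2 * pi) = x rmod (2 * pi)"
    by (subst rmod_add) simp
  moreover have "(y rmod (2 * pi) + z) rmod (2 * pi) = (y rmod (2 * pi) + z rmod (2 * pi)) rmod (2 * pi)" for y z
    by (metis rmod_add rmod_rmod)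
  ultimately show "rot1 (- \<tau>) (rot1 \<tau> x) = x" using id by (simp add: rot1_def)
  have "((x - \<tau>) rmod (2 * pi) + \<tau> rmod (2 * pi)) rmod (2 * pi) = x rmod (2 * pi)"
    by (subst rmod_add) simp
  moreover have "(y rmod (2 * pi) + z) rmod (2 * pi) = (y rmod (2 * pi) + z rmod (2 * pi)) rmod (2 * pi)" for y z
    by (metis rmod_add rmod_rmod)
  ultimately show "rot1 \<tau> (rot1 (- \<tau>) x) = x" using id by (simp add: rot1_def)
qed

lemma rot1_cases:
  assumes "0 < \<tau>" "\<tau> < 2 * pi" "x \<in> circle"
  shows "rot1 \<tau> x = (if x < 2 * pi - \<tau> then x + \<tau> else x + \<tau> - 2 * pi)"
proof (cases "x < 2 * pi - \<tau>")
  case True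
  then show ?thesis using assms unfolding rot1_def by (subst rmod_idem) (auto simp: circle_def)
next
  case False
  then have "(x + \<tau>) rmod (2 * pi) = x + \<tau> - 2 * pi"
    using assms by (intro rmod_unique[where n = 1]) (auto simp: circle_def)
  then show ?thesis using False by (simp add: rot1_def)
qed

lemma rot1_measurable [measurable]: "rot1 \<tau> \<in> borel_measurable borel"
  unfolding rot1_def[abs_def] rmod_def[abs_def] by measurable

lemma rot1_LC: "rot1 \<tau> \<in> measurable LC LC"
proof -
  have "rot1 \<tau> \<in> borel_measurable (restrict_space borel circle)" by (rule measurable_restrict_space1) measurable
  then have "rot1 \<tau> \<in> measurable (restrict_space borel circle) (restrict_space borel circle)"
    by (intro measurable_restrict_space2) (auto simp: rot1_circle)
  then show ?thesis by (simp add: measurable_cong_sets[OF sets_LC sets_LC])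
qed

lemma emeasure_lborel_shift: "A \<in> sets borel ==> emeasure lborel {x. c + x \<in> A} = emeasure lborel (A :: real set)"
proof -
  assume A: "A \<in> sets borel"
  have "emeasure lborel A = emeasure (distr lborel borel ((+) c)) A" by (simp add: lborel_distr_plus)
  also have "\<dots> = emeasure lborel ((+) c -` A)" using A by (subst emeasure_distr) auto
  finally show ?thesis by (simp add: vimage_def)
qed

lemma distr_rot1: assumes "0 < \<tau>" "\<tau> < 2 * pi" shows "distr LC LC (rot1 \<tau>) = LC"
proof (rule measure_eqI)
  fix B assume "B \<in> sets (distr LC LC (rot1 \<tau>))"
  then have BL: "B \<in> sets LC" by simp
  then have B: "B \<in> sets borel" "B \<subseteq> circle" by (auto simp: sets_restrict_space_iff)
  \<comment> \<open>Points landing at or beyond \<open>\<tau>\<close> come from a shift without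
    wrapping, those below \<open>\<tau>\<close> from a shift by \<open>\<tau> - 2 * pi\<close>.
    Lebesgue measure thus sees two translations with disjoint images.\<close>
  define B1 where "B1 = B \<inter> {\<tau>..}" define B2 where "B2 = B \<inter> {..<\<tau>}"
  have Bs: "B1 \<in> sets borel" "B2 \<in> sets borel" using B by (auto simp: B1_def B2_def)
  have eq: "rot1 \<tau> -` B \<inter> circle = {x. \<tau> + x \<in> B1} \<union> {x. (\<tau> - 2 * pi) + x \<in> B2}"
  proof (intro set_eqI iffI)
    fix x assume "x \<in> rot1 \<tau> -` B \<inter> circle"
    then show "x \<in> {x. \<tau> + x \<in> B1} \<union> {x. (\<tau> - 2 * pi) + x \<in> B2}"
      using rot1_cases[OF assms, of x] by (auto simp: B1_def B2_def circle_def add.commute algebra_simps split: if_splits)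
  next
    fix x assume x: "x \<in> {x. \<tau> + x \<in> B1} \<union> {x. (\<tau> - 2 * pi) + x \<in> B2}"
    have c: "x \<in> circle"
    proof (cases "\<tau> + x \<in> B1")
      case True
      then have "\<tau> + x \<in> circle" "\<tau> \<le> \<tau> + x" using B(2) by (auto simp: B1_def)
      then show ?thesis using assms by (auto simp: circle_def)
    next
      case False
      then have "(\<tau> - 2 * pi) + x \<in> B2" using x by auto
      then have "(\<tau> - 2 * pi) + x \<in> circle" "(\<tau> - 2 * pi) + x < \<tau>" using B(2) by (auto simp: B2_def)
      then show ?thesis using assms by (auto simp: circle_def)
    qed
    have bc: "y \<in> circle" if "y \<in> B" for y using that B(2) by auto
    show "x \<in> rot1 \<tau> -` B \<inter> circle"
      using x rot1_cases[OF assms c] c bc[of "\<tau> + x"] bc[of "\<tau> - 2 * pi + x"]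
      by (auto simp: B1_def B2_def circle_def add.commute algebra_simps split: if_splits)
  qed
  have m: "{x. c + x \<in> A} \<in> sets borel" if "A \<in> sets borel" for c and A :: "real set"
    using measurable_sets[of "\<lambda>x. c + x" borel borel A] that by (simp add: vimage_def)
  have "emeasure (distr LC LC (rot1 \<tau>)) B = emeasure LC (rot1 \<tau> -` B \<inter> circle)"
    using BL by (subst emeasure_distr[OF rot1_LC]) auto
  also have "\<dots> = emeasure lborel ({x. \<tau> + x \<in> B1} \<union> {x. (\<tau> - 2 * pi) + x \<in> B2})"
    using eq by (subst emeasure_restrict_space) auto
  also have "\<dots> = emeasure lborel {x. \<tau> + x \<in> B1} + emeasure lborel {x. (\<tau> - 2 * pi) + x \<in> B2}"
      proof (rule plus_emeasure[symmetric])
    show "{x. \<tau> + x \<in> B1} \<inter> {x. (\<tau> - 2 * pi) + x \<in> B2} = {}"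
    proof (rule ccontr)
      assume "{x. \<tau> + x \<in> B1} \<inter> {x. (\<tau> - 2 * pi) + x \<in> B2} \<noteq> {}"
      then obtain x where "\<tau> + x \<in> B1" "(\<tau> - 2 * pi) + x \<in> B2" by auto
      then have "\<tau> + x \<in> circle" "(\<tau> - 2 * pi) + x \<in> circle" using B(2) by (auto simp: B1_def B2_def)
      then show False by (auto simp: circle_def)
    qed
  qed (use m Bs in auto)
  also have "\<dots> = emeasure lborel B1 + emeasure lborel B2" using Bs by (simp add: emeasure_lborel_shift)
  also have "\<dots> = emeasure lborel (B1 \<union> B2)" using Bs by (intro plus_emeasure) (auto simp: B1_def B2_def)
  also have "B1 \<union> B2 = B" by (auto simp: B1_def B2_def)
  also have "emeasure lborel B = emeasure LC B" using B by (subst emeasure_restrict_space) auto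
  finally show "emeasure (distr LC LC (rot1 \<tau>)) B = emeasure LC B" .
qed simp

definition rotL :: "real => 'i set => ('i => real) => 'i => real" where
  "rotL \<tau> Y \<sigma> = (\<lambda>i\<in>Y. rot1 \<tau> (\<sigma> i))"

lemma rotL_measurable: "rotL \<tau> Y \<in> measurable (lebc Y) (lebc Y)"
  unfolding leb_prod_def rotL_def
proof (rule measurable_restrict)
  fix i assume "i \<in> Y"
  then have "(\<lambda>x. x i) \<in> measurable (PiM Y (\<lambda>_. LC)) LC" by measurable
  from measurable_compose[OF this rot1_LC] show "(\<lambda>x. rot1 \<tau> (x i)) \<in> measurable (PiM Y (\<lambda>_. LC)) LC" .
qed

lemma distr_rotL:
  assumes "0 < \<tau>" "\<tau> < 2 * pi" "finite Y" shows "distr (lebc Y) (lebc Y) (rotL \<tau> Y) = lebc Y"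
proof -
  interpret c: product_sigma_finite "\<lambda>_. LC" by (rule product_sigma_finite_LC)
  show ?thesis
  proof (rule measure_eqI_PiM_finite[OF assms(3), of _ "\<lambda>_. LC" _ "\<lambda>_. PiE Y (\<lambda>_. circle)"])
    fix A assume A: "\<And>i. i \<in> Y ==> A i \<in> sets LC"
    have bA: "PiE Y A \<in> sets (lebc Y)" unfolding leb_prod_def using A assms(3) by (intro sets_PiM_I_finite) auto
    have "rotL \<tau> Y -` PiE Y A \<inter> space (lebc Y) = PiE Y (\<lambda>i. rot1 \<tau> -` A i \<inter> circle)"
      by (auto simp: rotL_def space_leb_prod PiE_iff)
    then have "emeasure (distr (lebc Y) (lebc Y) (rotL \<tau> Y)) (PiE Y A) = emeasure (lebc Y) (PiE Y (\<lambda>i. rot1 \<tau> -` A i \<inter> circle))"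
      using emeasure_distr[OF rotL_measurable bA] by simp
    also have "\<dots> = (\<Prod>i\<in>Y. emeasure LC (rot1 \<tau> -` A i \<inter> circle))"
      unfolding leb_prod_def using measurable_sets[OF rot1_LC A] by (intro c.emeasure_PiM assms) auto
    also have "\<dots> = (\<Prod>i\<in>Y. emeasure LC (A i))"
    proof (rule prod.cong[OF refl])
      fix i assume i: "i \<in> Y"
      have "emeasure LC (A i) = emeasure (distr LC LC (rot1 \<tau>)) (A i)" by (simp add: distr_rot1[OF assms(1,2)])
      then show "emeasure LC (rot1 \<tau> -` A i \<inter> circle) = emeasure LC (A i)" using emeasure_distr[OF rot1_LC A[OF i]] by simp
    qed
    also have "\<dots> = emeasure (lebc Y) (PiE Y A)" unfolding leb_prod_def using A by (intro c.emeasure_PiM[symmetric] assms)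
    finally show "emeasure (distr (lebc Y) (lebc Y) (rotL \<tau> Y)) (PiE Y A) = emeasure (lebc Y) (PiE Y A)" .
  next
    show "emeasure (distr (lebc Y) (lebc Y) (rotL \<tau> Y)) (PiE Y (\<lambda>_. circle)) \<noteq> \<infinity>"
      using finite_measure.emeasure_finite[OF finite_measure.finite_measure_distr[OF finite_measure_lebc[OF assms(3)] rotL_measurable]] by auto
    show "range (\<lambda>_::nat. PiE Y (\<lambda>_. circle)) \<subseteq> prod_algebra Y (\<lambda>_. LC)"
      using prod_algebraI_finite[OF assms(3), of "\<lambda>_. circle" "\<lambda>_. LC"] by (auto simp: sets_restrict_space_iff)
  qed (auto simp: space_PiM leb_prod_def)
qed

abbreviation CU :: "(('d::finite) site => real) measure" where "CU \<equiv> cspace UNIV"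

lemma space_CU: "x \<in> space CU \<longleftrightarrow> (\<forall>i. x i \<in> circle)"
  by (auto simp: space_conf_space)

lemma rotate_measurable: "rotate_conf \<tau> \<in> measurable CU CU"
proof (rule measurable_cspaceI)
  fix i
  have "rot1 \<tau> \<in> measurable (restrict_space borel circle) (restrict_space borel circle)"
    using rot1_LC by (simp add: measurable_cong_sets[OF sets_LC sets_LC])
  from measurable_compose[OF cspace_component this, of i UNIV]
  show "(\<lambda>x. rotate_conf \<tau> x i) \<in> measurable CU (restrict_space borel circle)" by (simp add: rotate_conf_alt)
qed auto

lemma rotate_space: "rotate_conf \<tau> x \<in> space CU"
  by (simp add: space_CU rotate_conf_alt rot1_circle)

lemma rotate_inverse: "x \<in> space CU ==> rotate_conf (- \<tau>) (rotate_conf \<tau> x) = x" "x \<in> space CU ==> rotate_conf \<tau> (rotate_conf (- \<tau>) x) = x"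
  by (auto simp: rotate_conf_alt space_CU rot1_inverse)

lemma shift_measurable: "shift_conf k \<in> measurable CU CU"
  by (rule measurable_cspaceI) (auto simp: shift_conf_def)

lemma shift_space: "x \<in> space CU ==> shift_conf k x \<in> space CU"
  by (simp add: space_CU shift_conf_def)

lemma shift_upd: "(shift_conf k x)(i := y) = shift_conf k (x(i + k := y))"
  by (auto simp: shift_conf_def fun_eq_iff)

lemma infsum_UN_le:
  fixes f :: "'a => real"
  assumes "finite I" "\<And>i. i \<in> I ==> f summable_on R i" "\<And>i x. i \<in> I ==> x \<in> R i ==> 0 \<le> f x"
  shows "f summable_on (\<Union>i\<in>I. R i) \<and> infsum f (\<Union>i\<in>I. R i) \<le> (\<Sum>i\<in>I. infsum f (R i))"
  using assms
proof (induction I)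
  case (insert i I)
  then have IH: "f summable_on (\<Union>i\<in>I. R i)" "infsum f (\<Union>i\<in>I. R i) \<le> (\<Sum>i\<in>I. infsum f (R i))" by auto
  have s: "f summable_on R i" "f summable_on ((\<Union>i\<in>I. R i) - R i)"
    using insert IH by (auto intro: summable_on_subset_banach)
  have eq: "(\<Union>i\<in>insert i I. R i) = R i \<union> ((\<Union>i\<in>I. R i) - R i)" by auto
  have "infsum f (\<Union>i\<in>insert i I. R i) = infsum f (R i) + infsum f ((\<Union>i\<in>I. R i) - R i)"
    unfolding eq by (rule infsum_Un_disjoint[OF s]) auto
  moreover have "infsum f ((\<Union>i\<in>I. R i) - R i) \<le> infsum f (\<Union>i\<in>I. R i)"
    using s IH insert by (intro infsum_mono2) auto
  moreover have "f summable_on (\<Union>i\<in>insert i I. R i)" using IH insert by (auto intro: summable_on_union)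
  ultimately show ?case using insert IH by simp
qed auto

lemma card_hypercube: "card (hypercube n :: ('d::finite) site set) = (2 * n + 1) ^ CARD('d)"
proof -
  have "bij_betw (vec_nth :: 'd site => 'd => int) (hypercube n) (PiE UNIV (\<lambda>_. {- int n .. int n}))"
    unfolding bij_betw_def
  proof
    show "inj_on (vec_nth :: 'd site => 'd => int) (hypercube n)" by (auto simp: inj_on_def vec_eq_iff)
    show "(vec_nth :: 'd site => 'd => int) ` hypercube n = PiE UNIV (\<lambda>_. {- int n .. int n})"
    proof (intro set_eqI iffI)
      fix f :: "'d => int" assume "f \<in> PiE UNIV (\<lambda>_. {- int n .. int n})"
      then have "- int n \<le> f k \<and> f k \<le> int n" for k by auto
      then have "(\<chi> k. f k) \<in> (hypercube n :: 'd site set)" by (auto simp: hypercube_def abs_le_iff minus_le_iff)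
      then show "f \<in> vec_nth ` hypercube n" by (intro image_eqI[of _ _ "\<chi> k. f k"]) auto
    qed (auto simp: hypercube_def abs_le_iff minus_le_iff)
  qed
  then have "card (hypercube n :: 'd site set) = card (PiE (UNIV :: 'd set) (\<lambda>_. {- int n .. int n}))" by (rule bij_betw_same_card)
  also have "\<dots> = (2 * n + 1) ^ CARD('d)" 
  proof -
    have "card {- int n .. int n} = 2 * n + 1" by simp
    then show ?thesis by (simp only: card_PiE[OF finite_class.finite_UNIV] prod_constant)
  qed
  finally show ?thesis .
qed

locale clock_model = dobrushin_potential \<Phi> q for \<Phi> :: "('d::finite) potential" and q +
  fixes \<tau> :: real
  assumes ti: "translation_invariant_potential \<Phi>" and ri: "rotation_invariant_potential \<Phi>"
    and tau: "0 < \<tau>" "\<tau> < 2 * pi / real q"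
begin

abbreviation cube :: "nat => 'd site set" where "cube \<equiv> hypercube"

lemma tau2: "\<tau> < 2 * pi"
proof -
  have "2 * pi / real q \<le> 2 * pi / 1" using q by (intro divide_left_mono) auto
  then show ?thesis using tau(2) by simp
qed

lemma CU_PiE: "x \<in> space CU \<longleftrightarrow> x \<in> UNIV \<rightarrow>\<^sub>E circle" by (simp add: space_conf_space)

lemma H_rotate: "x \<in> space CU ==> H V D (rotate_conf t x) = H V D x"
  unfolding H_def using ri bondsD unfolding rotation_invariant_potential_def CU_PiE by (intro infsum_cong) metis

lemma wt_rotate: "x \<in> space CU ==> wt V D (rotate_conf t x) = wt V D x"
  by (simp add: wt_def H_rotate)

abbreviation tr :: "'d site => 'd site set => 'd site set" where "tr k \<equiv> (`) (\<lambda>i. i + k)"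

lemma tr_inj: "inj (tr k)"
proof (rule injI)
  fix A B assume "tr k A = tr k B"
  then have "tr (- k) (tr k A) = tr (- k) (tr k B)" by simp
  then show "A = B" by (simp add: image_image)
qed

lemma tr_inverse: "tr k (tr (- k) A) = A" "tr (- k) (tr k A) = A"
  by (simp_all add: image_image)

lemma tr_bonds: "bonds UNIV (tr k D) = tr k ` bonds UNIV D"
proof (intro set_eqI iffI)
  fix A assume A: "A \<in> bonds UNIV (tr k D)"
  have "tr (- k) A \<in> bonds UNIV D" using A by (force simp: bonds_def)
  then show "A \<in> tr k ` bonds UNIV D" by (intro image_eqI[of _ _ "tr (- k) A"]) (simp_all only: tr_inverse)
qed (auto simp: bonds_def)

lemma H_shift: assumes "x \<in> space CU" shows "H UNIV (tr k D) x = H UNIV D (shift_conf k x)"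
proof -
  have "H UNIV (tr k D) x = (\<Sum>\<^sub>\<infinity>A\<in>bonds UNIV D. \<Phi> (tr k A) x)"
    unfolding H_def tr_bonds infsum_reindex[OF inj_on_subset[OF tr_inj subset_UNIV]] o_def ..
  also have "\<dots> = H UNIV D (shift_conf k x)"
    unfolding H_def using ti assms bondsD unfolding translation_invariant_potential_def CU_PiE by (intro infsum_cong) metis
  finally show ?thesis .
qed

lemma wt_shift: "x \<in> space CU ==> wt UNIV {i + k} x = wt UNIV {i} (shift_conf k x)"
  using H_shift[of x k "{i}"] by (simp add: wt_def)

lemma nrm_tr: assumes "finite A" shows "nrm (tr k A) = nrm A"
proof -
  have "(\<lambda>\<eta>. \<bar>\<Phi> (tr k A) \<eta>\<bar>) ` (UNIV \<rightarrow>\<^sub>E circle) = (\<lambda>\<eta>. \<bar>\<Phi> A \<eta>\<bar>) ` (UNIV \<rightarrow>\<^sub>E circle)"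
  proof (intro set_eqI iffI)
    fix y assume "y \<in> (\<lambda>\<eta>. \<bar>\<Phi> (tr k A) \<eta>\<bar>) ` (UNIV \<rightarrow>\<^sub>E circle)"
    then obtain x where x: "x \<in> UNIV \<rightarrow>\<^sub>E circle" "y = \<bar>\<Phi> A (shift_conf k x)\<bar>"
      using ti assms unfolding translation_invariant_potential_def by auto
    then show "y \<in> (\<lambda>\<eta>. \<bar>\<Phi> A \<eta>\<bar>) ` (UNIV \<rightarrow>\<^sub>E circle)" by (intro image_eqI[of _ _ "shift_conf k x"]) (auto simp: shift_conf_def)
  next
    fix y assume "y \<in> (\<lambda>\<eta>. \<bar>\<Phi> A \<eta>\<bar>) ` (UNIV \<rightarrow>\<^sub>E circle)"
    then obtain x where x: "x \<in> UNIV \<rightarrow>\<^sub>E circle" "y = \<bar>\<Phi> A x\<bar>" by auto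
    have "x = shift_conf k (shift_conf (- k) x)" by (simp add: shift_conf_def)
    then have "y = \<bar>\<Phi> (tr k A) (shift_conf (- k) x)\<bar>"
      using ti assms x unfolding translation_invariant_potential_def by (metis CU_PiE shift_space)
    then show "y \<in> (\<lambda>\<eta>. \<bar>\<Phi> (tr k A) \<eta>\<bar>) ` (UNIV \<rightarrow>\<^sub>E circle)"
      using x by (intro image_eqI[of _ _ "shift_conf (- k) x"]) (auto simp: shift_conf_def)
  qed
  then show ?thesis by (simp add: nrm_def sup_norm_def)
qed

text \<open>Translation invariance of the potential makes shifting the configuration the same as
  moving the resampled site.\<close>

lemma K_shift_conf:
  assumes E: "fatrel E" and f: "bm CU f" and x: "x \<in> space CU"
  shows "K UNIV E {i} f (shift_conf k x) = K UNIV E {i + k} (\<lambda>x. f (shift_conf k x)) x"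
proof -
  interpret a: pot_resample \<Phi> E UNIV "{i}" using E by unfold_locales auto
  interpret b: pot_resample \<Phi> E UNIV "{i + k}" using E by unfold_locales auto
  have "num UNIV E {i} g (shift_conf k x) = num UNIV E {i + k} (\<lambda>x. g (shift_conf k x)) x" if g: "bm CU g" for g
  proof -
    have g': "bm CU (\<lambda>x. g (shift_conf k x))" by (rule bm_compose[OF g shift_measurable])
    have "num UNIV E {i} g (shift_conf k x) = (LINT y|LC. of_bool (E (x (i + k)) y) * (wt UNIV {i} (shift_conf k (x(i + k := y))) * g (shift_conf k (x(i + k := y)))))"
      unfolding num_def J_single[OF E UNIV_I a.bm_wf[OF g] shift_space[OF x]] shift_upd by (simp add: shift_conf_def)
    also have "\<dots> = (LINT y|LC. of_bool (E (x (i + k)) y) * (wt UNIV {i + k} (x(i + k := y)) * g (shift_conf k (x(i + k := y)))))"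
      using x by (intro icong refl) (simp add: wt_shift[OF upd_space])
    also have "\<dots> = num UNIV E {i + k} (\<lambda>x. g (shift_conf k x)) x"
      unfolding num_def J_single[OF E UNIV_I b.bm_wf[OF g'] x] ..
    finally show ?thesis .
  qed
  from this[OF f] this[OF bm_const, of 1] show ?thesis by (simp add: K_def)
qed

text \<open>Each crossing bond is charged to the sites of the cube it contains. At depth at least
  \<open>r\<close> such a bond must leave the cube of radius \<open>r\<close> around its site, so it
  falls into the tail; the sites of the remaining shell are charged the full norm
  \<open>Nrm {0}\<close>.\<close>

lemma Bd_le:
  fixes r n :: nat
  assumes tail: "(\<Sum>\<^sub>\<infinity>A\<in>{A. finite A \<and> 0 \<in> A \<and> \<not> A \<subseteq> hypercube r}. nrm A) \<le> \<epsilon>" and "r \<le> n"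
  shows "Bd (cube n) \<le> \<epsilon> * card (cube n) +
     Nrm {0} * (real (card (cube n)) - real (card (hypercube (n - r) :: 'd site set)))"
proof -
  let ?L = "cube n"
  let ?R = "\<lambda>i. {A. finite A \<and> i \<in> A \<and> \<not> A \<subseteq> ?L}"
  have sR: "nrm summable_on {A. finite A \<and> i \<in> A}" for i
    using is_pot unfolding is_potential_def nrm_def by blast
  have tr0: "(\<Sum>\<^sub>\<infinity>A\<in>tr i ` Q. nrm A) = (\<Sum>\<^sub>\<infinity>A\<in>Q. nrm A)" if "Q \<subseteq> Collect finite" for i Q
  proof -
    have "(\<Sum>\<^sub>\<infinity>A\<in>tr i ` Q. nrm A) = (\<Sum>\<^sub>\<infinity>A\<in>Q. nrm (tr i A))"
      unfolding infsum_reindex[OF inj_on_subset[OF tr_inj subset_UNIV]] o_def ..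
    also have "\<dots> = (\<Sum>\<^sub>\<infinity>A\<in>Q. nrm A)" using that by (intro infsum_cong) (auto intro: nrm_tr)
    finally show ?thesis .
  qed
  have "(\<Union>i\<in>?L. ?R i) = {A. finite A \<and> A \<inter> ?L \<noteq> {} \<and> \<not> A \<subseteq> ?L}" by auto
  then have "Bd ?L \<le> (\<Sum>i\<in>?L. infsum nrm (?R i))"
    using infsum_UN_le[of ?L nrm ?R] finite_hypercube[of n] nrm_nonneg unfolding Bd_def
    by (auto intro: summable_on_subset_banach[OF sR])
  also have "\<dots> \<le> (\<Sum>i\<in>?L. if i \<in> hypercube (n - r) then \<epsilon> else Nrm {0})"
  proof (rule sum_mono)
    fix i assume "i \<in> ?L"
    have mono: "infsum nrm (?R i) \<le> infsum nrm (tr i ` Q)" if "?R i \<subseteq> tr i ` Q" "Q \<subseteq> {A. finite A \<and> 0 \<in> A}" for Q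
    proof (rule infsum_mono2)
      show "nrm summable_on ?R i" by (rule summable_on_subset_banach[OF sR[of i]]) auto
      show "nrm summable_on tr i ` Q" by (rule summable_on_subset_banach[OF sR[of i]]) (use that(2) in force)
    qed (use that in \<open>auto intro!: nrm_nonneg\<close>)
    have un: "A = tr i (tr (- i) A)" for A using tr_inverse(1)[of i A] by simp
    show "infsum nrm (?R i) \<le> (if i \<in> hypercube (n - r) then \<epsilon> else Nrm {0})"
    proof (cases "i \<in> hypercube (n - r)")
      case True
      have "?R i \<subseteq> tr i ` {A. finite A \<and> 0 \<in> A \<and> \<not> A \<subseteq> hypercube r}"
      proof
        fix A assume A: "A \<in> ?R i"
        have "\<not> tr (- i) A \<subseteq> hypercube r"
        proof
          assume s: "tr (- i) A \<subseteq> hypercube r"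
          have "A \<subseteq> ?L"
          proof
            fix j assume "j \<in> A"
            then have "j + - i \<in> hypercube r" using s by blast
            then have jk: "\<bar>j $ k - i $ k\<bar> \<le> int r" "\<bar>i $ k\<bar> \<le> int (n - r)" for k using True by (auto simp: hypercube_def)
            have "\<bar>j $ k\<bar> \<le> int n" for k using jk[of k] \<open>r \<le> n\<close> by linarith
            then show "j \<in> ?L" by (simp add: hypercube_def)
          qed
          then show False using A by auto
        qed
        moreover have "finite (tr (- i) A)" "0 \<in> tr (- i) A" using A by (auto intro: image_eqI[of _ _ i])
        ultimately show "A \<in> tr i ` {A. finite A \<and> 0 \<in> A \<and> \<not> A \<subseteq> hypercube r}" using un[of A] by blast
      qed
      moreover have "{A :: 'd site set. finite A \<and> 0 \<in> A \<and> \<not> A \<subseteq> hypercube r} \<subseteq> {A. finite A \<and> 0 \<in> A}"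
        "{A :: 'd site set. finite A \<and> 0 \<in> A \<and> \<not> A \<subseteq> hypercube r} \<subseteq> Collect finite" by blast+
      ultimately have "infsum nrm (?R i) \<le> infsum nrm {A. finite A \<and> 0 \<in> A \<and> \<not> A \<subseteq> hypercube r}"
        using mono[of "{A. finite A \<and> 0 \<in> A \<and> \<not> A \<subseteq> hypercube r}"] tr0[of "{A. finite A \<and> 0 \<in> A \<and> \<not> A \<subseteq> hypercube r}" i] by linarith
      then show ?thesis using tail True by simp
    next
      case False
      have "?R i \<subseteq> tr i ` {A. finite A \<and> 0 \<in> A}"
      proof
        fix A assume A: "A \<in> ?R i"
        have "finite (tr (- i) A)" "0 \<in> tr (- i) A" using A by (auto intro: image_eqI[of _ _ i])
        then show "A \<in> tr i ` {A. finite A \<and> 0 \<in> A}" using un[of A] by blast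
      qed
      from mono[OF this] have "infsum nrm (?R i) \<le> infsum nrm {A :: 'd site set. finite A \<and> 0 \<in> A}"
        using tr0[of "{A. finite A \<and> 0 \<in> A}" i, OF Collect_mono] by simp
      moreover have "Nrm {0} = infsum nrm {A. finite A \<and> 0 \<in> A}"
        unfolding Nrm_def by (rule arg_cong[of _ _ "infsum nrm"]) (auto simp: bonds_def)
      ultimately show ?thesis using False by simp
    qed
  qed
  also have "\<dots> = (\<Sum>i\<in>?L \<inter> hypercube (n - r). \<epsilon>) + (\<Sum>i\<in>?L - hypercube (n - r). Nrm {0})"
    by (subst sum.If_cases) (auto simp: finite_hypercube Diff_eq)
  also have "?L \<inter> hypercube (n - r) = hypercube (n - r)" using hypercube_mono[of "n - r" n] by auto
  also have "(\<Sum>i\<in>(hypercube (n - r) :: 'd site set). \<epsilon>) + (\<Sum>i\<in>?L - hypercube (n - r). Nrm {0}) =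
      \<epsilon> * card (hypercube (n - r) :: 'd site set) + Nrm {0} * (real (card ?L) - real (card (hypercube (n - r) :: 'd site set)))"
  proof -
    have "card (?L - hypercube (n - r)) = card ?L - card (hypercube (n - r) :: 'd site set)"
      by (rule card_Diff_subset[OF finite_hypercube hypercube_mono]) simp
    moreover have "card (hypercube (n - r) :: 'd site set) \<le> card ?L"
      by (rule card_mono[OF finite_hypercube hypercube_mono]) simp
    ultimately show ?thesis by (simp add: of_nat_diff mult.commute)
  qed
  also have "\<dots> \<le> \<epsilon> * card ?L + Nrm {0} * (real (card ?L) - real (card (hypercube (n - r) :: 'd site set)))"
  proof -
    have "0 \<le> \<epsilon>" using tail by (rule order_trans[rotated]) (auto intro!: infsum_nonneg nrm_nonneg)
    then show ?thesis using hypercube_mono[of "n - r" n] finite_hypercube by (intro add_right_mono mult_left_mono) (auto intro: card_mono)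
  qed
  finally show ?thesis .
qed

text \<open>A radius \<open>r\<close> makes the tail at most \<open>e / 4\<close>; for this fixed
  \<open>r\<close> the shell of thickness \<open>r\<close> has vanishing proportion in the
  cube.\<close>

lemma Bd_density: "(\<lambda>n. Bd (cube n) / card (cube n)) \<longlonglongrightarrow> 0"
proof (rule LIMSEQ_I)
  fix e :: real assume e: "0 < e"
  let ?F = "{A :: 'd site set. finite A \<and> 0 \<in> A}"
  have sm: "nrm summable_on ?F" using is_pot unfolding is_potential_def nrm_def by blast
  have "(nrm has_sum infsum nrm ?F) ?F" using sm by simp
  then have "\<forall>\<^sub>F X in finite_subsets_at_top ?F. dist (sum nrm X) (infsum nrm ?F) < e / 4"
    unfolding has_sum_def by (rule tendstoD) (use e in simp)
  then obtain X where X: "finite X" "X \<subseteq> ?F" "dist (sum nrm X) (infsum nrm ?F) < e / 4"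
    by (auto simp: eventually_finite_subsets_at_top)
  have "finite (\<Union>X)" using X by auto
  then obtain r where r: "\<Union>X \<subseteq> hypercube r" using hypercube_exhausts by blast
  have sX: "nrm summable_on X" "nrm summable_on (?F - X)" using sm X by (auto intro: summable_on_subset_banach)
  have "infsum nrm ?F = sum nrm X + infsum nrm (?F - X)"
    using infsum_Un_disjoint[OF sX] X by (simp add: Un_absorb1)
  then have "infsum nrm (?F - X) \<le> e / 4" using X(3) by (simp add: dist_real_def)
  moreover have "infsum nrm {A. finite A \<and> 0 \<in> A \<and> \<not> A \<subseteq> hypercube r} \<le> infsum nrm (?F - X)"
  proof (rule infsum_mono2[OF _ sX(2)])
    show "nrm summable_on {A. finite A \<and> 0 \<in> A \<and> \<not> A \<subseteq> hypercube r}" by (rule summable_on_subset_banach[OF sm]) auto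
  qed (use r in \<open>auto intro: nrm_nonneg\<close>)
  ultimately have tail: "infsum nrm {A. finite A \<and> 0 \<in> A \<and> \<not> A \<subseteq> hypercube r} \<le> e / 4" by linarith
  let ?c = "\<lambda>n. real (card (cube n))"
  have cpos: "0 < ?c n" for n unfolding card_hypercube by simp
  have "(\<lambda>n. (1 - 2 * real r / (2 * real n + 1)) ^ CARD('d)) \<longlonglongrightarrow> (1 - 0) ^ CARD('d)"
  proof (intro tendsto_power tendsto_diff tendsto_const)
    have "(\<lambda>n. 2 * real r * inverse (real (Suc n))) \<longlonglongrightarrow> 2 * real r * 0"
      by (intro tendsto_mult tendsto_const LIMSEQ_inverse_real_of_nat)
    then have z: "(\<lambda>n. 2 * real r * inverse (real (Suc n))) \<longlonglongrightarrow> 0" by simp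
    have le: "2 * real r / (2 * real n + 1) \<le> 2 * real r * inverse (real (Suc n))" for n
      unfolding divide_inverse by (intro mult_left_mono le_imp_inverse_le) auto
    show "(\<lambda>n. 2 * real r / (2 * real n + 1)) \<longlonglongrightarrow> 0"
      by (rule Lim_null_comparison[OF _ z]) (use le in \<open>simp add: always_eventually\<close>)
  qed
  then have "(\<lambda>n. Nrm {0} * (1 - (1 - 2 * real r / (2 * real n + 1)) ^ CARD('d))) \<longlonglongrightarrow> Nrm {0} * (1 - 1)"
    by (intro tendsto_intros) simp
  from LIMSEQ_D[OF this, of "e / 4"] e
  obtain n0 where n0: "\<And>n. n \<ge> n0 ==> \<bar>Nrm {0} * (1 - (1 - 2 * real r / (2 * real n + 1)) ^ CARD('d))\<bar> < e / 4"
    by auto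
  have "norm (Bd (cube n) / ?c n - 0) < e" if n: "n \<ge> max n0 r" for n
  proof -
    have nr: "r \<le> n" using n by simp
    have "1 - 2 * real r / (2 * real n + 1) = (2 * real (n - r) + 1) / (2 * real n + 1)"
      using nr by (simp add: of_nat_diff field_simps)
    then have eq: "?c (n - r) / ?c n = (1 - 2 * real r / (2 * real n + 1)) ^ CARD('d)"
      unfolding card_hypercube by (simp add: power_divide add.commute)
    have "Bd (cube n) / ?c n \<le> (e / 4 * ?c n + Nrm {0} * (?c n - ?c (n - r))) / ?c n"
      by (rule divide_right_mono[OF Bd_le[OF tail nr]]) simp
    also have "\<dots> = e / 4 + Nrm {0} * (1 - ?c (n - r) / ?c n)" using cpos[of n] by (simp add: field_simps)
    also have "\<dots> < e" using n0[of n] n e unfolding eq by (auto simp: abs_less_iff)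
    finally show ?thesis using Bd_nonneg[of "hypercube n"] cpos[of n] by simp
  qed
  then show "\<exists>no. \<forall>n\<ge>no. norm (Bd (cube n) / ?c n - 0) < e" by blast
qed

end

section \<open>Lifting discrete measures\<close>

text \<open>The tangent to the exponential at \<open>c\<close>, the logarithm of the mean of
  \<open>exp (X x)\<close>, lies below the graph; integrating it gives the inequality.\<close>

lemma jensen_exp:
  assumes "prob_space M" "bm M X" shows "(LINT x|M. X x) \<le> ln (LINT x|M. exp (X x))" and "0 < (LINT x|M. exp (X x))"
proof -
  interpret prob_space M by fact
  obtain b where b: "\<And>x. x \<in> space M ==> \<bar>X x\<bar> \<le> b" using bm_bounded[OF assms(2)] by blast
  have e: "bm M (\<lambda>x. exp (X x))" using assms(2) by (rule bm_exp)
  note int = prob_integrable[OF prob_space_axioms]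
  have "exp (- b) = (LINT x|M. exp (- b))" by (simp add: prob_space)
  also have "\<dots> \<le> (LINT x|M. exp (X x))"
    using b by (intro integral_mono int bm_const e) (auto simp: abs_le_iff minus_le_iff)
  finally show pos: "0 < (LINT x|M. exp (X x))" by (smt (verit) exp_gt_zero)
  define c where "c = ln (LINT x|M. exp (X x))"
  have ec: "exp c = (LINT x|M. exp (X x))" using pos by (simp add: c_def)
  have "(LINT x|M. exp c * (1 + (X x - c))) \<le> (LINT x|M. exp (X x))"
  proof (intro integral_mono int e)
    show "bm M (\<lambda>x. exp c * (1 + (X x - c)))" using assms(2) by (intro bm_mult bm_add bm_diff bm_const)
    fix x
    have "exp c * (1 + (X x - c)) \<le> exp c * exp (X x - c)" by (intro mult_left_mono exp_ge_add_one_self) auto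
    then show "exp c * (1 + (X x - c)) \<le> exp (X x)" by (simp add: exp_diff)
  qed
  moreover have "(LINT x|M. exp c * (1 + (X x - c))) = exp c * (1 + ((LINT x|M. X x) - c))"
    using int[OF assms(2)] by (simp add: prob_space)
  ultimately have "exp c * (1 + ((LINT x|M. X x) - c)) \<le> exp c * 1" using ec by (metis mult.right_neutral)
  then have "1 + ((LINT x|M. X x) - c) \<le> 1" using mult_le_cancel_left_pos[OF exp_gt_zero] by blast
  then show "(LINT x|M. X x) \<le> ln (LINT x|M. exp (X x))" unfolding c_def[symmetric] by simp
qed

context clock_model
begin

abbreviation Om :: "('d, nat) conf measure" where "Om \<equiv> Omega q"

definition tmap :: "('d, real) conf => ('d, nat) conf" where "tmap x = (\<lambda>i. coarse q (x i))"

lemma tmap_space: "x \<in> space CU ==> tmap x \<in> space Om"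
  using coarse_less[OF q] by (auto simp: space_CU space_Omega tmap_def)

lemma tmap_measurable: "tmap \<in> measurable CU Om"
  unfolding Omega_def
proof (rule measurable_PiM_single')
  fix i :: "'d site"
  have "(\<lambda>x. coarse q (x i)) \<in> measurable CU (count_space UNIV)"
    using measurable_compose[OF cspace_component[OF UNIV_I] measurable_restrict_space1[OF coarse_borel]] .
  then have "(\<lambda>x. coarse q (x i)) \<in> measurable CU (restrict_space (count_space UNIV) {..<q})"
    using coarse_less[OF q] by (intro measurable_restrict_space2) (auto simp: space_CU)
  then show "(\<lambda>x. tmap x i) \<in> measurable CU (count_space {..<q})" by (simp add: tmap_def restrict_count_space)
qed (use coarse_less[OF q] in \<open>auto simp: tmap_def space_CU\<close>)

lemma cgO:
  assumes "s \<in> space Om"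
  shows "invar UNIV C1 (cg UNIV s)" "prob_space (cg UNIV s)" "sets (cg UNIV s) = sets CU" "space (cg UNIV s) = space CU"
    "AE x in cg UNIV s. tmap x = s"
proof -
  have s: "\<And>i. i \<in> UNIV ==> s i < q" using OmegaD[OF assms] .
  show inv: "invar UNIV C1 (cg UNIV s)" by (rule cg(1)) (rule s)
  show "prob_space (cg UNIV s)" "sets (cg UNIV s) = sets CU" "space (cg UNIV s) = space CU" using invarD[OF inv] .
  have "AE x in cg UNIV s. same UNIV (cellpt UNIV s) x" by (rule cg(2)) (rule s)
  moreover have "coarse q (cellpt UNIV s i) = s i" for i by (rule cellpt(2)) (use s in auto)
  ultimately show "AE x in cg UNIV s. tmap x = s" by (auto simp: same_def cellrel_def tmap_def fun_eq_iff)
qed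

lemma cgO_unique:
  assumes "s \<in> space Om" "invar UNIV C1 \<mu>" "AE x in \<mu>. tmap x = s" shows "\<mu> = cg UNIV s"
proof (rule cg(7)[OF _ assms(2)])
  show s: "\<And>i. i \<in> UNIV ==> s i < q" using OmegaD[OF assms(1)] .
  have c: "coarse q (cellpt UNIV s i) = s i" for i by (rule cellpt(2)) (use s in auto)
  have "same UNIV (cellpt UNIV s) x" if "tmap x = s" for x
    using c fun_cong[OF that] by (simp add: same_def cellrel_def tmap_def)
  then have "AE x in \<mu>. tmap x = s \<longrightarrow> same UNIV (cellpt UNIV s) x"
    by (intro always_eventually allI impI)
  from AE_mp[OF assms(3) this] show "AE x in \<mu>. same UNIV (cellpt UNIV s) x" .
qed

definition lift :: "('d, nat) conf measure => ('d, real) conf measure" where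
  "lift \<nu> = bind \<nu> (cg UNIV)"

definition pm :: "('d, nat) conf measure => bool" where
  "pm \<nu> \<longleftrightarrow> prob_space \<nu> \<and> sets \<nu> = sets Om"

lemma pmD: "pm \<nu> ==> prob_space \<nu>" "pm \<nu> ==> sets \<nu> = sets Om" "pm \<nu> ==> space \<nu> = space Om"
  "pm \<nu> ==> bm \<nu> f = bm Om f"
  using sets_eq_imp_space_eq[of \<nu> Om] bm_sets_cong[of \<nu> Om f] by (auto simp: pm_def)

lemma pm_int: "pm \<nu> ==> bm Om f ==> integrable \<nu> f"
  using prob_integrable[OF pmD(1), of \<nu> f] pmD(4)[of \<nu> f] by simp

lemma bm_cg: assumes f: "bm (cspace V) f" shows "bm Om (\<lambda>s. LINT x|cg V s. f x)"
proof -
  obtain b where b: "\<And>x. x \<in> cs V ==> \<bar>f x\<bar> \<le> b" using bm_bounded[OF f] by blast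
  have "(\<lambda>M. LINT x|M. f x) \<in> borel_measurable (subprob_algebra (cspace V))"
    by (rule integral_measurable_subprob_algebra[OF bm_measurable[OF f]])
  from measurable_compose[OF measurable_prob_algebraD[OF cg_measurable] this]
  have "(\<lambda>s. LINT x|cg V s. f x) \<in> borel_measurable Om" .
  then show ?thesis
  proof (rule bmI[of _ _ b])
    fix s assume s: "s \<in> space Om"
    have "invar V C1 (cg V s)" by (rule cg(1)) (rule OmegaD[OF s])
    note c = invarD[OF this]
    show "\<bar>LINT x|cg V s. f x\<bar> \<le> b"
      using f b c(3) bm_sets_cong[OF c(2)] by (intro prob_abs_integral_le c(1)) simp_all
  qed
qed

lemma lift:
  assumes \<nu>: "pm \<nu>"
  shows "prob_space (lift \<nu>)" "sets (lift \<nu>) = sets CU" "space (lift \<nu>) = space CU"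
    "bm CU f ==> integrable (lift \<nu>) f"
    "bm CU f ==> (LINT x|lift \<nu>. f x) = (LINT s|\<nu>. (LINT x|cg UNIV s. f x))"
proof -
  have m: "\<nu> \<in> space (prob_algebra Om)" using \<nu> by (simp add: space_prob_algebra pm_def)
  show 1: "prob_space (lift \<nu>)" unfolding lift_def by (rule prob_space_bind'[OF m cg_measurable])
  show 2: "sets (lift \<nu>) = sets CU" unfolding lift_def by (rule sets_bind'[OF m cg_measurable])
  show "space (lift \<nu>) = space CU" using 2 by (rule sets_eq_imp_space_eq)
  show "bm CU f ==> integrable (lift \<nu>) f" using 1 2 by (auto intro!: prob_integrable simp: bm_sets_cong[OF 2])
  have k: "cg UNIV \<in> measurable \<nu> (subprob_algebra CU)"
    unfolding measurable_cong_sets[OF pmD(2)[OF \<nu>] refl] by (rule measurable_prob_algebraD[OF cg_measurable])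
  show "(LINT x|lift \<nu>. f x) = (LINT s|\<nu>. (LINT x|cg UNIV s. f x))" if f: "bm CU f"
  proof -
    obtain b where b: "\<And>x. x \<in> space CU ==> \<bar>f x\<bar> \<le> b" using bm_bounded[OF f] by blast
    show ?thesis unfolding lift_def
    proof (rule integral_bind[where K = CU and B' = 1 and B = b])
      show "finite_measure \<nu>" using pmD(1)[OF \<nu>] by (rule prob_space.finite_measure)
      show "f \<in> borel_measurable CU" using f by (rule bm_measurable)
      show "cg UNIV \<in> measurable \<nu> (subprob_algebra CU)" by (rule k)
      show "AE x in \<nu>. emeasure (cg UNIV x) (space (cg UNIV x)) \<le> ennreal 1"
      proof (rule AE_I2)
        fix s assume "s \<in> space \<nu>"
        then have "prob_space (cg UNIV s)" using pmD(3)[OF \<nu>] by (intro cgO(2)) simp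
        from prob_space.emeasure_space_1[OF this] show "emeasure (cg UNIV s) (space (cg UNIV s)) \<le> ennreal 1" by simp
      qed
    qed (rule b)
  qed
qed

lemma bm_tmap: "bm Om g ==> bm CU (\<lambda>x. g (tmap x))"
  by (rule bm_compose[OF _ tmap_measurable])

lemma cg_pull:
  assumes s: "s \<in> space Om" and f: "bm CU f" and g: "bm Om g"
  shows "(LINT x|cg UNIV s. g (tmap x) * f x) = g s * (LINT x|cg UNIV s. f x)"
proof -
  have "(LINT x|cg UNIV s. g (tmap x) * f x) = (LINT x|cg UNIV s. g s * f x)"
  proof (rule integral_cong_AE)
    show "AE x in cg UNIV s. g (tmap x) * f x = g s * f x" using cgO(5)[OF s] by eventually_elim simp
    show "(\<lambda>x. g (tmap x) * f x) \<in> borel_measurable (cg UNIV s)" "(\<lambda>x. g s * f x) \<in> borel_measurable (cg UNIV s)"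
      using bm_measurable[OF bm_mult[OF bm_tmap[OF g] f]] bm_measurable[OF f] by (simp_all add: measurable_cong_sets[OF cgO(3)[OF s] refl])
  qed
  then show ?thesis by simp
qed

lemma lift_pull:
  assumes \<nu>: "pm \<nu>" and f: "bm CU f" and g: "bm Om g"
  shows "(LINT x|lift \<nu>. g (tmap x) * f x) = (LINT s|\<nu>. g s * (LINT x|cg UNIV s. f x))"
  unfolding lift(5)[OF \<nu> bm_mult[OF bm_tmap[OF g] f]]
  using pmD(3)[OF \<nu>] cg_pull[OF _ f g] by (intro icong) auto

lemma lift_tmap: assumes "pm \<nu>" "bm Om g" shows "(LINT x|lift \<nu>. g (tmap x)) = (LINT s|\<nu>. g s)"
proof -
  have "(LINT x|lift \<nu>. g (tmap x)) = (LINT s|\<nu>. g s * (LINT x|cg UNIV s. 1))"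
    using lift_pull[OF assms(1) bm_const assms(2), of 1] by simp
  also have "\<dots> = (LINT s|\<nu>. g s)"
    using pmD(3)[OF assms(1)] prob_space.prob_space[OF cgO(2)] cgO(4) by (intro icong) auto
  finally show ?thesis .
qed

lemma lift_invar: assumes "pm \<nu>" shows "invar UNIV C1 (lift \<nu>)"
  unfolding invar_def
proof (intro conjI ballI allI impI lift(1,2)[OF assms])
  fix i and f :: "('d, real) conf => real" assume f: "bm CU f"
  interpret pot_resample \<Phi> C1 UNIV "{i}" using fat by unfold_locales auto
  show "(LINT x|lift \<nu>. K UNIV C1 {i} f x) = (LINT x|lift \<nu>. f x)"
    unfolding lift(5)[OF assms bm_K[OF f]] lift(5)[OF assms f]
  proof (rule icong[OF refl])
    fix s assume "s \<in> space \<nu>"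
    then have "invar UNIV C1 (cg UNIV s)" using pmD(3)[OF assms] by (intro cgO(1)) simp
    then show "(LINT x|cg UNIV s. K UNIV C1 {i} f x) = (LINT x|cg UNIV s. f x)" using f unfolding invar_def by blast
  qed
qed

text \<open>The measure \<lambda> of the overview; \<lambda>' is the lift of the evolved
  measure.\<close>

definition lam :: "('d, nat) conf measure => ('d, real) conf measure" where
  "lam \<nu> = distr (lift \<nu>) CU (rotate_conf \<tau>)"

lemma rot_lift: "pm \<nu> ==> rotate_conf \<tau> \<in> measurable (lift \<nu>) CU"
  using rotate_measurable by (simp add: measurable_cong_sets[OF lift(2) refl])

lemma lam:
  assumes "pm \<nu>"
  shows "prob_space (lam \<nu>)" "sets (lam \<nu>) = sets CU" "space (lam \<nu>) = space CU"
    "bm CU f ==> (LINT x|lam \<nu>. f x) = (LINT x|lift \<nu>. f (rotate_conf \<tau> x))"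
  unfolding lam_def using prob_space.prob_space_distr[OF lift(1)[OF assms] rot_lift[OF assms]]
    integral_distr[OF rot_lift[OF assms] bm_measurable] by auto

text \<open>Rotation and coarse-graining commute with averaging over the discrete configuration, so
  one time step can be read off from the lift.\<close>

lemma evolve_eq: assumes \<nu>: "pm \<nu>" shows "evolve \<Phi> q \<tau> \<nu> = distr (lam \<nu>) Om tmap"
proof -
  let ?g = "\<lambda>x. tmap (rotate_conf \<tau> x)"
  have g: "?g \<in> measurable CU Om" by (rule measurable_compose[OF rotate_measurable tmap_measurable])
  have "rot_kernel \<Phi> q \<tau> s = distr (cg UNIV s) Om ?g" if s: "s \<in> space Om" for s
  proof -
    have im: "(\<lambda>x. x) \<in> measurable (constr_gibbs \<Phi> q UNIV s) CU" by (rule cg(5)) (rule OmegaD[OF s])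
    show ?thesis unfolding cg_def rot_kernel_def using g im by (subst distr_distr) (auto simp: comp_def tmap_def)
  qed
  then have "evolve \<Phi> q \<tau> \<nu> = bind \<nu> (\<lambda>s. distr (cg UNIV s) Om ?g)"
    unfolding evolve_def using pmD(3)[OF \<nu>] by (intro bind_cong refl) auto
  also have "\<dots> = distr (lift \<nu>) Om ?g"
    unfolding lift_def
  proof (rule distr_bind[symmetric, OF _ _ g])
    show "cg UNIV \<in> measurable \<nu> (subprob_algebra CU)"
      unfolding measurable_cong_sets[OF pmD(2)[OF \<nu>] refl] by (rule measurable_prob_algebraD[OF cg_measurable])
    show "space \<nu> \<noteq> {}" by (rule prob_space.not_empty[OF pmD(1)[OF \<nu>]])
  qed
  also have "\<dots> = distr (lam \<nu>) Om tmap"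
    unfolding lam_def distr_distr[OF tmap_measurable rot_lift[OF \<nu>]] comp_def ..
  finally show ?thesis .
qed

lemma tmap_lam: "pm \<nu> ==> tmap \<in> measurable (lam \<nu>) Om"
  using tmap_measurable by (simp add: measurable_cong_sets[OF lam(2) refl])

lemma evolve_pm: assumes "pm \<nu>" shows "pm (evolve \<Phi> q \<tau> \<nu>)"
  unfolding pm_def evolve_eq[OF assms] using prob_space.prob_space_distr[OF lam(1)[OF assms] tmap_lam[OF assms]] by simp

lemma evolve_int: "pm \<nu> ==> bm Om g ==> (LINT s|evolve \<Phi> q \<tau> \<nu>. g s) = (LINT x|lam \<nu>. g (tmap x))"
  unfolding evolve_eq using integral_distr[OF tmap_lam bm_measurable] by simp

section \<open>Comparison with the free-boundary weights\<close>

definition W :: "'d site set => ('d, nat) conf set" where "W Y = Y \<rightarrow>\<^sub>E {..<q}"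

lemma finite_W: "finite Y ==> finite (W Y)" by (simp add: W_def finite_PiE)

lemma restrict_W: "s \<in> space Om ==> restrict s Y \<in> W Y"
  using OmegaD by (auto simp: W_def)

lemma cylinder_restrict: "w \<in> W Y ==> cylinder q Y w = {s \<in> space Om. restrict s Y = w}"
  by (auto simp: cylinder_def W_def PiE_iff extensional_def fun_eq_iff restrict_def)

lemma cylinder_sets: "finite Y ==> cylinder q Y w \<in> sets Om"
proof -
  assume f: "finite Y"
  have "{s \<in> space Om. s i = w i} \<in> sets Om" for i
  proof -
    have "(\<lambda>s. s i) -` {w i} \<inter> space Om \<in> sets Om" by (rule measurable_sets[OF Omega_component]) simp
    then show ?thesis by (simp add: vimage_def Int_def conj_commute)
  qed
  then have "{s \<in> space Om. \<forall>i\<in>Y. s i = w i} \<in> sets Om" using f by (intro sets.sets_Collect_finite_All) auto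
  then show ?thesis by (simp add: cylinder_def)
qed

definition mc :: "('d, nat) conf measure => 'd site set => ('d, nat) conf => real" where
  "mc \<nu> Y w = measure \<nu> (cylinder q Y w)"

lemma mc_nonneg: "0 \<le> mc \<nu> Y w" by (simp add: mc_def)

lemma W_expand:
  assumes "finite Y" "s \<in> space Om"
  shows "(\<phi> (restrict s Y) :: real) = (\<Sum>w\<in>W Y. \<phi> w * indicator (cylinder q Y w) s)"
proof -
  have "(\<Sum>w\<in>W Y. \<phi> w * indicator (cylinder q Y w) s) = (\<Sum>w\<in>W Y. if w = restrict s Y then \<phi> w else 0)"
    using assms(2) by (intro sum.cong) (auto simp: cylinder_restrict)
  then show ?thesis using restrict_W[OF assms(2)] finite_W[OF assms(1)] by simp
qed

lemma bm_W: "finite Y ==> bm Om (\<lambda>s. \<phi> (restrict s Y))"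
  by (rule bm_cong[of _ "\<lambda>s. \<Sum>w\<in>W Y. \<phi> w * indicator (cylinder q Y w) s"])
    (auto intro!: bm_sum bm_mult bm_indicator cylinder_sets simp: W_expand)

lemma int_W: assumes "finite Y" "pm \<nu>" shows "(LINT s|\<nu>. \<phi> (restrict s Y)) = (\<Sum>w\<in>W Y. \<phi> w * mc \<nu> Y w)"
proof -
  have "(LINT s|\<nu>. \<phi> (restrict s Y)) = (LINT s|\<nu>. (\<Sum>w\<in>W Y. \<phi> w * indicator (cylinder q Y w) s))"
    using pmD(3)[OF assms(2)] W_expand[OF assms(1)] by (intro icong) auto
  also have "\<dots> = (\<Sum>w\<in>W Y. LINT s|\<nu>. \<phi> w * indicator (cylinder q Y w) s)"
    by (intro Bochner_Integration.integral_sum pm_int[OF assms(2)] bm_mult bm_const bm_indicator cylinder_sets assms)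
  also have "\<dots> = (\<Sum>w\<in>W Y. \<phi> w * mc \<nu> Y w)"
    using pmD(2,3)[OF assms(2)] sets.sets_into_space[OF cylinder_sets[OF assms(1)]]
    by (intro sum.cong refl) (simp add: mc_def Int_absorb2)
  finally show ?thesis .
qed

lemma sum_mc: "finite Y ==> pm \<nu> ==> (\<Sum>w\<in>W Y. mc \<nu> Y w) = 1"
  using int_W[of Y \<nu> "\<lambda>_. 1"] prob_space.prob_space[OF pmD(1)] by simp

definition loc :: "'d site set => (('d, real) conf => real) => bool" where
  "loc Y f \<longleftrightarrow> (\<forall>x\<in>space CU. \<forall>y\<in>space CU. (\<forall>i\<in>Y. x i = y i) \<longrightarrow> f x = f y)"

lemma loc_const: "loc Y (\<lambda>_. c)" by (simp add: loc_def)

lemma loc_mult: "loc Y f ==> loc Y g ==> loc Y (\<lambda>x. f x * g x)"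
  unfolding loc_def by metis

lemma loc_comp: "loc Y f ==> loc Y (\<lambda>x. \<phi> (f x))"
  unfolding loc_def by metis

lemma loc_rot: "loc Y f ==> loc Y (\<lambda>x. f (rotate_conf t x))"
  unfolding loc_def
proof (intro ballI impI)
  fix x y :: "('d, real) conf" assume h: "\<forall>x\<in>space CU. \<forall>y\<in>space CU. (\<forall>i\<in>Y. x i = y i) \<longrightarrow> f x = f y" "\<forall>i\<in>Y. x i = y i"
  show "f (rotate_conf t x) = f (rotate_conf t y)"
    by (rule h(1)[rule_format, OF rotate_space rotate_space]) (use h(2) in \<open>simp add: rotate_conf_alt\<close>)
qed

lemma loc_W: "loc Y (\<lambda>x. \<phi> (restrict (tmap x) Y))"
proof -
  have "restrict (tmap x) Y = restrict (tmap y) Y" if "\<forall>i\<in>Y. x i = y i" for x y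
    using that by (auto simp: tmap_def restrict_def)
  then show ?thesis unfolding loc_def by metis
qed

lemma loc_wt: "loc Y (wt Y Y)"
  unfolding loc_def using wt_cong by (metis subset_UNIV)

lemma bm_wtL: "finite Y ==> bm CU (wt Y Y)" by (rule bm_wt_sub) auto

text \<open>Reference configuration of the cells \<open>w\<close> in \<open>Y\<close>. The values
  off \<open>Y\<close> do not influence functions local in \<open>Y\<close> and are set to
  0.\<close>

definition pt :: "'d site set => ('d, nat) conf => ('d, real) conf" where
  "pt Y w = (\<lambda>i. if i \<in> Y then 2 * pi * real (w i) / real q else 0)"

lemma pt: assumes "w \<in> W Y" shows "pt Y w \<in> space CU" "i \<in> Y ==> coarse q (pt Y w i) = w i"
proof -
  have w: "\<And>i. i \<in> Y ==> w i < q" using assms by (auto simp: W_def)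
  have eq: "pt Y w i = cellpt Y w i" if "i \<in> Y" for i using that by (simp add: pt_def cellpt_def)
  have 1: "cellpt Y w \<in> space (cspace Y)" by (rule cellpt(1)) (rule w)
  have "pt Y w i \<in> circle" for i using cspaceD[OF 1, of i] eq[of i] by (cases "i \<in> Y") (auto simp: pt_def)
  then show "pt Y w \<in> space CU" by (simp add: space_CU)
  show "coarse q (pt Y w i) = w i" if "i \<in> Y" unfolding eq[OF that] by (rule cellpt(2)[OF _ that]) (rule w)
qed

text \<open>Free-boundary integral of \<open>f\<close> over the cells \<open>w\<close>, meaningful
  for \<open>f\<close> local in \<open>Y\<close>. Its value at the constant 1 is the partition
  function \<open>z\<close> of the cells, and \<open>I0\<close> below is the same integral over the
  full circle.\<close>

definition I1 :: "'d site set => (('d, real) conf => real) => ('d, nat) conf => real" where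
  "I1 Y f w = J C1 Y (\<lambda>\<zeta>. wt Y Y \<zeta> * f \<zeta>) (pt Y w)"

definition z :: "'d site set => ('d, nat) conf => real" where "z Y = I1 Y (\<lambda>_. 1)"

definition I0 :: "'d site set => (('d, real) conf => real) => real" where
  "I0 Y f = J Full Y (\<lambda>\<zeta>. wt Y Y \<zeta> * f \<zeta>) (\<lambda>_. 0)"

lemma resC: "finite Y ==> resample C1 UNIV Y" using fat by unfold_locales auto
lemma resF: "finite Y ==> resample Full UNIV Y" using fatrel_Full by unfold_locales auto
lemma presC: "finite Y ==> pot_resample \<Phi> C1 UNIV Y" using fat by unfold_locales auto
lemma presF: "finite Y ==> pot_resample \<Phi> Full UNIV Y" using fatrel_Full by unfold_locales auto

lemma zero_CU: "(\<lambda>_. 0) \<in> space CU" by (simp add: space_CU)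

lemma z_pos: assumes "finite Y" "w \<in> W Y" shows "0 < z Y w"
proof -
  interpret resample C1 UNIV Y using assms by (intro resC)
  obtain c where c: "c > 0" "\<And>\<eta>. \<eta> \<in> space CU ==> c \<le> J C1 Y (\<lambda>_. 1) \<eta>" using J_one by blast
  have lb: "exp (- Nrm Y) \<le> wt Y Y \<zeta>" if "\<zeta> \<in> space CU" for \<zeta>
    using abs_H_le[of Y Y \<zeta>] assms that by (auto simp: wt_def space_CU abs_le_iff)
  have "exp (- Nrm Y) * J C1 Y (\<lambda>_. 1) (pt Y w) = J C1 Y (\<lambda>_. exp (- Nrm Y) * 1) (pt Y w)"
    using J_pull[OF pt(1)[OF assms(2)], of "\<lambda>_. exp (- Nrm Y)" "\<lambda>_. 1"] by simp
  also have "\<dots> \<le> z Y w"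
    unfolding z_def I1_def using lb bm_wtL[OF assms(1)] by (intro J_mono pt(1)[OF assms(2)]) auto
  finally show ?thesis using c(2)[OF pt(1)[OF assms(2)]] c(1) by (smt (verit) exp_gt_zero mult_pos_pos)
qed

lemma J_loc:
  assumes fin: "finite Y" and g: "loc Y g" and x: "x \<in> space CU" and w: "w \<in> W Y" and t: "\<And>i. i \<in> Y ==> coarse q (x i) = w i"
  shows "J C1 Y g x = J C1 Y g (pt Y w)"
  unfolding J_def
proof (rule icong[OF refl])
  fix \<sigma> assume s: "\<sigma> \<in> space (lebc Y)"
  have "comp_ind C1 Y x \<sigma> = comp_ind C1 Y (pt Y w) \<sigma>"
    unfolding comp_ind_def using t pt(2)[OF w] by (intro prod.cong refl) (simp add: cellrel_def)
  moreover have "g (override_on x \<sigma> Y) = g (override_on (pt Y w) \<sigma> Y)"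
    by (rule g[unfolded loc_def, rule_format, OF override_space[OF x s subset_UNIV] override_space[OF pt(1)[OF w] s subset_UNIV]]) (simp add: override_on_def)
  ultimately show "comp_ind C1 Y x \<sigma> * g (override_on x \<sigma> Y) = comp_ind C1 Y (pt Y w) \<sigma> * g (override_on (pt Y w) \<sigma> Y)" by simp
qed

lemma wt_compare: assumes "finite Y" "\<zeta> \<in> space CU"
  shows "wt UNIV Y \<zeta> \<le> exp (Bd Y) * wt Y Y \<zeta>" "exp (- Bd Y) * wt Y Y \<zeta> \<le> wt UNIV Y \<zeta>"
  using H_boundary[OF assms(1), of \<zeta>] assms(2) by (auto simp: wt_def space_CU abs_le_iff simp flip: exp_add)

lemma num_compare:
  assumes fin: "finite Y" and f: "bm CU f" "loc Y f" "\<And>x. x \<in> space CU ==> 0 \<le> f x"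
    and x: "x \<in> space CU" and w: "w \<in> W Y" and t: "\<And>i. i \<in> Y ==> coarse q (x i) = w i"
  shows "num UNIV C1 Y f x \<le> exp (Bd Y) * I1 Y f w" "exp (- Bd Y) * I1 Y f w \<le> num UNIV C1 Y f x"
proof -
  interpret pot_resample \<Phi> C1 UNIV Y by (rule presC[OF fin])
  let ?g = "\<lambda>\<zeta>. wt Y Y \<zeta> * f \<zeta>"
  have g: "bm CU ?g" "loc Y ?g" using bm_wtL[OF fin] f loc_wt by (auto intro: loc_mult)
  have eq: "J C1 Y (\<lambda>\<zeta>. c * ?g \<zeta>) x = c * I1 Y f w" for c
    using J_pull[OF x, of "\<lambda>_. c" ?g] J_loc[OF fin g(2) x w t] by (simp add: I1_def)
  have bc: "bm CU (\<lambda>\<zeta>. c * ?g \<zeta>)" for c using g by auto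
  have "num UNIV C1 Y f x \<le> J C1 Y (\<lambda>\<zeta>. exp (Bd Y) * ?g \<zeta>) x"
    unfolding num_def
  proof (rule J_mono[OF bm_wf[OF f(1)] bc x])
    fix \<zeta> :: "('d, real) conf" assume z: "\<zeta> \<in> space CU"
    from mult_right_mono[OF wt_compare(1)[OF fin z] f(3)[OF z]]
    show "wt UNIV Y \<zeta> * f \<zeta> \<le> exp (Bd Y) * ?g \<zeta>" by (simp only: mult.assoc)
  qed
  then show "num UNIV C1 Y f x \<le> exp (Bd Y) * I1 Y f w" unfolding eq .
  have "J C1 Y (\<lambda>\<zeta>. exp (- Bd Y) * ?g \<zeta>) x \<le> num UNIV C1 Y f x"
    unfolding num_def
  proof (rule J_mono[OF bc bm_wf[OF f(1)] x])
    fix \<zeta> :: "('d, real) conf" assume z: "\<zeta> \<in> space CU"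
    from mult_right_mono[OF wt_compare(2)[OF fin z] f(3)[OF z]]
    show "exp (- Bd Y) * ?g \<zeta> \<le> wt UNIV Y \<zeta> * f \<zeta>" by (simp only: mult.assoc)
  qed
  then show "exp (- Bd Y) * I1 Y f w \<le> num UNIV C1 Y f x" unfolding eq .
qed

text \<open>By block invariance the expectation is an average of \<open>K\<close>, a quotient whose
  numerator and denominator each change by a factor of at most \<open>exp (Bd Y)\<close> when the
  outside is cut off; hence twice the boundary norm.\<close>

lemma cg_compare:
  assumes fin: "finite Y" and f: "bm CU f" "loc Y f" "\<And>x. x \<in> space CU ==> 0 \<le> f x" and s: "s \<in> space Om"
  defines "w \<equiv> restrict s Y"
  shows "(LINT x|cg UNIV s. f x) \<le> exp (2 * Bd Y) * (I1 Y f w / z Y w)"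
    "exp (- (2 * Bd Y)) * (I1 Y f w / z Y w) \<le> (LINT x|cg UNIV s. f x)"
proof -
  interpret pot_resample \<Phi> C1 UNIV Y by (rule presC[OF fin])
  interpret c: prob_space "cg UNIV s" by (rule cgO(2)[OF s])
  have w: "w \<in> W Y" unfolding w_def by (rule restrict_W[OF s])
  have zp: "0 < z Y w" by (rule z_pos[OF fin w])
  have bK: "integrable (cg UNIV s) (K UNIV C1 Y f)"
    using bm_K[OF f(1)] bm_sets_cong[OF cgO(3)[OF s]] by (intro prob_integrable cgO(2)[OF s]) simp
  have eq: "(LINT x|cg UNIV s. f x) = (LINT x|cg UNIV s. K UNIV C1 Y f x)"
    using invar_block[OF cgO(1)[OF s] fat _ fin f(1)] by simp
  have I0': "0 \<le> I1 Y f w"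
  proof -
    have "J C1 Y (\<lambda>_. 0) (pt Y w) \<le> I1 Y f w"
      unfolding I1_def
      by (rule J_mono[OF bm_const bm_mult[OF bm_wtL[OF fin] f(1)] pt(1)[OF w]]) (intro mult_nonneg_nonneg less_imp_le[OF wt_pos] f(3))
    then show ?thesis by (simp add: J_def)
  qed
  have b: "K UNIV C1 Y f x \<le> exp (2 * Bd Y) * (I1 Y f w / z Y w)" "exp (- (2 * Bd Y)) * (I1 Y f w / z Y w) \<le> K UNIV C1 Y f x"
    if x: "x \<in> space CU" "tmap x = s" for x
  proof -
    have t: "\<And>i. i \<in> Y ==> coarse q (x i) = w i" using x(2) by (auto simp: tmap_def w_def)
    have e: "exp (2 * Bd Y) = exp (Bd Y) * exp (Bd Y)" by (simp flip: exp_add)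
    note n = num_compare[OF fin f x(1) w t]
    note n1 = num_compare[OF fin bm_const loc_const zero_le_one x(1) w t, folded z_def]
    have p: "0 < num UNIV C1 Y (\<lambda>_. 1) x" by (rule num_one_pos[OF x(1)])
    have "K UNIV C1 Y f x \<le> (exp (Bd Y) * I1 Y f w) / (exp (- Bd Y) * z Y w)"
      unfolding K_def using n(1) n1(2) zp I0' by (intro frac_le) simp_all
    also have "\<dots> = exp (2 * Bd Y) * (I1 Y f w / z Y w)" unfolding e exp_minus by (simp add: divide_inverse mult_ac)
    finally show "K UNIV C1 Y f x \<le> exp (2 * Bd Y) * (I1 Y f w / z Y w)" .
    have "exp (- (2 * Bd Y)) * (I1 Y f w / z Y w) = (exp (- Bd Y) * I1 Y f w) / (exp (Bd Y) * z Y w)"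
      unfolding e exp_minus by (simp add: divide_inverse mult_ac)
    also have "\<dots> \<le> K UNIV C1 Y f x"
      unfolding K_def
    proof (rule frac_le[OF _ n(2) p])
      show "0 \<le> num UNIV C1 Y f x" by (rule order_trans[OF _ n(2)]) (use I0' in simp)
    qed (use n1(1) zp in \<open>simp_all\<close>)
    finally show "exp (- (2 * Bd Y)) * (I1 Y f w / z Y w) \<le> K UNIV C1 Y f x" .
  qed
  have ae: "AE x in cg UNIV s. x \<in> space CU \<and> tmap x = s" using AE_space cgO(5)[OF s] by eventually_elim (simp add: cgO(4)[OF s])
  have "(LINT x|cg UNIV s. K UNIV C1 Y f x) \<le> (LINT x|cg UNIV s. exp (2 * Bd Y) * (I1 Y f w / z Y w))"
  proof (rule integral_mono_AE[OF bK])
    show "AE x in cg UNIV s. K UNIV C1 Y f x \<le> exp (2 * Bd Y) * (I1 Y f w / z Y w)"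
      using ae by (rule AE_mp) (intro always_eventually allI impI, elim conjE, rule b)
  qed auto
  then show "(LINT x|cg UNIV s. f x) \<le> exp (2 * Bd Y) * (I1 Y f w / z Y w)" unfolding eq by (simp add: c.prob_space)
  have "(LINT x|cg UNIV s. exp (- (2 * Bd Y)) * (I1 Y f w / z Y w)) \<le> (LINT x|cg UNIV s. K UNIV C1 Y f x)"
  proof (rule integral_mono_AE[OF _ bK])
    show "AE x in cg UNIV s. exp (- (2 * Bd Y)) * (I1 Y f w / z Y w) \<le> K UNIV C1 Y f x"
      using ae by (rule AE_mp) (intro always_eventually allI impI, elim conjE, rule b)
  qed auto
  then show "exp (- (2 * Bd Y)) * (I1 Y f w / z Y w) \<le> (LINT x|cg UNIV s. f x)" unfolding eq by (simp add: c.prob_space)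
qed

lemma comp_ind_split:
  assumes fin: "finite Y" and s: "\<sigma> \<in> space (lebc Y)"
  shows "w \<in> W Y ==> comp_ind C1 Y (pt Y w) \<sigma> = of_bool (w = restrict (\<lambda>i. coarse q (\<sigma> i)) Y)"
    and "restrict (\<lambda>i. coarse q (\<sigma> i)) Y \<in> W Y"
proof -
  show "restrict (\<lambda>i. coarse q (\<sigma> i)) Y \<in> W Y"
    using s coarse_less[OF q] by (auto simp: W_def space_leb_prod)
  show "comp_ind C1 Y (pt Y w) \<sigma> = of_bool (w = restrict (\<lambda>i. coarse q (\<sigma> i)) Y)" if w: "w \<in> W Y"
  proof -
    have "comp_ind C1 Y (pt Y w) \<sigma> = of_bool (\<forall>i\<in>Y. C1 (pt Y w i) (\<sigma> i))"
      unfolding comp_ind_def using fin by (induction Y) auto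
    also have "(\<forall>i\<in>Y. C1 (pt Y w i) (\<sigma> i)) \<longleftrightarrow> w = restrict (\<lambda>i. coarse q (\<sigma> i)) Y"
      using w pt(2)[OF w] by (auto simp: cellrel_def W_def PiE_iff extensional_def fun_eq_iff restrict_def)
    finally show ?thesis .
  qed
qed

lemma J_Full_split:
  assumes fin: "finite Y" and f: "bm CU f" and x: "x \<in> space CU"
  shows "J Full Y (\<lambda>y. \<alpha> (restrict (tmap y) Y) * f y) x = (\<Sum>w\<in>W Y. \<alpha> w * J C1 Y f (override_on x (pt Y w) Y))"
proof -
  let ?h = "\<lambda>w \<sigma>. comp_ind C1 Y (pt Y w) \<sigma> * f (override_on x \<sigma> Y)"
  have xw: "override_on x (pt Y w) Y \<in> space CU" if "w \<in> W Y" for w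
    using x pt(1)[OF that] by (auto simp: space_CU override_on_def)
  have hJ: "J C1 Y f (override_on x (pt Y w) Y) = (LINT \<sigma>|lebc Y. ?h w \<sigma>)"
    and hi: "w \<in> W Y ==> integrable (lebc Y) (?h w)" for w
  proof -
    have c: "comp_ind C1 Y (override_on x (pt Y w) Y) \<sigma> = comp_ind C1 Y (pt Y w) \<sigma>"
      "override_on (override_on x (pt Y w) Y) \<sigma> Y = override_on x \<sigma> Y" for \<sigma>
      by (auto simp: comp_ind_def override_on_def intro!: prod.cong)
    show "J C1 Y f (override_on x (pt Y w) Y) = (LINT \<sigma>|lebc Y. ?h w \<sigma>)" unfolding J_def c ..
    show "w \<in> W Y ==> integrable (lebc Y) (?h w)"
      using resample.J_integrable[OF resC[OF fin] f xw, of w] unfolding c .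
  qed
  have "J Full Y (\<lambda>y. \<alpha> (restrict (tmap y) Y) * f y) x = (LINT \<sigma>|lebc Y. (\<Sum>w\<in>W Y. \<alpha> w * ?h w \<sigma>))"
    unfolding J_def
  proof (rule icong[OF refl])
    fix \<sigma> assume s: "\<sigma> \<in> space (lebc Y)"
    let ?w = "restrict (\<lambda>i. coarse q (\<sigma> i)) Y"
    have "(\<Sum>w\<in>W Y. \<alpha> w * ?h w \<sigma>) = (\<Sum>w\<in>W Y. if w = ?w then \<alpha> w * f (override_on x \<sigma> Y) else 0)"
      by (intro sum.cong refl) (simp add: comp_ind_split(1)[OF fin s])
    also have "\<dots> = \<alpha> ?w * f (override_on x \<sigma> Y)" using comp_ind_split(2)[OF fin s] finite_W[OF fin] by simp
    finally have e: "(\<Sum>w\<in>W Y. \<alpha> w * ?h w \<sigma>) = \<alpha> ?w * f (override_on x \<sigma> Y)" .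
    have "?w = restrict (tmap (override_on x \<sigma> Y)) Y" by (rule ext) (simp add: tmap_def)
    then show "comp_ind Full Y x \<sigma> * (\<alpha> (restrict (tmap (override_on x \<sigma> Y)) Y) * f (override_on x \<sigma> Y)) = (\<Sum>w\<in>W Y. \<alpha> w * ?h w \<sigma>)"
      unfolding e by (simp add: comp_ind_def[of Full])
  qed
  also have "\<dots> = (\<Sum>w\<in>W Y. LINT \<sigma>|lebc Y. \<alpha> w * ?h w \<sigma>)"
    by (rule Bochner_Integration.integral_sum) (intro integrable_mult_right hi)
  also have "\<dots> = (\<Sum>w\<in>W Y. \<alpha> w * J C1 Y f (override_on x (pt Y w) Y))" unfolding hJ by simp
  finally show ?thesis .
qed

lemma I0_split:
  assumes fin: "finite Y" and f: "bm CU f"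
  shows "I0 Y (\<lambda>x. \<alpha> (restrict (tmap x) Y) * f x) = (\<Sum>w\<in>W Y. \<alpha> w * I1 Y f w)"
proof -
  have "override_on (\<lambda>_. 0) (pt Y w) Y = pt Y w" for w by (auto simp: override_on_def pt_def)
  then show ?thesis
    using J_Full_split[OF fin bm_mult[OF bm_wtL[OF fin] f] zero_CU, of \<alpha>] unfolding I0_def I1_def
    by (simp add: mult.left_commute)
qed

text \<open>The free-boundary weight and Lebesgue measure are both rotation invariant. The
  configuration off \<open>Y\<close> is rotated too, which locality of \<open>h\<close> and of the
  weight makes invisible.\<close>

lemma I0_rot:
  assumes fin: "finite Y" and h: "bm CU h" "loc Y h"
  shows "I0 Y (\<lambda>x. h (rotate_conf \<tau> x)) = I0 Y h"
proof -
  let ?g = "\<lambda>x. wt Y Y x * h x" and ?o = "\<lambda>\<sigma>. override_on (\<lambda>_. 0) \<sigma> Y :: ('d, real) conf"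
  have g: "bm CU ?g" "loc Y ?g" using bm_wtL[OF fin] h loc_wt by (auto intro: loc_mult)
  have F: "J Full Y f (\<lambda>_. 0) = (LINT \<sigma>|lebc Y. f (?o \<sigma>))" for f by (simp add: J_def comp_ind_def)
  have "I0 Y (\<lambda>x. h (rotate_conf \<tau> x)) = (LINT \<sigma>|lebc Y. ?g (rotate_conf \<tau> (?o \<sigma>)))"
    unfolding I0_def F
    by (intro icong refl) (simp add: wt_rotate[OF override_space[OF zero_CU]])
  also have "\<dots> = (LINT \<sigma>|lebc Y. ?g (?o (rotL \<tau> Y \<sigma>)))"
  proof (rule icong[OF refl])
    fix \<sigma> assume s: "\<sigma> \<in> space (lebc Y)"
    have "?o (rotL \<tau> Y \<sigma>) \<in> space CU" by (rule override_space[OF zero_CU measurable_space[OF rotL_measurable s]]) simp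
    moreover have "\<forall>i\<in>Y. rotate_conf \<tau> (?o \<sigma>) i = ?o (rotL \<tau> Y \<sigma>) i" by (auto simp: rotate_conf_alt rotL_def)
    ultimately show "?g (rotate_conf \<tau> (?o \<sigma>)) = ?g (?o (rotL \<tau> Y \<sigma>))"
      using g(2) rotate_space unfolding loc_def by blast
  qed
  also have "\<dots> = (LINT \<sigma>|distr (lebc Y) (lebc Y) (rotL \<tau> Y). ?g (?o \<sigma>))"
    by (rule integral_distr[symmetric, OF rotL_measurable])
      (rule measurable_compose[OF override_measurable2[OF subset_UNIV zero_CU] bm_measurable[OF g(1)]])
  also have "\<dots> = I0 Y h" unfolding distr_rotL[OF tau(1) tau2 fin] I0_def F ..
  finally show ?thesis .
qed

lemma I0_mono:
  assumes "finite Y" "bm CU f" "bm CU g" "\<And>x. x \<in> space CU ==> f x \<le> g x" shows "I0 Y f \<le> I0 Y g"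
  unfolding I0_def using assms bm_wtL[OF assms(1)] wt_pos
  by (intro resample.J_mono[OF resF[OF assms(1)]] zero_CU bm_mult) (auto intro!: mult_left_mono less_imp_le)

text \<open>Up to boundary factors, the density of the box marginal of the lift with respect to the
  free-boundary weight; it depends on the cells only.\<close>

definition dens :: "('d, nat) conf measure => 'd site set => ('d, nat) conf => real" where
  "dens \<nu> Y w = mc \<nu> Y w / z Y w"

lemma dens_nonneg: "finite Y ==> w \<in> W Y ==> 0 \<le> dens \<nu> Y w"
  using z_pos[of Y w] mc_nonneg by (simp add: dens_def)

lemma lift_compare:
  assumes fin: "finite Y" and \<nu>: "pm \<nu>" and f: "bm CU f" "loc Y f" "\<And>x. x \<in> space CU ==> 0 \<le> f x"
  shows "(LINT x|lift \<nu>. f x) \<le> exp (2 * Bd Y) * I0 Y (\<lambda>x. dens \<nu> Y (restrict (tmap x) Y) * f x)"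
    "exp (- (2 * Bd Y)) * I0 Y (\<lambda>x. dens \<nu> Y (restrict (tmap x) Y) * f x) \<le> (LINT x|lift \<nu>. f x)"
proof -
  let ?\<phi> = "\<lambda>w. I1 Y f w / z Y w"
  have b: "bm Om (\<lambda>s. c * ?\<phi> (restrict s Y))" for c using bm_W[OF fin, of "\<lambda>w. c * ?\<phi> w"] by simp
  have eq: "(LINT s|\<nu>. c * ?\<phi> (restrict s Y)) = c * I0 Y (\<lambda>x. dens \<nu> Y (restrict (tmap x) Y) * f x)" for c
    unfolding I0_split[OF fin f(1)] int_W[OF fin \<nu>, of "\<lambda>w. c * ?\<phi> w"] sum_distrib_left
    by (intro sum.cong refl) (simp add: dens_def)
  have "(LINT s|\<nu>. (LINT x|cg UNIV s. f x)) \<le> (LINT s|\<nu>. exp (2 * Bd Y) * ?\<phi> (restrict s Y))"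
    by (rule integral_mono[OF pm_int[OF \<nu> bm_cg[OF f(1)]] pm_int[OF \<nu> b]])
      (use cg_compare(1)[OF fin f] pmD(3)[OF \<nu>] in auto)
  then show "(LINT x|lift \<nu>. f x) \<le> exp (2 * Bd Y) * I0 Y (\<lambda>x. dens \<nu> Y (restrict (tmap x) Y) * f x)"
    unfolding lift(5)[OF \<nu> f(1)] eq .
  have "(LINT s|\<nu>. exp (- (2 * Bd Y)) * ?\<phi> (restrict s Y)) \<le> (LINT s|\<nu>. (LINT x|cg UNIV s. f x))"
    by (rule integral_mono[OF pm_int[OF \<nu> b] pm_int[OF \<nu> bm_cg[OF f(1)]]])
      (use cg_compare(2)[OF fin f] pmD(3)[OF \<nu>] in auto)
  then show "exp (- (2 * Bd Y)) * I0 Y (\<lambda>x. dens \<nu> Y (restrict (tmap x) Y) * f x) \<le> (LINT x|lift \<nu>. f x)"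
    unfolding lift(5)[OF \<nu> f(1)] eq .
qed

text \<open>Relative entropy of the box marginal with respect to the unnormalised weights
  \<open>z\<close>. The missing normalisation is common to all measures and drops out of
  differences.\<close>

definition fe :: "'d site set => ('d, nat) conf measure => real" where
  "fe Y \<nu> = (\<Sum>w\<in>W Y. mc \<nu> Y w * ln (dens \<nu> Y w))"

lemma dens_AE: assumes "finite Y" "pm \<nu>" shows "AE s in \<nu>. dens \<nu> Y (restrict s Y) \<noteq> 0"
proof -
  let ?f = "\<lambda>s. of_bool (dens \<nu> Y (restrict s Y) \<noteq> 0) :: real"
  have b: "bm Om ?f" using bm_W[OF assms(1), of "\<lambda>w. of_bool (dens \<nu> Y w \<noteq> 0)"] .
  have "(LINT s|\<nu>. ?f s) = (\<Sum>w\<in>W Y. of_bool (dens \<nu> Y w \<noteq> 0) * mc \<nu> Y w)"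
    using int_W[OF assms, of "\<lambda>w. of_bool (dens \<nu> Y w \<noteq> 0)"] .
  also have "\<dots> = (\<Sum>w\<in>W Y. mc \<nu> Y w)"
    using z_pos[OF assms(1)] by (intro sum.cong refl) (force simp: dens_def)
  finally have "(LINT s|\<nu>. ?f s) = 1" using sum_mc[OF assms] by simp
  then have "AE s in \<nu>. ?f s = 1" using b pmD[OF assms(2)] by (intro prob_integral_one_AE) auto
  then show ?thesis by (rule AE_mp) (auto intro!: AE_I2)
qed

text \<open>Donsker-Varadhan form of the entropy bound: \<open>lam \<nu>\<close> and the lift of \<open>\<nu>'\<close> share the
  rotation-invariant free-boundary reference measure.\<close>

lemma entropy_ineq:
  assumes fin: "finite Y" and \<nu>: "pm \<nu>" and u: "bm CU u" "loc Y u"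
  defines "\<nu>' \<equiv> evolve \<Phi> q \<tau> \<nu>"
  shows "(LINT x|lam \<nu>. u x) - ln (LINT x|lift \<nu>'. exp (u x)) \<le> fe Y \<nu> - fe Y \<nu>' + 4 * Bd Y"
proof -
  have \<nu>': "pm \<nu>'" unfolding \<nu>'_def by (rule evolve_pm[OF \<nu>])
  let ?R = "rotate_conf \<tau>"
  let ?A = "\<lambda>x. dens \<nu> Y (restrict (tmap x) Y)" and ?A' = "\<lambda>x. dens \<nu>' Y (restrict (tmap x) Y)"
  \<comment> \<open>The test function at the rotated configuration, corrected by the logarithms of
    the two densities. Its mean produces the two entropies, while its exponential replaces the
    density of \<open>\<nu>\<close> by that of \<open>\<nu>'\<close>.\<close>
  let ?X = "\<lambda>x. u (?R x) - ln (?A x) + ln (?A' (?R x))"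
  have bR: "bm CU (\<lambda>x. f (?R x))" if "bm CU f" for f by (rule bm_compose[OF that rotate_measurable])
  have bT: "bm CU (\<lambda>x. \<phi> (restrict (tmap x) Y))" for \<phi> by (rule bm_tmap[OF bm_W[OF fin]])
  have bTR: "bm CU (\<lambda>x. \<phi> (restrict (tmap (?R x)) Y))" for \<phi> by (rule bR[OF bT])
  have bl: "bm (lift \<nu>) f = bm CU f" for f by (rule bm_sets_cong[OF lift(2)[OF \<nu>]])
  have bX: "bm CU ?X"
    using bR[OF u(1)] bT[of "\<lambda>w. ln (dens \<nu> Y w)"] bTR[of "\<lambda>w. ln (dens \<nu>' Y w)"] by (intro bm_add bm_diff)
  have i1: "(LINT x|lift \<nu>. ln (?A x)) = fe Y \<nu>"
    using lift_tmap[OF \<nu> bm_W[OF fin, of "\<lambda>w. ln (dens \<nu> Y w)"]] int_W[OF fin \<nu>, of "\<lambda>w. ln (dens \<nu> Y w)"]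
    by (simp add: fe_def mult.commute)
  have i2: "(LINT x|lift \<nu>. ln (?A' (?R x))) = fe Y \<nu>'"
    using lam(4)[OF \<nu> bT[of "\<lambda>w. ln (dens \<nu>' Y w)"]] evolve_int[OF \<nu> bm_W[OF fin, of "\<lambda>w. ln (dens \<nu>' Y w)"]]
      int_W[OF fin \<nu>', of "\<lambda>w. ln (dens \<nu>' Y w)"] by (simp add: fe_def mult.commute \<nu>'_def)
  have iX: "(LINT x|lift \<nu>. ?X x) = (LINT x|lam \<nu>. u x) - fe Y \<nu> + fe Y \<nu>'"
  proof -
    have "(LINT x|lift \<nu>. ?X x) = (LINT x|lift \<nu>. u (?R x) - ln (?A x)) + (LINT x|lift \<nu>. ln (?A' (?R x)))"
      using bR[OF u(1)] bT[of "\<lambda>w. ln (dens \<nu> Y w)"] bTR[of "\<lambda>w. ln (dens \<nu>' Y w)"]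
      by (intro Bochner_Integration.integral_add lift(4)[OF \<nu>] bm_diff)
    also have "(LINT x|lift \<nu>. u (?R x) - ln (?A x)) = (LINT x|lift \<nu>. u (?R x)) - (LINT x|lift \<nu>. ln (?A x))"
      using bR[OF u(1)] bT[of "\<lambda>w. ln (dens \<nu> Y w)"] by (intro Bochner_Integration.integral_diff lift(4)[OF \<nu>])
    finally show ?thesis unfolding i1 i2 lam(4)[OF \<nu> u(1)] .
  qed
  \<comment> \<open>Cells of zero mass receive 0. They are null for the lift, and this choice makes
    \<open>?A x * ?g x \<le> ?h (?R x)\<close> hold at every configuration.\<close>
  define inv' where "inv' w = (if dens \<nu> Y w = 0 then 0 else 1 / dens \<nu> Y w)" for w
  let ?h = "\<lambda>y. exp (u y) * ?A' y"
  let ?g = "\<lambda>x. inv' (restrict (tmap x) Y) * ?h (?R x)"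
  have bh: "bm CU ?h" "loc Y ?h"
    using bm_exp[OF u(1)] bT[of "dens \<nu>' Y"] loc_comp[OF u(2), of exp] loc_W[of Y "dens \<nu>' Y"] by (auto intro: loc_mult)
  have bg: "bm CU ?g" using bT[of inv'] bR[OF bh(1)] by (rule bm_mult)
  have lg: "loc Y ?g" using loc_W[of Y inv'] loc_rot[OF bh(2)] by (rule loc_mult)
  have A0: "0 \<le> ?A x" "0 \<le> ?A' x" if "x \<in> space CU" for x :: "('d, real) conf"
    using dens_nonneg[OF fin restrict_W[OF tmap_space[OF that]]] by auto
  have h0: "0 \<le> ?h x" if "x \<in> space CU" for x :: "('d, real) conf" using A0[OF that] by simp
  have g0: "0 \<le> ?g x" if "x \<in> space CU" for x :: "('d, real) conf"
    using A0[OF that] A0[OF rotate_space] by (auto simp: inv'_def)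
  have ae: "AE x in lift \<nu>. exp (?X x) = ?g x"
  proof -
    have m: "tmap \<in> measurable (lift \<nu>) Om" using tmap_measurable by (simp add: measurable_cong_sets[OF lift(2)[OF \<nu>] refl])
    have z1: "{s \<in> space Om. dens \<rho> Y (restrict s Y) \<noteq> 0} \<in> sets Om" for \<rho>
      using bm_measurable[OF bm_W[OF fin, of "dens \<rho> Y"]] by measurable
    have z2: "{x \<in> space CU. ?A' x \<noteq> 0} \<in> sets CU"
      using bm_measurable[OF bT[of "dens \<nu>' Y"]] by measurable
    have dl: "distr (lift \<nu>) Om tmap = \<nu>"
    proof (rule measure_eqI)
      fix B assume "B \<in> sets (distr (lift \<nu>) Om tmap)"
      then have B: "B \<in> sets Om" by simp
      interpret l: prob_space "distr (lift \<nu>) Om tmap" by (rule prob_space.prob_space_distr[OF lift(1)[OF \<nu>] m])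
      interpret n: prob_space \<nu> by (rule pmD(1)[OF \<nu>])
      have "(LINT s|distr (lift \<nu>) Om tmap. (indicator B s :: real)) = (LINT x|lift \<nu>. indicator B (tmap x))"
        using B by (intro integral_distr[OF m]) auto
      also have "\<dots> = (LINT s|\<nu>. indicator B s)" by (rule lift_tmap[OF \<nu> bm_indicator[OF B]])
      finally show "emeasure (distr (lift \<nu>) Om tmap) B = emeasure \<nu> B"
        using B pmD(2,3)[OF \<nu>] sets.sets_into_space[OF B] by (simp add: l.emeasure_eq_measure n.emeasure_eq_measure Int_absorb2)
    qed (simp add: pmD(2)[OF \<nu>])
    have a1: "AE x in lift \<nu>. ?A x \<noteq> 0"
      using dens_AE[OF fin \<nu>] AE_distr_iff[OF m z1[of \<nu>]] unfolding dl by simp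
    have "AE x in lam \<nu>. ?A' x \<noteq> 0"
      using dens_AE[OF fin \<nu>'] AE_distr_iff[OF tmap_lam[OF \<nu>] z1[of \<nu>']] unfolding \<nu>'_def evolve_eq[OF \<nu>] by simp
    then have a2: "AE x in lift \<nu>. ?A' (?R x) \<noteq> 0"
      using AE_distr_iff[OF rot_lift[OF \<nu>] z2] unfolding lam_def by simp
    show ?thesis using a1 a2 AE_space
    proof eventually_elim
      case (elim x)
      then have x: "x \<in> space CU" using lift(3)[OF \<nu>] by simp
      have "0 < ?A x" "0 < ?A' (?R x)" using elim A0[OF x] A0[OF rotate_space, of \<tau> x] by auto
      then show ?case by (simp add: exp_add exp_diff inv'_def)
    qed
  qed
  \<comment> \<open>One comparison with the free system, here for \<open>\<nu>'\<close>; together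
    with the one for \<open>\<nu>\<close> it accounts for the boundary term
    \<open>4 * Bd Y\<close>.\<close>
  have I0le: "I0 Y ?h \<le> exp (2 * Bd Y) * (LINT x|lift \<nu>'. exp (u x))"
  proof -
    have "exp (- (2 * Bd Y)) * I0 Y (\<lambda>x. ?A' x * exp (u x)) \<le> (LINT x|lift \<nu>'. exp (u x))"
      by (rule lift_compare(2)[OF fin \<nu>' bm_exp[OF u(1)] loc_comp[OF u(2)]]) auto
    then have "exp (2 * Bd Y) * (exp (- (2 * Bd Y)) * I0 Y (\<lambda>x. ?A' x * exp (u x))) \<le> exp (2 * Bd Y) * (LINT x|lift \<nu>'. exp (u x))"
      by (intro mult_left_mono) auto
    moreover have "exp (2 * Bd Y) * (exp (- (2 * Bd Y)) * X) = X" for X by (simp flip: exp_add mult.assoc)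
    ultimately show ?thesis by (simp only: mult.commute[of "exp (u _)"])
  qed
  have "(LINT x|lift \<nu>. exp (?X x)) = (LINT x|lift \<nu>. ?g x)"
    by (rule integral_cong_AE[OF bm_measurable bm_measurable ae]) (simp_all only: bl bm_exp[OF bX] bg)
  also have "\<dots> \<le> exp (2 * Bd Y) * I0 Y (\<lambda>x. ?A x * ?g x)" by (rule lift_compare(1)[OF fin \<nu> bg lg g0])
  also have "\<dots> \<le> exp (2 * Bd Y) * I0 Y (\<lambda>x. ?h (?R x))"
  proof (intro mult_left_mono I0_mono[OF fin bm_mult[OF bT bg] bR[OF bh(1)]])
    fix x :: "('d, real) conf" assume "x \<in> space CU"
    show "?A x * ?g x \<le> ?h (?R x)" using h0[OF rotate_space, of \<tau> x] by (cases "?A x = 0") (simp_all add: inv'_def zero_le_mult_iff)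
  qed auto
  also have "I0 Y (\<lambda>x. ?h (?R x)) = I0 Y ?h" by (rule I0_rot[OF fin bh])
  also have "exp (2 * Bd Y) * I0 Y ?h \<le> exp (2 * Bd Y) * (exp (2 * Bd Y) * (LINT x|lift \<nu>'. exp (u x)))"
    by (rule mult_left_mono[OF I0le]) simp
  finally have "(LINT x|lift \<nu>. exp (?X x)) \<le> exp (2 * Bd Y) * (exp (2 * Bd Y) * (LINT x|lift \<nu>'. exp (u x)))" .
  also have "\<dots> = exp (4 * Bd Y) * (LINT x|lift \<nu>'. exp (u x))" by (simp flip: exp_add mult.assoc)
  finally have le: "(LINT x|lift \<nu>. exp (?X x)) \<le> exp (4 * Bd Y) * (LINT x|lift \<nu>'. exp (u x))" .
  have bX': "bm (lift \<nu>) ?X" using bX bl by simp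
  have pu: "0 < (LINT x|lift \<nu>'. exp (u x))"
    using jensen_exp(2)[OF lift(1)[OF \<nu>']] u(1) by (simp add: bm_sets_cong[OF lift(2)[OF \<nu>']])
  have "(LINT x|lift \<nu>. ?X x) \<le> ln (LINT x|lift \<nu>. exp (?X x))" by (rule jensen_exp(1)[OF lift(1)[OF \<nu>] bX'])
  also have "\<dots> \<le> ln (exp (4 * Bd Y) * (LINT x|lift \<nu>'. exp (u x)))"
    using le jensen_exp(2)[OF lift(1)[OF \<nu>] bX'] by simp
  also have "\<dots> = 4 * Bd Y + ln (LINT x|lift \<nu>'. exp (u x))" using pu by (simp add: ln_mult)
  finally show ?thesis unfolding iX by simp
qed

end

section \<open>Entropy gain of measures that are not conditionally Gibbs\<close>

context clock_model
begin

definition tip :: "('d, nat) conf measure => bool" where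
  "tip \<nu> \<longleftrightarrow> pm \<nu> \<and> (\<forall>k. distr \<nu> Om (shift_conf k) = \<nu>)"

lemma shift_Om: "shift_conf k \<in> measurable Om Om"
  unfolding Omega_def
proof (rule measurable_PiM_single')
  fix i :: "'d site"
  show "(\<lambda>s. shift_conf k s i) \<in> measurable (PiM UNIV (\<lambda>_. count_space {..<q})) (count_space {..<q})"
    unfolding shift_conf_def by (rule measurable_component_singleton) simp
qed (auto simp: shift_conf_def space_PiM)

lemma bm_shift: "bm CU f ==> bm CU (\<lambda>x. f (shift_conf k x))"
  by (rule bm_compose[OF _ shift_measurable])

text \<open>The shifted measure is again invariant, by translation invariance of the potential, and
  sits in the shifted cells; uniqueness identifies it.\<close>

lemma cg_shift:
  assumes s: "s \<in> space Om" shows "distr (cg UNIV s) CU (shift_conf k) = cg UNIV (shift_conf k s)"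
proof (rule cgO_unique)
  note c = cgO[OF s]
  have m: "shift_conf k \<in> measurable (cg UNIV s) CU"
    unfolding measurable_cong_sets[OF c(3) refl] by (rule shift_measurable)
  have I: "(LINT x|distr (cg UNIV s) CU (shift_conf k). f x) = (LINT x|cg UNIV s. f (shift_conf k x))"
    if "bm CU f" for f :: "('d, real) conf => real"
    by (rule integral_distr[OF m bm_measurable[OF that]])
  show "shift_conf k s \<in> space Om" by (rule measurable_space[OF shift_Om s])
  show "invar UNIV C1 (distr (cg UNIV s) CU (shift_conf k))"
    unfolding invar_def
  proof (intro conjI ballI allI impI)
    show "prob_space (distr (cg UNIV s) CU (shift_conf k))" by (rule prob_space.prob_space_distr[OF c(2) m])
    fix i and f :: "('d, real) conf => real" assume f: "bm CU f"
    interpret pot_resample \<Phi> C1 UNIV "{i}" using fat by unfold_locales auto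
    have "(LINT x|cg UNIV s. K UNIV C1 {i} f (shift_conf k x)) = (LINT x|cg UNIV s. K UNIV C1 {i + k} (\<lambda>x. f (shift_conf k x)) x)"
      by (rule icong[OF refl], rule K_shift_conf[OF fat f]) (simp add: c(4))
    also have "\<dots> = (LINT x|cg UNIV s. f (shift_conf k x))"
      using c(1) bm_shift[OF f] unfolding invar_def by blast
    finally show "(LINT x|distr (cg UNIV s) CU (shift_conf k). K UNIV C1 {i} f x) = (LINT x|distr (cg UNIV s) CU (shift_conf k). f x)"
      unfolding I[OF f] I[OF bm_K[OF f]] .
  qed simp
  have "{x \<in> space CU. tmap x = shift_conf k s} \<in> sets CU"
  proof -
    have "{x \<in> space CU. tmap x = shift_conf k s} = {x \<in> space CU. \<forall>i. coarse q (x i) = shift_conf k s i}"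
      by (auto simp: tmap_def fun_eq_iff)
    also have "\<dots> \<in> sets CU"
    proof (intro sets.sets_Collect_countable_All)
      fix i :: "'d site"
      have "(\<lambda>x. coarse q (x i)) \<in> measurable CU (count_space UNIV)"
        using measurable_compose[OF cspace_component[OF UNIV_I] measurable_restrict_space1[OF coarse_borel]] .
      from measurable_sets[OF this, of "{shift_conf k s i}"]
      show "{x \<in> space CU. coarse q (x i) = shift_conf k s i} \<in> sets CU" by (simp add: vimage_def Int_def conj_commute)
    qed
    finally show ?thesis .
  qed
  from AE_distr_iff[OF m this] show "AE x in distr (cg UNIV s) CU (shift_conf k). tmap x = shift_conf k s"
  proof simp
    show "AE x in cg UNIV s. tmap (shift_conf k x) = shift_conf k s"
      by (rule AE_mp[OF c(5)]) (intro always_eventually allI impI, auto simp: tmap_def shift_conf_def)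
  qed
qed

lemma lift_shift:
  assumes \<nu>: "tip \<nu>" and f: "bm CU f" shows "(LINT x|lift \<nu>. f (shift_conf k x)) = (LINT x|lift \<nu>. f x)"
proof -
  have p: "pm \<nu>" and d: "distr \<nu> Om (shift_conf k) = \<nu>" using \<nu> by (auto simp: tip_def)
  let ?g = "\<lambda>s. LINT x|cg UNIV s. f x"
  have m: "shift_conf k \<in> measurable \<nu> Om"
    unfolding measurable_cong_sets[OF pmD(2)[OF p] refl] by (rule shift_Om)
  have "(LINT x|lift \<nu>. f (shift_conf k x)) = (LINT s|\<nu>. (LINT x|cg UNIV s. f (shift_conf k x)))"
    by (rule lift(5)[OF p bm_shift[OF f]])
  also have "\<dots> = (LINT s|\<nu>. ?g (shift_conf k s))"
  proof (rule icong[OF refl])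
    fix s assume "s \<in> space \<nu>"
    then have s: "s \<in> space Om" using pmD(3)[OF p] by simp
    have "shift_conf k \<in> measurable (cg UNIV s) CU"
      unfolding measurable_cong_sets[OF cgO(3)[OF s] refl] by (rule shift_measurable)
    from integral_distr[OF this bm_measurable[OF f]]
    show "(LINT x|cg UNIV s. f (shift_conf k x)) = ?g (shift_conf k s)" unfolding cg_shift[OF s] ..
  qed
  also have "\<dots> = (LINT s|distr \<nu> Om (shift_conf k). ?g s)"
    by (rule integral_distr[symmetric, OF m bm_measurable[OF bm_cg[OF f]]])
  also have "\<dots> = (LINT x|lift \<nu>. f x)" unfolding d lift(5)[OF p f] ..
  finally show ?thesis .
qed

lemma lam_shift:
  assumes \<nu>: "tip \<nu>" and f: "bm CU f" shows "(LINT x|lam \<nu>. f (shift_conf k x)) = (LINT x|lam \<nu>. f x)"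
proof -
  have p: "pm \<nu>" using \<nu> by (simp add: tip_def)
  have c: "shift_conf k (rotate_conf \<tau> x) = rotate_conf \<tau> (shift_conf k x)" for x :: "('d, real) conf"
    by (simp add: shift_conf_def rotate_conf_def)
  show ?thesis
    unfolding lam(4)[OF p bm_shift[OF f]] lam(4)[OF p f] c
    by (rule lift_shift[OF \<nu> bm_compose[OF f rotate_measurable]])
qed

text \<open>For nonnegative \<open>y\<close> the Taylor bound has constant 1, for negative
  \<open>y\<close> the bound \<open>1 / (1 - y)\<close> is compared with the polynomial; the
  constant 2 covers both.\<close>

lemma exp_quadratic_bound: fixes y :: real assumes "\<bar>y\<bar> \<le> 1 / 2" shows "exp y \<le> 1 + y + 2 * y\<^sup>2"
proof (cases "0 \<le> y")
  case True
  then have "exp y \<le> 1 + y + y\<^sup>2" using assms by (intro exp_bound) auto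
  then show ?thesis by (smt (verit) zero_le_power2)
next
  case False
  have "exp (- y) \<ge> 1 - y" using exp_ge_add_one_self[of "- y"] by simp
  then have "exp y \<le> 1 / (1 - y)" using False by (simp add: exp_minus field_simps)
  also have "\<dots> \<le> 1 + y + 2 * y\<^sup>2"
  proof -
    have "0 \<le> y\<^sup>2 * (1 - 2 * y)" using False by (intro mult_nonneg_nonneg) auto
    then have "1 \<le> (1 + y + 2 * y\<^sup>2) * (1 - y)" by (simp add: algebra_simps power2_eq_square)
    then show ?thesis using False by (simp add: divide_le_eq)
  qed
  finally show ?thesis .
qed

lemma bm_shift_sum: "finite P ==> bm CU v ==> bm CU (\<lambda>x. t * (\<Sum>k\<in>P. v (shift_conf k x)))"
  by (intro bm_mult bm_const bm_sum bm_shift)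

text \<open>Conditionally on the other spins the factor of a centre \<open>l\<close> has mean at most
  \<open>1 + t \<epsilon> + 2 (t b)\<^sup>2\<close>, and the factors of the other centres do not see the spin at \<open>i + l\<close>.\<close>

lemma packed_moment:
  assumes inv: "invar UNIV C1 \<mu>" and v: "bm CU v" "\<And>x. x \<in> space CU ==> \<bar>v x\<bar> \<le> b"
    and loc: "\<And>\<xi> \<eta> :: ('d, real) conf. (\<forall>j\<in>L. \<xi> j = \<eta> j) ==> v \<xi> = v \<eta>"
    and Kv: "\<And>x. x \<in> space CU ==> K UNIV C1 {i} v x \<le> \<epsilon>" and t: "0 \<le> t" "t * b \<le> 1 / 2" and \<epsilon>: "0 \<le> \<epsilon>"
    and "finite P" and sep: "\<And>k l j. k \<in> P ==> l \<in> P ==> k \<noteq> l ==> j \<in> L ==> i + l \<noteq> j + k"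
  shows "(LINT x|\<mu>. exp (t * (\<Sum>k\<in>P. v (shift_conf k x)))) \<le> (1 + t * \<epsilon> + 2 * (t * b)\<^sup>2) ^ card P"
  using \<open>finite P\<close> sep
proof (induction P)
  case empty
  then show ?case using prob_space.prob_space[OF invarD(1)[OF inv]] by simp
next
  case (insert l P)
  let ?G = "\<lambda>x. exp (t * (\<Sum>k\<in>P. v (shift_conf k x)))" and ?e = "\<lambda>x. exp (t * v x)"
  let ?c = "1 + t * \<epsilon> + 2 * (t * b)\<^sup>2"
  interpret a: pot_resample \<Phi> C1 UNIV "{i}" using fat by unfold_locales auto
  interpret r: pot_resample \<Phi> C1 UNIV "{i + l}" using fat by unfold_locales auto
  have bG: "bm CU ?G" by (rule bm_exp[OF bm_shift_sum[OF insert.hyps(1) v(1)]])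
  have be: "bm CU ?e" by (intro bm_exp bm_mult bm_const v)
  note int = prob_integrable[OF invarD(1)[OF inv], unfolded bm_sets_cong[OF invarD(2)[OF inv]]]
  have "(LINT x|\<mu>. exp (t * (\<Sum>k\<in>insert l P. v (shift_conf k x)))) = (LINT x|\<mu>. ?G x * ?e (shift_conf l x))"
    using insert.hyps by (intro icong refl) (simp add: ring_distribs exp_add mult.commute)
  \<comment> \<open>Invariance at the site \<open>i + l\<close> inserts a conditional expectation
    that averages the new factor while the others stand still.\<close>
  also have "\<dots> = (LINT x|\<mu>. K UNIV C1 {i + l} (\<lambda>x. ?G x * ?e (shift_conf l x)) x)"
    using inv bm_mult[OF bG bm_shift[OF be]] unfolding invar_def by simp
  also have "\<dots> \<le> (LINT x|\<mu>. ?G x * ?c)"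
  proof (rule integral_mono[OF int[OF r.bm_K[OF bm_mult[OF bG bm_shift[OF be]]]] int[OF bm_mult[OF bG bm_const]]])
    fix x assume "x \<in> space \<mu>"
    then have x: "x \<in> space CU" using invarD(3)[OF inv] by simp
    have g: "?G (override_on x \<sigma> {i + l}) = ?G x" for \<sigma>
    proof -
      have "v (shift_conf k (override_on x \<sigma> {i + l})) = v (shift_conf k x)" if "k \<in> P" for k
      proof (rule loc, intro ballI)
        fix j assume "j \<in> L"
        moreover have "k \<noteq> l" using insert.hyps(2) that by blast
        ultimately have "j + k \<noteq> i + l" using insert.prems[of k l j] that by auto
        then show "shift_conf k (override_on x \<sigma> {i + l}) j = shift_conf k x j" by (simp add: shift_conf_def override_on_def)
      qed
      then show ?thesis by simp
    qed
    have y: "shift_conf l x \<in> space CU" by (rule shift_space[OF x])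
    \<comment> \<open>The quadratic remainder is bounded by its uniform size, so that only the
      linear term still needs averaging.\<close>
    have "K UNIV C1 {i} ?e (shift_conf l x) \<le> K UNIV C1 {i} (\<lambda>x. (1 + 2 * (t * b)\<^sup>2) + t * v x) (shift_conf l x)"
    proof (rule a.K_mono[OF be _ y])
      show "bm CU (\<lambda>x. (1 + 2 * (t * b)\<^sup>2) + t * v x)" by (intro bm_add bm_mult bm_const v)
      fix z :: "('d, real) conf" assume z: "z \<in> space CU"
      have tv: "\<bar>t * v z\<bar> \<le> t * b" using v(2)[OF z] t(1) by (simp add: abs_mult mult_left_mono)
      then have "(t * v z)\<^sup>2 \<le> (t * b)\<^sup>2" by (simp add: abs_le_square_iff[symmetric])
      moreover have "?e z \<le> 1 + t * v z + 2 * (t * v z)\<^sup>2" using tv t(2) by (intro exp_quadratic_bound) simp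
      ultimately show "?e z \<le> (1 + 2 * (t * b)\<^sup>2) + t * v z" by simp
    qed
    also have "\<dots> = (1 + 2 * (t * b)\<^sup>2) + t * K UNIV C1 {i} v (shift_conf l x)" by (rule a.K_shift[OF v(1) y])
    also have "\<dots> \<le> ?c" using mult_left_mono[OF Kv[OF y] t(1)] by simp
    finally have le: "K UNIV C1 {i} ?e (shift_conf l x) \<le> ?c" .
    have "K UNIV C1 {i + l} (\<lambda>x. ?G x * ?e (shift_conf l x)) x = ?G x * K UNIV C1 {i} ?e (shift_conf l x)"
      unfolding r.K_pull[OF x g] K_shift_conf[OF fat be x] ..
    then show "K UNIV C1 {i + l} (\<lambda>x. ?G x * ?e (shift_conf l x)) x \<le> ?G x * ?c"
      using mult_left_mono[OF le exp_ge_zero] by simp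
  qed
  also have "\<dots> = ?c * (LINT x|\<mu>. ?G x)" by simp
  also have "\<dots> \<le> ?c * ?c ^ card P"
    using insert.IH insert.prems t(1) \<epsilon> by (intro mult_left_mono) auto
  finally show ?case using insert.hyps by simp
qed

text \<open>Spacing \<open>2 * r + 1\<close> makes the cubes of radius \<open>r\<close> around the
  centres pairwise disjoint.\<close>

definition centres :: "nat => nat => 'd site set" where
  "centres r m = (\<lambda>c. \<chi> a. (2 * int r + 1) * c $ a) ` hypercube m"

lemma centres:
  shows "finite (centres r m)" "card (centres r m) = (2 * m + 1) ^ CARD('d)"
    "[|k \<in> centres r m; l \<in> centres r m; k \<noteq> l; i \<in> hypercube r; j \<in> hypercube r|] ==> i + l \<noteq> j + k"
    "[|k \<in> centres r m; j \<in> hypercube r; r + (2 * r + 1) * m \<le> n|] ==> j + k \<in> hypercube n"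
proof -
  show "finite (centres r m)" unfolding centres_def by (intro finite_imageI finite_hypercube)
  have "inj (\<lambda>c :: 'd site. \<chi> a. (2 * int r + 1) * c $ a)"
    by (rule injI) (auto simp: vec_eq_iff)
  then show "card (centres r m) = (2 * m + 1) ^ CARD('d)"
    unfolding centres_def by (subst card_image) (auto intro: inj_on_subset simp: card_hypercube)
  show "i + l \<noteq> j + k" if h: "k \<in> centres r m" "l \<in> centres r m" "k \<noteq> l" "i \<in> hypercube r" "j \<in> hypercube r"
  proof
    assume e: "i + l = j + k"
    obtain c d where c: "k = (\<chi> a. (2 * int r + 1) * c $ a)" "l = (\<chi> a. (2 * int r + 1) * d $ a)"
      using h(1,2) by (auto simp: centres_def)
    have "c $ a = d $ a" for a
    proof (rule ccontr)
      assume "c $ a \<noteq> d $ a"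
      then have "1 \<le> \<bar>d $ a - c $ a\<bar>" by linarith
      then have "2 * int r + 1 \<le> (2 * int r + 1) * \<bar>d $ a - c $ a\<bar>" using mult_left_mono[of 1 _ "2 * int r + 1"] by simp
      also have "\<dots> = \<bar>(2 * int r + 1) * d $ a - (2 * int r + 1) * c $ a\<bar>" by (simp add: abs_mult flip: right_diff_distrib)
      also have "\<dots> = \<bar>j $ a - i $ a\<bar>" using arg_cong[OF e, of "\<lambda>x. x $ a"] c by (simp add: algebra_simps)
      also have "\<dots> \<le> 2 * int r" 
      proof -
        have "\<bar>i $ a\<bar> \<le> int r" "\<bar>j $ a\<bar> \<le> int r" using h(4,5) by (auto simp: hypercube_def)
        then show ?thesis by linarith
      qed
      finally show False by simp
    qed
    then show False using h(3) c by (simp add: vec_eq_iff)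
  qed
  show "j + k \<in> hypercube n" if h: "k \<in> centres r m" "j \<in> hypercube r" "r + (2 * r + 1) * m \<le> n"
    unfolding hypercube_def
  proof (intro CollectI allI)
    fix a
    obtain c where c: "k = (\<chi> a. (2 * int r + 1) * c $ a)" "c \<in> hypercube m" using h(1) by (auto simp: centres_def)
    have "\<bar>(j + k) $ a\<bar> \<le> \<bar>j $ a\<bar> + (2 * int r + 1) * \<bar>c $ a\<bar>"
      using abs_triangle_ineq[of "j $ a" "(2 * int r + 1) * c $ a"] c by (simp add: abs_mult)
    also have "\<dots> \<le> int r + (2 * int r + 1) * int m"
      using h(2) c(2) by (intro add_mono mult_left_mono) (auto simp: hypercube_def)
    also have "\<dots> \<le> int n" using of_nat_mono[OF h(3), where 'a = int] by (simp add: algebra_simps)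
    finally show "\<bar>(j + k) $ a\<bar> \<le> int n" .
  qed
qed

text \<open>A violated one-site equation gives a local observable whose mean under
  \<open>lam \<nu>\<close> clearly exceeds all its one-site conditional means. The sum of its
  translates over separated centres is the test function in \<open>entropy_ineq\<close>: its mean
  grows with the number of centres by translation invariance, and \<open>packed_moment\<close>
  bounds the exponential moment by a product with a smaller rate.\<close>

lemma entropy_gap:
  assumes \<nu>: "tip \<nu>" and ninv: "\<not> invar UNIV C1 (lam \<nu>)"
  shows "\<exists>\<kappa>>0. \<exists>N. \<forall>n\<ge>N. \<kappa> * real (card (cube n)) \<le>
     fe (hypercube n) \<nu> - fe (hypercube n) (evolve \<Phi> q \<tau> \<nu>) + 4 * Bd (cube n)"
proof -
  have p: "pm \<nu>" using \<nu> by (simp add: tip_def)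
  let ?\<nu>' = "evolve \<Phi> q \<tau> \<nu>"
  note il = prob_integrable[OF lam(1)[OF p], unfolded bm_sets_cong[OF lam(2)[OF p]]]
  obtain i f0 where f0: "bm CU f0" "ql UNIV f0" "(LINT x|lam \<nu>. K UNIV C1 {i} f0 x) \<noteq> (LINT x|lam \<nu>. f0 x)"
    using invar_from_ql[OF fat lam(1,2)[OF p]] ninv by blast
  interpret r: pot_resample \<Phi> C1 UNIV "{i}" using fat by unfold_locales auto
  define x0 where "x0 = (LINT x|lam \<nu>. f0 x - K UNIV C1 {i} f0 x)"
  have x0: "x0 \<noteq> 0" using f0 Bochner_Integration.integral_diff[OF il il, OF f0(1) r.bm_K[OF f0(1)]] by (simp add: x0_def)
  define s where "s = sgn x0"
  have s: "\<bar>s\<bar> = 1" using x0 by (simp add: s_def abs_sgn_eq)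
  \<comment> \<open>\<open>K\<close> is idempotent, so \<open>v\<close> has conditional mean 0
    everywhere, yet its mean under \<open>lam \<nu>\<close> is not 0; the sign \<open>s\<close>
    makes it the positive number \<open>X\<close>.\<close>
  define v where "v = (\<lambda>x. s * (f0 x - K UNIV C1 {i} f0 x))"
  define X where "X = \<bar>x0\<bar>"
  have X: "0 < X" "(LINT x|lam \<nu>. v x) = X" using x0 by (simp_all add: X_def v_def x0_def[symmetric] s_def sgn_if)
  have bv: "bm CU v" unfolding v_def by (intro bm_mult bm_const bm_diff f0 r.bm_K)
  have qv: "ql UNIV v"
  proof -
    have "ql UNIV (\<lambda>x. f0 x - K UNIV C1 {i} f0 x)"
      unfolding ql_def
    proof (intro allI impI)
      fix e :: real assume e: "e > 0"
      obtain L1 where L1: "finite L1" "\<And>\<xi> \<eta>. \<xi> \<in> space CU ==> \<eta> \<in> space CU ==> (\<And>i. i \<in> L1 ==> \<xi> i = \<eta> i) ==> \<bar>f0 \<xi> - f0 \<eta>\<bar> \<le> e / 2"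
        using qlE[OF f0(2), of "e / 2"] e by (metis half_gt_zero)
      obtain L2 where L2: "finite L2" "\<And>\<xi> \<eta>. \<xi> \<in> space CU ==> \<eta> \<in> space CU ==> (\<And>i. i \<in> L2 ==> \<xi> i = \<eta> i) ==> \<bar>K UNIV C1 {i} f0 \<xi> - K UNIV C1 {i} f0 \<eta>\<bar> \<le> e / 2"
        using qlE[OF r.ql_K[OF f0(2,1)], of "e / 2"] e by (metis half_gt_zero)
      show "\<exists>L. finite L \<and> L \<subseteq> UNIV \<and> (\<forall>\<xi>\<in>space CU. \<forall>\<eta>\<in>space CU. (\<forall>i\<in>L. \<xi> i = \<eta> i) \<longrightarrow>
          \<bar>f0 \<xi> - K UNIV C1 {i} f0 \<xi> - (f0 \<eta> - K UNIV C1 {i} f0 \<eta>)\<bar> \<le> e)"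
      proof (intro exI[of _ "L1 \<union> L2"] conjI ballI impI)
        fix \<xi> \<eta> :: "('d, real) conf" assume h: "\<xi> \<in> space CU" "\<eta> \<in> space CU" "\<forall>i\<in>L1 \<union> L2. \<xi> i = \<eta> i"
        have "\<bar>f0 \<xi> - f0 \<eta>\<bar> \<le> e / 2" "\<bar>K UNIV C1 {i} f0 \<xi> - K UNIV C1 {i} f0 \<eta>\<bar> \<le> e / 2"
          by (rule L1(2)[OF h(1,2)], use h(3) in simp, rule L2(2)[OF h(1,2)], use h(3) in simp)
        then show "\<bar>f0 \<xi> - K UNIV C1 {i} f0 \<xi> - (f0 \<eta> - K UNIV C1 {i} f0 \<eta>)\<bar> \<le> e" by linarith
      qed (use L1 L2 in auto)
    qed
    then show ?thesis unfolding v_def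
      by (rule ql_lipschitz[of _ _ 1 "\<lambda>y. s * y"]) (use s in \<open>auto simp: abs_mult simp flip: right_diff_distrib\<close>)
  qed
  have Kv: "K UNIV C1 {i} v x = 0" if x: "x \<in> space CU" for x
  proof -
    have "K UNIV C1 {i} v x = s * K UNIV C1 {i} (\<lambda>x. f0 x - K UNIV C1 {i} f0 x) x"
      using r.K_shift[OF bm_diff[OF f0(1) r.bm_K[OF f0(1)]] x, of 0 s] by (simp add: v_def)
    also have "K UNIV C1 {i} (\<lambda>x. f0 x - K UNIV C1 {i} f0 x) x = 0"
      unfolding r.K_diff[OF f0(1) r.bm_K[OF f0(1)] x] r.K_idem[OF x] by simp
    finally show ?thesis by simp
  qed
  \<comment> \<open>The localisation error \<open>X / 4\<close> leaves conditional means of at most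
    \<open>X / 4\<close> against a mean of at least \<open>3 * X / 4\<close>.\<close>
  obtain L w where w: "finite L" "bm CU w" "\<And>x. x \<in> space CU ==> \<bar>v x - w x\<bar> \<le> X / 4"
    "\<And>\<xi> \<eta> :: ('d, real) conf. (\<forall>i\<in>L. \<xi> i = \<eta> i) ==> w \<xi> = w \<eta>"
    using local_approx[OF bv qv, of "X / 4"] X(1) by (metis zero_less_divide_iff zero_less_numeral)
  obtain b0 where b0: "\<And>x. x \<in> space CU ==> \<bar>w x\<bar> \<le> b0" using bm_bounded[OF w(2)] by blast
  \<comment> \<open>Taking \<open>b\<close> at least \<open>X\<close> ensures
    \<open>t * b \<le> 1 / 2\<close> below.\<close>
  define b where "b = max b0 X"
  have b: "\<And>x. x \<in> space CU ==> \<bar>w x\<bar> \<le> b" "X \<le> b" "0 < b" using b0 X(1) by (auto simp: b_def le_max_iff_disj)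
  have Kw: "K UNIV C1 {i} w x \<le> X / 4" if x: "x \<in> space CU" for x
  proof -
    have "K UNIV C1 {i} w x = - K UNIV C1 {i} (\<lambda>x. v x - w x) x" using r.K_diff[OF bv w(2) x] Kv[OF x] by simp
    also have "\<dots> \<le> X / 4" using r.K_abs_le[OF bm_diff[OF bv w(2)] x w(3)] by (simp add: abs_le_iff)
    finally show ?thesis .
  qed
  have lw: "3 * X / 4 \<le> (LINT x|lam \<nu>. w x)"
  proof -
    have "(LINT x|lam \<nu>. v x) - (LINT x|lam \<nu>. w x) = (LINT x|lam \<nu>. v x - w x)"
      by (rule Bochner_Integration.integral_diff[OF il il, OF bv w(2), symmetric])
    also have "\<dots> \<le> X / 4"
      using prob_abs_integral_le[OF lam(1)[OF p], of "\<lambda>x. v x - w x" "X / 4"] w(3) bm_diff[OF bv w(2)]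
      by (simp add: bm_sets_cong[OF lam(2)[OF p]] lam(3)[OF p] abs_le_iff)
    finally show ?thesis using X(2) by simp
  qed
  \<comment> \<open>Maximiser of \<open>t * X / 2 - 2 * (t * b)\<^sup>2\<close>, the guaranteed gain
    per centre; the maximal value is \<open>\<delta>\<close> below.\<close>
  define t where "t = X / (8 * b\<^sup>2)"
  have tb: "t * b = X / (8 * b)" using b(3) by (simp add: t_def power2_eq_square)
  have t: "0 < t" "t * b \<le> 1 / 2"
    using X(1) b(2,3) unfolding tb by (auto simp: t_def field_simps)
  define \<delta> where "\<delta> = X\<^sup>2 / (32 * b\<^sup>2)"
  have \<delta>: "0 < \<delta>" using X(1) b(3) by (simp add: \<delta>_def)
  have \<delta>_eq: "t * (3 * X / 4) - (t * (X / 4) + 2 * (t * b)\<^sup>2) = \<delta>"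
    unfolding tb using b(3) by (simp add: t_def \<delta>_def field_simps power2_eq_square)
  obtain r where r: "insert i L \<subseteq> hypercube r" using hypercube_exhausts[of "insert i L"] w(1) by auto
  have main: "real ((2 * m + 1) ^ CARD('d)) * \<delta> \<le> fe (hypercube n) \<nu> - fe (hypercube n) ?\<nu>' + 4 * Bd (cube n)"
    if n: "r + (2 * r + 1) * m \<le> n" for m n
  proof -
    let ?P = "centres r m" and ?N = "real (card (centres r m))"
    let ?u = "\<lambda>x. t * (\<Sum>k\<in>?P. w (shift_conf k x))"
    have bu: "bm CU ?u" by (rule bm_shift_sum[OF centres(1) w(2)])
    have lu: "loc (hypercube n) ?u"
      unfolding loc_def
    proof (intro ballI impI arg_cong[of _ _ "\<lambda>y. t * y"] sum.cong refl w(4))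
      fix x y :: "('d, real) conf" and k j assume h: "\<forall>i\<in>hypercube n. x i = y i" "k \<in> ?P" "j \<in> L"
      then have "j + k \<in> hypercube n" using centres(4)[OF _ _ n] r by blast
      then show "shift_conf k x j = shift_conf k y j" using h(1) by (simp add: shift_conf_def)
    qed
    have "(LINT x|lam \<nu>. ?u x) = t * (\<Sum>k\<in>?P. LINT x|lam \<nu>. w (shift_conf k x))"
      using Bochner_Integration.integral_sum[of ?P "lam \<nu>" "\<lambda>k x. w (shift_conf k x)"] il[OF bm_shift[OF w(2)]] by simp
    also have "\<dots> = t * (?N * (LINT x|lam \<nu>. w x))" by (simp add: lam_shift[OF \<nu> w(2)])
    also have "\<dots> \<ge> t * (?N * (3 * X / 4))" using lw t(1) by (intro mult_left_mono) auto
    finally have 1: "?N * (t * (3 * X / 4)) \<le> (LINT x|lam \<nu>. ?u x)" by (simp add: mult_ac)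
    have p': "pm ?\<nu>'" by (rule evolve_pm[OF p])
    let ?c = "t * (X / 4) + 2 * (t * b)\<^sup>2"
    have c0: "0 \<le> ?c" using t(1) X(1) by simp
    have pos: "0 < (LINT x|lift ?\<nu>'. exp (?u x))"
      by (rule jensen_exp(2)[OF lift(1)[OF p']]) (simp only: bm_sets_cong[OF lift(2)[OF p']] bu)
    have "(LINT x|lift ?\<nu>'. exp (?u x)) \<le> (1 + t * (X / 4) + 2 * (t * b)\<^sup>2) ^ card ?P"
    proof (rule packed_moment[OF lift_invar[OF p'] w(2) b(1) w(4) Kw _ t(2) _ centres(1)])
      show "i + l \<noteq> j + k" if "k \<in> ?P" "l \<in> ?P" "k \<noteq> l" "j \<in> L" for k l j
        using centres(3)[OF that(1-3), of i j] r that(4) by blast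
    qed (use t(1) X(1) in auto)
    then have "ln (LINT x|lift ?\<nu>'. exp (?u x)) \<le> ln ((1 + ?c) ^ card ?P)"
      using pos c0 by (simp add: add.assoc)
    also have "\<dots> = ?N * ln (1 + ?c)" using c0 by (simp add: ln_realpow)
    also have "\<dots> \<le> ?N * ?c" using c0 by (intro mult_left_mono ln_add_one_self_le_self) auto
    finally have "?N * (t * (3 * X / 4)) - ?N * ?c \<le> fe (hypercube n) \<nu> - fe (hypercube n) ?\<nu>' + 4 * Bd (cube n)"
      using 1 entropy_ineq[OF finite_hypercube p bu lu] by linarith
    then show ?thesis unfolding right_diff_distrib[symmetric] \<delta>_eq centres(2) .
  qed
  \<comment> \<open>Bounds the number of sites per centre, because
    \<open>2 * n + 1 \<le> 3 * (2 * r + 1) * (2 * m + 1)\<close> for the largest admissible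
    \<open>m\<close>.\<close>
  define C where "C = (3 * (2 * real r + 1)) ^ CARD('d)"
  have C: "0 < C" by (simp add: C_def)
  have "\<delta> / C * card (cube n) \<le> fe (hypercube n) \<nu> - fe (hypercube n) ?\<nu>' + 4 * Bd (cube n)"
    if n: "r \<le> n" for n
  proof -
    define m where "m = (n - r) div (2 * r + 1)"
    have m: "r + (2 * r + 1) * m \<le> n" using n div_times_less_eq_dividend[of "n - r" "2 * r + 1"] by (simp add: m_def mult.commute)
    have "n - r < (2 * r + 1) * (m + 1)" unfolding m_def using dividend_less_div_times[of "2 * r + 1" "n - r"] by (simp add: mult.commute)
    then have "2 * n + 1 \<le> (3 * (2 * r + 1)) * (2 * m + 1)" using n by (simp add: algebra_simps)
    then have "(2 * n + 1) ^ CARD('d) \<le> ((3 * (2 * r + 1)) * (2 * m + 1)) ^ CARD('d)" by (rule power_mono) simp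
    then have "real ((2 * n + 1) ^ CARD('d)) \<le> real (((3 * (2 * r + 1)) * (2 * m + 1)) ^ CARD('d))" by (simp only: of_nat_le_iff)
    also have "\<dots> = C * real ((2 * m + 1) ^ CARD('d))"
      unfolding power_mult_distrib of_nat_mult C_def by (simp add: add.commute)
    finally have "real (card (cube n)) / C \<le> real ((2 * m + 1) ^ CARD('d))"
      unfolding card_hypercube using C by (simp add: divide_le_eq mult.commute)
    from mult_right_mono[OF this less_imp_le[OF \<delta>]] main[OF m]
    show ?thesis
      by (simp add: mult.commute)
  qed
  moreover have "0 < \<delta> / C" using \<delta> C by simp
  ultimately show ?thesis by blast
qed

end

section \<open>The discrete specification and its local entropies\<close>

context clock_model
begin

text \<open>Filling in the angle 0 on \<open>Y\<close> lets functions on the full space be evaluated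
  at configurations off \<open>Y\<close>. The partition functions it is used for ignore the spins in
  \<open>Y\<close>.\<close>

definition ext :: "'d site set => ('d, real) conf => ('d, real) conf" where
  "ext Y \<xi> = (\<lambda>i. if i \<in> Y then 0 else \<xi> i)"

lemma ext_measurable: "ext Y \<in> measurable (cspace (- Y)) CU"
proof (rule measurable_cspaceI)
  fix i :: "'d site"
  have "(0 :: real) \<in> circle" by (simp add: circle_def)
  then show "(\<lambda>\<xi>. ext Y \<xi> i) \<in> measurable (cspace (- Y)) (restrict_space borel circle)"
    by (cases "i \<in> Y") (simp_all add: ext_def cspace_component space_restrict_space)
qed auto

lemma ext_space: "\<xi> \<in> cs (- Y) ==> ext Y \<xi> \<in> space CU"
  by (rule measurable_space[OF ext_measurable])

text \<open>Partition function of \<open>Y\<close> in the cells \<open>w\<close>, given the outside.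
  The resampling operators read the cells off their argument, hence the overwriting with
  \<open>pt Y w\<close>.\<close>

definition Nw :: "'d site set => ('d, nat) conf => ('d, real) conf => real" where
  "Nw Y w x = num UNIV C1 Y (\<lambda>_. 1) (override_on x (pt Y w) Y)"

definition Nn :: "'d site set => ('d, real) conf => real" where
  "Nn Y = num UNIV Full Y (\<lambda>_. 1)"

lemma override_pt: "w \<in> W Y ==> x \<in> space CU ==> override_on x (pt Y w) Y \<in> space CU"
  using pt(1)[of w Y] by (auto simp: space_CU override_on_def)

lemma override_pt_measurable: "w \<in> W Y ==> (\<lambda>x. override_on x (pt Y w) Y) \<in> measurable CU CU"
proof (rule measurable_cspaceI)
  fix i :: "'d site" assume w: "w \<in> W Y"
  have "pt Y w i \<in> circle" using pt(1)[OF w] by (simp add: space_CU)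
  then show "(\<lambda>x. override_on x (pt Y w) Y i) \<in> measurable CU (restrict_space borel circle)"
    by (cases "i \<in> Y") (simp_all add: cspace_component space_restrict_space)
qed auto

lemma Nn_sum: "finite Y ==> x \<in> space CU ==> Nn Y x = (\<Sum>w\<in>W Y. Nw Y w x)"
  using J_Full_split[of Y "wt UNIV Y" x "\<lambda>_. 1"] bm_wt[of Y UNIV] by (simp add: Nn_def Nw_def num_def)

lemma bm_Nw: "finite Y ==> w \<in> W Y ==> bm CU (Nw Y w)"
  unfolding Nw_def by (rule bm_compose[OF pot_resample.bm_num[OF presC bm_const] override_pt_measurable])

lemma bm_Nn: "finite Y ==> bm CU (Nn Y)"
  unfolding Nn_def by (rule pot_resample.bm_num[OF presF bm_const])

lemma bm_ext: "bm CU f ==> bm (cspace (- Y)) (\<lambda>\<xi>. f (ext Y \<xi>))"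
  by (rule bm_compose[OF _ ext_measurable])

lemma Nw_bounds:
  assumes "finite Y" "w \<in> W Y" "x \<in> space CU"
  shows "exp (- Bd Y) * z Y w \<le> Nw Y w x" "Nw Y w x \<le> exp (Bd Y) * z Y w"
proof -
  have "coarse q (override_on x (pt Y w) Y i) = w i" if "i \<in> Y" for i
    using pt(2)[OF assms(2) that] that by (simp add: override_on_def)
  from num_compare[OF assms(1) bm_const loc_const zero_le_one override_pt[OF assms(2,3)] assms(2) this, folded z_def]
  show "exp (- Bd Y) * z Y w \<le> Nw Y w x" "Nw Y w x \<le> exp (Bd Y) * z Y w" by (simp_all add: Nw_def)
qed

definition Z :: "'d site set => real" where "Z Y = (\<Sum>w\<in>W Y. z Y w)"

lemma W_nonempty: "W Y \<noteq> {}"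
  using q by (auto simp: W_def PiE_eq_empty_iff)

lemma Z_pos: "finite Y ==> 0 < Z Y"
  unfolding Z_def using z_pos finite_W W_nonempty by (intro sum_pos) auto

lemma Nn_bounds:
  assumes "finite Y" "x \<in> space CU"
  shows "exp (- Bd Y) * Z Y \<le> Nn Y x" "Nn Y x \<le> exp (Bd Y) * Z Y"
  unfolding Nn_sum[OF assms] Z_def sum_distrib_left using Nw_bounds[OF assms(1) _ assms(2)] by (auto intro: sum_mono)

lemma cgV:
  assumes "s \<in> space Om"
  shows "invar V C1 (cg V s)" "prob_space (cg V s)" "sets (cg V s) = sets (cspace V)" "space (cg V s) = cs V"
    "bm (cspace V) f ==> integrable (cg V s) f"
proof -
  show 1: "invar V C1 (cg V s)" by (rule cg(1)) (rule OmegaD[OF assms])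
  note i = invarD[OF 1]
  show "prob_space (cg V s)" "sets (cg V s) = sets (cspace V)" "space (cg V s) = cs V" using i .
  show "bm (cspace V) f ==> integrable (cg V s) f" using prob_integrable[OF i(1), of f] by (simp add: bm_sets_cong[OF i(2)])
qed

definition cN :: "'d site set => (('d, real) conf => real) => ('d, nat) conf => real" where
  "cN Y f s = (LINT \<xi>|cg (- Y) s. f (ext Y \<xi>))"

lemma bm_cN: "bm CU f ==> bm Om (cN Y f)"
  unfolding cN_def by (rule bm_cg[OF bm_ext])

lemma cN_mono:
  assumes "s \<in> space Om" "bm CU f" "bm CU g" "\<And>x. x \<in> space CU ==> f x \<le> g x" shows "cN Y f s \<le> cN Y g s"
  unfolding cN_def using assms(4) cgV(4)[OF assms(1)] ext_space
  by (intro integral_mono cgV(5)[OF assms(1)] bm_ext assms(2,3)) auto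

lemma cN_const: "s \<in> space Om ==> cN Y (\<lambda>_. c) s = c"
  unfolding cN_def using prob_space.prob_space[OF cgV(2)] by simp

text \<open>A quotient of two expectations under the constrained measure off \<open>Y\<close>, not
  the expectation of a quotient: this is the difficulty in deriving the discrete DLR
  equations.\<close>

lemma disc_prob_eq:
  assumes fin: "finite Y" and w: "w \<in> W Y" and s: "s \<in> space Om"
  shows "disc_prob \<Phi> q Y w s = cN Y (Nw Y w) s / cN Y (Nn Y) s"
proof -
  have s': "\<And>i. i \<in> - Y ==> s i < q" using OmegaD[OF s] by blast
  have o: "override_on \<xi> \<sigma> Y = override_on (ext Y \<xi>) \<sigma> Y" for \<xi> \<sigma> :: "('d, real) conf"
    by (auto simp: override_on_def ext_def)
  have a: "(LINT \<sigma>|lebc Y. exp (- H UNIV Y (override_on \<xi> \<sigma> Y)) * indicator {\<sigma>. \<forall>i\<in>Y. coarse q (\<sigma> i) = w i} \<sigma>) = Nw Y w (ext Y \<xi>)" for \<xi>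
    unfolding Nw_def num_def J_def
  proof (rule icong[OF refl])
    fix \<sigma> assume sg: "\<sigma> \<in> space (lebc Y)"
    have c: "comp_ind C1 Y (override_on (ext Y \<xi>) (pt Y w) Y) \<sigma> = comp_ind C1 Y (pt Y w) \<sigma>"
      by (auto simp: comp_ind_def override_on_def intro!: prod.cong)
    have d: "override_on (override_on (ext Y \<xi>) (pt Y w) Y) \<sigma> Y = override_on \<xi> \<sigma> Y"
      by (auto simp: override_on_def ext_def)
    have e: "(w = restrict (\<lambda>i. coarse q (\<sigma> i)) Y) \<longleftrightarrow> (\<forall>i\<in>Y. coarse q (\<sigma> i) = w i)"
      using w by (auto simp: W_def PiE_iff extensional_def fun_eq_iff restrict_def)
    show "exp (- H UNIV Y (override_on \<xi> \<sigma> Y)) * indicator {\<sigma>. \<forall>i\<in>Y. coarse q (\<sigma> i) = w i} \<sigma> =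
      comp_ind C1 Y (override_on (ext Y \<xi>) (pt Y w) Y) \<sigma> * (wt UNIV Y (override_on (override_on (ext Y \<xi>) (pt Y w) Y) \<sigma> Y) * 1)"
      unfolding c d comp_ind_split(1)[OF fin sg w] e wt_def by (simp add: indicator_def)
  qed
  have b: "(LINT \<sigma>|lebc Y. exp (- H UNIV Y (override_on \<xi> \<sigma> Y))) = Nn Y (ext Y \<xi>)" for \<xi>
    unfolding Nn_def num_def J_def o[of \<xi>] by (simp add: comp_ind_def wt_def)
  show ?thesis
    unfolding disc_prob_def a b cN_def
    by (subst (1 2) cg(6)[OF s']) (auto intro: bm_measurable bm_ext bm_Nw bm_Nn fin w)
qed

lemma cN_bounds:
  assumes "finite Y" "s \<in> space Om"
  shows "exp (- Bd Y) * Z Y \<le> cN Y (Nn Y) s" "cN Y (Nn Y) s \<le> exp (Bd Y) * Z Y" "0 < cN Y (Nn Y) s"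
    "w \<in> W Y ==> exp (- Bd Y) * z Y w \<le> cN Y (Nw Y w) s" "w \<in> W Y ==> cN Y (Nw Y w) s \<le> exp (Bd Y) * z Y w"
proof -
  show 1: "exp (- Bd Y) * Z Y \<le> cN Y (Nn Y) s"
    using cN_mono[OF assms(2) bm_const bm_Nn[OF assms(1)] Nn_bounds(1)[OF assms(1)], of Y] by (simp add: cN_const[OF assms(2)])
  show "cN Y (Nn Y) s \<le> exp (Bd Y) * Z Y"
    using cN_mono[OF assms(2) bm_Nn[OF assms(1)] bm_const Nn_bounds(2)[OF assms(1)], of Y] by (simp add: cN_const[OF assms(2)])
  show "0 < cN Y (Nn Y) s" using 1 Z_pos[OF assms(1)] by (smt (verit) exp_gt_zero mult_pos_pos)
  show "w \<in> W Y ==> exp (- Bd Y) * z Y w \<le> cN Y (Nw Y w) s"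
    using cN_mono[OF assms(2) bm_const bm_Nw[OF assms(1)] Nw_bounds(1)[OF assms(1)], of w Y] by (simp add: cN_const[OF assms(2)])
  show "w \<in> W Y ==> cN Y (Nw Y w) s \<le> exp (Bd Y) * z Y w"
    using cN_mono[OF assms(2) bm_Nw[OF assms(1)] bm_const Nw_bounds(2)[OF assms(1)], of w Y] by (simp add: cN_const[OF assms(2)])
qed

text \<open>Numerator and denominator are each compared with the free system. The bounds do not
  involve the outside configuration, so all Gibbs measures share their cylinder probabilities up to
  boundary factors.\<close>

lemma disc_prob_bounds:
  assumes "finite Y" "w \<in> W Y" "s \<in> space Om"
  shows "exp (- (2 * Bd Y)) * (z Y w / Z Y) \<le> disc_prob \<Phi> q Y w s" "disc_prob \<Phi> q Y w s \<le> exp (2 * Bd Y) * (z Y w / Z Y)"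
    "0 \<le> disc_prob \<Phi> q Y w s"
proof -
  note b = cN_bounds[OF assms(1,3)]
  have e: "exp (2 * Bd Y) = exp (Bd Y) * exp (Bd Y)" by (simp flip: exp_add)
  have zp: "0 < z Y w" "0 < Z Y" using z_pos[OF assms(1,2)] Z_pos[OF assms(1)] .
  have n0: "0 \<le> cN Y (Nw Y w) s" by (rule order_trans[OF _ b(4)[OF assms(2)]]) (use zp in simp)
  show "0 \<le> disc_prob \<Phi> q Y w s" unfolding disc_prob_eq[OF assms] using n0 b(3) by simp
  have "exp (- (2 * Bd Y)) * (z Y w / Z Y) = (exp (- Bd Y) * z Y w) / (exp (Bd Y) * Z Y)"
    unfolding exp_minus e by (simp add: divide_inverse mult_ac)
  also have "\<dots> \<le> disc_prob \<Phi> q Y w s"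
    unfolding disc_prob_eq[OF assms] by (rule frac_le[OF n0 b(4)[OF assms(2)] b(3,2)])
  finally show "exp (- (2 * Bd Y)) * (z Y w / Z Y) \<le> disc_prob \<Phi> q Y w s" .
  have "disc_prob \<Phi> q Y w s \<le> (exp (Bd Y) * z Y w) / (exp (- Bd Y) * Z Y)"
    unfolding disc_prob_eq[OF assms] by (rule frac_le[OF _ b(5)[OF assms(2)] _ b(1)]) (use zp in simp_all)
  also have "\<dots> = exp (2 * Bd Y) * (z Y w / Z Y)" unfolding exp_minus e by (simp add: divide_inverse mult_ac)
  finally show "disc_prob \<Phi> q Y w s \<le> exp (2 * Bd Y) * (z Y w / Z Y)" .
qed

lemma disc_prob_measurable: "finite Y ==> w \<in> W Y ==> bm Om (disc_prob \<Phi> q Y w)"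
proof -
  assume h: "finite Y" "w \<in> W Y"
  have "bm Om (\<lambda>s. cN Y (Nw Y w) s / cN Y (Nn Y) s)"
  proof (rule bmI)
    show "(\<lambda>s. cN Y (Nw Y w) s / cN Y (Nn Y) s) \<in> borel_measurable Om"
      by (intro borel_measurable_divide bm_measurable bm_cN bm_Nw bm_Nn h)
    show "\<bar>cN Y (Nw Y w) s / cN Y (Nn Y) s\<bar> \<le> exp (2 * Bd Y) * (z Y w / Z Y)" if "s \<in> space Om" for s
      using disc_prob_bounds(2,3)[OF h that] disc_prob_eq[OF h that] by simp
  qed
  then show ?thesis by (rule bm_cong) (simp add: disc_prob_eq[OF h])
qed

lemma override_Om:
  assumes "w \<in> W Y" shows "s \<in> space Om ==> override_on s w Y \<in> space Om"
    "(\<lambda>s. override_on s w Y) \<in> measurable Om Om"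
proof -
  show sp: "override_on s w Y \<in> space Om" if "s \<in> space Om" for s
    using OmegaD[OF that] assms by (auto simp: space_Omega W_def override_on_def)
  show "(\<lambda>s. override_on s w Y) \<in> measurable Om Om"
    unfolding Omega_def
  proof (rule measurable_PiM_single')
    fix i :: "'d site"
    have "(\<lambda>s. s i) \<in> measurable (PiM UNIV (\<lambda>_. count_space {..<q})) (count_space {..<q})"
      by (rule measurable_component_singleton) simp
    then show "(\<lambda>s. override_on s w Y i) \<in> measurable (PiM UNIV (\<lambda>_. count_space {..<q})) (count_space {..<q})"
      using assms by (cases "i \<in> Y") (auto simp: override_on_def W_def intro!: measurable_const)
  qed (use sp in \<open>auto simp: Omega_def space_PiM\<close>)
qed

lemma disc_spec_emeasure:
  assumes fin: "finite Y" and s: "s \<in> space Om" and B: "B \<in> sets Om"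
  shows "emeasure (disc_spec \<Phi> q Y s) B = ennreal (\<Sum>w\<in>W Y. disc_prob \<Phi> q Y w s * indicator B (override_on s w Y))"
proof -
  let ?D = "density (count_space (W Y)) (\<lambda>w. ennreal (disc_prob \<Phi> q Y w s))"
  have m: "(\<lambda>w. override_on s w Y) \<in> measurable ?D Om" using override_Om(1)[OF _ s] by (auto simp: measurable_def)
  have "emeasure (disc_spec \<Phi> q Y s) B = emeasure ?D ((\<lambda>w. override_on s w Y) -` B \<inter> space ?D)"
    unfolding disc_spec_def W_def[symmetric] by (rule emeasure_distr[OF m B])
  also have "\<dots> = (\<integral>\<^sup>+w. ennreal (disc_prob \<Phi> q Y w s) * indicator ((\<lambda>w. override_on s w Y) -` B \<inter> W Y) w \<partial>count_space (W Y))"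
    by (subst emeasure_density) auto
  also have "\<dots> = (\<Sum>w\<in>W Y. ennreal (disc_prob \<Phi> q Y w s) * indicator ((\<lambda>w. override_on s w Y) -` B \<inter> W Y) w)"
    by (rule nn_integral_count_space_finite[OF finite_W[OF fin]])
  also have "\<dots> = (\<Sum>w\<in>W Y. ennreal (disc_prob \<Phi> q Y w s * indicator B (override_on s w Y)))"
    by (intro sum.cong refl) (auto simp: indicator_def)
  also have "\<dots> = ennreal (\<Sum>w\<in>W Y. disc_prob \<Phi> q Y w s * indicator B (override_on s w Y))"
    using disc_prob_bounds(3)[OF fin _ s] by (intro sum_ennreal) auto
  finally show ?thesis .
qed

text \<open>A block has finitely many discrete configurations, so the kernel integral in the DLR
  equation is a finite sum of real integrals.\<close>

lemma gibbs_iff: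
  assumes \<mu>: "pm \<mu>"
  shows "\<mu> \<in> gibbs_measures UNIV Om (disc_spec \<Phi> q) \<longleftrightarrow> (\<forall>Y B. finite Y \<longrightarrow> B \<in> sets Om \<longrightarrow>
    measure \<mu> B = (\<Sum>w\<in>W Y. LINT s|\<mu>. disc_prob \<Phi> q Y w s * indicator B (override_on s w Y)))"
proof -
  interpret prob_space \<mu> by (rule pmD(1)[OF \<mu>])
  have eq: "(\<integral>\<^sup>+s. emeasure (disc_spec \<Phi> q Y s) B \<partial>\<mu>) = ennreal (\<Sum>w\<in>W Y. LINT s|\<mu>. disc_prob \<Phi> q Y w s * indicator B (override_on s w Y))"
    and nn: "0 \<le> (\<Sum>w\<in>W Y. LINT s|\<mu>. disc_prob \<Phi> q Y w s * indicator B (override_on s w Y))"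
    if fin: "finite Y" and B: "B \<in> sets Om" for Y B
  proof -
    let ?f = "\<lambda>w s. disc_prob \<Phi> q Y w s * indicator B (override_on s w Y)"
    have b: "bm Om (?f w)" if "w \<in> W Y" for w
      by (rule bm_mult[OF disc_prob_measurable[OF fin that] bm_compose[OF bm_indicator[OF B] override_Om(2)[OF that]]])
    have n0: "0 \<le> ?f w s" if "w \<in> W Y" "s \<in> space Om" for w s using disc_prob_bounds(3)[OF fin that] by simp
    have "(\<integral>\<^sup>+s. emeasure (disc_spec \<Phi> q Y s) B \<partial>\<mu>) = (\<integral>\<^sup>+s. ennreal (\<Sum>w\<in>W Y. ?f w s) \<partial>\<mu>)"
      using pmD(3)[OF \<mu>] by (intro nn_integral_cong) (simp add: disc_spec_emeasure[OF fin _ B])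
    also have "\<dots> = ennreal (LINT s|\<mu>. (\<Sum>w\<in>W Y. ?f w s))"
      using b n0 pmD(3)[OF \<mu>] by (intro nn_integral_eq_integral pm_int[OF \<mu>] bm_sum finite_W fin AE_I2 sum_nonneg) auto
    also have "(LINT s|\<mu>. (\<Sum>w\<in>W Y. ?f w s)) = (\<Sum>w\<in>W Y. LINT s|\<mu>. ?f w s)"
      by (rule Bochner_Integration.integral_sum) (rule pm_int[OF \<mu> b])
    finally show "(\<integral>\<^sup>+s. emeasure (disc_spec \<Phi> q Y s) B \<partial>\<mu>) = ennreal (\<Sum>w\<in>W Y. LINT s|\<mu>. ?f w s)" .
    show "0 \<le> (\<Sum>w\<in>W Y. LINT s|\<mu>. ?f w s)"
      using n0 pmD(3)[OF \<mu>] by (intro sum_nonneg integral_nonneg_AE AE_I2) auto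
  qed
  show ?thesis
    unfolding gibbs_measures_def using pmD(1,2)[OF \<mu>] eq nn
    by (auto simp: emeasure_eq_measure)
qed

text \<open>The DLR equation of \<open>Y\<close> is applied to a cylinder of \<open>Y\<close>
  itself: only the term of that cylinder survives, and its kernel value has bounds independent of
  the outside.\<close>

lemma gibbs_mc_bounds:
  assumes \<mu>: "pm \<mu>" "\<mu> \<in> gibbs_measures UNIV Om (disc_spec \<Phi> q)" and fin: "finite Y" and w: "w \<in> W Y"
  shows "exp (- (2 * Bd Y)) * (z Y w / Z Y) \<le> mc \<mu> Y w" "mc \<mu> Y w \<le> exp (2 * Bd Y) * (z Y w / Z Y)"
proof -
  interpret prob_space \<mu> by (rule pmD(1)[OF \<mu>(1)])
  have "mc \<mu> Y w = (\<Sum>w'\<in>W Y. LINT s|\<mu>. disc_prob \<Phi> q Y w' s * indicator (cylinder q Y w) (override_on s w' Y))"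
    using \<mu>(2) fin cylinder_sets[OF fin] unfolding gibbs_iff[OF \<mu>(1)] mc_def by blast
  also have "\<dots> = (\<Sum>w'\<in>W Y. if w' = w then LINT s|\<mu>. disc_prob \<Phi> q Y w s else 0)"
  proof (rule sum.cong[OF refl])
    fix w' assume w': "w' \<in> W Y"
    have "indicator (cylinder q Y w) (override_on s w' Y) = (of_bool (w' = w) :: real)" if "s \<in> space Om" for s
    proof -
      have "restrict (override_on s w' Y) Y = w'" using w' by (auto simp: W_def PiE_iff extensional_def fun_eq_iff)
      then show ?thesis using override_Om(1)[OF w' that] by (auto simp: cylinder_restrict[OF w] indicator_def)
    qed
    then have "(LINT s|\<mu>. disc_prob \<Phi> q Y w' s * indicator (cylinder q Y w) (override_on s w' Y)) = (LINT s|\<mu>. disc_prob \<Phi> q Y w' s * of_bool (w' = w))"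
      using pmD(3)[OF \<mu>(1)] by (intro icong refl) auto
    then show "(LINT s|\<mu>. disc_prob \<Phi> q Y w' s * indicator (cylinder q Y w) (override_on s w' Y)) = (if w' = w then LINT s|\<mu>. disc_prob \<Phi> q Y w s else 0)"
      by simp
  qed
  also have "\<dots> = (LINT s|\<mu>. disc_prob \<Phi> q Y w s)" using w finite_W[OF fin] by simp
  finally have eq: "mc \<mu> Y w = (LINT s|\<mu>. disc_prob \<Phi> q Y w s)" .
  note i = pm_int[OF \<mu>(1) disc_prob_measurable[OF fin w]] pm_int[OF \<mu>(1) bm_const]
  have "(LINT s|\<mu>. exp (- (2 * Bd Y)) * (z Y w / Z Y)) \<le> (LINT s|\<mu>. disc_prob \<Phi> q Y w s)"
    using disc_prob_bounds(1)[OF fin w] pmD(3)[OF \<mu>(1)] by (intro integral_mono i) simp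
  then show "exp (- (2 * Bd Y)) * (z Y w / Z Y) \<le> mc \<mu> Y w" unfolding eq by (simp add: prob_space)
  have "(LINT s|\<mu>. disc_prob \<Phi> q Y w s) \<le> (LINT s|\<mu>. exp (2 * Bd Y) * (z Y w / Z Y))"
    using disc_prob_bounds(2)[OF fin w] pmD(3)[OF \<mu>(1)] by (intro integral_mono i) simp
  then show "mc \<mu> Y w \<le> exp (2 * Bd Y) * (z Y w / Z Y)" unfolding eq by (simp add: prob_space)
qed

end

section \<open>Relative entropy per site with respect to a Gibbs measure\<close>

context clock_model
begin

lemma Nrm_le: assumes "finite Y" shows "Nrm Y \<le> card Y * Nrm {0}"
proof -
  have e: "Nrm {i} = Nrm {0}" for i
  proof -
    have "bonds UNIV {i} = tr i ` bonds UNIV {0}" using tr_bonds[of i "{0}"] by simp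
    then have "Nrm {i} = (\<Sum>\<^sub>\<infinity>A\<in>bonds UNIV {0}. nrm (tr i A))"
      unfolding Nrm_def using infsum_reindex[OF inj_on_subset[OF tr_inj subset_UNIV], of nrm i "bonds UNIV {0}"] by (simp add: o_def)
    also have "\<dots> = Nrm {0}" unfolding Nrm_def by (intro infsum_cong nrm_tr) (simp add: bonds_def)
    finally show ?thesis .
  qed
  have u: "(\<Union>i\<in>Y. bonds UNIV {i}) = bonds UNIV Y" by (auto simp: bonds_def)
  have "infsum nrm (\<Union>i\<in>Y. bonds UNIV {i}) \<le> (\<Sum>i\<in>Y. infsum nrm (bonds UNIV {i}))"
  proof (rule infsum_UN_le[OF assms, THEN conjunct2])
    show "nrm summable_on bonds UNIV {i}" for i by (rule summable_bonds) simp
    show "0 \<le> nrm A" if "A \<in> bonds UNIV {i}" for i A using bondsD[OF that] nrm_nonneg by blast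
  qed
  moreover have "(\<Sum>i\<in>Y. Nrm {i}) = (\<Sum>i\<in>Y. Nrm {0})" by (rule sum.cong[OF refl e])
  ultimately show ?thesis unfolding u Nrm_def[symmetric] by simp
qed

lemma J_C1_one: "finite Y ==> x \<in> space CU ==> J C1 Y (\<lambda>_. 1) x = (2 * pi / real q) ^ card Y"
proof (induction Y rule: finite_induct)
  case empty
  show ?case by (simp add: J_def comp_ind_def leb_prod_def PiM_empty)
next
  case (insert i Y)
  interpret resample C1 UNIV Y by (rule resC[OF insert.hyps(1)])
  have s: "J C1 {i} (\<lambda>_. 1) \<zeta> = 2 * pi / real q" if "\<zeta> \<in> space CU" for \<zeta>
  proof -
    have c: "\<zeta> i \<in> circle" using that by (simp add: space_CU)
    show ?thesis
      unfolding J_single[OF fat UNIV_I bm_const that] cellrel_def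
      using arc_measure[OF q coarse_less[OF q c]] by (simp add: eq_commute)
  qed
  have "J C1 (insert i Y) (\<lambda>_. 1) x = J C1 Y (J C1 {i} (\<lambda>_. 1)) x"
    using insert by (intro J_insert[OF fat]) (auto intro: bm_const)
  also have "\<dots> = J C1 Y (\<lambda>\<zeta>. (2 * pi / real q) * 1) x"
    by (rule J_cong_space[OF insert.prems]) (simp add: s)
  also have "\<dots> = (2 * pi / real q) * J C1 Y (\<lambda>_. 1) x"
    using J_pull[OF insert.prems, of "\<lambda>_. 2 * pi / real q" "\<lambda>_. 1"] by simp
  finally show ?case using insert by simp
qed

lemma z_bounds:
  assumes "finite Y" "w \<in> W Y"
  shows "exp (- Nrm Y) * (2 * pi / real q) ^ card Y \<le> z Y w" "z Y w \<le> exp (Nrm Y) * (2 * pi / real q) ^ card Y"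
proof -
  interpret resample C1 UNIV Y by (rule resC[OF assms(1)])
  have b: "exp (- Nrm Y) \<le> wt Y Y \<zeta>" "wt Y Y \<zeta> \<le> exp (Nrm Y)" if "\<zeta> \<in> space CU" for \<zeta> :: "('d, real) conf"
    using abs_H_le[of Y Y \<zeta>] assms that by (auto simp: wt_def space_CU abs_le_iff)
  have e: "J C1 Y (\<lambda>_. c * 1) (pt Y w) = c * (2 * pi / real q) ^ card Y" for c
    using J_pull[OF pt(1)[OF assms(2)], of "\<lambda>_. c" "\<lambda>_. 1"] J_C1_one[OF assms(1) pt(1)[OF assms(2)]] by simp
  have zb: "bm CU (\<lambda>\<zeta>. wt Y Y \<zeta> * 1)" "bm CU (\<lambda>_. c * 1 :: real)" for c using bm_wtL[OF assms(1)] by (simp_all add: bm_const)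
  show "exp (- Nrm Y) * (2 * pi / real q) ^ card Y \<le> z Y w"
    unfolding z_def I1_def e[symmetric] using b by (intro J_mono zb pt(1)[OF assms(2)]) simp
  show "z Y w \<le> exp (Nrm Y) * (2 * pi / real q) ^ card Y"
    unfolding z_def I1_def e[symmetric] using b by (intro J_mono zb pt(1)[OF assms(2)]) simp
qed

text \<open>A bound exponential in the volume and the boundary norm. It keeps the relative entropy
  per site bounded, so that the limsup is finite and a gap cannot disappear at infinity.\<close>

lemma gibbs_mc_lower:
  assumes \<mu>: "pm \<mu>" "\<mu> \<in> gibbs_measures UNIV Om (disc_spec \<Phi> q)" and fin: "finite Y" and w: "w \<in> W Y"
  shows "exp (- (2 * Bd Y + 2 * Nrm Y + card Y * ln (real q))) \<le> mc \<mu> Y w"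
proof -
  let ?p = "(2 * pi / real q) ^ card Y"
  have p: "0 < ?p" using q by simp
  have "Z Y \<le> (\<Sum>w\<in>W Y. exp (Nrm Y) * ?p)" unfolding Z_def by (intro sum_mono z_bounds(2) fin)
  also have "\<dots> = real q ^ card Y * (exp (Nrm Y) * ?p)" using fin by (simp add: W_def card_PiE)
  finally have Z: "Z Y \<le> real q ^ card Y * (exp (Nrm Y) * ?p)" .
  have qe: "real q ^ card Y = exp (card Y * ln (real q))" using q by (simp add: exp_of_nat_mult)
  have "exp (- (2 * Bd Y + 2 * Nrm Y + card Y * ln (real q))) =
      exp (- (2 * Bd Y)) * ((exp (- Nrm Y) * ?p) / (real q ^ card Y * (exp (Nrm Y) * ?p)))"
  proof -
    have "(exp (- Nrm Y) * ?p) / (real q ^ card Y * (exp (Nrm Y) * ?p)) = exp (- Nrm Y) / (exp (card Y * ln (real q)) * exp (Nrm Y))"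
      unfolding qe using p q by (simp only: mult.assoc[symmetric]) simp
    also have "\<dots> = exp (- Nrm Y - (card Y * ln (real q) + Nrm Y))" by (simp only: exp_diff exp_add)
    finally show ?thesis by (simp only: exp_add[symmetric]) (simp add: algebra_simps)
  qed
  also have "\<dots> \<le> exp (- (2 * Bd Y)) * (z Y w / Z Y)"
    using z_bounds(1)[OF fin w] Z Z_pos[OF fin] p z_pos[OF fin w] by (intro mult_left_mono frac_le) auto
  also have "\<dots> \<le> mc \<mu> Y w" by (rule gibbs_mc_bounds(1)[OF \<mu> fin w])
  finally show ?thesis .
qed

text \<open>Real-valued form of the local entropy, available because Gibbs measures charge every
  cylinder.\<close>

definition le :: "'d site set => ('d, nat) conf measure => ('d, nat) conf measure => real" where
  "le Y \<nu> \<mu> = (\<Sum>w\<in>W Y. mc \<nu> Y w * ln (mc \<nu> Y w / mc \<mu> Y w))"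

lemma local_entropy_eq:
  assumes "\<And>w. w \<in> W Y ==> 0 < mc \<mu> Y w" shows "local_entropy q Y \<nu> \<mu> = ereal (le Y \<nu> \<mu>)"
proof -
  have "local_entropy q Y \<nu> \<mu> = (\<Sum>w\<in>W Y. ereal (mc \<nu> Y w * ln (mc \<nu> Y w / mc \<mu> Y w)))"
    unfolding local_entropy_def W_def[symmetric] mc_def[symmetric]
    using assms by (intro sum.cong refl) (force simp: entropy_term_def)
  then show ?thesis by (simp add: le_def)
qed

lemma le_nonneg:
  assumes fin: "finite Y" and "pm \<nu>" "pm \<mu>" and p: "\<And>w. w \<in> W Y ==> 0 < mc \<mu> Y w" shows "0 \<le> le Y \<nu> \<mu>"
proof -
  have "(\<Sum>w\<in>W Y. mc \<nu> Y w - mc \<mu> Y w) \<le> le Y \<nu> \<mu>"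
    unfolding le_def
  proof (rule sum_mono)
    fix w assume w: "w \<in> W Y"
    show "mc \<nu> Y w - mc \<mu> Y w \<le> mc \<nu> Y w * ln (mc \<nu> Y w / mc \<mu> Y w)"
    proof (cases "mc \<nu> Y w = 0")
      case False
      then have n: "0 < mc \<nu> Y w" using mc_nonneg[of \<nu> Y w] by simp
      have "ln (mc \<mu> Y w / mc \<nu> Y w) \<le> mc \<mu> Y w / mc \<nu> Y w - 1" using n p[OF w] by (intro ln_le_minus_one) simp
      then have "mc \<nu> Y w * (1 - mc \<mu> Y w / mc \<nu> Y w) \<le> mc \<nu> Y w * ln (mc \<nu> Y w / mc \<mu> Y w)"
        using n p[OF w] by (intro mult_left_mono) (auto simp: ln_div)
      then show ?thesis using n by (simp add: right_diff_distrib)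
    qed (use p[OF w] in simp)
  qed
  then show ?thesis using sum_mc[OF fin assms(2)] sum_mc[OF fin assms(3)] by (simp add: sum_subtractf)
qed

lemma le_upper:
  assumes fin: "finite Y" and "pm \<nu>" and p: "\<And>w. w \<in> W Y ==> 0 < mc \<mu> Y w"
    and c: "\<And>w. w \<in> W Y ==> mc \<nu> Y w \<le> exp c * mc \<mu> Y w"
  shows "le Y \<nu> \<mu> \<le> c"
proof -
  have "le Y \<nu> \<mu> \<le> (\<Sum>w\<in>W Y. mc \<nu> Y w * c)"
    unfolding le_def
  proof (rule sum_mono)
    fix w assume w: "w \<in> W Y"
    show "mc \<nu> Y w * ln (mc \<nu> Y w / mc \<mu> Y w) \<le> mc \<nu> Y w * c"
    proof (cases "mc \<nu> Y w = 0")
      case False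
      then have n: "0 < mc \<nu> Y w" using mc_nonneg[of \<nu> Y w] by simp
      have "mc \<nu> Y w / mc \<mu> Y w \<le> exp c" using c[OF w] p[OF w] by (simp add: divide_le_eq)
      then have "ln (mc \<nu> Y w / mc \<mu> Y w) \<le> ln (exp c)" using n p[OF w] by (subst ln_le_cancel_iff) auto
      then show ?thesis using n by simp
    qed simp
  qed
  then show ?thesis using sum_mc[OF fin assms(2)] by (simp flip: sum_distrib_right)
qed

text \<open>Cylinder probabilities of a Gibbs measure are \<open>z Y w / Z Y\<close> up to boundary
  factors, so the entropy relative to it is \<open>fe\<close> plus the term \<open>ln (Z Y)\<close>
  common to all measures. Entropy differences thus become differences of \<open>fe\<close>.\<close>

lemma le_fe:
  assumes fin: "finite Y" and "pm \<nu>" and \<mu>: "pm \<mu>" "\<mu> \<in> gibbs_measures UNIV Om (disc_spec \<Phi> q)"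
  shows "\<bar>le Y \<nu> \<mu> - (fe Y \<nu> + ln (Z Y))\<bar> \<le> 2 * Bd Y"
proof -
  have t: "\<bar>mc \<nu> Y w * ln (mc \<nu> Y w / mc \<mu> Y w) - (mc \<nu> Y w * ln (dens \<nu> Y w) + mc \<nu> Y w * ln (Z Y))\<bar> \<le> mc \<nu> Y w * (2 * Bd Y)"
    if w: "w \<in> W Y" for w
  proof (cases "mc \<nu> Y w = 0")
    case False
    then have n: "0 < mc \<nu> Y w" using mc_nonneg[of \<nu> Y w] by simp
    note g = gibbs_mc_bounds[OF \<mu> fin w]
    have zp: "0 < z Y w" "0 < Z Y" using z_pos[OF fin w] Z_pos[OF fin] .
    have mp: "0 < mc \<mu> Y w" by (rule less_le_trans[OF _ g(1)]) (use zp in simp)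
    have "ln (exp (- (2 * Bd Y)) * (z Y w / Z Y)) \<le> ln (mc \<mu> Y w)" using g(1) zp mp by (subst ln_le_cancel_iff) auto
    moreover have "ln (mc \<mu> Y w) \<le> ln (exp (2 * Bd Y) * (z Y w / Z Y))" using g(2) zp mp by (subst ln_le_cancel_iff) auto
    ultimately have "\<bar>ln (mc \<mu> Y w) - (ln (z Y w) - ln (Z Y))\<bar> \<le> 2 * Bd Y"
      using zp by (simp add: ln_mult ln_div)
    moreover have "ln (mc \<nu> Y w / mc \<mu> Y w) - (ln (dens \<nu> Y w) + ln (Z Y)) = - (ln (mc \<mu> Y w) - (ln (z Y w) - ln (Z Y)))"
      using n mp zp by (simp add: dens_def ln_div)
    ultimately have "\<bar>ln (mc \<nu> Y w / mc \<mu> Y w) - (ln (dens \<nu> Y w) + ln (Z Y))\<bar> \<le> 2 * Bd Y" by simp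
    then have "mc \<nu> Y w * \<bar>ln (mc \<nu> Y w / mc \<mu> Y w) - (ln (dens \<nu> Y w) + ln (Z Y))\<bar> \<le> mc \<nu> Y w * (2 * Bd Y)"
      using n by (intro mult_left_mono) auto
    moreover have "mc \<nu> Y w * \<bar>ln (mc \<nu> Y w / mc \<mu> Y w) - (ln (dens \<nu> Y w) + ln (Z Y))\<bar> =
      \<bar>mc \<nu> Y w * ln (mc \<nu> Y w / mc \<mu> Y w) - (mc \<nu> Y w * ln (dens \<nu> Y w) + mc \<nu> Y w * ln (Z Y))\<bar>"
      using n by (simp add: abs_mult_pos' right_diff_distrib distrib_left)
    ultimately show ?thesis by simp
  qed simp
  have s: "(\<Sum>w\<in>W Y. mc \<nu> Y w * c) = c" for c using sum_mc[OF fin assms(2)] by (simp flip: sum_distrib_right)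
  have "le Y \<nu> \<mu> - (fe Y \<nu> + ln (Z Y)) =
     (\<Sum>w\<in>W Y. mc \<nu> Y w * ln (mc \<nu> Y w / mc \<mu> Y w) - (mc \<nu> Y w * ln (dens \<nu> Y w) + mc \<nu> Y w * ln (Z Y)))"
    by (simp add: le_def fe_def sum_subtractf sum.distrib s)
  also have "\<bar>\<dots>\<bar> \<le> (\<Sum>w\<in>W Y. mc \<nu> Y w * (2 * Bd Y))" by (rule order_trans[OF sum_abs sum_mono[OF t]])
  finally show ?thesis unfolding s .
qed

definition ld :: "nat => ('d, nat) conf measure => ('d, nat) conf measure => real" where
  "ld n \<nu> \<mu> = le (hypercube n) \<nu> \<mu> / card (cube n)"

lemma card_hypercube_pos: "0 < real (card (cube n))"
  by (simp add: card_hypercube)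

lemma gibbs_mc_pos:
  assumes \<mu>: "pm \<mu>" "\<mu> \<in> gibbs_measures UNIV Om (disc_spec \<Phi> q)" and "finite Y" "w \<in> W Y"
  shows "0 < mc \<mu> Y w"
  by (rule less_le_trans[OF exp_gt_zero gibbs_mc_lower[OF assms]])

lemma rel_entropy_density_eq:
  assumes \<mu>: "pm \<mu>" "\<mu> \<in> gibbs_measures UNIV Om (disc_spec \<Phi> q)"
  shows "rel_entropy_density q \<nu> \<mu> = limsup (\<lambda>n. ereal (ld n \<nu> \<mu>))"
proof -
  have "local_entropy q (hypercube n) \<nu> \<mu> = ereal (le (hypercube n) \<nu> \<mu>)" for n
    by (rule local_entropy_eq) (rule gibbs_mc_pos[OF \<mu> finite_hypercube])
  then show ?thesis unfolding rel_entropy_density_def ld_def by (simp add: card_hypercube)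
qed

lemma ld_bounds:
  assumes \<mu>: "pm \<mu>" "\<mu> \<in> gibbs_measures UNIV Om (disc_spec \<Phi> q)" and \<nu>: "pm \<nu>"
  shows "0 \<le> ld n \<nu> \<mu>" "ld n \<nu> \<mu> \<le> 2 * (Bd (cube n) / card (cube n)) + 2 * Nrm {0} + ln (real q)"
proof -
  let ?L = "cube n"
  note fin = finite_hypercube[of n]
  note p = gibbs_mc_pos[OF \<mu> fin]
  show "0 \<le> ld n \<nu> \<mu>" unfolding ld_def using le_nonneg[OF fin \<nu> \<mu>(1) p] by simp
  let ?c = "2 * Bd ?L + 2 * Nrm ?L + card ?L * ln (real q)"
  have "le ?L \<nu> \<mu> \<le> ?c"
  proof (rule le_upper[OF fin \<nu> p])
    fix w assume w: "w \<in> W ?L"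
    have "mc \<nu> ?L w \<le> 1" unfolding mc_def using pmD(1)[OF \<nu>] by (rule prob_space.prob_le_1)
    also have "1 = exp ?c * exp (- ?c)" by (simp flip: exp_add)
    also have "\<dots> \<le> exp ?c * mc \<mu> ?L w" by (intro mult_left_mono gibbs_mc_lower[OF \<mu> fin w]) simp
    finally show "mc \<nu> ?L w \<le> exp ?c * mc \<mu> ?L w" .
  qed
  also have "?c \<le> 2 * Bd ?L + 2 * (card ?L * Nrm {0}) + card ?L * ln (real q)" using Nrm_le[OF fin] by simp
  finally have "ld n \<nu> \<mu> \<le> (2 * Bd ?L + 2 * (card ?L * Nrm {0}) + card ?L * ln (real q)) / card ?L"
    unfolding ld_def using card_hypercube_pos by (intro divide_right_mono) auto
  also have "\<dots> = 2 * (Bd ?L / card ?L) + 2 * Nrm {0} + ln (real q)"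
    using card_hypercube_pos[of n] by (simp add: add_divide_distrib)
  finally show "ld n \<nu> \<mu> \<le> 2 * (Bd ?L / card ?L) + 2 * Nrm {0} + ln (real q)" .
qed

text \<open>The bounds make a common limsup finite: \<open>C\<close> excludes plus infinity,
  nonnegativity excludes minus infinity. An eventual gap then contradicts equality.\<close>

lemma limsup_gap:
  fixes a b :: "nat => real"
  assumes "\<And>n. 0 \<le> b n" "\<forall>\<^sub>F n in sequentially. a n \<le> C" "0 < \<kappa>" "\<forall>\<^sub>F n in sequentially. b n + \<kappa> \<le> a n"
  shows "limsup (\<lambda>n. ereal (a n)) \<noteq> limsup (\<lambda>n. ereal (b n))"
proof
  assume eq: "limsup (\<lambda>n. ereal (a n)) = limsup (\<lambda>n. ereal (b n))"
  have "limsup (\<lambda>n. ereal (a n)) \<le> ereal C" using assms(2) by (intro Limsup_bounded) simp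
  moreover have "0 \<le> limsup (\<lambda>n. ereal (b n))"
    by (rule order_trans[OF _ Liminf_le_Limsup]) (auto intro!: Liminf_bounded always_eventually assms(1))
  ultimately have "\<exists>l. limsup (\<lambda>n. ereal (b n)) = ereal l" unfolding eq by (cases "limsup (\<lambda>n. ereal (b n))") auto
  then obtain l where l: "limsup (\<lambda>n. ereal (a n)) = ereal l" using eq by auto
  have "limsup (\<lambda>n. ereal (a n)) < ereal (l + \<kappa> / 2)" using l assms(3) by simp
  from Limsup_lessD[OF this] assms(4) have "\<forall>\<^sub>F n in sequentially. ereal (b n) \<le> ereal (l - \<kappa> / 2)"
    by eventually_elim simp
  then have "limsup (\<lambda>n. ereal (b n)) \<le> ereal (l - \<kappa> / 2)" by (rule Limsup_bounded)
  then show False unfolding eq[symmetric] l using assms(3) by simp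
qed

lemma equal_density_invar:
  assumes \<nu>: "tip \<nu>" and \<mu>: "pm \<mu>" "\<mu> \<in> gibbs_measures UNIV Om (disc_spec \<Phi> q)"
    and eq: "rel_entropy_density q \<nu> \<mu> = rel_entropy_density q (evolve \<Phi> q \<tau> \<nu>) \<mu>"
  shows "invar UNIV C1 (lam \<nu>)"
proof (rule ccontr)
  assume "\<not> invar UNIV C1 (lam \<nu>)"
  have p: "pm \<nu>" using \<nu> by (simp add: tip_def)
  let ?e = "evolve \<Phi> q \<tau> \<nu>"
  have p': "pm ?e" by (rule evolve_pm[OF p])
  let ?B = "\<lambda>n. Bd (cube n) / card (cube n)"
  obtain \<kappa> N where \<kappa>: "\<kappa> > 0" and gap: "\<And>n. n \<ge> N ==> \<kappa> * real (card (cube n)) \<le>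
     fe (hypercube n) \<nu> - fe (hypercube n) ?e + 4 * Bd (cube n)"
    using entropy_gap[OF \<nu> \<open>\<not> invar UNIV C1 (lam \<nu>)\<close>] by blast
  have ev: "\<forall>\<^sub>F n in sequentially. ?B n < \<epsilon>" if "0 < \<epsilon>" for \<epsilon>
    using order_tendstoD(2)[OF Bd_density that] .
  have "limsup (\<lambda>n. ereal (ld n \<nu> \<mu>)) \<noteq> limsup (\<lambda>n. ereal (ld n ?e \<mu>))"
  proof (rule limsup_gap)
    show "0 \<le> ld n ?e \<mu>" for n by (rule ld_bounds(1)[OF \<mu> p'])
    show "\<forall>\<^sub>F n in sequentially. ld n \<nu> \<mu> \<le> 2 + 2 * Nrm {0} + ln (real q)"
    proof (rule eventually_mono[OF ev[OF zero_less_one]])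
      show "ld n \<nu> \<mu> \<le> 2 + 2 * Nrm {0} + ln (real q)" if "?B n < 1" for n
        using ld_bounds(2)[OF \<mu> p, of n] that by linarith
    qed
    \<comment> \<open>Half of the gap survives: \<open>le_fe\<close> is used twice at cost
      \<open>2 * Bd\<close> and the gap itself loses \<open>4 * Bd\<close>, so there are eight
      boundary terms, each below \<open>\<kappa> / 16\<close> per site.\<close>
    show "0 < \<kappa> / 2" using \<kappa> by simp
    show "\<forall>\<^sub>F n in sequentially. ld n ?e \<mu> + \<kappa> / 2 \<le> ld n \<nu> \<mu>"
      using ev[OF divide_pos_pos[OF \<kappa>], of 16, OF zero_less_numeral] eventually_ge_at_top[of N]
    proof eventually_elim
      case (elim n)
      let ?L = "cube n"
      have c: "0 < real (card ?L)" by (rule card_hypercube_pos)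
      have "\<kappa> * card ?L \<le> le ?L \<nu> \<mu> - le ?L ?e \<mu> + 8 * Bd ?L"
        using gap[OF elim(2)] le_fe[OF finite_hypercube p \<mu>, of n] le_fe[OF finite_hypercube p' \<mu>, of n] by linarith
      then have "\<kappa> \<le> (le ?L \<nu> \<mu> - le ?L ?e \<mu> + 8 * Bd ?L) / card ?L" using c by (simp add: pos_le_divide_eq)
      then have "\<kappa> \<le> ld n \<nu> \<mu> - ld n ?e \<mu> + 8 * ?B n" by (simp add: ld_def add_divide_distrib diff_divide_distrib)
      then show ?case using elim(1) \<kappa> by linarith
    qed
  qed
  then show False using eq unfolding rel_entropy_density_eq[OF \<mu>] by simp
qed

lemma mc_int: assumes "finite Y" "pm \<nu>" "w \<in> W Y" shows "mc \<nu> Y w = (LINT s|\<nu>. of_bool (restrict s Y = w))"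
  unfolding int_W[OF assms(1,2), of "\<lambda>w'. of_bool (w' = w)"]
  using finite_W[OF assms(1)] assms(3) by (simp add: of_bool_def if_distrib[of "\<lambda>a. a * _"] cong: if_cong)

text \<open>Domination of the cylinder probabilities by \<open>c * z\<close> bounds the box density
  by \<open>c\<close>. The free-boundary measure is rotation invariant, so the domination survives a
  time step up to the factor from one comparison.\<close>

lemma evolve_mc_bound:
  assumes fin: "finite Y" and \<nu>: "pm \<nu>" and w: "w \<in> W Y" and c: "\<And>w'. w' \<in> W Y ==> mc \<nu> Y w' \<le> c * z Y w'"
  shows "mc (evolve \<Phi> q \<tau> \<nu>) Y w \<le> exp (2 * Bd Y) * (c * z Y w)"
proof -
  let ?h = "\<lambda>x. of_bool (restrict (tmap x) Y = w) :: real" and ?R = "rotate_conf \<tau> :: ('d, real) conf => _"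
  have bW: "bm Om (\<lambda>s. of_bool (restrict s Y = w) :: real)" by (rule bm_W[OF fin, of "\<lambda>w'. of_bool (w' = w)"])
  have bh: "bm CU ?h" by (rule bm_tmap[OF bW])
  have bR: "bm CU (\<lambda>x. ?h (?R x))" by (rule bm_compose[OF bh rotate_measurable])
  have lh: "loc Y ?h" by (rule loc_W[of Y "\<lambda>w'. of_bool (w' = w)"])
  have "mc (evolve \<Phi> q \<tau> \<nu>) Y w = (LINT x|lift \<nu>. ?h (?R x))"
    unfolding mc_int[OF fin evolve_pm[OF \<nu>] w] evolve_int[OF \<nu> bW] by (rule lam(4)[OF \<nu> bh])
  also have "\<dots> \<le> exp (2 * Bd Y) * I0 Y (\<lambda>x. dens \<nu> Y (restrict (tmap x) Y) * ?h (?R x))"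
    by (rule lift_compare(1)[OF fin \<nu> bR loc_rot[OF lh]]) simp
  also have "\<dots> \<le> exp (2 * Bd Y) * I0 Y (\<lambda>x. c * ?h (?R x))"
  proof (intro mult_left_mono I0_mono[OF fin] bm_mult bm_const bR bm_tmap[OF bm_W[OF fin]])
    fix x :: "('d, real) conf" assume x: "x \<in> space CU"
    note w' = restrict_W[OF tmap_space[OF x], of Y]
    have "dens \<nu> Y (restrict (tmap x) Y) \<le> c" using c[OF w'] z_pos[OF fin w'] by (simp add: dens_def divide_le_eq)
    then show "dens \<nu> Y (restrict (tmap x) Y) * ?h (?R x) \<le> c * ?h (?R x)" by (intro mult_right_mono) auto
  qed simp
  also have "I0 Y (\<lambda>x. c * ?h (?R x)) = I0 Y (\<lambda>x. c * ?h x)"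
    by (rule I0_rot[OF fin bm_mult[OF bm_const bh] loc_mult[OF loc_const lh]])
  also have "I0 Y (\<lambda>x. c * ?h x) = c * z Y w"
    using I0_split[OF fin bm_const, of "\<lambda>w'. c * of_bool (w' = w)" 1] finite_W[OF fin] w
    by (simp add: z_def of_bool_def if_distrib[of "\<lambda>a. _ * a"] if_distrib[of "\<lambda>a. a * _"] cong: if_cong)
  finally show ?thesis by simp
qed

text \<open>On cylinders of a cube \<open>\<nu>\<close> is at most \<open>exp (4 * Bd)\<close> times
  \<open>\<mu>\<close>, and the time step adds a factor \<open>exp (2 * Bd)\<close>; hence the
  constant 6. Both densities vanish together with the boundary term per site.\<close>

lemma gibbs_equal_density:
  assumes \<nu>: "pm \<nu>" "\<nu> \<in> gibbs_measures UNIV Om (disc_spec \<Phi> q)"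
    and \<mu>: "pm \<mu>" "\<mu> \<in> gibbs_measures UNIV Om (disc_spec \<Phi> q)"
  shows "rel_entropy_density q \<nu> \<mu> = rel_entropy_density q (evolve \<Phi> q \<tau> \<nu>) \<mu>"
proof -
  have zero: "rel_entropy_density q \<rho> \<mu> = 0"
    if \<rho>: "pm \<rho>" and b: "\<And>n w. w \<in> W (hypercube n) ==> mc \<rho> (hypercube n) w \<le> exp (6 * Bd (cube n)) * mc \<mu> (hypercube n) w" for \<rho>
  proof -
    have "(\<lambda>n. ld n \<rho> \<mu>) \<longlonglongrightarrow> 0"
    proof (rule tendsto_sandwich[OF _ _ tendsto_const])
      show "\<forall>\<^sub>F n in sequentially. 0 \<le> ld n \<rho> \<mu>" using ld_bounds(1)[OF \<mu> \<rho>] by simp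
      show "(\<lambda>n. 6 * (Bd (cube n) / card (cube n))) \<longlonglongrightarrow> 0"
        using tendsto_mult_right_zero[OF Bd_density] .
      have "le (hypercube n) \<rho> \<mu> \<le> 6 * Bd (cube n)" for n
        by (rule le_upper[OF finite_hypercube \<rho> gibbs_mc_pos[OF \<mu> finite_hypercube] b])
      then show "\<forall>\<^sub>F n in sequentially. ld n \<rho> \<mu> \<le> 6 * (Bd (cube n) / card (cube n))"
        by (auto simp: ld_def intro!: always_eventually divide_right_mono)
    qed
    then have "(\<lambda>n. ereal (ld n \<rho> \<mu>)) \<longlonglongrightarrow> ereal 0" by simp
    then show ?thesis unfolding rel_entropy_density_eq[OF \<mu>] by (metis lim_imp_Limsup trivial_limit_sequentially zero_ereal_def)
  qed
  have g: "exp (2 * Bd Y) * (z Y w / Z Y) \<le> exp (4 * Bd Y) * mc \<mu> Y w"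
    if "finite Y" "w \<in> W Y" for Y w
  proof -
    have "exp (4 * Bd Y) * (exp (- (2 * Bd Y)) * (z Y w / Z Y)) \<le> exp (4 * Bd Y) * mc \<mu> Y w"
      by (intro mult_left_mono gibbs_mc_bounds(1)[OF \<mu> that]) simp
    then show ?thesis by (simp flip: mult.assoc exp_add)
  qed
  have "rel_entropy_density q \<nu> \<mu> = 0"
  proof (rule zero[OF \<nu>(1)])
    fix n w assume w: "w \<in> W (cube n)"
    let ?L = "cube n"
    have "mc \<nu> ?L w \<le> exp (4 * Bd ?L) * mc \<mu> ?L w"
      using gibbs_mc_bounds(2)[OF \<nu> finite_hypercube w] g[OF finite_hypercube w] by linarith
    also have "\<dots> \<le> exp (6 * Bd ?L) * mc \<mu> ?L w" using Bd_nonneg[of ?L] by (intro mult_right_mono mc_nonneg) simp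
    finally show "mc \<nu> ?L w \<le> exp (6 * Bd ?L) * mc \<mu> ?L w" .
  qed
  moreover have "rel_entropy_density q (evolve \<Phi> q \<tau> \<nu>) \<mu> = 0"
  proof (rule zero[OF evolve_pm[OF \<nu>(1)]])
    fix n w assume w: "w \<in> W (cube n)"
    let ?L = "cube n"
    have "mc (evolve \<Phi> q \<tau> \<nu>) ?L w \<le> exp (2 * Bd ?L) * (exp (2 * Bd ?L) / Z ?L * z ?L w)"
      using gibbs_mc_bounds(2)[OF \<nu> finite_hypercube] by (intro evolve_mc_bound[OF finite_hypercube \<nu>(1) w]) simp
    also have "\<dots> = exp (2 * Bd ?L) * (exp (2 * Bd ?L) * (z ?L w / Z ?L))" by simp
    also have "\<dots> \<le> exp (2 * Bd ?L) * (exp (4 * Bd ?L) * mc \<mu> ?L w)"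
      by (intro mult_left_mono g[OF finite_hypercube w]) simp
    also have "\<dots> = exp (6 * Bd ?L) * mc \<mu> ?L w" by (simp flip: mult.assoc exp_add)
    finally show "mc (evolve \<Phi> q \<tau> \<nu>) ?L w \<le> exp (6 * Bd ?L) * mc \<mu> ?L w" .
  qed
  ultimately show ?thesis by simp
qed

end

section \<open>Two overlapping discretisations generate all rotations of a spin\<close>

context clock_model
begin

definition C2 :: "real => real => bool" where
  "C2 a b \<longleftrightarrow> coarse q (rot1 \<tau> a) = coarse q (rot1 \<tau> b)"

lemma coarse_rot_LC: "(\<lambda>y. coarse q (rot1 \<tau> y)) \<in> measurable LC (count_space UNIV)"
  by (rule measurable_compose[OF rot1_LC coarse_LC])

lemma integral_rot1:
  assumes "g \<in> borel_measurable LC" shows "(LINT y|LC. g (rot1 \<tau> y)) = (LINT y|LC. (g y :: real))"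
  using integral_distr[OF rot1_LC assms, of \<tau>] distr_rot1[OF tau(1) tau2] by simp

lemma fatrel_C2: "fatrel C2"
  unfolding fatrel_def
proof (intro conjI)
  show "(\<lambda>(x, y). of_bool (C2 x y) :: real) \<in> borel_measurable (LC \<Otimes>\<^sub>M LC)"
    unfolding C2_def by (rule measurable_eq_rel[OF coarse_rot_LC])
  show "\<exists>c>0::real. \<forall>x\<in>circle. c \<le> (LINT y|LC. of_bool (C2 x y))"
  proof (intro exI[of _ "2 * pi / real q"] conjI ballI)
    show "0 < 2 * pi / real q" using q by simp
    fix x
    let ?k = "coarse q (rot1 \<tau> x)"
    have m: "(\<lambda>y. of_bool (coarse q y = ?k) :: real) \<in> borel_measurable LC"
      using measurable_compose[OF coarse_LC, of "\<lambda>j. of_bool (j = ?k) :: real" borel] by simp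
    have "(LINT y|LC. of_bool (C2 x y)) = (LINT y|LC. of_bool (coarse q (rot1 \<tau> y) = ?k))"
      unfolding C2_def by (simp add: eq_commute)
    also have "\<dots> = 2 * pi / real q"
      using integral_rot1[OF m] arc_measure[OF q coarse_less[OF q rot1_circle]] by simp
    finally show "2 * pi / real q \<le> (LINT y|LC. of_bool (C2 x y))" by simp
  qed
qed (simp_all add: C2_def)

text \<open>Substitute \<open>rot1 \<tau> y\<close> for the new spin: the weight is rotation
  invariant, and the cell relation pulled back by the rotation is \<open>C2\<close>.\<close>

lemma num_rotate:
  assumes f: "bm CU f" and x: "x \<in> space CU"
  shows "num UNIV C1 {i} f (rotate_conf \<tau> x) = num UNIV C2 {i} (\<lambda>x. f (rotate_conf \<tau> x)) x"
proof -
  let ?R = "rotate_conf \<tau> :: ('d, real) conf => _"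
  let ?g = "\<lambda>x. wt UNIV {i} x * f x"
  have g: "bm CU ?g" by (intro bm_mult bm_wt f) simp
  have gR: "bm CU (\<lambda>x. wt UNIV {i} x * f (?R x))" by (intro bm_mult bm_wt bm_compose[OF f rotate_measurable]) simp
  have "num UNIV C1 {i} f (?R x) = (LINT y|LC. of_bool (C1 (?R x i) y) * ?g ((?R x)(i := y)))"
    unfolding num_def by (rule J_single[OF fat UNIV_I g rotate_space])
  also have "\<dots> = (LINT y|LC. of_bool (C1 (?R x i) (rot1 \<tau> y)) * ?g ((?R x)(i := rot1 \<tau> y)))"
    by (rule integral_rot1[symmetric], rule bm_measurable,
      rule bm_mult[OF bm_rel_section[OF fat] bm_upd[OF g rotate_space UNIV_I]])
      (simp add: rotate_conf_alt rot1_circle)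
  also have "\<dots> = (LINT y|LC. of_bool (C2 (x i) y) * (wt UNIV {i} (x(i := y)) * f (?R (x(i := y)))))"
  proof (rule icong[OF refl])
    fix y assume "y \<in> space LC"
    then have "x(i := y) \<in> space CU" by (intro upd_space[OF x UNIV_I]) (simp add: space_restrict_space)
    from wt_rotate[OF this, of UNIV "{i}" \<tau>]
    have w: "wt UNIV {i} (?R (x(i := y))) = wt UNIV {i} (x(i := y))" .
    have u: "(?R x)(i := rot1 \<tau> y) = ?R (x(i := y))" by (auto simp: rotate_conf_alt)
    have c: "C1 (?R x i) (rot1 \<tau> y) = C2 (x i) y" by (simp add: C2_def cellrel_def rotate_conf_alt)
    show "of_bool (C1 (?R x i) (rot1 \<tau> y)) * ?g ((?R x)(i := rot1 \<tau> y)) =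
      of_bool (C2 (x i) y) * (wt UNIV {i} (x(i := y)) * f (?R (x(i := y))))"
      unfolding u w c ..
  qed
  also have "\<dots> = num UNIV C2 {i} (\<lambda>x. f (?R x)) x"
    unfolding num_def by (rule J_single[symmetric, OF fatrel_C2 UNIV_I gR x])
  finally show ?thesis .
qed

lemma invar_unrotate:
  assumes \<nu>: "pm \<nu>" and inv: "invar UNIV C1 (lam \<nu>)" shows "invar UNIV C2 (lift \<nu>)"
  unfolding invar_def
proof (intro conjI ballI allI impI lift(1,2)[OF \<nu>])
  fix i and f :: "('d, real) conf => real" assume f: "bm CU f"
  interpret a: pot_resample \<Phi> C1 UNIV "{i}" using fat by unfold_locales auto
  interpret b: pot_resample \<Phi> C2 UNIV "{i}" using fatrel_C2 by unfold_locales auto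
  let ?R = "rotate_conf \<tau> :: ('d, real) conf => _"
  let ?f = "\<lambda>x. f (rotate_conf (- \<tau>) x)"
  have bf: "bm CU ?f" by (rule bm_compose[OF f rotate_measurable])
  have e: "?f (?R x) = f x" if "x \<in> space CU" for x using rotate_inverse(1)[OF that] by simp
  have "(LINT x|lift \<nu>. K UNIV C2 {i} f x) = (LINT x|lift \<nu>. K UNIV C1 {i} ?f (?R x))"
  proof (rule icong[OF refl])
    fix x assume "x \<in> space (lift \<nu>)"
    then have x: "x \<in> space CU" using lift(3)[OF \<nu>] by simp
    have "K UNIV C1 {i} ?f (?R x) = K UNIV C2 {i} (\<lambda>x. ?f (?R x)) x"
      unfolding K_def num_rotate[OF bf x] num_rotate[OF bm_const x] ..
    also have "\<dots> = K UNIV C2 {i} f x" by (rule b.K_cong[OF x e])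
    finally show "K UNIV C2 {i} f x = K UNIV C1 {i} ?f (?R x)" ..
  qed
  also have "\<dots> = (LINT x|lam \<nu>. K UNIV C1 {i} ?f x)" by (rule lam(4)[OF \<nu> a.bm_K[OF bf], symmetric])
  also have "\<dots> = (LINT x|lam \<nu>. ?f x)" using inv bf unfolding invar_def by blast
  also have "\<dots> = (LINT x|lift \<nu>. ?f (?R x))" by (rule lam(4)[OF \<nu> bf])
  also have "\<dots> = (LINT x|lift \<nu>. f x)" using e lift(3)[OF \<nu>] by (intro icong) auto
  finally show "(LINT x|lift \<nu>. K UNIV C2 {i} f x) = (LINT x|lift \<nu>. f x)" .
qed

section \<open>One-spin integrals over arcs\<close>

definition DA :: "'d site => real set => (('d, real) conf => real) => ('d, real) conf => real" where
  "DA i A G = num UNIV Full {i} (\<lambda>\<zeta>. indicator A (\<zeta> i) * G \<zeta>)"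

definition indep :: "'d site set => (('d, real) conf => real) => bool" where
  "indep Y h \<longleftrightarrow> (\<forall>x\<in>space CU. \<forall>\<sigma>\<in>space (lebc Y). h (override_on x \<sigma> Y) = h x)"

definition fatset :: "real set => bool" where
  "fatset A \<longleftrightarrow> A \<in> sets borel \<and> A \<subseteq> circle \<and> 0 < (LINT y|LC. indicator A y :: real)"

lemma bm_ind: assumes "A \<in> sets borel" shows "bm CU (\<lambda>x. indicator A (x i) :: real)"
proof (rule bmI[of _ _ 1])
  have "(indicator A :: real => real) \<in> borel_measurable (restrict_space borel circle)"
    using assms by (intro measurable_restrict_space1) simp
  from measurable_compose[OF cspace_component[OF UNIV_I] this]
  show "(\<lambda>x. indicator A (x i) :: real) \<in> borel_measurable CU" .
qed (simp add: indicator_def)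

lemma DA_bm: "A \<in> sets borel ==> bm CU G ==> bm CU (DA i A G)"
  unfolding DA_def by (intro pot_resample.bm_num[OF presF] bm_mult bm_ind) auto

lemma DA_indep: "indep {i} (DA i A G)"
  unfolding indep_def DA_def by (intro ballI pot_resample.num_self[OF presF]) auto

lemma DA_pull: assumes "indep {i} h" "x \<in> space CU" shows "DA i A (\<lambda>x. h x * G x) x = h x * DA i A G x"
proof -
  interpret pot_resample \<Phi> Full UNIV "{i}" by (rule presF) simp
  have "num UNIV Full {i} (\<lambda>\<zeta>. h \<zeta> * (indicator A (\<zeta> i) * G \<zeta>)) x = h x * DA i A G x"
    unfolding DA_def using assms by (intro num_pull) (auto simp: indep_def)
  then show ?thesis by (simp add: DA_def mult.left_commute)
qed

lemma DA_lower: assumes "fatset A" shows "\<exists>c>0. \<forall>x\<in>space CU. c \<le> DA i A (\<lambda>_. 1) x"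
proof -
  interpret pot_resample \<Phi> Full UNIV "{i}" by (rule presF) simp
  let ?m = "LINT y|LC. indicator A y :: real"
  have A: "A \<in> sets borel" "0 < ?m" using assms by (auto simp: fatset_def)
  have b: "bm CU (\<lambda>\<zeta>. indicator A (\<zeta> i) * 1 :: real)" by (intro bm_mult bm_const bm_ind A)
  have "exp (- Nrm {i}) * ?m \<le> DA i A (\<lambda>_. 1) x" if x: "x \<in> space CU" for x
  proof -
    have "J Full {i} (\<lambda>\<zeta>. indicator A (\<zeta> i) * 1) x = ?m"
      unfolding J_single[OF fatrel_Full UNIV_I b x] by simp
    then show ?thesis using num_lower_J[OF b x] unfolding DA_def by simp
  qed
  then show ?thesis using A(2) by (intro exI[of _ "exp (- Nrm {i}) * ?m"]) auto
qed

lemma bm_div_DA: assumes "fatset A" "bm CU h" shows "bm CU (\<lambda>x. h x / DA i A (\<lambda>_. 1) x)"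
proof -
  obtain c where "c > 0" "\<forall>x\<in>space CU. c \<le> DA i A (\<lambda>_. 1) x" using DA_lower[OF assms(1)] by blast
  then show ?thesis using assms by (intro bm_divide[of _ _ _ c] DA_bm bm_const) (auto simp: fatset_def)
qed

lemma DA_pos: assumes "fatset A" "x \<in> space CU" shows "0 < DA i A (\<lambda>_. 1) x"
  using DA_lower[OF assms(1), of i] assms(2) by force

text \<open>The hypotheses on \<open>B\<close> and \<open>E\<close> say that \<open>B\<close> is one
  class of \<open>E\<close>. If the spin lies in \<open>B\<close>, the one-site kernel is the
  normalised integral over \<open>B\<close>; if not, resampling never enters
  \<open>B\<close>.\<close>

lemma class_step:
  assumes inv: "invar UNIV E \<mu>" and E: "fatrel E" and B: "fatset B"
    and cl: "\<And>x y. x \<in> circle ==> y \<in> circle ==> x \<in> B ==> E x y \<longleftrightarrow> y \<in> B"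
      "\<And>x y. x \<in> circle ==> y \<in> circle ==> x \<notin> B ==> E x y ==> y \<notin> B"
    and G: "bm CU G"
  shows "(LINT x|\<mu>. indicator B (x i) * G x) = (LINT x|\<mu>. indicator B (x i) * (DA i B G x / DA i B (\<lambda>_. 1) x))"
proof -
  interpret pot_resample \<Phi> E UNIV "{i}" using E by unfold_locales auto
  have Bb: "B \<in> sets borel" using B by (simp add: fatset_def)
  have bG: "bm CU (\<lambda>x. indicator B (x i) * G x)" by (rule bm_mult[OF bm_ind[OF Bb] G])
  have sp: "space \<mu> = space CU" using inv sets_eq_imp_space_eq[of \<mu> CU] unfolding invar_def by blast
  have n: "num UNIV E {i} F x = DA i B F x" if F: "bm CU F" and x: "x \<in> space CU" "x i \<in> B" for F x
  proof -
    have b1: "bm CU (\<lambda>\<zeta>. wt UNIV {i} \<zeta> * F \<zeta>)" by (intro bm_mult bm_wt F) simp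
    have b2: "bm CU (\<lambda>\<zeta>. wt UNIV {i} \<zeta> * (indicator B (\<zeta> i) * F \<zeta>))" by (intro bm_mult bm_wt bm_ind Bb F) simp
    have xi: "x i \<in> circle" using x(1) by (simp add: space_CU)
    show ?thesis
      unfolding num_def DA_def J_single[OF E UNIV_I b1 x(1)] J_single[OF fatrel_Full UNIV_I b2 x(1)]
      using cl(1)[OF xi _ x(2)] by (intro icong refl) (auto simp: space_restrict_space indicator_def)
  qed
  have "(LINT x|\<mu>. indicator B (x i) * G x) = (LINT x|\<mu>. K UNIV E {i} (\<lambda>x. indicator B (x i) * G x) x)"
    using inv bG unfolding invar_def by simp
  also have "\<dots> = (LINT x|\<mu>. indicator B (x i) * (DA i B G x / DA i B (\<lambda>_. 1) x))"
  proof (rule icong[OF refl])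
    fix x assume "x \<in> space \<mu>"
    then have x: "x \<in> space CU" using sp by simp
    have xi: "x i \<in> circle" using x by (simp add: space_CU)
    have "K UNIV E {i} (\<lambda>x. indicator B (x i) * G x) x = indicator B (x i) * K UNIV E {i} G x"
    proof (rule K_pull[OF x])
      fix \<sigma> assume s: "\<sigma> \<in> space (lebc {i})" "\<And>j. j \<in> {i} ==> E (x j) (\<sigma> j)"
      have "\<sigma> i \<in> circle" using s(1) by (auto simp: space_leb_prod)
      then show "indicator B (override_on x \<sigma> {i} i) = (indicator B (x i) :: real)"
        using s(2)[of i] cl(1)[OF xi, of "\<sigma> i"] cl(2)[OF xi, of "\<sigma> i"] by (auto simp: indicator_def)
    qed
    also have "\<dots> = indicator B (x i) * (DA i B G x / DA i B (\<lambda>_. 1) x)"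
      unfolding K_def using n[OF G x] n[OF bm_const x] by (simp add: indicator_def)
    finally show "K UNIV E {i} (\<lambda>x. indicator B (x i) * G x) x = indicator B (x i) * (DA i B G x / DA i B (\<lambda>_. 1) x)" .
  qed
  finally show ?thesis .
qed

text \<open>Under full resampling the conditional probability of \<open>A\<close> at
  \<open>i\<close> is the integral over \<open>A\<close> divided by the one over the circle, so for
  \<open>h\<close> independent of the spin at \<open>i\<close> this functional does not depend on
  \<open>A\<close>. The argument runs in the opposite direction: independence of \<open>A\<close> is
  established among the arcs, and full invariance is deduced.\<close>

definition Xf :: "('d, real) conf measure => 'd site => real set => (('d, real) conf => real) => real" where
  "Xf \<mu> i A h = (LINT x|\<mu>. indicator A (x i) * (h x / DA i A (\<lambda>_. 1) x))"

text \<open>Resample inside the class \<open>B\<close>: averaging the indicator of \<open>A\<close>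
  produces exactly the normalisation of \<open>A\<close>, which cancels the one in the integrand and
  leaves that of \<open>B\<close>.\<close>

lemma sub_step:
  assumes inv: "invar UNIV E \<mu>" and E: "fatrel E" and B: "fatset B"
    and cl: "\<And>x y. x \<in> circle ==> y \<in> circle ==> x \<in> B ==> E x y \<longleftrightarrow> y \<in> B"
      "\<And>x y. x \<in> circle ==> y \<in> circle ==> x \<notin> B ==> E x y ==> y \<notin> B"
    and A: "fatset A" "A \<subseteq> B" and h: "bm CU h" "indep {i} h"
  shows "Xf \<mu> i A h = Xf \<mu> i B h"
proof -
  let ?k = "\<lambda>x. h x / DA i A (\<lambda>_. 1) x"
  let ?G = "\<lambda>x. indicator A (x i) * ?k x"
  have Ab: "A \<in> sets borel" using A by (simp add: fatset_def)
  have ik: "indep {i} ?k" using h(2) DA_indep[of i A "\<lambda>_. 1"] unfolding indep_def by simp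
  have ind: "indicator B y * (indicator A y :: real) = indicator A y" for y using A(2) by (auto simp: indicator_def)
  have sp: "space \<mu> = space CU" using inv sets_eq_imp_space_eq[of \<mu> CU] unfolding invar_def by blast
  have "Xf \<mu> i A h = (LINT x|\<mu>. indicator B (x i) * ?G x)"
    unfolding Xf_def by (simp only: mult.assoc[symmetric] ind)
  also have "\<dots> = (LINT x|\<mu>. indicator B (x i) * (DA i B ?G x / DA i B (\<lambda>_. 1) x))"
    by (rule class_step[OF inv E B cl(1) cl(2) bm_mult[OF bm_ind[OF Ab] bm_div_DA[OF A(1) h(1)]]])
  also have "\<dots> = Xf \<mu> i B h"
    unfolding Xf_def
  proof (rule icong[OF refl])
    fix x assume "x \<in> space \<mu>"
    then have x: "x \<in> space CU" using sp by simp
    have "DA i B ?G x = DA i B (\<lambda>x. ?k x * indicator A (x i)) x" by (simp only: mult.commute)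
    also have "\<dots> = ?k x * DA i B (\<lambda>x. indicator A (x i)) x" by (rule DA_pull[OF ik x])
    also have "DA i B (\<lambda>x. indicator A (x i)) x = DA i A (\<lambda>_. 1) x" unfolding DA_def ind by simp
    finally have "DA i B ?G x = h x" using DA_pos[OF A(1) x, of i] by simp
    then show "indicator B (x i) * (DA i B ?G x / DA i B (\<lambda>_. 1) x) = indicator B (x i) * (h x / DA i B (\<lambda>_. 1) x)" by simp
  qed
  finally show ?thesis .
qed

definition arcC :: "nat => real set" where "arcC k = {y \<in> circle. coarse q y = k}"
definition arcR :: "nat => real set" where "arcR k = {y \<in> circle. coarse q (rot1 \<tau> y) = k}"

lemma interval_fatset: assumes "a < b" "{a..<b} \<subseteq> circle" shows "fatset {a..<b}"
proof -
  have "(LINT y|LC. indicator {a..<b} y :: real) = measure LC {a..<b}"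
    using assms(2) by (simp add: space_restrict_space Int_absorb1 Int_absorb2 Int_commute)
  also have "\<dots> = measure lborel {a..<b}" using assms(2) by (subst measure_restrict_space) auto
  finally show ?thesis using assms by (simp add: fatset_def)
qed

lemma fatset_mono: assumes "fatset A" "A \<subseteq> B" "B \<in> sets borel" "B \<subseteq> circle" shows "fatset B"
proof -
  have A: "A \<in> sets LC" "B \<in> sets LC" using assms by (auto simp: fatset_def sets_restrict_space_iff circle_def)
  interpret finite_measure LC
    by (rule finite_measureI) (simp add: emeasure_restrict_space space_restrict_space circle_def)
  have "(LINT y|LC. indicator A y :: real) \<le> (LINT y|LC. indicator B y)"
    using A assms(2) by (intro integral_mono integrable_real_indicator) (auto simp: indicator_def emeasure_eq_measure)
  then show ?thesis using assms unfolding fatset_def by linarith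
qed

lemma arcs_borel: "arcC k \<in> sets borel" "arcR k \<in> sets borel"
proof -
  have c: "circle \<in> sets borel" by (simp add: circle_def)
  have "(\<lambda>y. coarse q (rot1 \<tau> y)) \<in> measurable borel (count_space UNIV)"
    by (rule measurable_compose[OF rot1_measurable coarse_borel])
  from measurable_sets[OF this, of "{k}"] measurable_sets[OF coarse_borel, of "{k}" q] c
  have "circle \<inter> coarse q -` {k} \<in> sets borel" "circle \<inter> (\<lambda>y. coarse q (rot1 \<tau> y)) -` {k} \<in> sets borel"
    by (auto intro!: sets.Int)
  then show "arcC k \<in> sets borel" "arcR k \<in> sets borel" by (simp_all add: arcC_def arcR_def Int_def)
qed

text \<open>Points of arc \<open>k\<close> further than \<open>\<tau>\<close> from its right end
  stay in the arc under the rotation; they form an interval of positive length since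
  \<open>\<tau> < 2 * pi / q\<close>.\<close>

lemma overlap1: assumes "k < q"
  shows "\<exists>A. fatset A \<and> A \<subseteq> arcC k \<and> A \<subseteq> arcR k"
proof (intro exI conjI)
  let ?a = "2 * pi * real k / real q" and ?b = "2 * pi * (real k + 1) / real q"
  let ?A = "{?a ..< ?b - \<tau>}"
  have ab: "?b = ?a + 2 * pi / real q" by (simp add: distrib_left add_divide_distrib)
  have sub: "?A \<subseteq> arc_of q k" using tau by (auto simp: arc_of_def)
  then have c: "?A \<subseteq> circle" using arc_of_circle[OF assms] by blast
  show "fatset ?A" using tau(2) ab by (intro interval_fatset c) simp
  show "?A \<subseteq> arcC k" using sub c coarse_arc[OF q assms] by (auto simp: arcC_def)
  show "?A \<subseteq> arcR k"
  proof
    fix y assume y: "y \<in> ?A"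
    then have m: "y + \<tau> \<in> arc_of q k" using tau(1) by (auto simp: arc_of_def)
    then have "y + \<tau> < 2 * pi" using arc_of_circle[OF assms] by (auto simp: circle_def)
    then have "rot1 \<tau> y = y + \<tau>" using rot1_cases[OF tau(1) tau2] y c by auto
    then show "y \<in> arcR k" using y c coarse_arc[OF q assms m] by (auto simp: arcR_def)
  qed
qed

text \<open>The last stretch of arc \<open>k\<close>, of length \<open>\<tau>\<close>, is rotated
  into the next arc. With \<open>Suc k < q\<close> no wrapping occurs, and the chain from arc 0 to
  arc \<open>q - 1\<close> connects all of them.\<close>

lemma overlap2: assumes "Suc k < q"
  shows "\<exists>A. fatset A \<and> A \<subseteq> arcC k \<and> A \<subseteq> arcR (Suc k)"
proof (intro exI conjI)
  let ?a = "2 * pi * real k / real q" and ?b = "2 * pi * (real k + 1) / real q"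
  let ?A = "{?b - \<tau> ..< ?b}"
  have ab: "?b = ?a + 2 * pi / real q" by (simp add: distrib_left add_divide_distrib)
  have k: "k < q" using assms by simp
  have sub: "?A \<subseteq> arc_of q k" using tau ab by (auto simp: arc_of_def)
  then have c: "?A \<subseteq> circle" using arc_of_circle[OF k] by blast
  show "fatset ?A" using tau(1) by (intro interval_fatset c) simp
  show "?A \<subseteq> arcC k" using sub c coarse_arc[OF q k] by (auto simp: arcC_def)
  have ab': "2 * pi * (real (Suc k) + 1) / real q = ?b + 2 * pi / real q" by (simp add: distrib_left add_divide_distrib)
  show "?A \<subseteq> arcR (Suc k)"
  proof
    fix y assume y: "y \<in> ?A"
    then have m: "y + \<tau> \<in> arc_of q (Suc k)" using tau(2) ab' unfolding arc_of_def by (simp add: add.commute)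
    then have "y + \<tau> < 2 * pi" using arc_of_circle[OF assms] by (auto simp: circle_def)
    then have "rot1 \<tau> y = y + \<tau>" using rot1_cases[OF tau(1) tau2] y c by auto
    then show "y \<in> arcR (Suc k)" using y c coarse_arc[OF q assms m] by (auto simp: arcR_def)
  qed
qed

lemma fat_arcs: assumes "k < q" shows "fatset (arcC k)" "fatset (arcR k)"
  using overlap1[OF assms] fatset_mono arcs_borel[of k] by (auto simp: arcC_def arcR_def)

text \<open>A subarc has the same normalised functional \<^term>\<open>Xf\<close> as any class containing it; moving along
  the overlaps of the two families of arcs identifies the functionals of all arcs.\<close>

lemma invar_Full:
  assumes i1: "invar UNIV C1 \<mu>" and i2: "invar UNIV C2 \<mu>" shows "invar UNIV Full \<mu>"
  unfolding invar_def
proof (intro conjI ballI allI impI)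
  show pr: "prob_space \<mu>" "sets \<mu> = sets CU" using invarD[OF i1] by auto
  have sp: "space \<mu> = space CU" using invarD(3)[OF i1] .
  fix i :: "'d site" and F :: "('d, real) conf => real" assume F: "bm CU F"
  interpret pot_resample \<Phi> Full UNIV "{i}" by (rule presF) simp
  note int = prob_integrable[OF pr(1), unfolded bm_sets_cong[OF pr(2)]]
  have s1: "Xf \<mu> i A h = Xf \<mu> i (arcC k) h" if "k < q" "fatset A" "A \<subseteq> arcC k" "bm CU h" "indep {i} h" for A k h
    by (rule sub_step[OF i1 fat fat_arcs(1)[OF that(1)]]) (use that in \<open>auto simp: arcC_def cellrel_def\<close>)
  have s2: "Xf \<mu> i A h = Xf \<mu> i (arcR k) h" if "k < q" "fatset A" "A \<subseteq> arcR k" "bm CU h" "indep {i} h" for A k h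
    by (rule sub_step[OF i2 fatrel_C2 fat_arcs(2)[OF that(1)]]) (use that in \<open>auto simp: arcR_def C2_def\<close>)
  \<comment> \<open>Inside the rotated arc \<open>Suc k\<close> sit a piece of cell \<open>k\<close>
    and a piece of cell \<open>Suc k\<close>; passing through them identifies the functionals of the
    two cells.\<close>
  have step: "Xf \<mu> i (arcC (Suc k)) h = Xf \<mu> i (arcC k) h" if k: "Suc k < q" and h: "bm CU h" "indep {i} h" for k h
  proof -
    obtain A B where A: "fatset A" "A \<subseteq> arcC k" "A \<subseteq> arcR (Suc k)" and B: "fatset B" "B \<subseteq> arcC (Suc k)" "B \<subseteq> arcR (Suc k)"
      using overlap1[OF k] overlap2[OF k] by blast
    have k': "k < q" using k by simp
    have "Xf \<mu> i (arcC (Suc k)) h = Xf \<mu> i B h" by (rule s1[OF k B(1,2) h, symmetric])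
    also have "\<dots> = Xf \<mu> i (arcR (Suc k)) h" by (rule s2[OF k B(1,3) h])
    also have "\<dots> = Xf \<mu> i A h" by (rule s2[OF k A(1,3) h, symmetric])
    also have "\<dots> = Xf \<mu> i (arcC k) h" by (rule s1[OF k' A(1,2) h])
    finally show ?thesis .
  qed
  have all: "Xf \<mu> i (arcC k) h = Xf \<mu> i (arcC 0) h" if "k < q" "bm CU h" "indep {i} h" for k h
    using that(1) by (induction k) (simp_all add: step that)
  \<comment> \<open>Split by the cell of the spin at \<open>i\<close>, average inside each cell, and
    transport all terms to cell 0, where they add up to the integral over the whole circle. The
    result depends on \<open>G\<close> only through its full one-site numerator, which a function
    shares with its full average.\<close>
  have main: "(LINT x|\<mu>. G x) = Xf \<mu> i (arcC 0) (num UNIV Full {i} G)" if G: "bm CU G" for G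
  proof -
    have part: "(\<Sum>k<q. indicator (arcC k) (x i)) = (1 :: real)" if "x \<in> space CU" for x
    proof -
      have c: "x i \<in> circle" using that by (simp add: space_CU)
      have "(\<Sum>k<q. indicator (arcC k) (x i)) = (\<Sum>k<q. if k = coarse q (x i) then 1 else 0 :: real)"
        using c by (intro sum.cong refl) (simp add: arcC_def indicator_def)
      then show ?thesis using coarse_less[OF q c] by simp
    qed
    have bk: "bm CU (\<lambda>x. indicator (arcC k) (x i) * G x)" for k by (rule bm_mult[OF bm_ind[OF arcs_borel(1)] G])
    have "(LINT x|\<mu>. G x) = (LINT x|\<mu>. (\<Sum>k<q. indicator (arcC k) (x i) * G x))"
      using part sp by (intro icong refl) (simp flip: sum_distrib_right)
    also have "\<dots> = (\<Sum>k<q. LINT x|\<mu>. indicator (arcC k) (x i) * G x)"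
      by (rule Bochner_Integration.integral_sum) (rule int[OF bk])
    also have "\<dots> = (\<Sum>k<q. Xf \<mu> i (arcC k) (DA i (arcC k) G))"
      unfolding Xf_def
    proof (rule sum.cong[OF refl])
      fix k assume "k \<in> {..<q}"
      then have "k < q" by simp
      then show "(LINT x|\<mu>. indicator (arcC k) (x i) * G x) = (LINT x|\<mu>. indicator (arcC k) (x i) * (DA i (arcC k) G x / DA i (arcC k) (\<lambda>_. 1) x))"
        by (rule class_step[OF i1 fat fat_arcs(1) _ _ G]) (auto simp: arcC_def cellrel_def)
    qed
    also have "\<dots> = (\<Sum>k<q. Xf \<mu> i (arcC 0) (DA i (arcC k) G))"
      by (intro sum.cong refl all DA_bm arcs_borel G DA_indep) simp
    also have "\<dots> = Xf \<mu> i (arcC 0) (num UNIV Full {i} G)"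
    proof -
      let ?I = "\<lambda>x. indicator (arcC 0) (x i) :: real" and ?d = "\<lambda>x. DA i (arcC 0) (\<lambda>_. 1) x"
      have f0: "fatset (arcC 0)" by (rule fat_arcs(1)[OF q])
      have "(\<Sum>k<q. Xf \<mu> i (arcC 0) (DA i (arcC k) G)) = (LINT x|\<mu>. (\<Sum>k<q. ?I x * (DA i (arcC k) G x / ?d x)))"
        unfolding Xf_def
        by (rule Bochner_Integration.integral_sum[symmetric])
          (intro int bm_mult bm_ind arcs_borel bm_div_DA f0 DA_bm G)
      also have "\<dots> = Xf \<mu> i (arcC 0) (num UNIV Full {i} G)"
        unfolding Xf_def
      proof (rule icong[OF refl])
        fix x assume "x \<in> space \<mu>"
        then have x: "x \<in> space CU" using sp by simp
        have "(\<Sum>k<n. DA i (arcC k) G x) = num UNIV Full {i} (\<lambda>\<zeta>. \<Sum>k<n. indicator (arcC k) (\<zeta> i) * G \<zeta>) x" for n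
        proof (induction n)
          case 0
          show ?case using num_pull[OF x, of "\<lambda>_. 0" "\<lambda>_. 0"] by simp
        next
          case (Suc n)
          show ?case using num_affine[OF bm_sum[of "{..<n}" CU "\<lambda>k \<zeta>. indicator (arcC k) (\<zeta> i) * G \<zeta>"] bk[of n] x, of 1 1] Suc bk
            by (simp add: DA_def)
        qed
        also have "num UNIV Full {i} (\<lambda>\<zeta>. \<Sum>k<q. indicator (arcC k) (\<zeta> i) * G \<zeta>) x = num UNIV Full {i} G x"
          unfolding num_def by (rule J_cong_space[OF x]) (simp add: part flip: sum_distrib_right)
        finally have e: "(\<Sum>k<q. DA i (arcC k) G x) = num UNIV Full {i} G x" .
        show "(\<Sum>k<q. ?I x * (DA i (arcC k) G x / ?d x)) = ?I x * (num UNIV Full {i} G x / ?d x)"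
          unfolding e[symmetric] by (simp add: sum_distrib_left sum_divide_distrib)
      qed
      finally show ?thesis .
    qed
    finally show ?thesis .
  qed
  have "(LINT x|\<mu>. K UNIV Full {i} F x) = Xf \<mu> i (arcC 0) (num UNIV Full {i} (K UNIV Full {i} F))"
    by (rule main[OF bm_K[OF F]])
  also have "\<dots> = Xf \<mu> i (arcC 0) (num UNIV Full {i} F)"
    unfolding Xf_def using sp by (intro icong refl) (simp add: num_K)
  also have "\<dots> = (LINT x|\<mu>. F x)" by (rule main[OF F, symmetric])
  finally show "(LINT x|\<mu>. K UNIV Full {i} F x) = (LINT x|\<mu>. F x)" .
qed

end

section \<open>From rotation of single spins to the discrete DLR equations\<close>

context clock_model
begin

abbreviation rs :: "'d site set => ('d, real) conf => ('d, real) conf" where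
  "rs Y x \<equiv> restrict x (- Y)"

lemma rs_space: "x \<in> space CU ==> rs Y x \<in> cs (- Y)"
  by (auto simp: space_conf_space)

lemma rs_measurable: "rs Y \<in> measurable CU (cspace (- Y))"
  by (rule measurable_cspaceI) (auto intro: cspace_component)

lemma bm_rs: "bm (cspace (- Y)) F ==> bm CU (\<lambda>x. F (rs Y x))"
  by (rule bm_compose[OF _ rs_measurable])

lemma indep_rs: "indep Y (\<lambda>x. F (rs Y x))"
proof -
  have "rs Y (override_on x \<sigma> Y) = rs Y x" for x \<sigma> :: "('d, real) conf" by (auto simp: override_on_def)
  then show ?thesis by (simp add: indep_def)
qed

lemma indep_Nn: "finite Y ==> indep Y (Nn Y)"
  unfolding indep_def Nn_def by (intro ballI pot_resample.num_self[OF presF]) auto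

lemma indep_Nw: "indep Y (Nw Y w)"
proof -
  have "override_on (override_on x \<sigma> Y) (pt Y w) Y = override_on x (pt Y w) Y" for x \<sigma> :: "('d, real) conf"
    by (auto simp: override_on_def)
  then show ?thesis unfolding indep_def Nw_def by simp
qed

definition off :: "'d site set => (('d, nat) conf => real) => bool" where
  "off Y g \<longleftrightarrow> (\<forall>s\<in>space Om. \<forall>s'\<in>space Om. (\<forall>i\<in>- Y. s i = s' i) \<longrightarrow> g s = g s')"

lemma indep_off: assumes "off Y g" shows "indep Y (\<lambda>x. g (tmap x))"
  unfolding indep_def
proof (intro ballI)
  fix x \<sigma> :: "('d, real) conf" assume x: "x \<in> space CU" and s: "\<sigma> \<in> space (lebc Y)"
  have "override_on x \<sigma> Y \<in> space CU" by (rule override_space[OF x s subset_UNIV])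
  then show "g (tmap (override_on x \<sigma> Y)) = g (tmap x)"
    using assms tmap_space x unfolding off_def by (simp add: tmap_def override_on_def)
qed

text \<open>The weight of the sites in \<open>Y\<close> integrates to \<^term>\<open>Nn Y\<close>, which cancels the denominator.\<close>

lemma num_insert_div:
  assumes fin: "finite Y" and i: "i \<notin> Y" and G: "bm CU G" "indep Y G" and x: "x \<in> space CU"
  shows "num UNIV Full (insert i Y) (\<lambda>x. G x / Nn Y x) x = J Full {i} (\<lambda>x. wt (- Y) {i} x * G x) x"
proof -
  interpret l: resample Full UNIV Y by (rule resF[OF fin])
  interpret r: resample Full UNIV "{i}" by (rule resF) simp
  let ?g = "\<lambda>x. G x / Nn Y x"
  have bN: "bm CU ?g"
    using Nn_bounds(1)[OF fin] Z_pos[OF fin] by (intro bm_divide[OF G(1) bm_Nn[OF fin], of "exp (- Bd Y) * Z Y"]) auto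
  have Np: "0 < Nn Y y" if "y \<in> space CU" for y
    using Nn_bounds(1)[OF fin that] Z_pos[OF fin] by (smt (verit) exp_gt_zero mult_pos_pos)
  have w: "wt UNIV (insert i Y) y = wt UNIV Y y * wt (- Y) {i} y" if "y \<in> space CU" for y
    using H_cocycle[of Y "{i}" UNIV y] fin i that by (simp add: wt_def space_CU Compl_eq_Diff_UNIV flip: exp_add)
  have b: "bm CU (\<lambda>x. wt UNIV (insert i Y) x * ?g x)" using fin by (intro bm_mult bm_wt bN) simp
  have "num UNIV Full (insert i Y) ?g x = J Full {i} (J Full Y (\<lambda>x. wt UNIV (insert i Y) x * ?g x)) x"
    unfolding num_def J_insert[OF fatrel_Full subset_UNIV fin i b x] J_swap[OF fatrel_Full subset_UNIV fin i b x] ..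
  also have "\<dots> = J Full {i} (\<lambda>x. wt (- Y) {i} x * G x) x"
  proof (rule r.J_cong_space[OF x])
    fix y :: "('d, real) conf" assume y: "y \<in> space CU"
    have "J Full Y (\<lambda>x. wt UNIV (insert i Y) x * ?g x) y = J Full Y (\<lambda>x. (wt (- Y) {i} x * ?g x) * (wt UNIV Y x * 1)) y"
      by (rule l.J_cong_space[OF y]) (simp add: w)
    also have "\<dots> = (wt (- Y) {i} y * ?g y) * J Full Y (\<lambda>x. wt UNIV Y x * 1) y"
    proof (rule l.J_pull[OF y])
      fix \<sigma> assume s: "\<sigma> \<in> space (lebc Y)"
      have o: "override_on y \<sigma> Y \<in> space CU" by (rule override_space[OF y s subset_UNIV])
      have "wt (- Y) {i} (override_on y \<sigma> Y) = wt (- Y) {i} y"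
        by (rule wt_cong[OF o]) (auto simp: override_on_def)
      then show "wt (- Y) {i} (override_on y \<sigma> Y) * ?g (override_on y \<sigma> Y) = wt (- Y) {i} y * ?g y"
        using G(2) indep_Nn[OF fin] y s unfolding indep_def by simp
    qed
    also have "\<dots> = wt (- Y) {i} y * G y"
      using Np[OF y] unfolding Nn_def num_def by simp
    finally show "J Full Y (\<lambda>x. wt UNIV (insert i Y) x * ?g x) y = wt (- Y) {i} y * G y" .
  qed
  finally show ?thesis .
qed

lemma J_rs: assumes "i \<notin> Y" shows "J E {i} (\<lambda>x. f (rs Y x)) x = J E {i} f (rs Y x)"
proof -
  have "rs Y (override_on x \<sigma> {i}) = override_on (rs Y x) \<sigma> {i}" for \<sigma> using assms by (auto simp: override_on_def)
  moreover have "comp_ind E {i} (rs Y x) \<sigma> = comp_ind E {i} x \<sigma>" for \<sigma> using assms by (simp add: comp_ind_def)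
  ultimately show ?thesis unfolding J_def by simp
qed

lemma wt_rs: "x \<in> space CU ==> wt (- Y) {i} x = wt (- Y) {i} (rs Y x)"
  by (rule wt_cong) auto

lemma bm_wt_off: "bm CU (wt (- Y) {i})" by (rule bm_wt_sub) auto

text \<open>The weight \<open>1 / Nn Y\<close> removes the influence of the spins in
  \<open>Y\<close> on those outside: after resampling \<open>Y\<close> and \<open>i\<close>
  together, only \<open>wt (- Y) {i}\<close> remains. Splitting the circle at \<open>i\<close> into
  cells then exhibits the constrained one-site kernel of the system on the complement.\<close>

lemma dlr_step:
  assumes inv: "invar UNIV Full \<mu>" and fin: "finite Y" and i: "i \<notin> Y" and F: "bm (cspace (- Y)) F"
    and g: "bm Om g" "off Y g"
  shows "(LINT x|\<mu>. g (tmap x) * K (- Y) C1 {i} F (rs Y x) / Nn Y x) = (LINT x|\<mu>. g (tmap x) * F (rs Y x) / Nn Y x)"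
proof -
  interpret v: pot_resample \<Phi> C1 "- Y" "{i}" using fat i by unfold_locales auto
  interpret c: resample C1 UNIV "{i}" by (rule resC) simp
  interpret m: pot_resample \<Phi> Full UNIV "insert i Y" using fin by (intro presF) simp
  let ?K = "K (- Y) C1 {i} F"
  have bdiv: "bm CU (\<lambda>x. G x / Nn Y x)" if "bm CU G" for G
    using Nn_bounds(1)[OF fin] Z_pos[OF fin] by (intro bm_divide[OF that bm_Nn[OF fin], of "exp (- Bd Y) * Z Y"]) auto
  have ind: "indep Y (\<lambda>x. g (tmap x) * f (rs Y x))" for f
    using indep_off[OF g(2)] indep_rs[of Y f] unfolding indep_def by simp
  have bG: "bm CU (\<lambda>x. g (tmap x) * f (rs Y x))" if "bm (cspace (- Y)) f" for f
    by (intro bm_mult bm_tmap bm_rs g that)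
  \<comment> \<open>\<open>g\<close> sees only the cells, which resampling in \<open>C1\<close>
    preserves, so it leaves the integral.\<close>
  have cell: "J C1 {i} (\<lambda>x. wt (- Y) {i} x * (g (tmap x) * f (rs Y x))) y = g (tmap y) * num (- Y) C1 {i} f (rs Y y)"
    if y: "y \<in> space CU" for f y
  proof -
    have "J C1 {i} (\<lambda>x. wt (- Y) {i} x * (g (tmap x) * f (rs Y x))) y = J C1 {i} (\<lambda>x. g (tmap x) * (wt (- Y) {i} (rs Y x) * f (rs Y x))) y"
      by (rule c.J_cong_space[OF y]) (simp add: wt_rs)
    also have "\<dots> = g (tmap y) * J C1 {i} (\<lambda>x. wt (- Y) {i} (rs Y x) * f (rs Y x)) y"
    proof (rule c.J_pull[OF y])
      fix \<sigma> assume "\<sigma> \<in> space (lebc {i})" "\<And>j. j \<in> {i} ==> C1 (y j) (\<sigma> j)"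
      then have "tmap (override_on y \<sigma> {i}) = tmap y" by (auto simp: tmap_def override_on_def cellrel_def)
      then show "g (tmap (override_on y \<sigma> {i})) = g (tmap y)" by simp
    qed
    also have "J C1 {i} (\<lambda>x. wt (- Y) {i} (rs Y x) * f (rs Y x)) y = num (- Y) C1 {i} f (rs Y y)"
      unfolding num_def by (rule J_rs[OF i])
    finally show ?thesis .
  qed
  have fullJ: "J Full {i} (\<lambda>x. wt (- Y) {i} x * (g (tmap x) * f (rs Y x))) x =
      (\<Sum>w\<in>W {i}. g (tmap (override_on x (pt {i} w) {i})) * num (- Y) C1 {i} f (rs Y (override_on x (pt {i} w) {i})))"
    if x: "x \<in> space CU" and f: "bm (cspace (- Y)) f" for x f
  proof -
    have "J Full {i} (\<lambda>x. 1 * (wt (- Y) {i} x * (g (tmap x) * f (rs Y x)))) x =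
      (\<Sum>w\<in>W {i}. 1 * J C1 {i} (\<lambda>x. wt (- Y) {i} x * (g (tmap x) * f (rs Y x))) (override_on x (pt {i} w) {i}))"
      by (rule J_Full_split[of _ _ _ "\<lambda>_. 1"]) (simp, rule bm_mult[OF bm_wt_off bG[OF f]], rule x)
    then show ?thesis using override_pt[OF _ x] by (simp add: cell cong: sum.cong)
  qed
  have key: "K UNIV Full (insert i Y) (\<lambda>x. g (tmap x) * ?K (rs Y x) / Nn Y x) x =
      K UNIV Full (insert i Y) (\<lambda>x. g (tmap x) * F (rs Y x) / Nn Y x) x" if x: "x \<in> space CU" for x
  proof -
    have "J Full {i} (\<lambda>x. wt (- Y) {i} x * (g (tmap x) * ?K (rs Y x))) x = J Full {i} (\<lambda>x. wt (- Y) {i} x * (g (tmap x) * F (rs Y x))) x"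
      unfolding fullJ[OF x F] fullJ[OF x v.bm_K[OF F]]
      using v.num_K[OF rs_space[OF override_pt[OF _ x]]] by (intro sum.cong refl) simp
    then show ?thesis
      unfolding K_def[of UNIV Full] num_insert_div[OF fin i bG[OF v.bm_K[OF F]] ind x] num_insert_div[OF fin i bG[OF F] ind x] by simp
  qed
  have sp: "space \<mu> = space CU" using inv sets_eq_imp_space_eq[of \<mu> CU] unfolding invar_def by blast
  note blk = invar_block[OF inv fatrel_Full subset_UNIV]
  have "(LINT x|\<mu>. g (tmap x) * ?K (rs Y x) / Nn Y x) = (LINT x|\<mu>. K UNIV Full (insert i Y) (\<lambda>x. g (tmap x) * ?K (rs Y x) / Nn Y x) x)"
    using fin by (intro blk[symmetric] bdiv bG v.bm_K F) simp
  also have "\<dots> = (LINT x|\<mu>. K UNIV Full (insert i Y) (\<lambda>x. g (tmap x) * F (rs Y x) / Nn Y x) x)"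
    using key sp by (intro icong refl) simp
  also have "\<dots> = (LINT x|\<mu>. g (tmap x) * F (rs Y x) / Nn Y x)"
    using fin by (intro blk bdiv bG F) simp
  finally show ?thesis .
qed

lemma dlr_steps:
  assumes inv: "invar UNIV Full \<mu>" and fin: "finite Y" and "set is \<subseteq> - Y" and F: "bm (cspace (- Y)) F"
    and g: "bm Om g" "off Y g"
  shows "(LINT x|\<mu>. g (tmap x) * Ks (- Y) C1 is F (rs Y x) / Nn Y x) = (LINT x|\<mu>. g (tmap x) * F (rs Y x) / Nn Y x)"
  using assms(3)
proof (induction "is")
  case (Cons i "is")
  then have h: "i \<notin> Y" "set is \<subseteq> - Y" by auto
  show ?case unfolding Ks_simps dlr_step[OF inv fin h(1) bm_Ks[OF fat h(2) F] g] by (rule Cons.IH[OF h(2)])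
qed simp

text \<open>Sweeps change nothing under the weighted measure, and they make \<open>F\<close> nearly
  constant on cells, hence uniformly close to its constrained expectation. In the limit the outside
  spins are replaced by the constrained law given their cells.\<close>

lemma dlr_constrained:
  assumes inv: "invar UNIV Full \<mu>" and fin: "finite Y" and F: "bm (cspace (- Y)) F" "ql (- Y) F"
    and g: "bm Om g" "off Y g"
  shows "(LINT x|\<mu>. g (tmap x) * F (rs Y x) / Nn Y x) = (LINT x|\<mu>. g (tmap x) * (LINT \<xi>|cg (- Y) (tmap x). F \<xi>) / Nn Y x)"
proof -
  let ?c = "\<lambda>s. LINT \<xi>|cg (- Y) s. F \<xi>"
  have pr: "prob_space \<mu>" "sets \<mu> = sets CU" using inv by (auto simp: invar_def)
  have sp: "space \<mu> = space CU" using pr(2) by (rule sets_eq_imp_space_eq)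
  note bs = bm_sets_cong[OF pr(2)]
  note int = prob_integrable[OF pr(1), unfolded bs]
  have bdiv: "bm CU (\<lambda>x. G x / Nn Y x)" if "bm CU G" for G
    using Nn_bounds(1)[OF fin] Z_pos[OF fin] by (intro bm_divide[OF that bm_Nn[OF fin], of "exp (- Bd Y) * Z Y"]) auto
  obtain b where b: "\<And>x. x \<in> space CU ==> \<bar>g (tmap x) / Nn Y x\<bar> \<le> b"
    using bm_bounded[OF bdiv[OF bm_tmap[OF g(1)]]] by blast
  have b0: "0 \<le> b" using b[OF zero_CU] by linarith
  have close: "\<bar>(LINT x|\<mu>. g (tmap x) * F (rs Y x) / Nn Y x) - (LINT x|\<mu>. g (tmap x) * ?c (tmap x) / Nn Y x)\<bar> \<le> e * b"
    if e: "0 < e" for e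
  proof -
    obtain "is" where L: "set is \<subseteq> - Y" "\<And>\<xi> \<eta>. \<xi> \<in> cs (- Y) ==> \<eta> \<in> cs (- Y) ==> same (- Y) \<xi> \<eta> ==>
       \<bar>Ks (- Y) C1 is F \<xi> - Ks (- Y) C1 is F \<eta>\<bar> \<le> e"
      using dobrushin_ql[OF F e] by blast
    let ?k = "Ks (- Y) C1 is F"
    have bk: "bm (cspace (- Y)) ?k" by (rule bm_Ks[OF fat L(1) F(1)])
    have d: "\<bar>?c (tmap x) - ?k (rs Y x)\<bar> \<le> e" if x: "x \<in> space CU" for x
    proof (rule invar_close[OF cgV(1)[OF tmap_space[OF x]] _ rs_space[OF x] L(1) F(1) L(2)])
      have s: "\<And>i. i \<in> - Y ==> tmap x i < q" using OmegaD[OF tmap_space[OF x]] .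
      have cp: "coarse q (cellpt (- Y) (tmap x) i) = coarse q (x i)" if "i \<in> - Y" for i
        using cellpt(2)[OF s that] by (simp add: tmap_def)
      have "AE \<xi> in cg (- Y) (tmap x). same (- Y) (cellpt (- Y) (tmap x)) \<xi>" by (rule cg(2)) (rule s)
      then show "AE \<xi> in cg (- Y) (tmap x). same (- Y) (rs Y x) \<xi>"
        by (rule AE_mp) (intro always_eventually allI impI, simp add: same_def cellrel_def cp)
    qed
    have bb: "bm CU (\<lambda>x. g (tmap x) * ?k (rs Y x) / Nn Y x)" "bm CU (\<lambda>x. g (tmap x) * ?c (tmap x) / Nn Y x)"
      by (intro bdiv bm_mult bm_tmap bm_rs g bk bm_cg F)+
    have "(LINT x|\<mu>. g (tmap x) * F (rs Y x) / Nn Y x) - (LINT x|\<mu>. g (tmap x) * ?c (tmap x) / Nn Y x) =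
      (LINT x|\<mu>. g (tmap x) * ?k (rs Y x) / Nn Y x - g (tmap x) * ?c (tmap x) / Nn Y x)"
      unfolding dlr_steps[OF inv fin L(1) F(1) g, symmetric] by (rule Bochner_Integration.integral_diff[OF int[OF bb(1)] int[OF bb(2)], symmetric])
    also have "\<bar>\<dots>\<bar> \<le> e * b"
    proof (rule prob_abs_integral_le[OF pr(1)])
      show "bm \<mu> (\<lambda>x. g (tmap x) * ?k (rs Y x) / Nn Y x - g (tmap x) * ?c (tmap x) / Nn Y x)"
        unfolding bs by (intro bm_diff bb)
      fix x assume "x \<in> space \<mu>"
      then have x: "x \<in> space CU" using sp by simp
      have "g (tmap x) * ?k (rs Y x) / Nn Y x - g (tmap x) * ?c (tmap x) / Nn Y x = - ((?c (tmap x) - ?k (rs Y x)) * (g (tmap x) / Nn Y x))"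
        by (simp add: algebra_simps diff_divide_distrib)
      then have "\<bar>g (tmap x) * ?k (rs Y x) / Nn Y x - g (tmap x) * ?c (tmap x) / Nn Y x\<bar> = \<bar>?c (tmap x) - ?k (rs Y x)\<bar> * \<bar>g (tmap x) / Nn Y x\<bar>"
        by (simp add: abs_mult)
      also have "\<dots> \<le> e * b" using d[OF x] b[OF x] e by (intro mult_mono) auto
      finally show "\<bar>g (tmap x) * ?k (rs Y x) / Nn Y x - g (tmap x) * ?c (tmap x) / Nn Y x\<bar> \<le> e * b" .
    qed
    finally show ?thesis .
  qed
  let ?D = "\<bar>(LINT x|\<mu>. g (tmap x) * F (rs Y x) / Nn Y x) - (LINT x|\<mu>. g (tmap x) * ?c (tmap x) / Nn Y x)\<bar>"
  have "?D \<le> 0 + e" if "0 < e" for e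
  proof -
    \<comment> \<open>The denominator \<open>b + 1\<close> is positive even when \<open>b\<close> is
      0.\<close>
    have "?D \<le> e / (b + 1) * b" using that b0 by (intro close) simp
    also have "\<dots> \<le> e" using that b0 by (simp add: divide_le_eq)
    finally show ?thesis by simp
  qed
  then have "?D \<le> 0" by (rule field_le_epsilon)
  then show ?thesis by simp
qed

lemma ql_num_ext:
  assumes fin: "finite Y" and f: "ql UNIV f" and a: "a \<in> space CU"
  shows "ql (- Y) (\<lambda>\<xi>. f (override_on (ext Y \<xi>) a Y))"
  unfolding ql_def
proof (intro allI impI)
  fix e :: real assume "e > 0"
  from qlE[OF f this] obtain L where L: "finite L"
    "\<And>\<xi> \<eta>. \<xi> \<in> space CU ==> \<eta> \<in> space CU ==> (\<And>i. i \<in> L ==> \<xi> i = \<eta> i) ==> \<bar>f \<xi> - f \<eta>\<bar> \<le> e" by metis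
  show "\<exists>L. finite L \<and> L \<subseteq> - Y \<and> (\<forall>\<xi>\<in>cs (- Y). \<forall>\<eta>\<in>cs (- Y). (\<forall>i\<in>L. \<xi> i = \<eta> i) \<longrightarrow>
      \<bar>f (override_on (ext Y \<xi>) a Y) - f (override_on (ext Y \<eta>) a Y)\<bar> \<le> e)"
  proof (intro exI[of _ "L - Y"] conjI ballI impI)
    fix \<xi> \<eta> :: "('d, real) conf" assume h: "\<xi> \<in> cs (- Y)" "\<eta> \<in> cs (- Y)" "\<forall>i\<in>L - Y. \<xi> i = \<eta> i"
    have "override_on (ext Y \<xi>) a Y \<in> space CU" "override_on (ext Y \<eta>) a Y \<in> space CU"
      using ext_space[OF h(1)] ext_space[OF h(2)] a by (auto simp: space_CU override_on_def)
    then show "\<bar>f (override_on (ext Y \<xi>) a Y) - f (override_on (ext Y \<eta>) a Y)\<bar> \<le> e"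
      by (rule L(2)) (use h(3) in \<open>auto simp: override_on_def ext_def\<close>)
  qed (use L(1) in auto)
qed

lemma ql_Nw_ext: assumes "finite Y" "w \<in> W Y" shows "ql (- Y) (\<lambda>\<xi>. Nw Y w (ext Y \<xi>))"
  unfolding Nw_def
  by (rule ql_num_ext[OF assms(1) pot_resample.ql_num[OF presC[OF assms(1)] ql_const bm_const] pt(1)[OF assms(2)]])

lemma ql_Nn_ext: assumes "finite Y" shows "ql (- Y) (\<lambda>\<xi>. Nn Y (ext Y \<xi>))"
proof -
  have "override_on (ext Y \<xi>) (\<lambda>_. 0) Y = ext Y \<xi>" for \<xi> by (auto simp: override_on_def ext_def)
  then show ?thesis
    using ql_num_ext[OF assms pot_resample.ql_num[OF presF[OF assms] ql_const bm_const] zero_CU, of 1] by (simp add: Nn_def)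
qed

lemma ext_rs: assumes "indep Y f" "x \<in> space CU" shows "f (ext Y (rs Y x)) = f x"
proof -
  have s: "(\<lambda>i\<in>Y. 0) \<in> space (lebc Y)" by (auto simp: space_leb_prod circle_def)
  have "ext Y (rs Y x) = override_on x (\<lambda>i\<in>Y. 0) Y" by (auto simp: ext_def override_on_def)
  then show ?thesis using assms s unfolding indep_def by simp
qed

text \<open>Uniqueness again: the properties that characterise the measure involve the discrete
  configuration only on \<open>V\<close>.\<close>

lemma cg_off:
  assumes s: "s \<in> space Om" "s' \<in> space Om" and "\<And>i. i \<in> V ==> s i = s' i"
  shows "cg V s = cg V s'"
proof (rule cg(7))
  show "s' i < q" for i by (rule OmegaD[OF s(2)])
  show "invar V C1 (cg V s)" by (rule cgV(1)[OF s(1)])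
  have "cellpt V s = cellpt V s'" unfolding cellpt_def by (rule restrict_ext) (simp add: assms(3))
  moreover have "AE x in cg V s. same V (cellpt V s) x" by (rule cg(2)) (rule OmegaD[OF s(1)])
  ultimately show "AE x in cg V s. same V (cellpt V s') x" by simp
qed

lemma off_cN: "off Y (cN Y f)"
  unfolding off_def cN_def using cg_off[of _ _ "- Y"] by metis

text \<open>The kernel value is a quotient of constrained expectations.
  \<open>dlr_constrained\<close> turns the numerator \<open>Nw\<close> into its expectation; this is
  the kernel value times the expectation of \<open>Nn\<close>, and the same lemma read backwards
  restores \<open>Nn\<close> itself, which cancels the weight.\<close>

lemma gibbs_of_invar_Full:
  assumes \<nu>: "pm \<nu>" and inv: "invar UNIV Full (lift \<nu>)"
  shows "\<nu> \<in> gibbs_measures UNIV Om (disc_spec \<Phi> q)"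
  unfolding gibbs_iff[OF \<nu>]
proof (intro allI impI)
  fix Y :: "'d site set" and B assume fin: "finite Y" and B: "B \<in> sets Om"
  interpret n: prob_space \<nu> by (rule pmD(1)[OF \<nu>])
  interpret pot_resample \<Phi> Full UNIV Y by (rule presF[OF fin])
  let ?\<mu> = "lift \<nu>"
  have sp: "space ?\<mu> = space CU" by (rule lift(3)[OF \<nu>])
  define g where "g w s = (indicator B (override_on s w Y) :: real)" for w s
  have bg: "bm Om (g w)" if "w \<in> W Y" for w
    unfolding g_def by (rule bm_compose[OF bm_indicator[OF B] override_Om(2)[OF that]])
  have og: "off Y (g w)" for w
  proof -
    have "override_on s w Y = override_on s' w Y" if "\<forall>i\<in>- Y. s i = s' i" for s s' using that by (auto simp: override_on_def)
    then show ?thesis unfolding off_def g_def by metis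
  qed
  have Np: "0 < Nn Y y" if "y \<in> space CU" for y
    using Nn_bounds(1)[OF fin that] Z_pos[OF fin] by (smt (verit) exp_gt_zero mult_pos_pos)
  have bB: "bm CU (\<lambda>x. indicator B (tmap x) :: real)" by (rule bm_tmap[OF bm_indicator[OF B]])
  have KB: "K UNIV Full Y (\<lambda>x. indicator B (tmap x)) x = (\<Sum>w\<in>W Y. g w (tmap x) * Nw Y w x / Nn Y x)"
    if x: "x \<in> space CU" for x
  proof -
    have "num UNIV Full Y (\<lambda>x. indicator B (tmap x)) x = J Full Y (\<lambda>y. g (restrict (tmap y) Y) (tmap x) * (wt UNIV Y y * 1)) x"
      unfolding num_def
    proof (rule J_cong[OF x])
      fix \<sigma>
      have "override_on (tmap x) (restrict (tmap (override_on x \<sigma> Y)) Y) Y = tmap (override_on x \<sigma> Y)"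
        by (auto simp: override_on_def tmap_def)
      then show "wt UNIV Y (override_on x \<sigma> Y) * indicator B (tmap (override_on x \<sigma> Y)) =
        g (restrict (tmap (override_on x \<sigma> Y)) Y) (tmap x) * (wt UNIV Y (override_on x \<sigma> Y) * 1)" by (simp add: g_def)
    qed
    also have "\<dots> = (\<Sum>w\<in>W Y. g w (tmap x) * Nw Y w x)"
      unfolding Nw_def num_def by (rule J_Full_split[OF fin bm_wf[OF bm_const] x, of "\<lambda>w. g w (tmap x)"])
    finally show ?thesis unfolding K_def Nn_def[symmetric] by (simp add: sum_divide_distrib)
  qed
  have bdiv: "bm CU (\<lambda>x. G x / Nn Y x)" if "bm CU G" for G
    using Nn_bounds(1)[OF fin] Z_pos[OF fin] by (intro bm_divide[OF that bm_Nn[OF fin], of "exp (- Bd Y) * Z Y"]) auto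
  have trm: "(LINT x|?\<mu>. g w (tmap x) * Nw Y w x / Nn Y x) = (LINT s|\<nu>. disc_prob \<Phi> q Y w s * g w s)" if w: "w \<in> W Y" for w
  proof -
    note bp = disc_prob_measurable[OF fin w]
    let ?h = "\<lambda>s. disc_prob \<Phi> q Y w s * g w s"
    have oh: "off Y ?h"
      using og[of w] off_cN[of Y "Nw Y w"] off_cN[of Y "Nn Y"] disc_prob_eq[OF fin w] unfolding off_def by metis
    have "(LINT x|?\<mu>. g w (tmap x) * Nw Y w x / Nn Y x) = (LINT x|?\<mu>. g w (tmap x) * Nw Y w (ext Y (rs Y x)) / Nn Y x)"
      using sp ext_rs[OF indep_Nw] by (intro icong refl) simp
    also have "\<dots> = (LINT x|?\<mu>. g w (tmap x) * cN Y (Nw Y w) (tmap x) / Nn Y x)"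
      unfolding cN_def by (rule dlr_constrained[OF inv fin bm_ext[OF bm_Nw[OF fin w]] ql_Nw_ext[OF fin w] bg[OF w] og])
    also have "\<dots> = (LINT x|?\<mu>. ?h (tmap x) * cN Y (Nn Y) (tmap x) / Nn Y x)"
    proof (rule icong[OF refl])
      fix x assume "x \<in> space ?\<mu>"
      then have t: "tmap x \<in> space Om" using sp tmap_space by simp
      show "g w (tmap x) * cN Y (Nw Y w) (tmap x) / Nn Y x = ?h (tmap x) * cN Y (Nn Y) (tmap x) / Nn Y x"
        unfolding disc_prob_eq[OF fin w t] using cN_bounds(3)[OF fin t] by simp
    qed
    also have "\<dots> = (LINT x|?\<mu>. ?h (tmap x) * Nn Y (ext Y (rs Y x)) / Nn Y x)"
      unfolding cN_def by (rule dlr_constrained[OF inv fin bm_ext[OF bm_Nn[OF fin]] ql_Nn_ext[OF fin] bm_mult[OF bp bg[OF w]] oh, symmetric])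
    also have "\<dots> = (LINT x|?\<mu>. ?h (tmap x))"
    proof (rule icong[OF refl])
      fix x assume "x \<in> space ?\<mu>"
      then have x: "x \<in> space CU" using sp by simp
      show "?h (tmap x) * Nn Y (ext Y (rs Y x)) / Nn Y x = ?h (tmap x)"
        using ext_rs[OF indep_Nn[OF fin] x] Np[OF x] by simp
    qed
    also have "\<dots> = (LINT s|\<nu>. ?h s)" by (rule lift_tmap[OF \<nu> bm_mult[OF bp bg[OF w]]])
    finally show ?thesis .
  qed
  have "measure \<nu> B = (LINT s|\<nu>. indicator B s)"
    using B pmD(2,3)[OF \<nu>] sets.sets_into_space[OF B] by (simp add: Int_absorb2)
  also have "\<dots> = (LINT x|?\<mu>. indicator B (tmap x))" by (rule lift_tmap[OF \<nu> bm_indicator[OF B], symmetric])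
  also have "\<dots> = (LINT x|?\<mu>. K UNIV Full Y (\<lambda>x. indicator B (tmap x)) x)"
    by (rule invar_block[OF inv fatrel_Full subset_UNIV fin bB, symmetric])
  also have "\<dots> = (LINT x|?\<mu>. (\<Sum>w\<in>W Y. g w (tmap x) * Nw Y w x / Nn Y x))"
    using KB sp by (intro icong refl) simp
  also have "\<dots> = (\<Sum>w\<in>W Y. LINT x|?\<mu>. g w (tmap x) * Nw Y w x / Nn Y x)"
    by (rule Bochner_Integration.integral_sum) (intro lift(4)[OF \<nu>] bdiv bm_mult bm_tmap bg bm_Nw fin)
  also have "\<dots> = (\<Sum>w\<in>W Y. LINT s|\<nu>. disc_prob \<Phi> q Y w s * g w s)" by (rule sum.cong[OF refl trm])
  finally show "measure \<nu> B = (\<Sum>w\<in>W Y. LINT s|\<nu>. disc_prob \<Phi> q Y w s * indicator B (override_on s w Y))"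
    unfolding g_def .
qed

end

section \<open>Equality of entropy densities characterises the Gibbs measures\<close>

theorem theorem3p3:
  fixes \<Phi> :: "('d::finite) potential" and q :: nat and \<tau> :: real
    and \<mu>' :: "('d, nat) conf measure"
  assumes "is_potential \<Phi>"
    and "translation_invariant_potential \<Phi>"
    and "rotation_invariant_potential \<Phi>"
    and "continuous_symmetry_breaking \<Phi>"
    and "0 < q" and "dobrushin_condition \<Phi> q"
    and "0 < \<tau>" and "\<tau> < 2 * pi / real q"
    and "\<mu>' \<in> ti_gibbs_measures (Omega q) (disc_spec \<Phi> q)"
    and "evolve \<Phi> q \<tau> \<mu>' = \<mu>'"
  shows "(\<forall>\<nu>' \<in> ti_prob_measures (Omega q).
            rel_entropy_density q \<nu>' \<mu>' = rel_entropy_density q (evolve \<Phi> q \<tau> \<nu>') \<mu>'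
              \<longrightarrow> \<nu>' \<in> ti_gibbs_measures (Omega q) (disc_spec \<Phi> q)) \<and>
         (\<forall>\<nu>' \<in> ti_gibbs_measures (Omega q) (disc_spec \<Phi> q).
            rel_entropy_density q \<nu>' \<mu>' = rel_entropy_density q (evolve \<Phi> q \<tau> \<nu>') \<mu>')"
proof -
  interpret clock_model \<Phi> q \<tau> using assms by unfold_locales auto
  have tip: "tip \<nu> \<longleftrightarrow> \<nu> \<in> ti_prob_measures Om" for \<nu> by (auto simp: tip_def pm_def ti_prob_measures_def)
  have \<mu>: "pm \<mu>'" "\<mu>' \<in> gibbs_measures UNIV Om (disc_spec \<Phi> q)"
    using assms(9) tip[of \<mu>'] by (auto simp: ti_gibbs_measures_def tip_def)
  show ?thesis
  proof (intro conjI ballI impI)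
    fix \<nu> assume \<nu>: "\<nu> \<in> ti_prob_measures Om"
      and eq: "rel_entropy_density q \<nu> \<mu>' = rel_entropy_density q (evolve \<Phi> q \<tau> \<nu>) \<mu>'"
    have p: "pm \<nu>" using \<nu> unfolding tip[symmetric] tip_def by blast
    have "invar UNIV C1 (lam \<nu>)" using equal_density_invar[OF _ \<mu> eq] \<nu> tip by simp
    then have "invar UNIV C2 (lift \<nu>)" by (rule invar_unrotate[OF p])
    then have "invar UNIV Full (lift \<nu>)" by (rule invar_Full[OF lift_invar[OF p]])
    then show "\<nu> \<in> ti_gibbs_measures Om (disc_spec \<Phi> q)"
      using gibbs_of_invar_Full[OF p] \<nu> by (simp add: ti_gibbs_measures_def)
  next
    fix \<nu> assume "\<nu> \<in> ti_gibbs_measures Om (disc_spec \<Phi> q)"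
    then have "pm \<nu>" "\<nu> \<in> gibbs_measures UNIV Om (disc_spec \<Phi> q)" using tip[of \<nu>] by (auto simp: ti_gibbs_measures_def tip_def)
    then show "rel_entropy_density q \<nu> \<mu>' = rel_entropy_density q (evolve \<Phi> q \<tau> \<nu>) \<mu>'"
      by (rule gibbs_equal_density[OF _ _ \<mu>])
  qed
qed

end
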